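(* For each entire function $f$ on $\mathbb{C}$ with $f(0)\neq 0$ and for every real number $p\ge 1$, there exists an entire function $h\neq 0$ (not identically zero) such that $$M(r;fh)\le \exp\int_0^{+\infty}C(rt;f)\,\frac{p^2t^{p-1}\,dt}{(1+t^p)^2}\quad\text{for all } r\in[0,+\infty),$$ but there is no entire function $h\neq 0$ for which $$\liminf_{r\to+\infty}\frac{M(r;fh)}{\exp C(r;f)}=0.$$
   Context: For an entire function $f$: $M(r;f):=\max_{|z|=r}|f(z)|$ for $r\ge 0$; $C(r;f):=\frac1{2\pi}\int_0^{2\pi}\ln|f(re^{i\theta})|\,d\theta$ for $r>0$, and $C(0;f):=\ln|f(0)|$. The integral on the right-hand side takes values in $(-\infty,+\infty]$, with $\exp(+\infty)=+\infty$ (so the inequality is trivial where the integral diverges). *)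

theory Defs
  imports "HOL-Complex_Analysis.Complex_Analysis"
begin

text \<open>For continuous \<open>f\<close> the supremum is attained, since the circle is compact and nonempty.\<close>

definition max_modulus :: "real \<Rightarrow> (complex \<Rightarrow> complex) \<Rightarrow> real" where
  "max_modulus r f = (SUP z\<in>sphere 0 r. cmod (f z))"

text \<open>\<open>ln 0 = 0\<close> in HOL; this is immaterial when \<open>f\<close> is entire and not identically zero,
  since then \<open>f\<close> has only finitely many zeros on each circle.\<close>

definition circle_mean :: "real \<Rightarrow> (complex \<Rightarrow> complex) \<Rightarrow> real" where
  "circle_mean r f =
    (if r = 0 then ln (cmod (f 0))
     else 1 / (2 * pi) *
       (LBINT \<theta>:{0..2 * pi}. ln (cmod (f (of_real r * exp (\<i> * of_real \<theta>))))))"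

text \<open>The Lebesgue integral with values in the extended reals, as the difference of the integrals
  of the positive and negative parts (\<open>ennreal\<close> sends negative numbers to \<open>0\<close>). It is meaningful
  when one of the two is finite; in HOL \<open>\<infinity> - \<infinity> = \<infinity>\<close> for extended reals. For entire \<open>f\<close> with \<open>f 0 \<noteq> 0\<close> and
  \<open>r \<ge> 0\<close>, the integrand \<open>circle_mean (r * t) f * (p\<^sup>2 * t powr (p - 1) / (1 + t powr p)\<^sup>2)\<close>
  on \<open>t > 0\<close> has a negative part of finite integral, since \<open>circle_mean (r * t) f\<close> is at least
  \<open>ln (cmod (f 0))\<close> and the second factor has integral \<open>p\<close>.\<close>

definition extended_integral :: "'a measure \<Rightarrow> ('a \<Rightarrow> real) \<Rightarrow> ereal" where
  "extended_integral M g =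
    enn2ereal (\<integral>\<^sup>+ x. ennreal (g x) \<partial>M) - enn2ereal (\<integral>\<^sup>+ x. ennreal (- g x) \<partial>M)"

definition exp_ereal :: "ereal \<Rightarrow> ereal" where
  "exp_ereal x = (case x of ereal y \<Rightarrow> ereal (exp y) | PInfty \<Rightarrow> \<infinity> | MInfty \<Rightarrow> 0)"

end

theory Submission
  imports Defs
begin

text \<open>By Jensen's inequality the integral on the right is at least
  \<open>p ln \<bar>f 0\<bar> + (\<Sum>a. m a ln (1 + (r / \<bar>a\<bar>) powr p))\<close>, summed over the zeros \<open>a\<close> of \<open>f\<close> with multiplicities \<open>m a\<close>.
  If \<open>\<Sum>a. m a \<bar>a\<bar> powr (- p)\<close> diverges, it is infinite for \<open>r > 0\<close> and a constant \<open>h\<close> will do. Otherwise one needs an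
  entire function \<open>F\<close> that vanishes at the zeros of \<open>f\<close> and is bounded by a multiple of
  \<open>\<Prod>a. (1 + (r / \<bar>a\<bar>) powr p) ^ m a\<close>; then \<open>h\<close> is a multiple of \<open>F / f\<close>. For \<open>p = 1\<close> a limit of partial canonical products works.

  For \<open>p > 1\<close> the logarithm of the bound is the maximum over the circle of a subharmonic potential \<open>\<psi>\<close> with
  logarithmic poles at the zeros, and \<open>F\<close> comes from an \<open>L\<^sup>2\<close> estimate of Hormander type with weight \<open>exp (-2 \<psi>)\<close>.
  To keep this elementary, the potential is smoothed (\<open>\<kappa> < 1\<close>), only finitely many zeros are used, and the estimate is a minimum
  problem for polynomials with constant term \<open>1\<close>, treated in the coordinates \<open>z = exp (s + i t)\<close> by orthogonal projection, Fourier series in \<open>t\<close>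
  and the Bochner identity. The polynomials are locally bounded uniformly in the zeros and in \<open>\<kappa>\<close>, so Montel's theorem provides \<open>F\<close>,
  and the non-integrable singularity of the limiting weight forces its zeros. The estimate loses a power of \<open>1 + r\<close>,
  which is regained by treating finitely many zeros with linear factors.

  For the second part, the mean of \<open>ln \<bar>f h\<bar>\<close> is the mean of \<open>ln \<bar>f\<bar>\<close> plus that of \<open>ln \<bar>h\<bar>\<close>, and the latter is bounded below for \<open>r \<ge> 1\<close>.\<close>

section \<open>Gram projections, trigonometric kernels and decaying solutions\<close>

text \<open>For \<open>p > 1\<close> canonical products of positive genus are of no use: the
  exponentials in their primary factors outgrow every power of \<open>r\<close>, and without them
  the product need not converge. The minimum is estimated by duality. Let \<open>v\<close> be the
  minimizer and \<open>h = cnj v * exp (-2 \<psi>)\<close>. The equation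
  \<open>F_s + i F_t = 2 h\<close>, smoothed in \<open>t\<close> to leave finitely many modes, has a
  solution decaying at both ends because \<open>v\<close> is orthogonal to \<open>z\<close>, ...,
  \<open>z\<^sup>N\<close>. The Bochner identity, in the dual weight \<open>exp (2 \<psi>)\<close>,
  bounds \<open>F\<close> by \<open>v\<close>, and pairing the equation with the cut-off expresses
  the squared norm of \<open>v\<close> by the mean of \<open>F\<close> over
  \<open>0 \<le> s \<le> 1\<close>, the only place where the cut-off varies. Hence the bound sees
  the weight only through lower bounds of \<psi> and its Laplacian there, uniform in the zeros and
  in \<kappa>; all other constants are qualitative. A multiple of
  \<open>ln (1 + \<bar>z\<bar>\<^sup>2)\<close> supplies the positive Laplacian and keeps the growth
  exponent off the integers; \<open>s / 4\<close> does the latter at the other end.\<close>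

lemma gram_projection:
  fixes g :: "nat \<Rightarrow> nat \<Rightarrow> complex"
  assumes psd: "\<And>x. 0 \<le> Re (\<Sum>i\<le>N. \<Sum>j\<le>N. x i * cnj (x j) * g i j)"
    and herm: "\<And>i j. g j i = cnj (g i j)"
  obtains x where "x 0 = 1" "\<And>j. j \<in> {1..N} \<Longrightarrow> (\<Sum>i\<le>N. x i * g i j) = 0"
proof -
  define B where "B x y = (\<Sum>i\<le>N. \<Sum>j\<le>N. x i * cnj (y j) * g i j)" for x y
  define d :: "nat \<Rightarrow> nat \<Rightarrow> complex" where "d k = (\<lambda>i. if i = k then 1 else 0)" for k
  have Bl: "B (\<lambda>i. x i + t * y i) w = B x w + t * B y w" for x y w t
    unfolding B_def by (simp add: sum.distrib sum_distrib_left algebra_simps)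
  have Bh: "B y x = cnj (B x y)" for x y
    unfolding B_def by (subst sum.swap) (simp add: mult_ac flip: herm)
  have Br: "B w (\<lambda>i. x i + t * y i) = B w x + cnj t * B w y" for x y w t
    by (metis Bh Bl complex_cnj_add complex_cnj_cnj complex_cnj_mult)
  have Bd: "B x (d k) = (\<Sum>i\<le>N. x i * g i k)" if "k \<le> N" for x k
  proof -
    have "(\<Sum>j\<le>N. x i * cnj (d k j) * g i j) = x i * g i k" for i
    proof -
      have "(\<Sum>j\<le>N. x i * cnj (d k j) * g i j) = (\<Sum>j\<le>N. if j = k then x i * g i k else 0)"
        by (rule sum.cong) (auto simp: d_def)
      thus ?thesis using that by simp
    qed
    thus ?thesis by (simp add: B_def)
  qed
  \<comment> \<open>An isotropic vector of a semidefinite form lies in its radical: otherwise moving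
    \<open>w\<close> along \<open>e\<close> makes the form negative, namely \<open>-1\<close> for
    the \<open>s\<close> chosen below. This covers Gram matrices that are not invertible.\<close>
  have deg: "B w e = 0" if "B e e = 0" for w e
  proof (rule ccontr)
    assume ne: "B w e \<noteq> 0"
    define b where "b = (cmod (B w e))\<^sup>2"
    have b: "b > 0" using ne by (simp add: b_def)
    have "0 \<le> Re (B w w) - 2 * s * b" for s :: real
    proof -
      let ?t = "- of_real s * B w e"
      have "B (\<lambda>i. w i + ?t * e i) (\<lambda>i. w i + ?t * e i)
              = B w w + cnj ?t * B w e + ?t * B e w + ?t * cnj ?t * B e e"
        unfolding Bl Br by (simp only: algebra_simps)
      also have "B e w = cnj (B w e)" by (rule Bh)
      finally have "Re (B (\<lambda>i. w i + ?t * e i) (\<lambda>i. w i + ?t * e i)) = Re (B w w) - 2 * s * b"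
        unfolding that b_def by (simp only:) (simp add: cmod_def power2_eq_square algebra_simps)
      moreover have "0 \<le> Re (B (\<lambda>i. w i + ?t * e i) (\<lambda>i. w i + ?t * e i))"
        unfolding B_def by (rule psd)
      ultimately show ?thesis by (simp only:)
    qed
    from this[of "(Re (B w w) + 1) / (2 * b)"] b show False by (simp add: field_simps)
  qed
  \<comment> \<open>Gram-Schmidt one index at a time. Letting \<open>u\<close> vary allows the
    induction hypothesis to be applied both to \<open>u\<close> and to the next unit vector
    \<open>d (Suc n)\<close>.\<close>
  have main: "\<exists>x. (\<forall>i. i \<notin> {1..n} \<longrightarrow> x i = u i) \<and> (\<forall>j\<in>{1..n}. B x (d j) = 0)" if "n \<le> N" for n u
    using that
  proof (induction n arbitrary: u)
    case 0
    then show ?case by auto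
  next
    case (Suc n)
    obtain e where e: "\<forall>i. i \<notin> {1..n} \<longrightarrow> e i = d (Suc n) i" "\<forall>j\<in>{1..n}. B e (d j) = 0"
      using Suc.IH[of "d (Suc n)"] Suc.prems by auto
    obtain y where y: "\<forall>i. i \<notin> {1..n} \<longrightarrow> y i = u i" "\<forall>j\<in>{1..n}. B y (d j) = 0"
      using Suc.IH[of u] Suc.prems by auto
    \<comment> \<open>\<open>e\<close> differs from \<open>d (Suc n)\<close> only by a combination
      of \<open>d 1\<close>, ..., \<open>d n\<close>, so testing against either is the same once
      \<open>x\<close> is orthogonal to these.\<close>
    have red: "B x (d (Suc n)) = B x e" if "\<forall>j\<in>{1..n}. B x (d j) = 0" for x
    proof -
      have *: "B x (\<lambda>i. d (Suc n) i + (\<Sum>k\<in>S. e k * d k i)) = B x (d (Suc n))"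
        if "S \<subseteq> {1..n}" for S
        using finite_subset[OF that finite_atLeastAtMost] that
      proof (induction S rule: finite_induct)
        case (insert k S)
        have "B x (\<lambda>i. d (Suc n) i + (\<Sum>k\<in>insert k S. e k * d k i))
            = B x (\<lambda>i. (d (Suc n) i + (\<Sum>k\<in>S. e k * d k i)) + e k * d k i)"
          using insert by (simp add: algebra_simps)
        also have "\<dots> = B x (\<lambda>i. d (Suc n) i + (\<Sum>k\<in>S. e k * d k i)) + cnj (e k) * B x (d k)"
          by (rule Br)
        also have "B x (d k) = 0" using insert \<open>\<forall>j\<in>{1..n}. B x (d j) = 0\<close> by auto
        finally show ?case using insert by simp
      qed auto
      have "e = (\<lambda>i. d (Suc n) i + (\<Sum>k\<in>{1..n}. e k * d k i))"
      proof
        fix i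
        have "(\<Sum>k\<in>{1..n}. e k * d k i) = (\<Sum>k\<in>{1..n}. if k = i then e i else 0)"
          by (rule sum.cong) (auto simp: d_def)
        also have "\<dots> = (if i \<in> {1..n} then e i else 0)" by simp
        finally show "e i = d (Suc n) i + (\<Sum>k\<in>{1..n}. e k * d k i)"
          using e(1) by (auto simp: d_def)
      qed
      thus ?thesis using *[of "{1..n}"] by (metis order_refl)
    qed
    show ?case
    proof (cases "B e e = 0")
      case True
      have "B y (d (Suc n)) = 0" using red[OF y(2)] deg[OF True] by simp
      with y show ?thesis
        by (intro exI[of _ y]) (auto simp: le_Suc_eq)
    next
      case False
      define t where "t = - (B y e / B e e)"
      define x where "x = (\<lambda>i. y i + t * e i)"
      have x0: "\<forall>j\<in>{1..n}. B x (d j) = 0" using y(2) e(2) unfolding x_def Bl by auto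
      have "B x e = 0" using False unfolding x_def Bl by (simp add: t_def)
      hence "B x (d (Suc n)) = 0" using red[OF x0] by simp
      with x0 y e show ?thesis
        by (intro exI[of _ x]) (auto simp: le_Suc_eq x_def d_def)
    qed
  qed
  from main[of N "d 0"] obtain x where
    x: "\<forall>i. i \<notin> {1..N} \<longrightarrow> x i = d 0 i" "\<forall>j\<in>{1..N}. B x (d j) = 0" by auto
  show ?thesis
    by (rule that[of x]) (use x Bd in \<open>auto simp: d_def\<close>)
qed

lemma integral_periodic_shift:
  fixes w :: "real \<Rightarrow> 'a :: banach"
  assumes c: "continuous_on UNIV w" and per: "\<And>t. w (t + T) = w t" and T: "T \<ge> 0"
  shows "integral {a..a+T} w = integral {0..T} w"
proof -
  have i: "w integrable_on {x..y}" for x y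
    by (intro integrable_continuous_real continuous_on_subset[OF c]) auto
  have sh: "integral {x+T..y+T} w = integral {x..y} w" for x y
    using integral_shift_Icc_real[of x y w T] per by (simp add: o_def add.commute)
  have pos: "integral {a..a+T} w = integral {0..T} w" if "0 \<le> a" for a
  proof -
    have "integral {0..a} w + integral {a..a+T} w = integral {0..a+T} w"
      by (rule Henstock_Kurzweil_Integration.integral_combine) (use that T i in auto)
    moreover have "integral {0..T} w + integral {T..a+T} w = integral {0..a+T} w"
      by (rule Henstock_Kurzweil_Integration.integral_combine) (use that T i in auto)
    moreover have "integral {T..a+T} w = integral {0..a} w" using sh[of 0 a] by simp
    ultimately show ?thesis by (auto simp: algebra_simps dest!: sym[of "_ + _"])
  qed
  show ?thesis
  proof (cases "0 \<le> a")
    case False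
    have "integral {a..0} w + integral {0..T} w = integral {a..T} w"
      by (rule Henstock_Kurzweil_Integration.integral_combine) (use False T i in auto)
    moreover have "integral {a..a+T} w + integral {a+T..T} w = integral {a..T} w"
      by (rule Henstock_Kurzweil_Integration.integral_combine) (use False T i in auto)
    moreover have "integral {a+T..T} w = integral {a..0} w" using sh[of a 0] by simp
    ultimately show ?thesis by (auto simp: algebra_simps dest!: sym[of "_ + _"])
  qed (use pos in auto)
qed

lemma has_integral_cis:
  assumes "j \<noteq> (0::int)"
  shows "((\<lambda>t. cis (of_int j * t)) has_integral 0) {a..a+2*pi}"
proof -
  have "((\<lambda>t. cis (of_int j * t)) has_integral
     (cis (of_int j * (a+2*pi)) / (\<i> * of_int j) - cis (of_int j * a) / (\<i> * of_int j))) {a..a+2*pi}"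
  proof (rule fundamental_theorem_of_calculus)
    fix t
    have "((\<lambda>z. exp (\<i> * (of_int j * z)) / (\<i> * of_int j)) has_field_derivative
             exp (\<i> * (of_int j * of_real t))) (at (of_real t))"
      using assms by (auto intro!: derivative_eq_intros simp: mult.left_commute[of \<i> _ \<i>])
    from has_vector_derivative_real_field[OF this]
    show "((\<lambda>t. cis (of_int j * t) / (\<i> * of_int j)) has_vector_derivative cis (of_int j * t)) (at t within {a..a+2*pi})"
      by (auto simp: cis_conv_exp intro: has_vector_derivative_at_within)
  qed auto
  moreover have "cis (of_int j * (a+2*pi)) = cis (of_int j * a)"
  proof -
    have "cis (of_int j * (a+2*pi)) = cis (of_int j * a) * cis (2 * pi * of_int j)"
      by (simp add: cis_mult algebra_simps)
    thus ?thesis by (simp add: cis_multiple_2pi)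
  qed
  ultimately show ?thesis by simp
qed

lemma cos_half_power_expansion:
  "complex_of_real (cos (t/2) ^ (2*n)) =
     (\<Sum>j\<in>{-int n..int n}. of_real (real (2*n choose nat (j + int n)) / 4^n) * cis (of_int j * t))"
proof -
  have "complex_of_real (cos (t/2)) = (cis (t/2) + cis (-(t/2))) / 2"
    by (simp add: complex_eq_iff)
  hence "complex_of_real (cos (t/2) ^ (2*n)) = (cis (t/2) + cis (-(t/2))) ^ (2*n) / 4^n"
    by (simp only: of_real_power power_divide) (simp add: power_mult)
  also have "(cis (t/2) + cis (-(t/2))) ^ (2*n)
      = (\<Sum>i\<le>2*n. of_nat (2*n choose i) * cis (t/2)^i * cis (-(t/2))^(2*n-i))"
    by (rule binomial_ring)
  also have "\<dots> = (\<Sum>i\<le>2*n. of_nat (2*n choose i) * cis ((real i - real n) * t))"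
  proof (rule sum.cong, goal_cases)
    case (2 i)
    have "cis (t/2)^i * cis (-(t/2))^(2*n-i) = cis (real i * (t/2) + real (2*n-i) * (-(t/2)))"
      unfolding Complex.DeMoivre cis_mult by (rule refl)
    also have "real i * (t/2) + real (2*n-i) * (-(t/2)) = (real i - real n) * t"
      using 2 by (simp add: field_simps)
    finally show ?case by (simp add: mult.assoc)
  qed auto
  also have "\<dots> = (\<Sum>j\<in>{-int n..int n}. of_nat (2*n choose nat (j + int n)) * cis (of_int j * t))"
    by (rule sum.reindex_bij_witness[of _ "\<lambda>j. nat (j + int n)" "\<lambda>i. int i - int n"]) auto
  finally show ?thesis by (simp add: sum_divide_distrib)
qed

text \<open>Normalized powers of \<open>cos (t/2) ^ 2\<close> concentrate at \<open>0\<close>, so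
  averaging a weight that grows like \<open>exp (L * \<bar>t\<bar>)\<close> costs little.
  Convolution with such a kernel leaves finitely many Fourier modes, and \<open>k 0\<close> records
  how it acts on the mean.\<close>

lemma trig_kernel:
  fixes L :: real
  assumes L: "L \<ge> 0"
  obtains n and k :: "int \<Rightarrow> real" and K :: "real \<Rightarrow> real" where
    "\<And>t. complex_of_real (K t) = (\<Sum>j\<in>{-int n..int n}. of_real (k j) * cis (of_int j * t))"
    "\<And>t. K t \<ge> 0" "continuous_on UNIV K" "k 0 = 1 / (2*pi)"
    "integral {-pi..pi} K = 1" "integral {-pi..pi} (\<lambda>t. K t * exp (L * \<bar>t\<bar>)) \<le> 2"
proof -
  \<comment> \<open>The target \<open>2\<close> is split: at most \<open>3/2\<close> comes from
    \<open>\<bar>t\<bar> \<le> d\<close>, at most \<open>1/2\<close> from the rest.\<close>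
  define d where "d = min pi (ln (3/2) / (L+1))"
  have d: "0 < d" "d \<le> pi" using L by (auto simp: d_def)
  have Ld: "exp (L * d) \<le> 3/2"
  proof -
    have "L * d \<le> (L+1) * (ln (3/2) / (L+1))"
      using L by (intro mult_mono) (auto simp: d_def)
    hence "L * d \<le> ln (3/2)" using L by simp
    thus ?thesis by (metis exp_le_cancel_iff exp_ln divide_pos_pos zero_less_numeral)
  qed
  \<comment> \<open>\<open>q^n\<close> bounds the unnormalized kernel from above for
    \<open>d \<le> \<bar>t\<bar> \<le> pi\<close>, and \<open>q'^n\<close> bounds it from below for
    \<open>\<bar>t\<bar> \<le> d/2\<close>. As \<open>q < q'\<close>, the tail is negligible against
    the mass for large \<open>n\<close>.\<close>
  define q q' where "q = (cos (d/2))^2" and "q' = (cos (d/4))^2"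
  have q: "0 \<le> q" "q < q'"
  proof -
    have "cos (d/2) < cos (d/4)" using d by (intro cos_monotone_0_pi) auto
    moreover have "0 \<le> cos (d/2)" using d by (intro cos_ge_zero) auto
    ultimately show "0 \<le> q" "q < q'" by (auto simp: q_def q'_def intro: power_strict_mono)
  qed
  \<comment> \<open>With this \<open>c\<close>, the condition \<open>c * q^n \<le> q'^n\<close>
    makes the tail \<open>2 * pi * exp (L*pi) * q^n\<close> at most half of the lower bound
    \<open>d * q'^n\<close> for the mass.\<close>
  define c where "c = 4 * pi * exp (L*pi) / d"
  have c: "c > 0" using d by (simp add: c_def)
  have "(\<lambda>n. (q/q')^n) \<longlonglongrightarrow> 0" using q by (intro LIMSEQ_realpow_zero) auto
  hence "eventually (\<lambda>n. (q/q')^n < 1/c) sequentially"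
    using c by (intro order_tendstoD) auto
  then obtain n where "(q/q')^n < 1/c" by (auto simp: eventually_sequentially)
  hence qn: "c * q^n \<le> q'^n" using q c by (simp add: field_simps)
  define k0 where "k0 t = cos (t/2) ^ (2*n)" for t :: real
  have k0c: "continuous_on S k0" for S unfolding k0_def by (intro continuous_intros) auto
  have k0p: "k0 t \<ge> 0" for t by (simp add: k0_def power_mult)
  define I where "I = integral {-pi..pi} k0"
  have k0i: "k0 integrable_on {x..y}" for x y by (intro integrable_continuous_real k0c)
  have I: "d * q'^n \<le> I"
  proof -
    have "d * q'^n = integral {-(d/2)..d/2} (\<lambda>t. q'^n)" using d by simp
    also have "\<dots> \<le> integral {-(d/2)..d/2} k0"
    proof (rule integral_le)
      fix t assume t: "t \<in> {-(d/2)..d/2}"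
      have "cos (d/4) \<le> cos (t/2)"
        using d t cos_monotone_0_pi_le[of "\<bar>t/2\<bar>" "d/4"] by (simp only: cos_abs_real) auto
      moreover have "0 \<le> cos (d/4)" using d by (intro cos_ge_zero) auto
      ultimately show "q'^n \<le> k0 t"
        unfolding q'_def k0_def power_mult[symmetric] by (simp add: power_mono)
    qed (auto intro: k0i)
    also have "\<dots> \<le> I" unfolding I_def
      using d k0p by (intro integral_subset_le k0i) auto
    finally show ?thesis .
  qed
  have Ipos: "I > 0" using I d q by (smt (verit) mult_pos_pos zero_less_power)
  define K where "K t = k0 t / I" for t
  define k where "k j = real (2*n choose nat (j + int n)) / 4^n / I" for j
  have Kk: "complex_of_real (K t) = (\<Sum>j\<in>{-int n..int n}. of_real (k j) * cis (of_int j * t))" for t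
    unfolding K_def k0_def of_real_divide[of "cos _ ^ _"] cos_half_power_expansion sum_divide_distrib
    by (simp add: k_def)
  have Kc: "continuous_on S K" for S unfolding K_def using Ipos by (intro continuous_intros k0c) auto
  have K1: "integral {-pi..pi} K = 1" unfolding K_def using Ipos by (simp add: I_def)
  have "((\<lambda>t. complex_of_real (K t)) has_integral (\<Sum>j\<in>{-int n..int n}. of_real (k j) * (if j = 0 then of_real (2*pi) else 0))) {-pi..-pi+2*pi}"
    unfolding Kk
  proof (intro has_integral_sum has_integral_mult_right)
    fix j :: int
    show "((\<lambda>t. cis (of_int j * t)) has_integral (if j = 0 then of_real (2*pi) else 0)) {-pi..-pi+2*pi}"
      using has_integral_cis[of j "-pi"] has_integral_const_real[of "1::complex" "-pi" "-pi+2*pi"]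
      by (auto simp: scaleR_conv_of_real)
  qed auto
  also have "(\<Sum>j\<in>{-int n..int n}. of_real (k j) * (if j = 0 then complex_of_real (2*pi) else 0)) = of_real (k 0 * (2*pi))"
    by (simp add: if_distrib sum.delta cong: if_cong)
  finally have "((\<lambda>t. complex_of_real (K t)) has_integral of_real (k 0 * (2*pi))) {-pi..pi}" by simp
  moreover have "((\<lambda>t. complex_of_real (K t)) has_integral of_real 1) {-pi..pi}"
    using K1 by (intro has_integral_of_real) (metis Kc integrable_continuous_real integrable_integral)
  ultimately have "complex_of_real (k 0 * (2*pi)) = of_real 1" by (rule has_integral_unique)
  hence k0: "k 0 = 1 / (2*pi)" by (simp only: of_real_eq_iff) (simp add: field_simps)
  have "integral {-pi..pi} (\<lambda>t. k0 t * exp (L * \<bar>t\<bar>)) \<le> integral {-pi..pi} (\<lambda>t. 3/2 * k0 t + exp (L*pi) * q^n)"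
  proof (rule integral_le)
    fix t assume t: "t \<in> {-pi..pi}"
    show "k0 t * exp (L * \<bar>t\<bar>) \<le> 3/2 * k0 t + exp (L*pi) * q^n"
    proof (cases "\<bar>t\<bar> \<le> d")
      case True
      hence "exp (L * \<bar>t\<bar>) \<le> exp (L * d)" using L by (simp add: mult_left_mono)
      hence "k0 t * exp (L * \<bar>t\<bar>) \<le> k0 t * (3/2)"
        using Ld k0p by (intro mult_left_mono) linarith+
      thus ?thesis using q by (smt (verit) exp_gt_zero mult_nonneg_nonneg zero_le_power mult.commute)
    next
      case False
      have "cos (t/2) \<le> cos (d/2)"
        using False t d cos_monotone_0_pi_le[of "d/2" "\<bar>t/2\<bar>"] by (simp only: cos_abs_real) auto
      moreover have "0 \<le> cos (t/2)" using t by (intro cos_ge_zero) auto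
      ultimately have "k0 t \<le> q^n" unfolding q_def k0_def power_mult[symmetric] by (simp add: power_mono)
      moreover have "exp (L * \<bar>t\<bar>) \<le> exp (L * pi)" using L t by (auto simp: mult_left_mono)
      ultimately have "k0 t * exp (L * \<bar>t\<bar>) \<le> q^n * exp (L*pi)" using q by (intro mult_mono) auto
      thus ?thesis using k0p[of t] by (simp add: mult.commute)
    qed
  qed (auto intro!: integrable_continuous_real continuous_intros k0c)
  also have "\<dots> = 3/2 * I + 2 * pi * exp (L*pi) * q^n"
    by (subst integral_add) (auto intro!: integrable_continuous_real continuous_intros k0c simp: I_def)
  also have "2 * pi * exp (L*pi) * q^n \<le> I / 2"
  proof -
    have "2 * pi * exp (L*pi) * q^n = d / 2 * (c * q^n)" using d by (simp add: c_def field_simps)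
    also have "\<dots> \<le> d / 2 * q'^n" using qn d by (intro mult_left_mono) auto
    also have "\<dots> \<le> I/2" using I by simp
    finally show ?thesis .
  qed
  finally have "integral {-pi..pi} (\<lambda>t. k0 t * exp (L * \<bar>t\<bar>)) \<le> 2 * I" by simp
  hence "integral {-pi..pi} (\<lambda>t. K t * exp (L * \<bar>t\<bar>)) \<le> 2"
    using Ipos by (simp add: K_def field_simps)
  with Kk k0 K1 Kc show ?thesis
    by (intro that[of K k n]) (use k0p Ipos in \<open>auto simp: K_def\<close>)
qed

lemma primitive_UNIV:
  fixes G :: "real \<Rightarrow> 'a :: banach"
  assumes c: "continuous_on UNIV G"
  obtains B where "\<And>s. (B has_vector_derivative G s) (at s)"
proof -
  define B where "B s = integral {0..s} G - integral {s..0} G" for s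
  have i: "G integrable_on {x..y}" for x y
    by (intro integrable_continuous_real continuous_on_subset[OF c]) auto
  have "(B has_vector_derivative G s) (at s)" for s
  proof -
    define R where "R = \<bar>s\<bar> + 1"
    have eq: "B x = integral {-R..x} G - integral {-R..0} G" if "x \<in> {-R<..<R}" for x
    proof (cases "x \<ge> 0")
      case True
      have "integral {-R..0} G + integral {0..x} G = integral {-R..x} G"
        by (rule Henstock_Kurzweil_Integration.integral_combine) (use True R_def i in auto)
      thus ?thesis using True by (cases "x = 0") (auto simp: B_def algebra_simps)
    next
      case False
      have "integral {-R..x} G + integral {x..0} G = integral {-R..0} G"
        by (rule Henstock_Kurzweil_Integration.integral_combine) (use False that i in auto)
      thus ?thesis using False by (auto simp: B_def algebra_simps)
    qed
    have s: "s \<in> {-R<..<R}" by (auto simp: R_def)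
    have "((\<lambda>x. integral {-R..x} G) has_vector_derivative G s) (at s within {-R..R})"
      by (rule integral_has_vector_derivative) (use s in \<open>auto intro: continuous_on_subset[OF c]\<close>)
    hence "((\<lambda>x. integral {-R..x} G) has_vector_derivative G s) (at s)"
      using s by (subst (asm) at_within_interior) (auto simp: interior_atLeastAtMost_real)
    hence "((\<lambda>x. integral {-R..x} G - integral {-R..0} G) has_vector_derivative G s) (at s)"
      by (auto intro!: derivative_eq_intros)
    thus ?thesis
      by (rule has_vector_derivative_transform_within_open[of _ _ _ "{-R<..<R}"]) (use s eq in auto)
  qed
  thus ?thesis by (rule that)
qed

lemma exp_neg_mult_tendsto_0: "c > 0 \<Longrightarrow> ((\<lambda>s::real. C * s * exp (- c * s)) \<longlongrightarrow> 0) at_top"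
  by real_asymp

lemma exp_neg_tendsto_0: "c > 0 \<Longrightarrow> ((\<lambda>s::real. C * exp (- c * s)) \<longlongrightarrow> 0) at_top"
  by real_asymp

context
  fixes q B :: "real \<Rightarrow> complex" and j C M \<alpha> :: real
  assumes B: "\<And>s. (B has_vector_derivative q s * of_real (exp (- j * s))) (at s)"
    and q: "\<And>s. s \<ge> 0 \<Longrightarrow> norm (q s) \<le> C * exp (- \<alpha> * s)"
    and M: "M < \<alpha>"
begin

private lemma int: "((\<lambda>s. q s * of_real (exp (- j * s))) has_integral B t - B s) {s..t}" if "s \<le> t"
  by (rule fundamental_theorem_of_calculus[OF that]) (rule has_vector_derivative_at_within[OF B])

private lemma nq: "s \<ge> 0 \<Longrightarrow> norm (q s * of_real (exp (- j * s))) \<le> C * exp (- (\<alpha> + j) * s)"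
  using mult_right_mono[OF q, of s "exp (- j * s)"] by (simp add: norm_mult exp_add[symmetric] algebra_simps)

private lemma C: "C \<ge> 0"
  using order_trans[OF norm_ge_zero q[of 0]] by simp

text \<open>The solutions of \<open>A' = j A + q\<close> are \<open>exp (j * s) * (B s - c)\<close>,
  and their size against the weight \<open>exp (M * s)\<close> is the quantity estimated here. For
  \<open>j + M < 0\<close> the exponential factor kills every constant \<open>c\<close>, and it also
  outweighs the growth of \<open>B\<close> because \<open>q\<close> decays faster than
  \<open>exp (- M * s)\<close>.\<close>

lemma primitive_weighted_at_top:
  assumes "j + M < 0"
  shows "((\<lambda>s. exp ((j + M) * s) * norm (B s - c)) \<longlongrightarrow> 0) at_top"
proof -
  define g where "g = min (\<alpha> - M) (-(j + M))"
  have g: "g > 0" using M assms by (auto simp: g_def)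
  have "exp ((j + M) * s) * norm (B s - c) \<le> C * s * exp (- g * s) + norm (B 0 - c) * exp (- g * s)"
    if s: "s \<ge> 0" for s
  proof -
    \<comment> \<open>A bound of the integrand that is uniform on \<open>{0..s}\<close> produces a
      factor \<open>s\<close>, and thereby no case distinction is needed for
      \<open>\<alpha> + j = 0\<close>.\<close>
    have "norm (B s - B 0) \<le> (C * exp (- g * s - (j + M) * s)) * Henstock_Kurzweil_Integration.content (cbox 0 s)"
    proof (rule has_integral_bound)
      show "((\<lambda>s. q s * of_real (exp (- j * s))) has_integral B s - B 0) (cbox 0 s)"
        using int[OF s] by simp
      fix x assume x: "x \<in> cbox 0 s"
      hence x: "0 \<le> x" "x \<le> s" by auto
      have "(j + M) * (s - x) - (\<alpha> - M) * x \<le> - g * (s - x) - g * x"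
        using x by (intro diff_mono mult_right_mono) (auto simp: g_def)
      hence "- (\<alpha> + j) * x \<le> - g * s - (j + M) * s" by (simp add: algebra_simps)
      hence "C * exp (- (\<alpha> + j) * x) \<le> C * exp (- g * s - (j + M) * s)"
        using C by (intro mult_left_mono) auto
      thus "norm (q x * of_real (exp (- j * x))) \<le> C * exp (- g * s - (j + M) * s)"
        using nq[OF x(1)] by linarith
    qed (use C in auto)
    hence 1: "norm (B s - B 0) \<le> C * exp (- g * s - (j + M) * s) * s" using s by simp
    have "norm (B s - c) \<le> norm (B s - B 0) + norm (B 0 - c)" by norm
    hence "exp ((j + M) * s) * norm (B s - c) \<le> exp ((j + M) * s) * (C * exp (- g * s - (j + M) * s) * s + norm (B 0 - c))"
      using 1 by (intro mult_left_mono) auto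
    also have "\<dots> = C * s * exp (- g * s) + exp ((j + M) * s) * norm (B 0 - c)"
      by (simp add: distrib_left mult_ac exp_add[symmetric])
    also have "exp ((j + M) * s) \<le> exp (- g * s)"
      using mult_right_mono[of "j + M" "- g" s] s by (simp add: g_def)
    finally show ?thesis by (simp add: mult_right_mono mult.commute)
  qed
  hence "eventually (\<lambda>s. norm (exp ((j + M) * s) * norm (B s - c)) \<le> C * s * exp (- g * s) + norm (B 0 - c) * exp (- g * s)) at_top"
    by (auto intro!: eventually_mono[OF eventually_ge_at_top[of 0]])
  moreover have "((\<lambda>s. C * s * exp (- g * s) + norm (B 0 - c) * exp (- g * s)) \<longlongrightarrow> 0) at_top"
    by (rule tendsto_add_zero) (intro exp_neg_mult_tendsto_0 exp_neg_tendsto_0 g)+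
  ultimately show ?thesis by (rule Lim_null_comparison)
qed

text \<open>For \<open>j + M > 0\<close> also \<open>\<alpha> + j > 0\<close>, so the integrand of
  \<open>B\<close> is integrable at infinity. Subtracting the limit \<open>c\<close> leaves the
  tail, of size \<open>exp (- (\<alpha> + j) * s)\<close>, which beats the growing weight.\<close>

lemma primitive_limit_at_top:
  assumes "j + M > 0"
  obtains c where "(B \<longlongrightarrow> c) at_top" "((\<lambda>s. exp ((j + M) * s) * norm (B s - c)) \<longlongrightarrow> 0) at_top"
proof -
  define b where "b = \<alpha> + j"
  have b: "b > 0" using assms M by (auto simp: b_def)
  have bd: "norm (B t - B s) \<le> C / b * exp (- b * s)" if st: "0 \<le> s" "s \<le> t" for s t
  proof -
    have "((\<lambda>x. C * exp (- b * x)) has_integral (- C / b * exp (- b * t) - (- C / b * exp (- b * s)))) {s..t}"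
      by (rule fundamental_theorem_of_calculus[OF st(2)])
         (use b in \<open>auto intro!: derivative_eq_intros simp flip: has_real_derivative_iff_has_vector_derivative\<close>)
    from has_integral_norm_bound_integral_component[OF int[OF st(2)] this, of 1]
    have "norm (B t - B s) \<le> - C / b * exp (- b * t) - (- C / b * exp (- b * s))"
      using nq st by (simp add: b_def)
    thus ?thesis using C b by (simp add: field_simps) (smt (verit) exp_gt_zero mult_nonneg_nonneg)
  qed
  have lim0: "((\<lambda>s. C / b * exp (- b * s)) \<longlongrightarrow> 0) at_top"
    by (rule exp_neg_tendsto_0[OF b])
  have "Cauchy (\<lambda>n. B (real n))"
  proof (rule metric_CauchyI)
    fix e :: real assume e: "e > 0"
    have "eventually (\<lambda>s. C / b * exp (- b * s) < e / 2) at_top"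
      using lim0 e by (intro order_tendstoD) auto
    then obtain s0 where s0: "\<And>s. s \<ge> s0 \<Longrightarrow> C / b * exp (- b * s) < e / 2"
      by (auto simp: eventually_at_top_linorder)
    define N where "N = nat \<lceil>\<bar>s0\<bar>\<rceil>"
    have N: "real N \<ge> s0" by (simp add: N_def) linarith
    show "\<exists>M. \<forall>m\<ge>M. \<forall>n\<ge>M. dist (B (real m)) (B (real n)) < e"
    proof (intro exI[of _ N] allI impI)
      fix m n assume "N \<le> m" "N \<le> n"
      have "norm (B (real k) - B (real N)) < e/2" if "N \<le> k" for k
        by (rule le_less_trans[OF bd s0[OF N]]) (use that in auto)
      from this[OF \<open>N \<le> m\<close>] this[OF \<open>N \<le> n\<close>]
      show "dist (B (real m)) (B (real n)) < e" unfolding dist_norm by norm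
    qed
  qed
  then obtain c where c: "(\<lambda>n. B (real n)) \<longlonglongrightarrow> c"
    using Cauchy_convergent convergent_def by blast
  have bc: "norm (B s - c) \<le> C / b * exp (- b * s)" if "s \<ge> 0" for s
  proof (rule Lim_norm_ubound[of sequentially "\<lambda>n. B s - B (real n)"])
    show "(\<lambda>n. B s - B (real n)) \<longlonglongrightarrow> B s - c" by (intro tendsto_intros c)
    show "eventually (\<lambda>n. norm (B s - B (real n)) \<le> C / b * exp (- b * s)) sequentially"
      using eventually_ge_at_top[of "nat \<lceil>s\<rceil>"]
    proof eventually_elim
      case (elim n)
      hence "s \<le> real n" by linarith
      from bd[OF that this] show ?case by (simp add: norm_minus_commute)
    qed
  qed auto
  have "(B \<longlongrightarrow> c) at_top"
  proof (rule LIM_zero_cancel, rule Lim_null_comparison[OF _ lim0])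
    show "eventually (\<lambda>s. norm (B s - c) \<le> C / b * exp (- b * s)) at_top"
      using eventually_ge_at_top[of 0] by eventually_elim (rule bc)
  qed
  moreover have "((\<lambda>s. exp ((j + M) * s) * norm (B s - c)) \<longlongrightarrow> 0) at_top"
  proof (rule Lim_null_comparison)
    show "eventually (\<lambda>s. norm (exp ((j + M) * s) * norm (B s - c)) \<le> C / b * exp (- (\<alpha> - M) * s)) at_top"
      using eventually_ge_at_top[of 0]
    proof eventually_elim
      case (elim s)
      have "exp ((j + M) * s) * norm (B s - c) \<le> exp ((j + M) * s) * (C / b * exp (- b * s))"
        by (intro mult_left_mono bc elim) auto
      also have "\<dots> = C / b * exp (- (\<alpha> - M) * s)"
        by (simp add: b_def exp_add[symmetric] algebra_simps)
      finally show ?case by simp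
    qed
    show "((\<lambda>s. C / b * exp (- (\<alpha> - M) * s)) \<longlongrightarrow> 0) at_top"
      using M by (intro exp_neg_tendsto_0) auto
  qed
  ultimately show ?thesis by (rule that)
qed

end

text \<open>Decay at both ends: of the solutions of \<open>A' = j A + q\<close>, which form a line, decay at an end where
  \<open>exp (j s)\<close> dominates the weight selects one, and decay at the other ends holds for all of them.
  The integral condition says that the two ends select the same solution.\<close>

lemma decaying_ode_solution:
  fixes q :: "real \<Rightarrow> complex"
  assumes cont: "continuous_on UNIV q"
    and q1: "\<And>s. s \<ge> 0 \<Longrightarrow> norm (q s) \<le> C1 * exp (- \<alpha> * s)"
    and q2: "\<And>s. s \<le> 0 \<Longrightarrow> norm (q s) \<le> C2 * exp (\<beta> * s)"
    and M1: "M1 < \<alpha>" and M2: "- M2 < \<beta>"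
    and cases: "j + M1 < 0 \<and> j + M2 < 0 \<or> j + M1 > 0 \<and> j + M2 > 0 \<or>
      j + M1 > 0 \<and> j + M2 < 0 \<and> ((\<lambda>R. integral {-R..R} (\<lambda>s. q s * of_real (exp (- j * s)))) \<longlongrightarrow> 0) at_top"
  obtains A where "\<And>s. (A has_vector_derivative of_real j * A s + q s) (at s)"
    "((\<lambda>s. exp (M1 * s) * norm (A s)) \<longlongrightarrow> 0) at_top"
    "((\<lambda>s. exp (M2 * s) * norm (A s)) \<longlongrightarrow> 0) at_bot"
proof -
  obtain B where B: "\<And>s. (B has_vector_derivative q s * of_real (exp (- j * s))) (at s)"
    by (rule primitive_UNIV[of "\<lambda>s. q s * of_real (exp (- j * s))"])
       (auto intro!: continuous_intros cont)
  \<comment> \<open>Reflection in \<open>s\<close> turns the lower end into an upper end with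
    \<open>-j\<close> and \<open>-M2\<close> in place of \<open>j\<close> and \<open>M2\<close>, so
    the two preceding lemmas serve both ends.\<close>
  have B': "((\<lambda>s. - B (- s)) has_vector_derivative q (- s) * of_real (exp (- (- j) * s))) (at s)" for s
  proof -
    have "((B \<circ> uminus) has_vector_derivative (-1) *\<^sub>R (q (- s) * of_real (exp (- j * (- s))))) (at s)"
      by (rule vector_diff_chain_at) (auto intro!: derivative_eq_intros B[of "- s", simplified])
    thus ?thesis using has_vector_derivative_minus by (fastforce simp: o_def)
  qed
  have q2': "norm (q (- s)) \<le> C2 * exp (- \<beta> * s)" if "s \<ge> 0" for s
    using q2[of "-s"] that by simp
  note solI = that
  have sol: ?thesis if c: "((\<lambda>s. exp ((j + M1) * s) * norm (B s - c)) \<longlongrightarrow> 0) at_top"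
    "((\<lambda>s. exp ((- j + - M2) * s) * norm (- B (- s) - (- c))) \<longlongrightarrow> 0) at_top" for c
  proof (rule solI[of "\<lambda>s. of_real (exp (j * s)) * (B s - c)"])
    fix s
    have e: "((\<lambda>s. complex_of_real (exp (j * s))) has_vector_derivative of_real (j * exp (j * s))) (at s)"
      by (intro has_vector_derivative_of_real) (auto intro!: derivative_eq_intros simp flip: has_real_derivative_iff_has_vector_derivative)
    have D: "((\<lambda>s. of_real (exp (j * s)) * (B s - c)) has_vector_derivative
        (of_real (exp (j * s)) * (q s * of_real (exp (- j * s)) - 0) + of_real (j * exp (j * s)) * (B s - c))) (at s)"
      by (intro has_vector_derivative_mult e has_vector_derivative_diff B has_vector_derivative_const)
    have "complex_of_real (exp (j * s)) * of_real (exp (- j * s)) = 1"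
      by (simp add: of_real_mult[symmetric] exp_add[symmetric] del: of_real_mult)
    hence E: "complex_of_real (exp (j * s)) * (q s * of_real (exp (- j * s)) - 0) = q s"
      by (simp add: mult.left_commute)
    from D show "((\<lambda>s. of_real (exp (j * s)) * (B s - c)) has_vector_derivative
        of_real j * (of_real (exp (j * s)) * (B s - c)) + q s) (at s)"
      unfolding E by (simp add: add.commute mult.assoc)
  next
    show "((\<lambda>s. exp (M1 * s) * norm (of_real (exp (j * s)) * (B s - c))) \<longlongrightarrow> 0) at_top"
      using c(1) unfolding norm_mult by (simp add: distrib_right exp_add mult.assoc mult.left_commute)
    have "((\<lambda>s. exp (M2 * (- s)) * norm (of_real (exp (j * (- s))) * (B (- s) - c))) \<longlongrightarrow> 0) at_top"
      using c(2) unfolding norm_mult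
      by (simp add: left_diff_distrib exp_diff exp_minus mult.assoc mult.left_commute norm_minus_commute divide_inverse norm_inverse)
    thus "((\<lambda>s. exp (M2 * s) * norm (of_real (exp (j * s)) * (B s - c))) \<longlongrightarrow> 0) at_bot"
      unfolding filterlim_at_bot_mirror .
  qed
  have top_any: "((\<lambda>s. exp ((j + M1) * s) * norm (B s - c)) \<longlongrightarrow> 0) at_top" if "j + M1 < 0" for c
    by (rule primitive_weighted_at_top[where q = q and C = C1 and \<alpha> = \<alpha>]; fact)
  have bot_any: "((\<lambda>s. exp ((- j + - M2) * s) * norm (- B (- s) - c)) \<longlongrightarrow> 0) at_top" if "- j + - M2 < 0" for c
    by (rule primitive_weighted_at_top[where q = "\<lambda>s. q (- s)" and C = C2 and \<alpha> = \<beta> and j = "-j"]; fact)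
  have top_lim: "\<exists>c. (B \<longlongrightarrow> c) at_top \<and> ((\<lambda>s. exp ((j + M1) * s) * norm (B s - c)) \<longlongrightarrow> 0) at_top"
    if "j + M1 > 0"
    by (rule primitive_limit_at_top[where q = q and C = C1 and \<alpha> = \<alpha> and B = B and j = j and M = M1]; (fact | blast))
  have bot_lim: "\<exists>c. ((\<lambda>s. - B (- s)) \<longlongrightarrow> c) at_top \<and> ((\<lambda>s. exp ((- j + - M2) * s) * norm (- B (- s) - c)) \<longlongrightarrow> 0) at_top"
    if "- j + - M2 > 0"
    by (rule primitive_limit_at_top[where q = "\<lambda>s. q (- s)" and C = C2 and \<alpha> = \<beta> and j = "-j" and B = "\<lambda>s. - B (- s)" and M = "-M2"]; (fact | blast))
  from cases consider "j + M1 < 0" "j + M2 < 0" | "j + M1 > 0" "j + M2 > 0" | "j + M1 > 0" "j + M2 < 0"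
      "((\<lambda>R. integral {-R..R} (\<lambda>s. q s * of_real (exp (- j * s)))) \<longlongrightarrow> 0) at_top" by blast
  thus ?thesis
  proof cases
    case 1
    obtain c where "((\<lambda>s. exp ((- j + - M2) * s) * norm (- B (- s) - c)) \<longlongrightarrow> 0) at_top"
      using bot_lim 1 by auto
    thus ?thesis using sol[of "- c"] top_any[OF 1(1), of "- c"] by simp
  next
    case 2
    obtain c where "((\<lambda>s. exp ((j + M1) * s) * norm (B s - c)) \<longlongrightarrow> 0) at_top"
      using top_lim 2 by auto
    thus ?thesis using sol[of c] bot_any[of "- c"] 2 by simp
  next
    \<comment> \<open>Both ends fix the constant. Since the integral over \<open>{-R..R}\<close> is
      \<open>B R - B (-R)\<close>, its convergence to \<open>0\<close> says that the two limits of
      \<open>B\<close> agree.\<close>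
    case 3
    obtain c where c: "(B \<longlongrightarrow> c) at_top" "((\<lambda>s. exp ((j + M1) * s) * norm (B s - c)) \<longlongrightarrow> 0) at_top"
      using top_lim 3 by auto
    obtain d where d: "((\<lambda>s. - B (- s)) \<longlongrightarrow> d) at_top"
      "((\<lambda>s. exp ((- j + - M2) * s) * norm (- B (- s) - d)) \<longlongrightarrow> 0) at_top"
      using bot_lim 3 by auto
    have "eventually (\<lambda>R. integral {-R..R} (\<lambda>s. q s * of_real (exp (- j * s))) = B R + - B (- R)) at_top"
      using eventually_ge_at_top[of 0]
    proof eventually_elim
      case (elim R)
      have "((\<lambda>s. q s * of_real (exp (- j * s))) has_integral B R - B (- R)) {-R..R}"
        by (rule fundamental_theorem_of_calculus) (use elim in \<open>auto intro!: has_vector_derivative_at_within B[simplified]\<close>)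
      thus ?case by (simp add: integral_unique)
    qed
    with 3(3) have "((\<lambda>R. B R + - B (- R)) \<longlongrightarrow> 0) at_top" by (rule Lim_transform_eventually)
    moreover have "((\<lambda>R. B R + - B (- R)) \<longlongrightarrow> c + d) at_top" by (intro tendsto_add c d)
    ultimately have "c + d = 0" using tendsto_unique trivial_limit_at_top_linorder by blast
    hence "d = - c" by (simp add: eq_neg_iff_add_eq_0 add.commute)
    thus ?thesis using sol[OF c(2)] d(2) by simp
  qed
qed

section \<open>The Bochner identity on the cylinder\<close>

lemma continuous_on_uncurry_compose:
  assumes "continuous_on UNIV (\<lambda>(s,t). f s t)" "continuous_on S g" "continuous_on S h"
  shows "continuous_on S (\<lambda>x. f (g x) (h x))"
  using continuous_on_compose2[OF assms(1) continuous_on_Pair[OF assms(2,3)]] by auto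

text \<open>\<open>M1\<close> and \<open>M2\<close> are the slopes of \<open>\<psi>\<close> at the
  two ends. They avoid the integers, so each Fourier mode is either dominated by the weight or
  dominates it at either end, and \<open>z\<^sup>m\<close> is square integrable against
  \<open>exp (-2 \<psi>)\<close> exactly for \<open>1 \<le> m \<le> N\<close>. \<open>X\<close>
  collects the angles where \<open>\<psi>t\<close> may have corners.\<close>

locale cylinder_weight =
  fixes \<psi> \<psi>s \<psi>t \<psi>ss \<psi>tt :: "real \<Rightarrow> real \<Rightarrow> real" and k :: "real \<Rightarrow> real"
    and X :: "real set" and M1 M2 K L :: real and N :: nat
  assumes ds: "((\<lambda>s. \<psi> s t) has_real_derivative \<psi>s s t) (at s)"
    and dt: "((\<lambda>t. \<psi> s t) has_real_derivative \<psi>t s t) (at t)"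
    and dss: "((\<lambda>s. \<psi>s s t) has_real_derivative \<psi>ss s t) (at s)"
    and dtt: "t \<notin> X \<Longrightarrow> ((\<lambda>t. \<psi>t s t) has_real_derivative \<psi>tt s t) (at t)"
    and finX: "finite (X \<inter> {0..2*pi})"
    and cont: "continuous_on UNIV (\<lambda>(s,t). \<psi> s t)"
    and conts: "continuous_on UNIV (\<lambda>(s,t). \<psi>s s t)"
    and contss: "continuous_on UNIV (\<lambda>(s,t). \<psi>ss s t)"
    and contt: "continuous_on UNIV (\<psi>t s)"
    and contk: "continuous_on UNIV k"
    and per: "\<psi> s (t + 2*pi) = \<psi> s t"
    and pert: "\<psi>t s (t + 2*pi) = \<psi>t s t"
    and lap: "t \<notin> X \<Longrightarrow> \<psi>ss s t + \<psi>tt s t \<ge> k s"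
    and kpos: "k s \<ge> 0"
    and bs: "\<bar>\<psi>s s t\<bar> \<le> K"
    and bt: "\<bar>\<psi>t s t\<bar> \<le> L"
    and up: "s \<ge> 0 \<Longrightarrow> \<bar>\<psi> s t - M1 * s\<bar> \<le> K"
    and down: "s \<le> 0 \<Longrightarrow> \<bar>\<psi> s t - M2 * s\<bar> \<le> K"
    and M1: "real N < M1" "M1 < real N + 1"
    and M2: "0 < M2" "M2 < 1/2"
begin

lemma K0: "K \<ge> 0" and L0: "L \<ge> 0"
  using order_trans[OF abs_ge_zero bs] order_trans[OF abs_ge_zero bt] by auto

lemma cont' [continuous_intros]:
  assumes "continuous_on S f" "continuous_on S g"
  shows "continuous_on S (\<lambda>x. \<psi> (f x) (g x))" "continuous_on S (\<lambda>x. \<psi>s (f x) (g x))"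
    "continuous_on S (\<lambda>x. \<psi>ss (f x) (g x))"
  using continuous_on_compose2[OF cont continuous_on_Pair[OF assms]]
    continuous_on_compose2[OF conts continuous_on_Pair[OF assms]]
    continuous_on_compose2[OF contss continuous_on_Pair[OF assms]] by auto

lemmas contk' [continuous_intros] = continuous_on_compose2[OF contk _ subset_UNIV]

text \<open>The Bochner identity for \<open>A = u + i w\<close>: up to the divergence of \<open>(P, Q)\<close> and a negative square,
  \<open>\<bar>A\<^sub>s + i A\<^sub>t\<bar>\<^sup>2 exp (2 \<psi>)\<close> dominates \<open>2 \<Delta>\<psi> \<bar>A\<bar>\<^sup>2 exp (2 \<psi>)\<close>.\<close>

lemma bochner_inequality:
  fixes u w us ws ut wt ust wst :: "real \<Rightarrow> real \<Rightarrow> real"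
  defines "P \<equiv> \<lambda>s t. 2 * exp (2 * \<psi> s t) * (w s t * ut s t - u s t * wt s t - \<psi>s s t * ((u s t)\<^sup>2 + (w s t)\<^sup>2))"
  assumes du: "\<And>s t. ((\<lambda>s. u s t) has_real_derivative us s t) (at s)"
    "\<And>s t. ((\<lambda>t. u s t) has_real_derivative ut s t) (at t)"
    "\<And>s t. ((\<lambda>s. ut s t) has_real_derivative ust s t) (at s)"
    "\<And>s t. ((\<lambda>t. us s t) has_real_derivative ust s t) (at t)"
    and dw: "\<And>s t. ((\<lambda>s. w s t) has_real_derivative ws s t) (at s)"
    "\<And>s t. ((\<lambda>t. w s t) has_real_derivative wt s t) (at t)"
    "\<And>s t. ((\<lambda>s. wt s t) has_real_derivative wst s t) (at s)"
    "\<And>s t. ((\<lambda>t. ws s t) has_real_derivative wst s t) (at t)"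
    and c: "continuous_on UNIV (\<lambda>(s,t). u s t)" "continuous_on UNIV (\<lambda>(s,t). us s t)"
      "continuous_on UNIV (\<lambda>(s,t). ut s t)" "continuous_on UNIV (\<lambda>(s,t). ust s t)"
      "continuous_on UNIV (\<lambda>(s,t). w s t)" "continuous_on UNIV (\<lambda>(s,t). ws s t)"
      "continuous_on UNIV (\<lambda>(s,t). wt s t)" "continuous_on UNIV (\<lambda>(s,t). wst s t)"
    and per': "\<And>s t. u s (t + 2*pi) = u s t" "\<And>s t. w s (t + 2*pi) = w s t"
      "\<And>s t. us s (t + 2*pi) = us s t" "\<And>s t. ws s (t + 2*pi) = ws s t"
    and top: "((\<lambda>s. integral {0..2*pi} (P s)) \<longlongrightarrow> 0) at_top"
    and bot: "((\<lambda>s. integral {0..2*pi} (P s)) \<longlongrightarrow> 0) at_bot"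
    and Y: "\<And>R. R \<ge> 1 \<Longrightarrow> integral {-R..R} (\<lambda>s. integral {0..2*pi}
       (\<lambda>t. exp (2 * \<psi> s t) * ((us s t - wt s t)\<^sup>2 + (ws s t + ut s t)\<^sup>2))) \<le> Y"
  shows "2 * integral {0..1} (\<lambda>s. k s * integral {0..2*pi} (\<lambda>t. exp (2 * \<psi> s t) * ((u s t)\<^sup>2 + (w s t)\<^sup>2))) \<le> Y"
proof -
  note [continuous_intros] = c[THEN continuous_on_uncurry_compose]
  define Ps where "Ps s t = 2 * exp (2 * \<psi> s t) * (2 * \<psi>s s t * (w s t * ut s t - u s t * wt s t - \<psi>s s t * ((u s t)\<^sup>2 + (w s t)\<^sup>2))
     + (ws s t * ut s t + w s t * ust s t - us s t * wt s t - u s t * wst s t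
        - \<psi>ss s t * ((u s t)\<^sup>2 + (w s t)\<^sup>2) - \<psi>s s t * (2 * u s t * us s t + 2 * w s t * ws s t)))" for s t
  \<comment> \<open>\<open>Q\<close> is periodic in \<open>t\<close>, so after integration over the
    circle only the component \<open>P\<close> of the field survives in the divergence.\<close>
  define Q where "Q s t = 2 * exp (2 * \<psi> s t) * (- (w s t * us s t - u s t * ws s t) - \<psi>t s t * ((u s t)\<^sup>2 + (w s t)\<^sup>2))" for s t
  define Qt where "Qt s t = 2 * exp (2 * \<psi> s t) * (2 * \<psi>t s t * (- (w s t * us s t - u s t * ws s t) - \<psi>t s t * ((u s t)\<^sup>2 + (w s t)\<^sup>2))
     + (- (wt s t * us s t + w s t * ust s t - ut s t * ws s t - u s t * wst s t)
        - \<psi>tt s t * ((u s t)\<^sup>2 + (w s t)\<^sup>2) - \<psi>t s t * (2 * u s t * ut s t + 2 * w s t * wt s t)))" for s t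
  define H where "H s t = exp (2 * \<psi> s t) * ((us s t - wt s t)\<^sup>2 + (ws s t + ut s t)\<^sup>2)" for s t
  define a where "a s t = exp (2 * \<psi> s t) * ((u s t)\<^sup>2 + (w s t)\<^sup>2)" for s t
  have dP: "((\<lambda>s. P s t) has_real_derivative Ps s t) (at s)" for s t
    unfolding P_def Ps_def
    by (rule derivative_eq_intros ds dss du dw refl)+ (simp add: power2_eq_square, algebra)
  have dQ: "((\<lambda>t. Q s t) has_real_derivative Qt s t) (at t)" if "t \<notin> X" for s t
    unfolding Q_def Qt_def
    by (rule derivative_eq_intros dt dtt[OF that] du dw refl)+ (simp add: power2_eq_square, algebra)
  have ineq: "Ps s t + Qt s t \<le> H s t - 2 * k s * a s t" if "t \<notin> X" for s t
  proof -
    define e where "e = exp (2 * \<psi> s t)"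
    \<comment> \<open>This \<open>Y\<close>, local to the block, is the squared modulus of
      \<open>exp (-2 \<psi>) (d/ds - i d/dt) (exp (2 \<psi>) A)\<close>, which up to sign is the
      formal adjoint of \<open>d/ds + i d/dt\<close> in the weight
      \<open>exp (2 \<psi>)\<close>.\<close>
    define Y where "Y = (us s t + wt s t + 2 * (\<psi>s s t * u s t + \<psi>t s t * w s t))\<^sup>2 +
        (ws s t - ut s t + 2 * (\<psi>s s t * w s t - \<psi>t s t * u s t))\<^sup>2"
    have "Ps s t + Qt s t = H s t - e * Y - 2 * (\<psi>ss s t + \<psi>tt s t) * a s t"
      unfolding Ps_def Qt_def H_def a_def Y_def e_def[symmetric] by algebra
    moreover have "e * Y \<ge> 0" by (simp add: e_def Y_def)
    moreover have "(\<psi>ss s t + \<psi>tt s t) * a s t \<ge> k s * a s t"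
      using lap[OF that] by (intro mult_right_mono) (auto simp: a_def)
    ultimately show ?thesis by (simp add: algebra_simps)
  qed
  have ctP: "continuous_on {0..2*pi} (P s)" "continuous_on {0..2*pi} (Ps s)" "continuous_on {0..2*pi} (H s)"
    "continuous_on {0..2*pi} (a s)" "continuous_on {0..2*pi} (Q s)" for s
    unfolding P_def Ps_def H_def a_def Q_def
    by (intro continuous_intros continuous_on_subset[OF contt] subset_UNIV)+
  have dE: "((\<lambda>s. integral {0..2*pi} (P s)) has_real_derivative integral {0..2*pi} (Ps s)) (at s)" for s
    unfolding cbox_interval[symmetric]
  proof (rule leibniz_rule_field_derivative[where U = UNIV])
    show "P s integrable_on cbox 0 (2*pi)" for s using ctP by (auto intro: integrable_continuous_real)
    show "continuous_on (UNIV \<times> cbox 0 (2*pi)) (\<lambda>(s,t). Ps s t)"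
      unfolding Ps_def split_beta by (intro continuous_intros)
  qed (use dP in auto)
  have Ele: "integral {0..2*pi} (Ps s) \<le> integral {0..2*pi} (H s) - 2 * k s * integral {0..2*pi} (a s)" for s
  proof -
    have q0: "(Qt s has_integral Q s (2*pi) - Q s 0) {0..2*pi}"
      by (rule fundamental_theorem_of_calculus_strong[OF finX])
         (use dQ ctP in \<open>auto simp flip: has_real_derivative_iff_has_vector_derivative\<close>)
    have "\<psi> s (2*pi) = \<psi> s 0" "\<psi>t s (2*pi) = \<psi>t s 0" "u s (2*pi) = u s 0" "w s (2*pi) = w s 0"
      "us s (2*pi) = us s 0" "ws s (2*pi) = ws s 0"
      using per[of s 0] pert[of s 0] per'[of s 0] by simp_all
    hence "Q s (2*pi) = Q s 0" by (simp add: Q_def)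
    with q0 have q0: "(Qt s has_integral 0) {0..2*pi}" by simp
    have i1: "((\<lambda>t. H s t - 2 * k s * a s t - Ps s t) has_integral
        (integral {0..2*pi} (H s) - 2 * k s * integral {0..2*pi} (a s) - integral {0..2*pi} (Ps s))) {0..2*pi}"
      by (intro has_integral_diff has_integral_mult_right integrable_integral integrable_continuous_real ctP)
    \<comment> \<open>\<open>Qt\<close> is the derivative of \<open>Q\<close> only off the finite
      set \<open>X\<close>; redefining it there leaves the integral unchanged and makes the
      comparison valid at every point.\<close>
    have i2: "((\<lambda>t. if t \<in> X \<inter> {0..2*pi} then H s t - 2 * k s * a s t - Ps s t else Qt s t) has_integral 0) {0..2*pi}"
      by (rule has_integral_spike_finite[OF finX _ q0]) auto
    have "0 \<le> integral {0..2*pi} (H s) - 2 * k s * integral {0..2*pi} (a s) - integral {0..2*pi} (Ps s)"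
      by (rule has_integral_le[OF i2 i1]) (use ineq in \<open>auto simp: algebra_simps\<close>)
    thus ?thesis by simp
  qed
  have cI: "continuous_on S (\<lambda>s. integral {0..2*pi} (H s))" "continuous_on S (\<lambda>s. integral {0..2*pi} (a s))"
     "continuous_on S (\<lambda>s. integral {0..2*pi} (Ps s))" for S
    unfolding cbox_interval[symmetric]
    by (rule integral_continuous_on_param; unfold H_def a_def Ps_def split_beta; intro continuous_intros)+
  define ka where "ka s = k s * integral {0..2*pi} (a s)" for s
  have cka: "continuous_on S ka" for S unfolding ka_def by (intro continuous_intros cI continuous_on_id)
  have ka0: "ka s \<ge> 0" for s unfolding ka_def
    by (intro mult_nonneg_nonneg kpos integral_nonneg integrable_continuous_real ctP) (auto simp: a_def)
  have *: "2 * integral {0..1} ka \<le> Y - integral {0..2*pi} (P R) + integral {0..2*pi} (P (-R))" if R: "R \<ge> 1" for R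
  proof -
    have "((\<lambda>s. integral {0..2*pi} (Ps s)) has_integral integral {0..2*pi} (P R) - integral {0..2*pi} (P (-R))) {-R..R}"
      by (rule fundamental_theorem_of_calculus)
         (use R dE in \<open>auto intro: has_field_derivative_at_within simp flip: has_real_derivative_iff_has_vector_derivative\<close>)
    moreover have "((\<lambda>s. integral {0..2*pi} (H s) - 2 * ka s) has_integral
        (integral {-R..R} (\<lambda>s. integral {0..2*pi} (H s)) - 2 * integral {-R..R} ka)) {-R..R}"
      by (intro has_integral_diff has_integral_mult_right integrable_integral integrable_continuous_real cI cka)
    ultimately have "integral {0..2*pi} (P R) - integral {0..2*pi} (P (-R)) \<le>
       integral {-R..R} (\<lambda>s. integral {0..2*pi} (H s)) - 2 * integral {-R..R} ka"
      by (rule has_integral_le) (use Ele in \<open>auto simp: ka_def mult.assoc\<close>)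
    moreover have "integral {-R..R} (\<lambda>s. integral {0..2*pi} (H s)) \<le> Y"
      using Y[OF R] unfolding H_def .
    moreover have "integral {0..1} ka \<le> integral {-R..R} ka"
      using R ka0 by (intro integral_subset_le integrable_continuous_real cka) auto
    ultimately show ?thesis by linarith
  qed
  have "((\<lambda>R. Y - integral {0..2*pi} (P R) + integral {0..2*pi} (P (-R))) \<longlongrightarrow> Y - 0 + 0) at_top"
    using bot unfolding filterlim_at_bot_mirror by (intro tendsto_intros top)
  hence "2 * integral {0..1} ka \<le> Y - 0 + 0"
    by (rule tendsto_lowerbound) (use * in \<open>auto intro!: eventually_mono[OF eventually_ge_at_top[of 1]]\<close>)
  thus ?thesis unfolding ka_def a_def by simp
qed

end

lemma integrable_exp_neg_abs:
  fixes c :: real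
  assumes "c > 0"
  shows "(\<lambda>s::real. C * exp (- c * \<bar>s\<bar>)) integrable_on UNIV"
proof -
  have 1: "((\<lambda>s. exp (- c * s)) has_integral exp (- c * 0) / c) {0..}"
    by (rule has_integral_exp_minus_to_infinity[OF assms])
  have i1: "(\<lambda>s. exp (- c * \<bar>s\<bar>)) integrable_on {0..}"
    by (rule integrable_eq[of "\<lambda>s. exp (- c * s)"]) (use 1 in auto)
  hence "(\<lambda>s. exp (- c * \<bar>s\<bar>)) absolutely_integrable_on {0..}"
    by (intro nonnegative_absolutely_integrable_1) auto
  hence "(\<lambda>s. exp (- c * \<bar>- s\<bar>)) absolutely_integrable_on {..0}"
    using has_absolute_integral_reflect_real[of "{..0::real}" "{0..}" "\<lambda>s. exp (- c * \<bar>s\<bar>)"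
        "integral {0..} (\<lambda>s. exp (- c * \<bar>s\<bar>))"] by force
  hence i2: "(\<lambda>s. exp (- c * \<bar>s\<bar>)) integrable_on {..0}"
    using set_lebesgue_integral_eq_integral(1) by simp
  have "(\<lambda>s. exp (- c * \<bar>s\<bar>)) integrable_on {0..} \<union> {..0}"
    by (rule integrable_Un[OF _ i1 i2]) (rule negligible_subset[of "{0}"], auto)
  moreover have "{0..} \<union> {..0::real} = UNIV" by auto
  ultimately show ?thesis by (intro integrable_on_mult_right) auto
qed

lemma exp_decay_integral:
  fixes q :: "real \<Rightarrow> 'a :: euclidean_space"
  assumes c: "continuous_on UNIV q" and g: "\<gamma> > 0"
    and b: "\<And>s. norm (q s) \<le> C * exp (- \<gamma> * \<bar>s\<bar>)"
  shows "q integrable_on UNIV" "((\<lambda>R. integral {-R..R} q) \<longlongrightarrow> integral UNIV q) at_top"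
proof -
  show i: "q integrable_on UNIV"
    by (rule integrable_on_all_intervals_integrable_bound[where g = "\<lambda>s. C * exp (- \<gamma> * \<bar>s\<bar>)"])
       (use b in \<open>auto intro: integrable_continuous_real continuous_on_subset[OF c] integrable_exp_neg_abs[OF g, simplified]\<close>)
  show "((\<lambda>R. integral {-R..R} q) \<longlongrightarrow> integral UNIV q) at_top"
  proof (rule tendstoI)
    fix e :: real assume "e > 0"
    with integrable_integral[OF i] obtain B where B: "B > 0"
      "\<And>a b. ball 0 B \<subseteq> cbox a b \<Longrightarrow> norm (integral (cbox a b) q - integral UNIV q) < e"
      unfolding has_integral_alt' by auto
    show "eventually (\<lambda>R. dist (integral {-R..R} q) (integral UNIV q) < e) at_top"
      using eventually_ge_at_top[of B]
    proof eventually_elim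
      case (elim R)
      hence "ball 0 B \<subseteq> cbox (-R) R" by (auto simp: dist_real_def)
      from B(2)[OF this] show ?case by (simp add: dist_norm)
    qed
  qed
qed

text \<open>Jensen's inequality for the probability kernel \<open>K\<close> moves the square inside
  the convolution. Shifting the argument by \<open>y\<close> changes \<open>exp (2 * \<psi>)\<close>
  by a factor of at most \<open>exp (2 * L * \<bar>y\<bar>)\<close>, and the kernel averages this to
  at most \<open>2\<close>.\<close>

lemma kernel_convolution_bound:
  fixes K \<psi> :: "real \<Rightarrow> real" and h :: "real \<Rightarrow> complex"
  assumes K: "\<And>t. K t \<ge> 0" "continuous_on UNIV K" "\<And>t. K (t + 2*pi) = K t"
    "integral {-pi..pi} K = 1" "integral {-pi..pi} (\<lambda>t. K t * exp (2 * L * \<bar>t\<bar>)) \<le> 2"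
    and h: "continuous_on UNIV h" "\<And>t. h (t + 2*pi) = h t"
    and p: "continuous_on UNIV \<psi>" "\<And>t. \<psi> (t + 2*pi) = \<psi> t" "\<And>t t'. \<bar>\<psi> t - \<psi> t'\<bar> \<le> L * \<bar>t - t'\<bar>"
  shows "integral {0..2*pi} (\<lambda>t. exp (2 * \<psi> t) * (cmod (integral {0..2*pi} (\<lambda>x. h x * of_real (K (t - x)))))\<^sup>2)
     \<le> 2 * integral {0..2*pi} (\<lambda>t. exp (2 * \<psi> t) * (cmod (h t))\<^sup>2)"
proof -
  note [continuous_intros] = continuous_on_compose2[OF K(2)] continuous_on_compose2[OF h(1)] continuous_on_compose2[OF p(1)]
  define \<eta> where "\<eta> t = exp (2 * \<psi> t) * (cmod (h t))\<^sup>2" for t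
  have ce: "continuous_on S \<eta>" for S unfolding \<eta>_def by (intro continuous_intros) auto
  note [continuous_intros] = continuous_on_compose2[OF ce[of UNIV]]
  have conv: "integral {0..2*pi} (\<lambda>x. h x * of_real (K (t - x))) = integral {-pi..pi} (\<lambda>y. of_real (K y) * h (t - y))" for t
  proof -
    define G where "G x = h x * complex_of_real (K (t - x))" for x
    have Gp: "G (x + 2*pi) = G x" for x
      using K(3)[of "t - (x + 2*pi)"] h(2)[of x] by (simp add: G_def algebra_simps)
    have Gc: "continuous_on S G" for S unfolding G_def by (intro continuous_intros) auto
    have "integral {0..2*pi} G = integral {t-pi..t-pi+2*pi} G"
      by (rule integral_periodic_shift[symmetric]) (use Gp Gc in auto)
    also have "\<dots> = integral {-pi..pi} (\<lambda>y. G (t + y))"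
      using integral_shift_Icc_real[of "-pi" pi G t] by (simp add: o_def algebra_simps)
    also have "\<dots> = integral {-pi..pi} (\<lambda>y. G (t - y))"
      using Henstock_Kurzweil_Integration.integral_reflect_real[of pi "-pi" "\<lambda>y. G (t + y)"] by simp
    finally have "integral {0..2*pi} G = integral {-pi..pi} (\<lambda>y. G (t - y))" .
    moreover have "G = (\<lambda>x. h x * of_real (K (t - x)))" by (simp add: fun_eq_iff G_def)
    ultimately show ?thesis by (simp add: mult.commute)
  qed
  have jensen: "(cmod (integral {-pi..pi} (\<lambda>y. of_real (K y) * h (t - y))))\<^sup>2 \<le> integral {-pi..pi} (\<lambda>y. K y * (cmod (h (t - y)))\<^sup>2)" for t
  proof -
    define c where "c = integral {-pi..pi} (\<lambda>y. of_real (K y) * h (t - y))"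
    have ci: "((\<lambda>y. of_real (K y) * h (t - y)) has_integral c) {-pi..pi}"
      unfolding c_def by (intro integrable_integral integrable_continuous_real continuous_intros) auto
    have "((\<lambda>y. Re (cnj c * (of_real (K y) * h (t - y)))) has_integral Re (cnj c * c)) {-pi..pi}"
      by (intro has_integral_linear[OF has_integral_mult_right[OF ci] bounded_linear_Re, unfolded o_def])
    hence i1: "((\<lambda>y. K y * Re (cnj c * h (t - y))) has_integral (cmod c)\<^sup>2) {-pi..pi}"
      unfolding cmod_power2 by (simp add: power2_eq_square algebra_simps)
    have i2: "(K has_integral 1) {-pi..pi}"
      using K(4) integrable_integral[OF integrable_continuous_real[OF continuous_on_subset[OF K(2)]], of "-pi" pi] by simp
    have i3: "((\<lambda>y. K y * (cmod (h (t - y)))\<^sup>2) has_integral integral {-pi..pi} (\<lambda>y. K y * (cmod (h (t - y)))\<^sup>2)) {-pi..pi}"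
      by (intro integrable_integral integrable_continuous_real continuous_intros) auto
    have i4: "((\<lambda>y. K y * (cmod (h (t - y)))\<^sup>2 - 2 * (K y * Re (cnj c * h (t - y))) + K y * (cmod c)\<^sup>2) has_integral
       (integral {-pi..pi} (\<lambda>y. K y * (cmod (h (t - y)))\<^sup>2) - 2 * (cmod c)\<^sup>2 + 1 * (cmod c)\<^sup>2)) {-pi..pi}"
      by (intro has_integral_add has_integral_diff has_integral_mult_right has_integral_mult_left i1 i2 i3)
    \<comment> \<open>Integrating \<open>K * \<bar>h - c\<bar>\<^sup>2 \<ge> 0\<close>, where
      \<open>c\<close> is the average of \<open>h\<close>, is the variance form of Jensen's
      inequality.\<close>
    have sq: "K y * (cmod (h (t - y)))\<^sup>2 - 2 * (K y * Re (cnj c * h (t - y))) + K y * (cmod c)\<^sup>2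
        = K y * (cmod (h (t - y) - c))\<^sup>2" for y
      unfolding cmod_power2 by (simp add: power2_eq_square algebra_simps)
    have "0 \<le> integral {-pi..pi} (\<lambda>y. K y * (cmod (h (t - y)))\<^sup>2) - 2 * (cmod c)\<^sup>2 + 1 * (cmod c)\<^sup>2"
      by (rule has_integral_nonneg[OF i4], unfold sq) (simp add: K(1))
    thus ?thesis by (simp add: c_def)
  qed
  have "integral {0..2*pi} (\<lambda>t. exp (2 * \<psi> t) * (cmod (integral {0..2*pi} (\<lambda>x. h x * of_real (K (t - x)))))\<^sup>2)
     \<le> integral {0..2*pi} (\<lambda>t. integral {-pi..pi} (\<lambda>y. K y * (exp (2 * L * \<bar>y\<bar>) * \<eta> (t - y))))"
  proof (rule integral_le)
    have "continuous_on {0..2*pi} (\<lambda>t. integral {-pi..pi} (\<lambda>y. of_real (K y) * h (t - y)))"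
      unfolding cbox_interval[symmetric]
      by (rule integral_continuous_on_param, unfold split_beta, intro continuous_intros) auto
    thus "(\<lambda>t. exp (2 * \<psi> t) * (cmod (integral {0..2*pi} (\<lambda>x. h x * of_real (K (t - x)))))\<^sup>2) integrable_on {0..2*pi}"
      unfolding conv by (intro integrable_continuous_real continuous_intros) auto
    have "continuous_on {0..2*pi} (\<lambda>t. integral {-pi..pi} (\<lambda>y. K y * (exp (2 * L * \<bar>y\<bar>) * \<eta> (t - y))))"
      unfolding cbox_interval[symmetric]
      by (rule integral_continuous_on_param, unfold split_beta, intro continuous_intros) auto
    thus "(\<lambda>t. integral {-pi..pi} (\<lambda>y. K y * (exp (2 * L * \<bar>y\<bar>) * \<eta> (t - y)))) integrable_on {0..2*pi}"
      by (rule integrable_continuous_real)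
    fix t
    have "exp (2 * \<psi> t) * (cmod (integral {0..2*pi} (\<lambda>x. h x * of_real (K (t - x)))))\<^sup>2
       \<le> exp (2 * \<psi> t) * integral {-pi..pi} (\<lambda>y. K y * (cmod (h (t - y)))\<^sup>2)"
      unfolding conv by (intro mult_left_mono jensen) auto
    also have "\<dots> = integral {-pi..pi} (\<lambda>y. exp (2 * \<psi> t) * (K y * (cmod (h (t - y)))\<^sup>2))" by simp
    also have "\<dots> \<le> integral {-pi..pi} (\<lambda>y. K y * (exp (2 * L * \<bar>y\<bar>) * \<eta> (t - y)))"
    proof (rule integral_le)
      fix y
      have "2 * \<psi> t \<le> 2 * L * \<bar>y\<bar> + 2 * \<psi> (t - y)" using p(3)[of t "t - y"] by (simp add: abs_le_iff)
      hence "exp (2 * \<psi> t) \<le> exp (2 * L * \<bar>y\<bar>) * exp (2 * \<psi> (t - y))"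
        by (simp add: exp_add[symmetric])
      from mult_right_mono[OF this, of "K y * (cmod (h (t - y)))\<^sup>2"]
      show "exp (2 * \<psi> t) * (K y * (cmod (h (t - y)))\<^sup>2) \<le> K y * (exp (2 * L * \<bar>y\<bar>) * \<eta> (t - y))"
        using K(1)[of y] by (simp add: \<eta>_def mult_ac)
    qed (intro integrable_continuous_real continuous_intros; simp)+
    finally show "exp (2 * \<psi> t) * (cmod (integral {0..2*pi} (\<lambda>x. h x * of_real (K (t - x)))))\<^sup>2
       \<le> integral {-pi..pi} (\<lambda>y. K y * (exp (2 * L * \<bar>y\<bar>) * \<eta> (t - y)))" .
  qed
  also have "\<dots> = integral {-pi..pi} (\<lambda>y. integral {0..2*pi} (\<lambda>t. K y * (exp (2 * L * \<bar>y\<bar>) * \<eta> (t - y))))"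
    unfolding cbox_interval[symmetric]
    by (rule integral_swap_continuous, unfold split_beta, intro continuous_intros) auto
  also have "\<dots> = integral {-pi..pi} (\<lambda>y. (K y * exp (2 * L * \<bar>y\<bar>)) * integral {0..2*pi} \<eta>)"
  proof (rule integral_cong)
    fix y
    have "integral {0..2*pi} (\<lambda>t. \<eta> (t - y)) = integral {-y..-y+2*pi} \<eta>"
      using integral_shift_Icc_real[of 0 "2*pi" \<eta> "-y"] by (simp add: o_def algebra_simps)
    also have "\<dots> = integral {0..2*pi} \<eta>"
      by (rule integral_periodic_shift) (use ce h p in \<open>auto simp: \<eta>_def\<close>)
    finally show "integral {0..2*pi} (\<lambda>t. K y * (exp (2 * L * \<bar>y\<bar>) * \<eta> (t - y))) = (K y * exp (2 * L * \<bar>y\<bar>)) * integral {0..2*pi} \<eta>"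
      by simp
  qed
  also have "\<dots> = integral {-pi..pi} (\<lambda>y. K y * exp (2 * L * \<bar>y\<bar>)) * integral {0..2*pi} \<eta>" by simp
  also have "\<dots> \<le> 2 * integral {0..2*pi} \<eta>"
    by (intro mult_right_mono K(5) integral_nonneg integrable_continuous_real ce) (auto simp: \<eta>_def)
  finally show ?thesis unfolding \<eta>_def .
qed

section \<open>A weighted minimum problem on the cylinder\<close>

text \<open>As \<open>M2 > 0\<close>, the constant function is not square integrable against
  \<open>exp (-2 \<psi>)\<close> when \<open>s\<close> tends to minus infinity; the cut-off removes
  that end. Its derivative is supported on \<open>0 \<le> s \<le> 1\<close>.\<close>

definition cutoff :: "real \<Rightarrow> real" where "cutoff s = min 1 (max 0 s)"

lemma cutoff_simps: "s \<le> 0 \<Longrightarrow> cutoff s = 0" "s \<ge> 1 \<Longrightarrow> cutoff s = 1"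
  "0 \<le> s \<Longrightarrow> s \<le> 1 \<Longrightarrow> cutoff s = s" "\<bar>cutoff s\<bar> \<le> 1"
  by (auto simp: cutoff_def)

lemma continuous_on_cutoff [continuous_intros]: "continuous_on S f \<Longrightarrow> continuous_on S (\<lambda>x. cutoff (f x))"
  unfolding cutoff_def by (intro continuous_intros)

text \<open>\<open>basis_fun m\<close> is \<open>z\<^sup>m\<close> for \<open>z = exp (s + i t)\<close> and \<open>m \<ge> 1\<close>, and the cut-off constant for \<open>m = 0\<close>.\<close>

definition basis_fun :: "nat \<Rightarrow> real \<Rightarrow> real \<Rightarrow> complex" where
  "basis_fun m s t = (if m = 0 then of_real (cutoff s) else of_real (exp (real m * s)) * cis (real m * t))"

lemma continuous_on_basis_fun [continuous_intros]:
  assumes "continuous_on S f" "continuous_on S g"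
  shows "continuous_on S (\<lambda>x. basis_fun m (f x) (g x))"
  unfolding basis_fun_def by (cases "m = 0") (auto intro!: continuous_intros assms)

lemma basis_fun_periodic: "basis_fun m s (t + 2*pi) = basis_fun m s t"
  using cis_multiple_2pi[of "of_nat m"]
  by (simp add: basis_fun_def distrib_left cis_mult[symmetric] mult_ac)

context cylinder_weight
begin

text \<open>A common majorant of all \<open>basis_fun m\<close> with \<open>m \<le> N\<close>. For
  \<open>s < 0\<close> the largest of them is \<open>z\<close>, because the cut-off constant
  vanishes there.\<close>

definition growth :: "real \<Rightarrow> real" where "growth s = (if s \<ge> 0 then exp (real N * s) else exp s)"

lemma growth_pos: "growth s > 0" by (simp add: growth_def)

lemma norm_basis_fun_le: "m \<le> N \<Longrightarrow> norm (basis_fun m s t) \<le> growth s"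
proof (cases "m = 0")
  case True
  thus ?thesis
    using cutoff_simps(4)[of s] cutoff_simps(1)[of s] one_le_exp_iff[of "real N * s"]
    by (auto simp: basis_fun_def growth_def intro: order_trans)
next
  case False
  assume "m \<le> N"
  with False show ?thesis
    by (auto simp: basis_fun_def growth_def norm_mult intro!: mult_right_mono)
qed

lemma weight_le: "exp (- 2 * \<psi> s t) \<le> exp (2 * K) * (if s \<ge> 0 then exp (- 2 * M1 * s) else exp (- 2 * M2 * s))"
  using up[of s t] down[of s t] by (auto simp: exp_add[symmetric] abs_le_iff)

text \<open>The smaller of the decay rates of
  \<open>growth s * growth s * exp (- 2 * \<psi> s t)\<close> at the two ends; the gaps
  \<open>N < M1\<close> and \<open>M2 < 1\<close> make it positive.\<close>

definition rate :: real where "rate = min (2 * (M1 - real N)) (2 * (1 - M2))"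

lemma rate_pos: "rate > 0" using M1 M2 by (auto simp: rate_def)

lemma growth_weight_le: "growth s * growth s * exp (- 2 * \<psi> s t) \<le> exp (2 * K) * exp (- rate * \<bar>s\<bar>)"
proof (cases "s \<ge> 0")
  case True
  have "growth s * growth s * exp (- 2 * \<psi> s t) \<le> growth s * growth s * (exp (2 * K) * exp (- 2 * M1 * s))"
    using weight_le[of s t] True growth_pos[of s] by (intro mult_left_mono) auto
  also have "\<dots> = exp (2 * K) * exp (- (2 * (M1 - real N)) * s)"
    using True by (simp add: growth_def exp_add[symmetric] algebra_simps)
  also have "- (2 * (M1 - real N)) * s \<le> - rate * s"
    using True by (intro mult_right_mono) (auto simp: rate_def)
  hence "exp (- (2 * (M1 - real N)) * s) \<le> exp (- rate * \<bar>s\<bar>)" using True by simp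
  finally show ?thesis by simp
next
  case False
  have "growth s * growth s * exp (- 2 * \<psi> s t) \<le> growth s * growth s * (exp (2 * K) * exp (- 2 * M2 * s))"
    using weight_le[of s t] False growth_pos[of s] by (intro mult_left_mono) auto
  also have "\<dots> = exp (2 * K) * exp (2 * (1 - M2) * s)"
    using False by (simp add: growth_def exp_add[symmetric] algebra_simps)
  also have "2 * (1 - M2) * s \<le> rate * s"
    using False by (intro mult_right_mono_neg) (auto simp: rate_def)
  hence "exp (2 * (1 - M2) * s) \<le> exp (- rate * \<bar>s\<bar>)" using False by simp
  finally show ?thesis by simp
qed

definition cyl_inner :: "(real \<Rightarrow> real \<Rightarrow> complex) \<Rightarrow> (real \<Rightarrow> real \<Rightarrow> complex) \<Rightarrow> complex" where
  "cyl_inner f g = integral UNIV (\<lambda>s. integral {0..2*pi} (\<lambda>t. f s t * cnj (g s t) * of_real (exp (- 2 * \<psi> s t))))"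

text \<open>A class closed under linear combinations on which \<open>cyl_inner\<close> converges:
  the bound by \<open>growth\<close> makes the integrand decay exponentially at both ends.\<close>

definition admissible :: "(real \<Rightarrow> real \<Rightarrow> complex) \<Rightarrow> bool" where
  "admissible f \<longleftrightarrow> continuous_on UNIV (\<lambda>(s,t). f s t) \<and> (\<exists>C\<ge>0. \<forall>s t. norm (f s t) \<le> C * growth s)"

lemma admissible_basis_fun: "m \<le> N \<Longrightarrow> admissible (basis_fun m)"
  unfolding admissible_def split_beta
  by (intro conjI continuous_intros exI[of _ 1]) (use norm_basis_fun_le in auto)

lemma admissible_scale: "admissible f \<Longrightarrow> admissible (\<lambda>s t. c * f s t)"
  unfolding admissible_def
proof safe
  fix C assume "C \<ge> 0" "\<forall>s t. norm (f s t) \<le> C * growth s"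
  thus "\<exists>C\<ge>0. \<forall>s t. norm (c * f s t) \<le> C * growth s"
    by (intro exI[of _ "norm c * C"]) (auto simp: norm_mult mult.assoc intro!: mult_left_mono)
qed (auto simp: split_beta intro!: continuous_intros)

lemma admissible_add: "admissible f \<Longrightarrow> admissible g \<Longrightarrow> admissible (\<lambda>s t. f s t + g s t)"
  unfolding admissible_def
proof safe
  fix C D assume "C \<ge> 0" "\<forall>s t. norm (f s t) \<le> C * growth s" "D \<ge> 0" "\<forall>s t. norm (g s t) \<le> D * growth s"
  thus "\<exists>C\<ge>0. \<forall>s t. norm (f s t + g s t) \<le> C * growth s"
    by (intro exI[of _ "C + D"]) (auto simp: distrib_right intro!: norm_triangle_le add_mono)
qed (auto simp: split_beta intro!: continuous_intros)

lemma admissible_sum: "finite I \<Longrightarrow> (\<And>i. i \<in> I \<Longrightarrow> admissible (f i)) \<Longrightarrow> admissible (\<lambda>s t. \<Sum>i\<in>I. f i s t)"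
proof (induction I rule: finite_induct)
  case empty
  show ?case by (auto simp: admissible_def intro: exI[of _ 0])
qed (auto intro: admissible_add)

lemma inner_slice:
  assumes "admissible f" "admissible g"
  defines "q \<equiv> \<lambda>s. integral {0..2*pi} (\<lambda>t. f s t * cnj (g s t) * of_real (exp (- 2 * \<psi> s t)))"
  shows "continuous_on {0..2*pi} (\<lambda>t. f s t * cnj (g s t) * of_real (exp (- 2 * \<psi> s t)))"
    and "continuous_on UNIV q"
    and "\<exists>C. \<forall>s. norm (q s) \<le> C * exp (- rate * \<bar>s\<bar>)"
proof -
  have cf: "continuous_on UNIV (\<lambda>(s,t). f s t)" "continuous_on UNIV (\<lambda>(s,t). g s t)"
    using assms by (auto simp: admissible_def)
  note [continuous_intros] = cf[THEN continuous_on_uncurry_compose]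
  show c: "continuous_on {0..2*pi} (\<lambda>t. f s t * cnj (g s t) * of_real (exp (- 2 * \<psi> s t)))" for s
    by (intro continuous_intros)
  show "continuous_on UNIV q" unfolding q_def cbox_interval[symmetric]
    by (rule integral_continuous_on_param, unfold split_beta, intro continuous_intros)
  from assms obtain C D where C: "C \<ge> 0" "\<And>s t. norm (f s t) \<le> C * growth s" and D: "D \<ge> 0" "\<And>s t. norm (g s t) \<le> D * growth s"
    by (auto simp: admissible_def)
  have "norm (q s) \<le> C * D * exp (2 * K) * (2 * pi) * exp (- rate * \<bar>s\<bar>)" for s
  proof -
    have "norm (q s) \<le> (C * D * (exp (2 * K) * exp (- rate * \<bar>s\<bar>))) * (2 * pi - 0)"
      unfolding q_def
    proof (rule integral_bound[OF _ c])
      fix t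
      have "norm (f s t * cnj (g s t) * of_real (exp (- 2 * \<psi> s t))) = norm (f s t) * norm (g s t) * exp (- 2 * \<psi> s t)"
        by (simp add: norm_mult)
      also have "\<dots> \<le> (C * growth s) * (D * growth s) * exp (- 2 * \<psi> s t)"
        using C D growth_pos[of s] by (intro mult_right_mono mult_mono) auto
      also have "\<dots> = C * D * (growth s * growth s * exp (- 2 * \<psi> s t))" by simp
      also have "\<dots> \<le> C * D * (exp (2 * K) * exp (- rate * \<bar>s\<bar>))"
        using C D by (intro mult_left_mono growth_weight_le) auto
      finally show "norm (f s t * cnj (g s t) * of_real (exp (- 2 * \<psi> s t))) \<le> C * D * (exp (2 * K) * exp (- rate * \<bar>s\<bar>))" .
    qed simp
    thus ?thesis by (simp add: mult_ac)
  qed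
  thus "\<exists>C. \<forall>s. norm (q s) \<le> C * exp (- rate * \<bar>s\<bar>)" by blast
qed

lemma inner_integrable:
  assumes "admissible f" "admissible g"
  shows "(\<lambda>t. f s t * cnj (g s t) * of_real (exp (- 2 * \<psi> s t))) integrable_on {0..2*pi}"
    and "(\<lambda>s. integral {0..2*pi} (\<lambda>t. f s t * cnj (g s t) * of_real (exp (- 2 * \<psi> s t)))) integrable_on UNIV"
    and "((\<lambda>R. integral {-R..R} (\<lambda>s. integral {0..2*pi} (\<lambda>t. f s t * cnj (g s t) * of_real (exp (- 2 * \<psi> s t)))))
      \<longlongrightarrow> cyl_inner f g) at_top"
proof -
  note sl = inner_slice[OF assms]
  show "(\<lambda>t. f s t * cnj (g s t) * of_real (exp (- 2 * \<psi> s t))) integrable_on {0..2*pi}"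
    by (rule integrable_continuous_real[OF sl(1)])
  from sl(3) obtain C where "\<And>s. norm (integral {0..2*pi} (\<lambda>t. f s t * cnj (g s t) * of_real (exp (- 2 * \<psi> s t)))) \<le> C * exp (- rate * \<bar>s\<bar>)"
    by blast
  from exp_decay_integral[OF sl(2) rate_pos this]
  show "(\<lambda>s. integral {0..2*pi} (\<lambda>t. f s t * cnj (g s t) * of_real (exp (- 2 * \<psi> s t)))) integrable_on UNIV"
    "((\<lambda>R. integral {-R..R} (\<lambda>s. integral {0..2*pi} (\<lambda>t. f s t * cnj (g s t) * of_real (exp (- 2 * \<psi> s t)))))
      \<longlongrightarrow> cyl_inner f g) at_top" unfolding cyl_inner_def by auto
qed

lemma cyl_inner_add:
  assumes "admissible f" "admissible g" "admissible h"
  shows "cyl_inner (\<lambda>s t. f s t + g s t) h = cyl_inner f h + cyl_inner g h"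
  unfolding cyl_inner_def
  using inner_integrable[OF assms(1,3)] inner_integrable[OF assms(2,3)]
  by (simp add: distrib_right integral_add)

lemma cyl_inner_scale:
  assumes "admissible f" "admissible h"
  shows "cyl_inner (\<lambda>s t. c * f s t) h = c * cyl_inner f h"
  unfolding cyl_inner_def mult.assoc by simp

lemma cyl_inner_sum:
  assumes "finite I" "\<And>i. i \<in> I \<Longrightarrow> admissible (f i)" "admissible h"
  shows "cyl_inner (\<lambda>s t. \<Sum>i\<in>I. c i * f i s t) h = (\<Sum>i\<in>I. c i * cyl_inner (f i) h)"
  using assms(1,2)
proof (induction I rule: finite_induct)
  case empty
  show ?case by (simp add: cyl_inner_def)
next
  case (insert i I)
  thus ?case
    by (simp add: cyl_inner_add admissible_scale admissible_sum assms(3) cyl_inner_scale)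
qed

lemma cyl_inner_cnj: "cyl_inner g f = cnj (cyl_inner f g)"
  unfolding cyl_inner_def integral_cnj by (simp add: mult.commute)

lemma cyl_inner_self:
  assumes "admissible f"
  shows "cyl_inner f f = of_real (integral UNIV (\<lambda>s. integral {0..2*pi} (\<lambda>t. (cmod (f s t))\<^sup>2 * exp (- 2 * \<psi> s t))))"
    and "(\<lambda>s. integral {0..2*pi} (\<lambda>t. (cmod (f s t))\<^sup>2 * exp (- 2 * \<psi> s t))) integrable_on UNIV"
    and "continuous_on {0..2*pi} (\<lambda>t. (cmod (f s t))\<^sup>2 * exp (- 2 * \<psi> s t))"
    and "continuous_on UNIV (\<lambda>s. integral {0..2*pi} (\<lambda>t. (cmod (f s t))\<^sup>2 * exp (- 2 * \<psi> s t)))"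
proof -
  have eq: "f s t * cnj (f s t) * of_real (exp (- 2 * \<psi> s t)) = of_real ((cmod (f s t))\<^sup>2 * exp (- 2 * \<psi> s t))" for s t
    unfolding complex_norm_square of_real_mult ..
  have cf: "continuous_on UNIV (\<lambda>(s,t). f s t)" using assms by (auto simp: admissible_def)
  note [continuous_intros] = cf[THEN continuous_on_uncurry_compose]
  show "continuous_on {0..2*pi} (\<lambda>t. (cmod (f s t))\<^sup>2 * exp (- 2 * \<psi> s t))" for s
    by (intro continuous_intros)
  hence i: "(\<lambda>t. (cmod (f s t))\<^sup>2 * exp (- 2 * \<psi> s t)) integrable_on {0..2*pi}" for s
    by (rule integrable_continuous_real)
  show "continuous_on UNIV (\<lambda>s. integral {0..2*pi} (\<lambda>t. (cmod (f s t))\<^sup>2 * exp (- 2 * \<psi> s t)))"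
    unfolding cbox_interval[symmetric]
    by (rule integral_continuous_on_param, unfold split_beta, intro continuous_intros)
  have eq2: "integral {0..2*pi} (\<lambda>t. f s t * cnj (f s t) * of_real (exp (- 2 * \<psi> s t)))
     = of_real (integral {0..2*pi} (\<lambda>t. (cmod (f s t))\<^sup>2 * exp (- 2 * \<psi> s t)))" for s
    unfolding eq by (intro integral_unique has_integral_of_real integrable_integral i)
  have "(\<lambda>s. complex_of_real (integral {0..2*pi} (\<lambda>t. (cmod (f s t))\<^sup>2 * exp (- 2 * \<psi> s t)))) integrable_on UNIV"
    using inner_integrable(2)[OF assms assms] unfolding eq2 .
  from integrable_linear[OF this bounded_linear_Re]
  show i2: "(\<lambda>s. integral {0..2*pi} (\<lambda>t. (cmod (f s t))\<^sup>2 * exp (- 2 * \<psi> s t))) integrable_on UNIV"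
    by (simp add: o_def)
  show "cyl_inner f f = of_real (integral UNIV (\<lambda>s. integral {0..2*pi} (\<lambda>t. (cmod (f s t))\<^sup>2 * exp (- 2 * \<psi> s t))))"
    unfolding cyl_inner_def eq2 by (intro integral_unique has_integral_of_real integrable_integral i2)
qed

text \<open>This combination is the projection of the cut-off constant off the span of
  \<open>z\<close>, ..., \<open>z\<^sup>N\<close>, hence of minimal weighted norm among those with
  coefficient \<open>1\<close> at the constant. Its orthogonality later becomes the solvability
  condition for the modes \<open>-1\<close>, ..., \<open>-N\<close>.\<close>

lemma orthogonal_combination:
  obtains x :: "nat \<Rightarrow> complex" where "x 0 = 1"
    "\<And>m. m \<in> {1..N} \<Longrightarrow> cyl_inner (\<lambda>s t. \<Sum>i\<le>N. x i * basis_fun i s t) (basis_fun m) = 0"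
proof -
  have psd: "0 \<le> Re (\<Sum>i\<le>N. \<Sum>j\<le>N. x i * cnj (x j) * cyl_inner (basis_fun (min i N)) (basis_fun (min j N)))" for x
  proof -
    define f where "f = (\<lambda>s t. \<Sum>i\<le>N. x i * basis_fun i s t)"
    have a: "admissible f" unfolding f_def by (intro admissible_sum admissible_scale admissible_basis_fun) auto
    have b: "admissible (basis_fun j)" if "j \<le> N" for j using that by (rule admissible_basis_fun)
    have "cyl_inner f f = (\<Sum>i\<le>N. x i * cyl_inner (basis_fun i) f)"
      unfolding f_def using a b by (subst cyl_inner_sum) (auto simp: f_def)
    also have "\<dots> = (\<Sum>i\<le>N. x i * cnj (cyl_inner f (basis_fun i)))" by (simp flip: cyl_inner_cnj)
    also have "\<dots> = (\<Sum>i\<le>N. x i * cnj (\<Sum>j\<le>N. x j * cyl_inner (basis_fun j) (basis_fun i)))"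
      unfolding f_def using b by (intro sum.cong refl) (subst cyl_inner_sum, auto)
    also have "\<dots> = (\<Sum>i\<le>N. \<Sum>j\<le>N. x i * cnj (x j) * cyl_inner (basis_fun i) (basis_fun j))"
      by (simp add: sum_distrib_left mult.assoc flip: cyl_inner_cnj)
    also have "\<dots> = (\<Sum>i\<le>N. \<Sum>j\<le>N. x i * cnj (x j) * cyl_inner (basis_fun (min i N)) (basis_fun (min j N)))"
      by (intro sum.cong refl) (auto simp: min_def)
    finally have e: "(\<Sum>i\<le>N. \<Sum>j\<le>N. x i * cnj (x j) * cyl_inner (basis_fun (min i N)) (basis_fun (min j N))) = cyl_inner f f" ..
    show ?thesis unfolding e cyl_inner_self(1)[OF a]
      using cyl_inner_self(2,3)[OF a] by (auto intro!: integral_nonneg integrable_continuous_real)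
  qed
  obtain x where x: "x 0 = 1" "\<And>j. j \<in> {1..N} \<Longrightarrow> (\<Sum>i\<le>N. x i * cyl_inner (basis_fun (min i N)) (basis_fun (min j N))) = 0"
    using gram_projection[where g = "\<lambda>i j. cyl_inner (basis_fun (min i N)) (basis_fun (min j N))", OF psd cyl_inner_cnj] by blast
  show ?thesis
  proof (rule that[of x])
    fix m assume m: "m \<in> {1..N}"
    have "cyl_inner (\<lambda>s t. \<Sum>i\<le>N. x i * basis_fun i s t) (basis_fun m) = (\<Sum>i\<le>N. x i * cyl_inner (basis_fun i) (basis_fun m))"
      using m by (intro cyl_inner_sum admissible_basis_fun) auto
    also have "\<dots> = (\<Sum>i\<le>N. x i * cyl_inner (basis_fun (min i N)) (basis_fun (min m N)))"
      using m by (intro sum.cong) (auto simp: min_def)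
    finally show "cyl_inner (\<lambda>s t. \<Sum>i\<le>N. x i * basis_fun i s t) (basis_fun m) = 0" using x(2)[OF m] by simp
  qed (use x in auto)
qed

end

lemma norm_integral_square_le:
  fixes f :: "real \<Rightarrow> complex"
  assumes c: "continuous_on {a..b} f" and ab: "a \<le> b"
  shows "(cmod (integral {a..b} f))\<^sup>2 \<le> (b - a) * integral {a..b} (\<lambda>t. (cmod (f t))\<^sup>2)"
proof (cases "a = b")
  case False
  define l where "l = b - a"
  have l: "l > 0" using False ab by (simp add: l_def)
  define c where "c = integral {a..b} f / of_real l"
  have fi: "(f has_integral of_real l * c) {a..b}"
    using l integrable_integral[OF integrable_continuous_real[OF assms(1)]] by (simp add: c_def)
  have "((\<lambda>t. Re (cnj c * f t)) has_integral Re (cnj c * (of_real l * c))) {a..b}"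
    by (intro has_integral_linear[OF has_integral_mult_right[OF fi] bounded_linear_Re, unfolded o_def])
  moreover have "Re (cnj c * (of_real l * c)) = l * (cmod c)\<^sup>2"
    unfolding cmod_power2 by (simp add: power2_eq_square algebra_simps)
  ultimately have i1: "((\<lambda>t. Re (cnj c * f t)) has_integral l * (cmod c)\<^sup>2) {a..b}" by simp
  have i2: "((\<lambda>t. (cmod (f t))\<^sup>2) has_integral integral {a..b} (\<lambda>t. (cmod (f t))\<^sup>2)) {a..b}"
    by (intro integrable_integral integrable_continuous_real continuous_intros assms(1))
  have i3: "((\<lambda>t. (cmod c)\<^sup>2) has_integral l * (cmod c)\<^sup>2) {a..b}"
    using has_integral_const_real[of "(cmod c)\<^sup>2" a b] ab by (simp add: l_def)
  have i4: "((\<lambda>t. (cmod (f t))\<^sup>2 - 2 * Re (cnj c * f t) + (cmod c)\<^sup>2) has_integral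
     (integral {a..b} (\<lambda>t. (cmod (f t))\<^sup>2) - 2 * (l * (cmod c)\<^sup>2) + l * (cmod c)\<^sup>2)) {a..b}"
    by (intro has_integral_add has_integral_diff has_integral_mult_right i1 i2 i3)
  have sq: "(cmod (f t))\<^sup>2 - 2 * Re (cnj c * f t) + (cmod c)\<^sup>2 = (cmod (f t - c))\<^sup>2" for t
    unfolding cmod_power2 by (simp add: power2_eq_square algebra_simps)
  have "0 \<le> integral {a..b} (\<lambda>t. (cmod (f t))\<^sup>2) - 2 * (l * (cmod c)\<^sup>2) + l * (cmod c)\<^sup>2"
    by (rule has_integral_nonneg[OF i4], unfold sq) simp
  hence "l * (cmod c)\<^sup>2 \<le> integral {a..b} (\<lambda>t. (cmod (f t))\<^sup>2)" by simp
  hence "l * (l * (cmod c)\<^sup>2) \<le> l * integral {a..b} (\<lambda>t. (cmod (f t))\<^sup>2)" using l by simp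
  moreover have "l * (l * (cmod c)\<^sup>2) = (cmod (integral {a..b} f))\<^sup>2"
    using l by (simp add: c_def norm_divide power_divide power2_eq_square)
  ultimately show ?thesis by (simp add: l_def)
qed auto

lemma has_vector_derivative_cis:
  "((\<lambda>t. cis (c * t)) has_vector_derivative \<i> * of_real c * cis (c * t)) (at t)"
proof -
  have "((\<lambda>z. exp (\<i> * (of_real c * z))) has_field_derivative \<i> * of_real c * exp (\<i> * (of_real c * of_real t))) (at (of_real t))"
    by (auto intro!: derivative_eq_intros)
  from has_vector_derivative_real_field[OF this] show ?thesis by (simp add: cis_conv_exp)
qed

context cylinder_weight
begin

lemma psi_lipschitz: "\<bar>\<psi> s t - \<psi> s t'\<bar> \<le> L * \<bar>t - t'\<bar>"
  using field_differentiable_bound[of UNIV "\<psi> s" "\<psi>t s" L t t'] dt bt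
  by (auto intro: has_field_derivative_at_within)

text \<open>Let \<open>nv\<close> be the squared norm of the minimizer and \<open>A 0\<close> the
  zero mode of the dual solution. The pairing gives \<open>nv\<^sup>2 \<le> pi\<^sup>2 * I\<close>
  and the Bochner identity gives \<open>4 * pi * c0 * exp (-2 * B0) * I \<le> 8 * nv\<close>, where
  \<open>I\<close> is the integral of \<open>\<bar>A 0\<bar>\<^sup>2\<close> over
  \<open>{0..1}\<close>. Eliminating \<open>I\<close> and cancelling one factor \<open>nv\<close>
  leaves the stated bound, which involves neither \<open>N\<close> nor \<open>K\<close> nor
  \<open>L\<close>.\<close>

lemma exists_small_dbar_correction:
  assumes c0: "c0 > 0" "\<And>s. s \<in> {0..1} \<Longrightarrow> c0 \<le> k s"
    and B0: "\<And>s t. s \<in> {0..1} \<Longrightarrow> - B0 \<le> \<psi> s t"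
  obtains x :: "nat \<Rightarrow> complex" where "x 0 = 1"
    "(\<lambda>s. integral {0..2*pi} (\<lambda>t. (cmod (\<Sum>i\<le>N. x i * basis_fun i s t))\<^sup>2 * exp (- 2 * \<psi> s t))) integrable_on UNIV"
    "integral UNIV (\<lambda>s. integral {0..2*pi} (\<lambda>t. (cmod (\<Sum>i\<le>N. x i * basis_fun i s t))\<^sup>2 * exp (- 2 * \<psi> s t)))
       \<le> 2 * pi * exp (2 * B0) / c0"
proof -
  obtain x where x0: "x 0 = 1"
    and orth: "\<And>m. m \<in> {1..N} \<Longrightarrow> cyl_inner (\<lambda>s t. \<Sum>i\<le>N. x i * basis_fun i s t) (basis_fun m) = 0"
    using orthogonal_combination by blast
  define v where "v = (\<lambda>s t. \<Sum>i\<le>N. x i * basis_fun i s t)"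
  have av: "admissible v" unfolding v_def by (intro admissible_sum admissible_scale admissible_basis_fun) auto
  then obtain C where C: "C \<ge> 0" "\<And>s t. norm (v s t) \<le> C * growth s" by (auto simp: admissible_def)
  have cv: "continuous_on UNIV (\<lambda>(s,t). v s t)" using av by (auto simp: admissible_def)
  note [continuous_intros] = cv[THEN continuous_on_uncurry_compose]
  define H where "H s = integral {0..2*pi} (\<lambda>t. (cmod (v s t))\<^sup>2 * exp (- 2 * \<psi> s t))" for s
  note self = cyl_inner_self[OF av, folded H_def]
  define nv where "nv = integral UNIV H"
  have H0: "H s \<ge> 0" for s unfolding H_def
    by (intro integral_nonneg integrable_continuous_real self(3)) auto
  have nv0: "nv \<ge> 0" unfolding nv_def using H0 self(2) by (intro integral_nonneg) auto

  \<comment> \<open>The right-hand side and its Fourier modes\<close>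
  define h where "h s t = cnj (v s t) * of_real (exp (- 2 * \<psi> s t))" for s t
  have ch: "continuous_on UNIV (\<lambda>(s,t). h s t)"
    unfolding h_def split_beta by (intro continuous_intros)
  note [continuous_intros] = ch[THEN continuous_on_uncurry_compose]
  define hh where "hh j s = integral {0..2*pi} (\<lambda>t. h s t * cis (- of_int j * t))" for j :: int and s
  have chh: "continuous_on S (hh j)" for j S unfolding hh_def cbox_interval[symmetric]
    by (rule integral_continuous_on_param, unfold split_beta, intro continuous_intros)
  have hhb: "norm (hh j s) \<le> 2 * pi * C * growth s * (exp (2 * K) * (if s \<ge> 0 then exp (- 2 * M1 * s) else exp (- 2 * M2 * s)))" for j s
  proof -
    have "norm (hh j s) \<le> (C * growth s * (exp (2 * K) * (if s \<ge> 0 then exp (- 2 * M1 * s) else exp (- 2 * M2 * s)))) * (2 * pi - 0)"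
      unfolding hh_def
    proof (rule integral_bound)
      fix t
      have "norm (h s t * cis (- of_int j * t)) = norm (v s t) * exp (- 2 * \<psi> s t)"
        by (simp add: h_def norm_mult)
      also have "\<dots> \<le> C * growth s * (exp (2 * K) * (if s \<ge> 0 then exp (- 2 * M1 * s) else exp (- 2 * M2 * s)))"
        using C growth_pos[of s] by (intro mult_mono weight_le) auto
      finally show "norm (h s t * cis (- of_int j * t)) \<le> C * growth s * (exp (2 * K) * (if s \<ge> 0 then exp (- 2 * M1 * s) else exp (- 2 * M2 * s)))" .
    qed (auto intro!: continuous_intros)
    thus ?thesis by (simp add: mult_ac)
  qed
  have hhb1: "norm (hh j s) \<le> 2 * pi * C * exp (2 * K) * exp (- (2 * M1 - real N) * s)" if "s \<ge> 0" for j s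
  proof -
    have "growth s * exp (- 2 * M1 * s) = exp (- (2 * M1 - real N) * s)"
      using that by (simp add: growth_def exp_add[symmetric] algebra_simps)
    moreover have "norm (hh j s) \<le> 2 * pi * C * exp (2 * K) * (growth s * exp (- 2 * M1 * s))"
      using hhb[of j s] that by (simp add: mult_ac)
    ultimately show ?thesis by simp
  qed
  have hhb2: "norm (hh j s) \<le> 2 * pi * C * exp (2 * K) * exp ((1 - 2 * M2) * s)" if "s \<le> 0" for j s
  proof (cases "s = 0")
    case False
    have "growth s * exp (- 2 * M2 * s) = exp ((1 - 2 * M2) * s)"
      using that False by (simp add: growth_def exp_add[symmetric] algebra_simps)
    moreover have "norm (hh j s) \<le> 2 * pi * C * exp (2 * K) * (growth s * exp (- 2 * M2 * s))"
      using hhb[of j s] that False by (simp add: mult_ac)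
    ultimately show ?thesis by simp
  qed (use hhb[of j s] in \<open>auto simp: growth_def\<close>)

  \<comment> \<open>Smoothing to finitely many modes\<close>
  have L2: "0 \<le> 2 * L" using L0 by simp
  obtain n \<kappa> KK where KK: "\<And>t. complex_of_real (KK t) = (\<Sum>j\<in>{-int n..int n}. of_real (\<kappa> j) * cis (of_int j * t))"
    "\<And>t. KK t \<ge> 0" "continuous_on UNIV KK" "\<kappa> 0 = 1 / (2*pi)"
    "integral {-pi..pi} KK = 1" "integral {-pi..pi} (\<lambda>t. KK t * exp (2 * L * \<bar>t\<bar>)) \<le> 2"
    by (rule trig_kernel[OF L2]) (rule that)
  define J where "J = {-int n..int n}"
  have J: "finite J" "0 \<in> J" by (auto simp: J_def)
  have KKper: "KK (t + 2*pi) = KK t" for t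
  proof -
    have "cis (of_int j * (t + 2*pi)) = cis (of_int j * t)" for j :: int
      using cis_multiple_2pi[of "of_int j"] by (simp add: distrib_left cis_mult[symmetric] mult_ac)
    hence "complex_of_real (KK (t + 2*pi)) = of_real (KK t)" unfolding KK(1) by simp
    thus ?thesis by (simp only: of_real_eq_iff)
  qed

  \<comment> \<open>Solving the equation mode by mode\<close>
  define q where "q j s = 2 * of_real (\<kappa> j) * hh j s" for j s
  have ex: "\<forall>j::int. \<exists>A. (\<forall>s. (A has_vector_derivative of_real (of_int j) * A s + q j s) (at s)) \<and>
     ((\<lambda>s. exp (M1 * s) * norm (A s)) \<longlongrightarrow> 0) at_top \<and> ((\<lambda>s. exp (M2 * s) * norm (A s)) \<longlongrightarrow> 0) at_bot"
  proof
    fix j :: int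
    let ?C = "2 * \<bar>\<kappa> j\<bar> * (2 * pi * C * exp (2 * K))"
    \<comment> \<open>For \<open>-N \<le> j < 0\<close> both ends select a solution. The
      compatibility integral is a multiple of \<open>cyl_inner (basis_fun m) v\<close> with
      \<open>m = -j\<close>, which is \<open>0\<close> by orthogonality.\<close>
    have lim: "((\<lambda>R. integral {-R..R} (\<lambda>s. q j s * of_real (exp (- of_int j * s)))) \<longlongrightarrow> 0) at_top"
      if j: "- int N \<le> j" "j < 0"
    proof -
      define m where "m = nat (- j)"
      have m: "m \<in> {1..N}" "real m = - of_int j" "m \<noteq> 0" using j by (auto simp: m_def)
      have "hh j s * of_real (exp (- of_int j * s)) = integral {0..2*pi} (\<lambda>t. basis_fun m s t * cnj (v s t) * of_real (exp (- 2 * \<psi> s t)))" for s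
      proof -
        have "integral {0..2*pi} (\<lambda>t. basis_fun m s t * cnj (v s t) * of_real (exp (- 2 * \<psi> s t)))
            = integral {0..2*pi} (\<lambda>t. (h s t * cis (- of_int j * t)) * of_real (exp (- of_int j * s)))"
          by (rule integral_cong) (use m in \<open>simp add: basis_fun_def h_def mult_ac\<close>)
        thus ?thesis unfolding hh_def by simp
      qed
      hence "q j s * of_real (exp (- of_int j * s)) = 2 * of_real (\<kappa> j) * integral {0..2*pi} (\<lambda>t. basis_fun m s t * cnj (v s t) * of_real (exp (- 2 * \<psi> s t)))" for s
        by (simp add: q_def mult.assoc)
      moreover have "cyl_inner (basis_fun m) v = 0"
        using orth[OF m(1)] cyl_inner_cnj[of "basis_fun m" v] by (simp add: v_def)
      ultimately show ?thesis
        using tendsto_mult_left[OF inner_integrable(3)[OF admissible_basis_fun av, of m], of "2 * of_real (\<kappa> j)"] m(1) by simp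
    qed
    have cq: "continuous_on UNIV (q j)" unfolding q_def by (intro continuous_intros chh)
    have q1: "norm (q j s) \<le> ?C * exp (- (2 * M1 - real N) * s)" if "s \<ge> 0" for s
      using mult_left_mono[OF hhb1[OF that, of j], of "2 * \<bar>\<kappa> j\<bar>"] by (simp add: q_def norm_mult mult.assoc)
    have q2: "norm (q j s) \<le> ?C * exp ((1 - 2 * M2) * s)" if "s \<le> 0" for s
      using mult_left_mono[OF hhb2[OF that, of j], of "2 * \<bar>\<kappa> j\<bar>"] by (simp add: q_def norm_mult mult.assoc)
    have m1: "M1 < 2 * M1 - real N" and m2: "- M2 < 1 - 2 * M2" using M1 M2 by auto
    have cases: "of_int j + M1 < 0 \<and> of_int j + M2 < 0 \<or> of_int j + M1 > 0 \<and> of_int j + M2 > 0 \<or>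
      of_int j + M1 > 0 \<and> of_int j + M2 < 0 \<and> ((\<lambda>R. integral {-R..R} (\<lambda>s. q j s * of_real (exp (- of_int j * s)))) \<longlongrightarrow> 0) at_top"
    proof -
      \<comment> \<open>For \<open>j \<ge> 0\<close> both \<open>j + M1\<close> and
        \<open>j + M2\<close> are positive; for \<open>j \<le> - N - 1\<close> both are negative,
        because \<open>M1 < N + 1\<close> and \<open>M2 < 1/2\<close>. Only the modes in between
        need the compatibility condition.\<close>
      consider "j \<ge> 0" | "j \<le> - int N - 1" | "- int N \<le> j" "j < 0" by linarith
      thus ?thesis
      proof cases
        case 2
        hence "of_int j \<le> - real N - 1" by linarith
        thus ?thesis using M1 M2 by auto
      next
        case 3
        hence "of_int j \<ge> - real N" "of_int j \<le> (-1::real)" by linarith+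
        thus ?thesis using M1 M2 lim[OF 3] by auto
      qed (use M1 M2 in auto)
    qed
    show "\<exists>A. (\<forall>s. (A has_vector_derivative of_real (of_int j) * A s + q j s) (at s)) \<and>
     ((\<lambda>s. exp (M1 * s) * norm (A s)) \<longlongrightarrow> 0) at_top \<and> ((\<lambda>s. exp (M2 * s) * norm (A s)) \<longlongrightarrow> 0) at_bot"
    proof (rule decaying_ode_solution[OF cq _ _ m1 m2 cases])
      show "norm (q j s) \<le> ?C * exp (- (2 * M1 - real N) * s)" if "s \<ge> 0" for s by (rule q1[OF that])
      show "norm (q j s) \<le> ?C * exp ((1 - 2 * M2) * s)" if "s \<le> 0" for s by (rule q2[OF that])
    qed (intro exI conjI allI)
  qed
  obtain A where A0: "\<forall>j. (\<forall>s. (A j has_vector_derivative of_real (of_int j) * A j s + q j s) (at s)) \<and>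
     ((\<lambda>s. exp (M1 * s) * norm (A j s)) \<longlongrightarrow> 0) at_top \<and> ((\<lambda>s. exp (M2 * s) * norm (A j s)) \<longlongrightarrow> 0) at_bot"
    using choice[OF ex] by (elim exE) (rule that)
  have A: "(A j has_vector_derivative of_real (of_int j) * A j s + q j s) (at s)"
    "((\<lambda>s. exp (M1 * s) * norm (A j s)) \<longlongrightarrow> 0) at_top"
    "((\<lambda>s. exp (M2 * s) * norm (A j s)) \<longlongrightarrow> 0) at_bot" for j s
    using A0[rule_format, of j] by auto
  define A' where "A' j s = of_int j * A j s + q j s" for j s
  have dA: "(A j has_vector_derivative A' j s) (at s)" for j s using A(1) by (simp add: A'_def)
  have cA: "continuous_on S (A j)" for S j
    by (rule continuous_at_imp_continuous_on, rule ballI, rule has_vector_derivative_continuous[OF dA])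
  have cA': "continuous_on S (A' j)" for S j
    unfolding A'_def q_def by (intro continuous_intros cA chh)
  note [continuous_intros] = continuous_on_compose2[OF cA[of UNIV]] continuous_on_compose2[OF cA'[of UNIV]]

  \<comment> \<open>The dual solution as a finite Fourier sum\<close>
  define F Fs Ft Fst where
    "F s t = (\<Sum>j\<in>J. A j s * cis (of_int j * t))" and
    "Fs s t = (\<Sum>j\<in>J. A' j s * cis (of_int j * t))" and
    "Ft s t = (\<Sum>j\<in>J. A j s * (\<i> * of_int j * cis (of_int j * t)))" and
    "Fst s t = (\<Sum>j\<in>J. A' j s * (\<i> * of_int j * cis (of_int j * t)))" for s t
  note Fdefs = F_def Fs_def Ft_def Fst_def
  have dF: "((\<lambda>s. F s t) has_vector_derivative Fs s t) (at s)" "((\<lambda>t. F s t) has_vector_derivative Ft s t) (at t)"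
    "((\<lambda>s. Ft s t) has_vector_derivative Fst s t) (at s)" "((\<lambda>t. Fs s t) has_vector_derivative Fst s t) (at t)" for s t
    unfolding Fdefs
    by (intro has_vector_derivative_sum has_vector_derivative_mult_left has_vector_derivative_mult_right dA
          has_vector_derivative_cis[of "of_int _", simplified])+
  have cF: "continuous_on UNIV (\<lambda>(s,t). F s t)" "continuous_on UNIV (\<lambda>(s,t). Fs s t)"
     "continuous_on UNIV (\<lambda>(s,t). Ft s t)" "continuous_on UNIV (\<lambda>(s,t). Fst s t)"
    unfolding Fdefs split_beta by (intro continuous_intros subset_UNIV)+
  have perF: "F s (t + 2*pi) = F s t" "Fs s (t + 2*pi) = Fs s t" for s t
  proof -
    have "cis (of_int j * (t + 2*pi)) = cis (of_int j * t)" for j :: int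
      using cis_multiple_2pi[of "of_int j"] by (simp add: distrib_left cis_mult[symmetric] mult_ac)
    thus "F s (t + 2*pi) = F s t" "Fs s (t + 2*pi) = Fs s t" unfolding Fdefs by simp_all
  qed
  note dRe = bounded_linear.has_vector_derivative[OF bounded_linear_Re, folded has_real_derivative_iff_has_vector_derivative]
  note dIm = bounded_linear.has_vector_derivative[OF bounded_linear_Im, folded has_real_derivative_iff_has_vector_derivative]
  note cFi = cF[THEN continuous_on_uncurry_compose]

  \<comment> \<open>Vanishing of the boundary terms\<close>
  define P where "P s t = 2 * exp (2 * \<psi> s t) * (Im (F s t) * Re (Ft s t) - Re (F s t) * Im (Ft s t)
     - \<psi>s s t * ((Re (F s t))\<^sup>2 + (Im (F s t))\<^sup>2))" for s t
  define S where "S s = (\<Sum>j\<in>J. norm (A j s))" for s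
  have S0: "S s \<ge> 0" for s by (auto simp: S_def intro: sum_nonneg)
  have FS: "norm (F s t) \<le> S s" "norm (Ft s t) \<le> real n * S s" for s t
  proof -
    show "norm (F s t) \<le> S s" unfolding F_def S_def by (rule sum_norm_le) (simp add: norm_mult)
    show "norm (Ft s t) \<le> real n * S s" unfolding Ft_def S_def sum_distrib_left
    proof (rule sum_norm_le)
      fix j assume "j \<in> J"
      hence "\<bar>of_int j\<bar> \<le> real n" by (auto simp: J_def)
      from mult_right_mono[OF this, of "norm (A j s)"]
      show "norm (A j s * (\<i> * of_int j * cis (of_int j * t))) \<le> real n * norm (A j s)"
        by (simp add: norm_mult mult.commute)
    qed
  qed
  \<comment> \<open>\<open>P\<close> is quadratic in \<open>F\<close> and \<open>Ft\<close>, and a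
    sum of modes of order at most \<open>n\<close> has \<open>\<bar>Ft\<bar> \<le> n * S s\<close>.
    So the boundary integral is at most a constant times \<open>(exp (M * s) * S s)\<^sup>2\<close>,
    which the decay of the modes controls.\<close>
  have PB: "\<bar>integral {0..2*pi} (P s)\<bar> \<le> 2 * pi * (2 * (2 * real n + K)) * exp (2 * K) * (exp (M * s) * S s)\<^sup>2"
    if M: "\<And>t. \<psi> s t \<le> M * s + K" for s M
  proof -
    have "norm (integral {0..2*pi} (P s)) \<le> (2 * (exp (2 * K) * exp (2 * M * s)) * ((2 * real n + K) * (S s)\<^sup>2)) * (2*pi - 0)"
    proof (rule integral_bound)
      show "continuous_on {0..2*pi} (P s)" unfolding P_def by (intro continuous_intros cFi)
      fix t
      have "\<bar>Im (F s t) * Re (Ft s t) - Re (F s t) * Im (Ft s t)\<bar>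
         \<le> \<bar>Im (F s t)\<bar> * \<bar>Re (Ft s t)\<bar> + \<bar>Re (F s t)\<bar> * \<bar>Im (Ft s t)\<bar>"
        unfolding abs_mult[symmetric] by (rule abs_triangle_ineq4)
      also have "\<dots> \<le> S s * (real n * S s) + S s * (real n * S s)"
        using order_trans[OF abs_Re_le_cmod FS(1)[of s t]] order_trans[OF abs_Im_le_cmod FS(1)[of s t]]
          order_trans[OF abs_Re_le_cmod FS(2)[of s t]] order_trans[OF abs_Im_le_cmod FS(2)[of s t]] S0
        by (intro add_mono mult_mono) auto
      finally have 1: "\<bar>Im (F s t) * Re (Ft s t) - Re (F s t) * Im (Ft s t)\<bar> \<le> 2 * real n * (S s)\<^sup>2"
        by (simp add: power2_eq_square algebra_simps)
      have "\<bar>\<psi>s s t * ((Re (F s t))\<^sup>2 + (Im (F s t))\<^sup>2)\<bar> = \<bar>\<psi>s s t\<bar> * (cmod (F s t))\<^sup>2"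
        by (simp add: cmod_power2 abs_mult)
      also have "\<dots> \<le> K * (S s)\<^sup>2"
        using bs FS(1) K0 by (intro mult_mono power_mono) auto
      finally have 2: "\<bar>\<psi>s s t * ((Re (F s t))\<^sup>2 + (Im (F s t))\<^sup>2)\<bar> \<le> K * (S s)\<^sup>2" .
      have 3: "2 * exp (2 * \<psi> s t) \<le> 2 * (exp (2 * K) * exp (2 * M * s))"
        using M[of t] by (simp add: exp_add[symmetric])
      have "norm (P s t) = 2 * exp (2 * \<psi> s t) * \<bar>(Im (F s t) * Re (Ft s t) - Re (F s t) * Im (Ft s t))
            - \<psi>s s t * ((Re (F s t))\<^sup>2 + (Im (F s t))\<^sup>2)\<bar>"
        by (simp add: P_def abs_mult)
      also have "\<dots> \<le> 2 * (exp (2 * K) * exp (2 * M * s)) * (2 * real n * (S s)\<^sup>2 + K * (S s)\<^sup>2)"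
        using 3 order_trans[OF abs_triangle_ineq4 add_mono[OF 1 2]] by (intro mult_mono) auto
      finally show "norm (P s t) \<le> 2 * (exp (2 * K) * exp (2 * M * s)) * ((2 * real n + K) * (S s)\<^sup>2)"
        by (simp add: distrib_right)
    qed auto
    also have "exp (2 * M * s) = (exp (M * s))\<^sup>2" by (simp add: exp_double[symmetric] mult.assoc)
    finally show ?thesis by (simp add: power_mult_distrib algebra_simps)
  qed
  have Slim: "((\<lambda>s. exp (M1 * s) * S s) \<longlongrightarrow> 0) at_top" "((\<lambda>s. exp (M2 * s) * S s) \<longlongrightarrow> 0) at_bot"
    unfolding S_def sum_distrib_left by (intro tendsto_null_sum A)+
  have top: "((\<lambda>s. integral {0..2*pi} (P s)) \<longlongrightarrow> 0) at_top"
  proof (rule Lim_null_comparison)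
    show "eventually (\<lambda>s. norm (integral {0..2*pi} (P s)) \<le> 2 * pi * (2 * (2 * real n + K)) * exp (2 * K) * (exp (M1 * s) * S s)\<^sup>2) at_top"
      using eventually_ge_at_top[of 0]
    proof eventually_elim
      case (elim s)
      have "\<psi> s t \<le> M1 * s + K" for t using up[OF elim, of t] by auto
      from PB[OF this] show ?case by simp
    qed
    show "((\<lambda>s. 2 * pi * (2 * (2 * real n + K)) * exp (2 * K) * (exp (M1 * s) * S s)\<^sup>2) \<longlongrightarrow> 0) at_top"
      by (rule tendsto_eq_intros Slim refl)+ simp
  qed
  have bot: "((\<lambda>s. integral {0..2*pi} (P s)) \<longlongrightarrow> 0) at_bot"
  proof (rule Lim_null_comparison)
    show "eventually (\<lambda>s. norm (integral {0..2*pi} (P s)) \<le> 2 * pi * (2 * (2 * real n + K)) * exp (2 * K) * (exp (M2 * s) * S s)\<^sup>2) at_bot"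
      using eventually_le_at_bot[of 0]
    proof eventually_elim
      case (elim s)
      have "\<psi> s t \<le> M2 * s + K" for t using down[OF elim, of t] by auto
      from PB[OF this] show ?case by simp
    qed
    show "((\<lambda>s. 2 * pi * (2 * (2 * real n + K)) * exp (2 * K) * (exp (M2 * s) * S s)\<^sup>2) \<longlongrightarrow> 0) at_bot"
      by (rule tendsto_eq_intros Slim refl)+ simp
  qed

  \<comment> \<open>The Bochner identity for the dual solution\<close>
  define X where "X s t = exp (2 * \<psi> s t) * ((Re (Fs s t) - Im (Ft s t))\<^sup>2 + (Im (Fs s t) + Re (Ft s t))\<^sup>2)" for s t
  \<comment> \<open>In the dual weight \<open>exp (2 * \<psi>) * \<bar>h\<bar>\<^sup>2\<close>
    equals \<open>\<bar>v\<bar>\<^sup>2 * exp (-2 * \<psi>)\<close> again. The factor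
    \<open>8\<close> is the square of the \<open>2\<close> in the definition of \<open>q\<close>,
    times the \<open>2\<close> lost in the smoothing.\<close>
  have XH: "integral {0..2*pi} (X s) \<le> 8 * H s" for s
  proof -
    have FK: "Fs s t + \<i> * Ft s t = 2 * integral {0..2*pi} (\<lambda>y. h s y * of_real (KK (t - y)))" for t
    proof -
      have "((\<lambda>y. h s y * of_real (KK (t - y))) has_integral (\<Sum>j\<in>J. of_real (\<kappa> j) * cis (of_int j * t) * hh j s)) {0..2*pi}"
      proof -
        have "((\<lambda>y. \<Sum>j\<in>J. of_real (\<kappa> j) * cis (of_int j * t) * (h s y * cis (- of_int j * y))) has_integral
           (\<Sum>j\<in>J. of_real (\<kappa> j) * cis (of_int j * t) * hh j s)) {0..2*pi}"
          unfolding hh_def by (intro has_integral_sum J has_integral_mult_right integrable_integral integrable_continuous_real continuous_intros)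
        moreover have cs: "cis (of_int j * (t - y)) = cis (of_int j * t) * cis (- of_int j * y)" for j :: int and y
          by (simp add: cis_mult right_diff_distrib)
        have "(\<Sum>j\<in>J. of_real (\<kappa> j) * cis (of_int j * t) * (h s y * cis (- of_int j * y))) = h s y * of_real (KK (t - y))" for y
          unfolding KK(1) J_def[symmetric] sum_distrib_left
          by (intro sum.cong refl) (simp only: cs, simp)
        ultimately show ?thesis by simp
      qed
      hence "2 * integral {0..2*pi} (\<lambda>y. h s y * of_real (KK (t - y))) = (\<Sum>j\<in>J. q j s * cis (of_int j * t))"
        by (simp add: integral_unique sum_distrib_left q_def mult_ac)
      also have "\<dots> = Fs s t + \<i> * Ft s t"
        unfolding Fdefs sum_distrib_left sum.distrib[symmetric] by (intro sum.cong refl) (simp add: A'_def algebra_simps)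
      finally show ?thesis ..
    qed
    have "X s t = 4 * (exp (2 * \<psi> s t) * (cmod (integral {0..2*pi} (\<lambda>y. h s y * of_real (KK (t - y)))))\<^sup>2)" for t
    proof -
      have "(Re (Fs s t) - Im (Ft s t))\<^sup>2 + (Im (Fs s t) + Re (Ft s t))\<^sup>2 = (cmod (Fs s t + \<i> * Ft s t))\<^sup>2"
        unfolding cmod_power2 by simp
      thus ?thesis unfolding X_def FK by (simp add: norm_mult power_mult_distrib)
    qed
    hence Xs: "X s = (\<lambda>t. 4 * (exp (2 * \<psi> s t) * (cmod (integral {0..2*pi} (\<lambda>y. h s y * of_real (KK (t - y)))))\<^sup>2))"
      by (rule ext)
    have "integral {0..2*pi} (X s) = 4 * integral {0..2*pi} (\<lambda>t. exp (2 * \<psi> s t) * (cmod (integral {0..2*pi} (\<lambda>y. h s y * of_real (KK (t - y)))))\<^sup>2)"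
      unfolding Xs by simp
    also have "\<dots> \<le> 4 * (2 * integral {0..2*pi} (\<lambda>t. exp (2 * \<psi> s t) * (cmod (h s t))\<^sup>2))"
    proof (intro mult_left_mono kernel_convolution_bound[where L = L] KK KKper psi_lipschitz per)
      show "continuous_on UNIV (h s)" "continuous_on UNIV (\<psi> s)" by (intro continuous_intros)+
      show "h s (t + 2*pi) = h s t" for t by (simp only: h_def v_def basis_fun_periodic per)
    qed auto
    also have "(\<lambda>t. exp (2 * \<psi> s t) * (cmod (h s t))\<^sup>2) = (\<lambda>t. (cmod (v s t))\<^sup>2 * exp (- 2 * \<psi> s t))"
    proof
      fix t
      have "exp (2 * \<psi> s t) * (cmod (h s t))\<^sup>2 = (cmod (v s t))\<^sup>2 * (exp (2 * \<psi> s t) * (exp (- 2 * \<psi> s t))\<^sup>2)"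
        by (simp add: h_def norm_mult power_mult_distrib)
      also have "exp (2 * \<psi> s t) * (exp (- 2 * \<psi> s t))\<^sup>2 = exp (- 2 * \<psi> s t)"
        by (simp add: exp_add[symmetric] exp_double[symmetric])
      finally show "exp (2 * \<psi> s t) * (cmod (h s t))\<^sup>2 = (cmod (v s t))\<^sup>2 * exp (- 2 * \<psi> s t)" .
    qed
    finally show ?thesis by (simp add: H_def)
  qed
  have "2 * integral {0..1} (\<lambda>s. k s * integral {0..2*pi} (\<lambda>t. exp (2 * \<psi> s t) * ((Re (F s t))\<^sup>2 + (Im (F s t))\<^sup>2))) \<le> 8 * nv"
  proof (rule bochner_inequality[where us = "\<lambda>s t. Re (Fs s t)" and ws = "\<lambda>s t. Im (Fs s t)" and ut = "\<lambda>s t. Re (Ft s t)"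
        and wt = "\<lambda>s t. Im (Ft s t)" and ust = "\<lambda>s t. Re (Fst s t)" and wst = "\<lambda>s t. Im (Fst s t)"])
    show "((\<lambda>s. integral {0..2*pi} (\<lambda>t. 2 * exp (2 * \<psi> s t) * (Im (F s t) * Re (Ft s t) - Re (F s t) * Im (Ft s t)
     - \<psi>s s t * ((Re (F s t))\<^sup>2 + (Im (F s t))\<^sup>2)))) \<longlongrightarrow> 0) at_top" using top unfolding P_def .
    show "((\<lambda>s. integral {0..2*pi} (\<lambda>t. 2 * exp (2 * \<psi> s t) * (Im (F s t) * Re (Ft s t) - Re (F s t) * Im (Ft s t)
     - \<psi>s s t * ((Re (F s t))\<^sup>2 + (Im (F s t))\<^sup>2)))) \<longlongrightarrow> 0) at_bot" using bot unfolding P_def .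
    fix R :: real assume "R \<ge> 1"
    have "integral {-R..R} (\<lambda>s. integral {0..2*pi} (X s)) \<le> integral {-R..R} (\<lambda>s. 8 * H s)"
    proof (rule integral_le)
      have "continuous_on {-R..R} (\<lambda>s. integral {0..2*pi} (X s))"
        unfolding cbox_interval[symmetric]
        by (rule integral_continuous_on_param, unfold split_beta X_def, intro continuous_intros cFi)
      thus "(\<lambda>s. integral {0..2*pi} (X s)) integrable_on {-R..R}" by (rule integrable_continuous_real)
      show "(\<lambda>s. 8 * H s) integrable_on {-R..R}"
        by (intro integrable_continuous_real continuous_intros continuous_on_subset[OF self(4)]) auto
    qed (use XH in auto)
    also have "\<dots> = 8 * integral {-R..R} H" by simp
    also have "\<dots> \<le> 8 * nv" unfolding nv_def
      by (intro mult_left_mono integral_subset_le self(2) integrable_continuous_real continuous_on_subset[OF self(4)]) (auto simp: H0)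
    finally show "integral {-R..R} (\<lambda>s. integral {0..2*pi} (\<lambda>t. exp (2 * \<psi> s t) *
        ((Re (Fs s t) - Im (Ft s t))\<^sup>2 + (Im (Fs s t) + Re (Ft s t))\<^sup>2))) \<le> 8 * nv"
      unfolding X_def .
  qed (use dF perF in \<open>auto intro!: dRe dIm continuous_intros cFi simp: split_beta\<close>)
  note bochner = this
  \<comment> \<open>Averaging over the circle extracts \<open>A 0\<close> from \<open>F\<close>,
    with Cauchy-Schwarz for the squares; \<open>k\<close> and \<open>exp (2 * \<psi>)\<close> are
    replaced by their lower bounds on \<open>0 \<le> s \<le> 1\<close>.\<close>
  have low: "c0 * exp (- 2 * B0) * (2 * pi) * (cmod (A 0 s))\<^sup>2 \<le> k s * integral {0..2*pi} (\<lambda>t. exp (2 * \<psi> s t) * ((Re (F s t))\<^sup>2 + (Im (F s t))\<^sup>2))"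
    if s: "s \<in> {0..1}" for s
  proof -
    have "((\<lambda>t. F s t) has_integral (\<Sum>j\<in>J. A j s * (if j = 0 then of_real (2*pi) else 0))) {0..0+2*pi}"
      unfolding F_def
    proof (intro has_integral_sum has_integral_mult_right J)
      fix j :: int
      show "((\<lambda>t. cis (of_int j * t)) has_integral (if j = 0 then of_real (2*pi) else 0)) {0..0+2*pi}"
        using has_integral_cis[of j 0] has_integral_const_real[of "1::complex" 0 "0+2*pi"]
        by (auto simp: scaleR_conv_of_real)
    qed
    hence Fi: "integral {0..2*pi} (F s) = A 0 s * of_real (2*pi)"
      using J by (simp add: integral_unique if_distrib sum.delta cong: if_cong)
    have "(2 * pi)\<^sup>2 * (cmod (A 0 s))\<^sup>2 = (cmod (integral {0..2*pi} (F s)))\<^sup>2"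
      unfolding Fi by (simp add: norm_mult power_mult_distrib)
    also have "\<dots> \<le> (2 * pi - 0) * integral {0..2*pi} (\<lambda>t. (cmod (F s t))\<^sup>2)"
      by (intro norm_integral_square_le continuous_intros cFi) auto
    finally have "(2 * pi) * ((2 * pi) * (cmod (A 0 s))\<^sup>2) \<le> (2 * pi) * integral {0..2*pi} (\<lambda>t. (cmod (F s t))\<^sup>2)"
      by (simp add: power2_eq_square)
    hence 1: "2 * pi * (cmod (A 0 s))\<^sup>2 \<le> integral {0..2*pi} (\<lambda>t. (cmod (F s t))\<^sup>2)"
      by (rule mult_left_le_imp_le) auto
    have "exp (- 2 * B0) * integral {0..2*pi} (\<lambda>t. (cmod (F s t))\<^sup>2) = integral {0..2*pi} (\<lambda>t. exp (- 2 * B0) * (cmod (F s t))\<^sup>2)"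
      by simp
    also have "\<dots> \<le> integral {0..2*pi} (\<lambda>t. exp (2 * \<psi> s t) * ((Re (F s t))\<^sup>2 + (Im (F s t))\<^sup>2))"
    proof (rule integral_le)
      show "exp (- 2 * B0) * (cmod (F s t))\<^sup>2 \<le> exp (2 * \<psi> s t) * ((Re (F s t))\<^sup>2 + (Im (F s t))\<^sup>2)" for t
        unfolding cmod_power2 using B0[OF s, of t] by (intro mult_right_mono) auto
    qed (intro integrable_continuous_real continuous_intros cFi)+
    finally have 2: "exp (- 2 * B0) * integral {0..2*pi} (\<lambda>t. (cmod (F s t))\<^sup>2) \<le> integral {0..2*pi} (\<lambda>t. exp (2 * \<psi> s t) * ((Re (F s t))\<^sup>2 + (Im (F s t))\<^sup>2))" .
    have "c0 * exp (- 2 * B0) * (2 * pi) * (cmod (A 0 s))\<^sup>2 = c0 * (exp (- 2 * B0) * (2 * pi * (cmod (A 0 s))\<^sup>2))" by simp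
    also have "\<dots> \<le> k s * (exp (- 2 * B0) * integral {0..2*pi} (\<lambda>t. (cmod (F s t))\<^sup>2))"
      using c0 s 1 kpos by (intro mult_mono mult_left_mono) auto
    also have "\<dots> \<le> k s * integral {0..2*pi} (\<lambda>t. exp (2 * \<psi> s t) * ((Re (F s t))\<^sup>2 + (Im (F s t))\<^sup>2))"
      by (intro mult_left_mono 2 kpos)
    finally show ?thesis .
  qed
  have "2 * (c0 * exp (- 2 * B0) * (2 * pi) * integral {0..1} (\<lambda>s. (cmod (A 0 s))\<^sup>2)) \<le> 8 * nv"
  proof -
    have "c0 * exp (- 2 * B0) * (2 * pi) * integral {0..1} (\<lambda>s. (cmod (A 0 s))\<^sup>2)
      = integral {0..1} (\<lambda>s. c0 * exp (- 2 * B0) * (2 * pi) * (cmod (A 0 s))\<^sup>2)" by simp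
    also have "\<dots> \<le> integral {0..1} (\<lambda>s. k s * integral {0..2*pi} (\<lambda>t. exp (2 * \<psi> s t) * ((Re (F s t))\<^sup>2 + (Im (F s t))\<^sup>2)))"
    proof (rule integral_le)
      have "continuous_on {0..1} (\<lambda>s. integral {0..2*pi} (\<lambda>t. exp (2 * \<psi> s t) * ((Re (F s t))\<^sup>2 + (Im (F s t))\<^sup>2)))"
        unfolding cbox_interval[symmetric]
        by (rule integral_continuous_on_param, unfold split_beta, intro continuous_intros cFi)
      thus "(\<lambda>s. k s * integral {0..2*pi} (\<lambda>t. exp (2 * \<psi> s t) * ((Re (F s t))\<^sup>2 + (Im (F s t))\<^sup>2))) integrable_on {0..1}"
        by (intro integrable_continuous_real continuous_intros)
      show "(\<lambda>s. c0 * exp (- 2 * B0) * (2 * pi) * (cmod (A 0 s))\<^sup>2) integrable_on {0..1}"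
        by (intro integrable_continuous_real continuous_intros cA)
    qed (use low in auto)
    finally show ?thesis using bochner by linarith
  qed
  note up_A0 = this

  \<comment> \<open>The squared norm as an integral of the zero mode\<close>
  have nvA: "nv = cmod (of_real pi * integral {0..1} (A 0))"
  proof -
    \<comment> \<open>Orthogonality leaves only the term of the cut-off constant, whose coefficient
      is \<open>1\<close>.\<close>
    have "cyl_inner v v = (\<Sum>i\<le>N. x i * cyl_inner (basis_fun i) v)"
      unfolding v_def by (rule cyl_inner_sum) (use av in \<open>auto simp: v_def intro: admissible_basis_fun\<close>)
    also have "\<dots> = (\<Sum>i\<le>N. if i = 0 then cyl_inner (basis_fun 0) v else 0)"
    proof (rule sum.cong)
      fix i assume "i \<in> {..N}"
      thus "x i * cyl_inner (basis_fun i) v = (if i = 0 then cyl_inner (basis_fun 0) v else 0)"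
        using orth[of i] cyl_inner_cnj[of "basis_fun i" v] x0 by (auto simp: v_def)
    qed auto
    also have "\<dots> = cyl_inner (basis_fun 0) v" by simp
    finally have nv1: "of_real nv = cyl_inner (basis_fun 0) v" using self(1) by (simp add: nv_def)
    have "((\<lambda>R. integral {-R..R} (\<lambda>s. integral {0..2*pi} (\<lambda>t. basis_fun 0 s t * cnj (v s t) * of_real (exp (- 2 * \<psi> s t))))) \<longlongrightarrow> of_real nv) at_top"
      unfolding nv1 by (rule inner_integrable(3)[OF admissible_basis_fun av]) auto
    moreover have "eventually (\<lambda>R. integral {-R..R} (\<lambda>s. integral {0..2*pi} (\<lambda>t. basis_fun 0 s t * cnj (v s t) * of_real (exp (- 2 * \<psi> s t))))
       = of_real pi * (A 0 R - integral {0..1} (A 0))) at_top"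
      using eventually_ge_at_top[of 1]
    proof eventually_elim
      case (elim R)
      \<comment> \<open>As \<open>\<kappa> 0 = 1 / (2 * pi)\<close>, the equation of the zero mode
        is \<open>A' 0 = hh 0 / pi\<close>. Integration by parts against the cut-off then leaves the
        integral of \<open>A 0\<close> over \<open>{0..1}\<close> and a boundary term that tends to
        \<open>0\<close>.\<close>
      have "integral {0..2*pi} (\<lambda>t. basis_fun 0 s t * cnj (v s t) * of_real (exp (- 2 * \<psi> s t))) = of_real pi * (of_real (cutoff s) * A' 0 s)" for s
      proof -
        have "integral {0..2*pi} (\<lambda>t. basis_fun 0 s t * cnj (v s t) * of_real (exp (- 2 * \<psi> s t))) = of_real (cutoff s) * hh 0 s"
          unfolding hh_def by (simp add: basis_fun_def h_def mult.assoc)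
        moreover have "A' 0 s = hh 0 s / of_real pi" by (simp add: A'_def q_def KK(4))
        ultimately show ?thesis by simp
      qed
      moreover have "((\<lambda>s. of_real (cutoff s) * A' 0 s) has_integral (A 0 R - integral {0..1} (A 0))) {-R..R}"
      proof -
        have "((\<lambda>s. of_real (cutoff s) * A' 0 s + (if s \<in> {0..1} then A 0 s else 0)) has_integral
            (of_real (cutoff R) * A 0 R - of_real (cutoff (-R)) * A 0 (-R))) {-R..R}"
        proof (rule fundamental_theorem_of_calculus_strong[of "{0,1}"])
          fix s assume "s \<in> {-R..R} - {0,1}"
          hence "s \<noteq> 0" "s \<noteq> 1" by auto
          then consider "s < 0" | "0 < s" "s < 1" | "s > 1" by linarith
          hence d: "((\<lambda>s. complex_of_real (cutoff s)) has_vector_derivative (if s \<in> {0..1} then 1 else 0)) (at s)"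
          proof cases
            case 1
            have "((\<lambda>s. 0::complex) has_vector_derivative 0) (at s)" by simp
            hence "((\<lambda>s. complex_of_real (cutoff s)) has_vector_derivative 0) (at s)"
              by (rule has_vector_derivative_transform_within_open[of _ _ _ "{..<0}"]) (use 1 in \<open>auto simp: cutoff_def\<close>)
            thus ?thesis using 1 by simp
          next
            case 2
            have "((\<lambda>s. complex_of_real s) has_vector_derivative 1) (at s)"
              by (auto intro!: derivative_eq_intros)
            hence "((\<lambda>s. complex_of_real (cutoff s)) has_vector_derivative 1) (at s)"
              by (rule has_vector_derivative_transform_within_open[of _ _ _ "{0<..<1}"]) (use 2 in \<open>auto simp: cutoff_def\<close>)
            thus ?thesis using 2 by simp
          next
            case 3
            have "((\<lambda>s. 1::complex) has_vector_derivative 0) (at s)" by simp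
            hence "((\<lambda>s. complex_of_real (cutoff s)) has_vector_derivative 0) (at s)"
              by (rule has_vector_derivative_transform_within_open[of _ _ _ "{1<..}"]) (use 3 in \<open>auto simp: cutoff_def\<close>)
            thus ?thesis using 3 by simp
          qed
          have "((\<lambda>s. complex_of_real (cutoff s) * A 0 s) has_vector_derivative
              (of_real (cutoff s) * A' 0 s + (if s \<in> {0..1} then 1 else 0) * A 0 s)) (at s)"
            by (intro has_vector_derivative_mult d dA)
          thus "((\<lambda>s. complex_of_real (cutoff s) * A 0 s) has_vector_derivative
              (of_real (cutoff s) * A' 0 s + (if s \<in> {0..1} then A 0 s else 0))) (at s)"
            by (cases "s \<in> {0..1}") (simp_all only: if_True if_False mult_1_left mult_zero_left)
        qed (use elim in \<open>auto intro!: continuous_intros cA\<close>)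
        moreover have "((\<lambda>s. if s \<in> {0..1} then A 0 s else 0) has_integral integral {0..1} (A 0)) {-R..R}"
          using elim by (subst has_integral_restrict) (auto intro!: integrable_integral integrable_continuous_real cA)
        ultimately have "((\<lambda>s. of_real (cutoff s) * A' 0 s + (if s \<in> {0..1} then A 0 s else 0) - (if s \<in> {0..1} then A 0 s else 0)) has_integral
            (of_real (cutoff R) * A 0 R - of_real (cutoff (-R)) * A 0 (-R) - integral {0..1} (A 0))) {-R..R}"
          by (rule has_integral_diff)
        thus ?thesis using elim by (simp add: cutoff_simps)
      qed
      ultimately show ?case by (simp add: integral_unique)
    qed
    ultimately have l1: "((\<lambda>R. of_real pi * (A 0 R - integral {0..1} (A 0))) \<longlongrightarrow> of_real nv) at_top"
      by (rule Lim_transform_eventually)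
    have "((\<lambda>R. A 0 R) \<longlongrightarrow> 0) at_top"
    proof (rule Lim_null_comparison[OF _ A(2)[of 0]])
      show "eventually (\<lambda>s. norm (A 0 s) \<le> exp (M1 * s) * norm (A 0 s)) at_top"
        using eventually_ge_at_top[of 0]
      proof eventually_elim
        case (elim s)
        hence "1 \<le> exp (M1 * s)" using M1 by simp
        from mult_right_mono[OF this, of "norm (A 0 s)"] show ?case by simp
      qed
    qed
    hence "((\<lambda>R. of_real pi * (A 0 R - integral {0..1} (A 0))) \<longlongrightarrow> of_real pi * (0 - integral {0..1} (A 0))) at_top"
      by (intro tendsto_intros)
    with l1 have "complex_of_real nv = of_real pi * (0 - integral {0..1} (A 0))"
      using tendsto_unique trivial_limit_at_top_linorder by blast
    hence "cmod (of_real nv) = cmod (of_real pi * (0 - integral {0..1} (A 0)))" by (rule arg_cong)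
    thus ?thesis using nv0 by (simp add: norm_mult)
  qed
  have "nv\<^sup>2 \<le> pi\<^sup>2 * integral {0..1} (\<lambda>s. (cmod (A 0 s))\<^sup>2)"
    using norm_integral_square_le[OF cA, of 0 1 0] unfolding nvA by (simp add: norm_mult power_mult_distrib)
  hence "c0 * exp (- 2 * B0) * nv\<^sup>2 \<le> c0 * exp (- 2 * B0) * (pi\<^sup>2 * integral {0..1} (\<lambda>s. (cmod (A 0 s))\<^sup>2))"
    using c0 by (intro mult_left_mono) auto
  also have "\<dots> = pi / 4 * (2 * (c0 * exp (- 2 * B0) * (2 * pi) * integral {0..1} (\<lambda>s. (cmod (A 0 s))\<^sup>2)))"
    by (simp add: power2_eq_square)
  also have "\<dots> \<le> pi / 4 * (8 * nv)" using up_A0 by (intro mult_left_mono) auto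
  finally have fin: "c0 * exp (- 2 * B0) * nv * nv \<le> 2 * pi * nv" by (simp add: power2_eq_square mult_ac)
  have "nv \<le> 2 * pi * exp (2 * B0) / c0"
  proof (cases "nv = 0")
    case True
    thus ?thesis using c0 by simp
  next
    case False
    hence "c0 * exp (- 2 * B0) * nv \<le> 2 * pi" using fin nv0 by simp
    hence "exp (2 * B0) * (c0 * exp (- 2 * B0) * nv) \<le> exp (2 * B0) * (2 * pi)" by (intro mult_left_mono) auto
    moreover have "exp (2 * B0) * (c0 * exp (- 2 * B0) * nv) = c0 * nv"
      by (simp add: exp_minus)
    ultimately have "c0 * nv \<le> exp (2 * B0) * (2 * pi)" by (simp only:)
    thus ?thesis using c0 by (simp add: pos_le_divide_eq mult_ac)
  qed
  thus ?thesis by (intro that[of x]) (use x0 self(2) in \<open>auto simp: nv_def H_def[abs_def] v_def\<close>)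
qed

end

section \<open>Subharmonic potentials with logarithmic poles\<close>

text \<open>\<open>profile p\<close> is \<open>cos (p t)\<close> on \<open>\<bar>t\<bar> < \<pi> / p\<close>, continued by its minimum \<open>-1\<close> to a \<open>C\<^sup>1\<close> function
  of period \<open>2 \<pi>\<close>; this is where \<open>p > 1\<close> is needed. Then \<open>ln \<bar>1 - z powr p\<bar>\<close> in the sector \<open>\<bar>Arg z\<bar> < \<pi> / p\<close>,
  continued by \<open>ln (1 + \<bar>z\<bar> powr p)\<close>, is \<open>ln (1 - 2 x c + x\<^sup>2) / 2\<close> with \<open>x = \<bar>z\<bar> powr p\<close> and
  \<open>c = profile p (Arg z)\<close>, and it is subharmonic.\<close>

definition trunc_cos :: "real \<Rightarrow> real" where "trunc_cos x = (if \<bar>x\<bar> < pi then cos x else -1)"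
definition trunc_cos' :: "real \<Rightarrow> real" where "trunc_cos' x = (if \<bar>x\<bar> < pi then - sin x else 0)"
definition trunc_cos'' :: "real \<Rightarrow> real" where "trunc_cos'' x = (if \<bar>x\<bar> < pi then - cos x else 0)"

definition profile :: "real \<Rightarrow> real \<Rightarrow> real" where "profile p t = trunc_cos (p * Arg (cis t))"
definition profile' :: "real \<Rightarrow> real \<Rightarrow> real" where "profile' p t = p * trunc_cos' (p * Arg (cis t))"
definition profile'' :: "real \<Rightarrow> real \<Rightarrow> real" where "profile'' p t = p\<^sup>2 * trunc_cos'' (p * Arg (cis t))"

lemma trunc_cos_minus: "trunc_cos (- x) = trunc_cos x" "trunc_cos' (- x) = - trunc_cos' x"
  by (auto simp: trunc_cos_def trunc_cos'_def)

lemma one_sided_glue: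
  fixes f g h :: "real \<Rightarrow> real"
  assumes "(f has_real_derivative D) (at a)" "(g has_real_derivative D) (at a)" "f a = g a" "d > 0"
    and "\<And>x. a - d < x \<Longrightarrow> x < a \<Longrightarrow> h x = f x" "\<And>x. a \<le> x \<Longrightarrow> x < a + d \<Longrightarrow> h x = g x"
  shows "(h has_real_derivative D) (at a)"
proof -
  have "(h has_real_derivative D) (at a within {..a})"
    by (rule has_field_derivative_transform_within[OF has_field_derivative_at_within[OF assms(1)] assms(4)])
       (use assms(3-6) in \<open>auto simp: dist_real_def order_le_less\<close>)
  moreover have "(h has_real_derivative D) (at a within {a..})"
    by (rule has_field_derivative_transform_within[OF has_field_derivative_at_within[OF assms(2)] assms(4)])
       (use assms(6) in \<open>auto simp: dist_real_def\<close>)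
  ultimately have "(h has_real_derivative D) (at a within {..a} \<union> {a..})"
    by (simp add: has_field_derivative_iff Lim_within_Un)
  moreover have "{..a} \<union> {a..} = UNIV" by auto
  ultimately show ?thesis by simp
qed

lemma trunc_cos_derivative: "(trunc_cos has_real_derivative trunc_cos' x) (at x)"
proof -
  consider "\<bar>x\<bar> < pi" | "\<bar>x\<bar> > pi" | "\<bar>x\<bar> = pi" by linarith
  thus ?thesis
  proof cases
    case 1
    have "(cos has_real_derivative - sin x) (at x)" by (auto intro!: derivative_eq_intros)
    hence "(trunc_cos has_real_derivative - sin x) (at x)"
      by (rule has_field_derivative_transform_within_open[of _ _ _ "{-pi<..<pi}"]) (use 1 in \<open>auto simp: trunc_cos_def\<close>)
    thus ?thesis using 1 by (simp add: trunc_cos'_def)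
  next
    case 2
    have "((\<lambda>_. -1) has_real_derivative 0) (at x)" by simp
    hence "(trunc_cos has_real_derivative 0) (at x)"
      by (rule has_field_derivative_transform_within_open[of _ _ _ "- cball 0 pi"])
         (use 2 in \<open>auto simp: trunc_cos_def dist_real_def\<close>)
    thus ?thesis using 2 by (simp add: trunc_cos'_def)
  next
    case 3
    have pp: "(trunc_cos has_real_derivative 0) (at pi)"
      by (rule one_sided_glue[of cos _ _ "\<lambda>_. -1" pi])
         (auto intro!: derivative_eq_intros simp: trunc_cos_def)
    have mm: "(trunc_cos has_real_derivative 0) (at (-pi))"
    proof -
      have "((\<lambda>x. trunc_cos (- x)) has_real_derivative 0 * (-1)) (at (-pi))"
        by (rule DERIV_chain2[where g = uminus]) (use pp in \<open>auto intro!: derivative_eq_intros\<close>)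
      thus ?thesis by (simp add: trunc_cos_minus)
    qed
    have "x = pi \<or> x = - pi" using 3 by auto
    thus ?thesis using pp mm by (auto simp: trunc_cos'_def)
  qed
qed

lemma trunc_cos'_derivative:
  assumes "\<bar>x\<bar> \<noteq> pi"
  shows "(trunc_cos' has_real_derivative trunc_cos'' x) (at x)"
proof (cases "\<bar>x\<bar> < pi")
  case True
  have "((\<lambda>x. - sin x) has_real_derivative - cos x) (at x)" by (auto intro!: derivative_eq_intros)
  hence "(trunc_cos' has_real_derivative - cos x) (at x)"
    by (rule has_field_derivative_transform_within_open[of _ _ _ "{-pi<..<pi}"]) (use True in \<open>auto simp: trunc_cos'_def\<close>)
  thus ?thesis using True by (simp add: trunc_cos''_def)
next
  case False
  have "((\<lambda>_. 0) has_real_derivative 0) (at x)" by simp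
  hence "(trunc_cos' has_real_derivative 0) (at x)"
    by (rule has_field_derivative_transform_within_open[of _ _ _ "- cball 0 pi"])
       (use False assms in \<open>auto simp: trunc_cos'_def dist_real_def\<close>)
  thus ?thesis using False assms by (simp add: trunc_cos''_def)
qed

lemma trunc_cos'_eq: "trunc_cos' x = - sin (max (-pi) (min pi x))"
proof (cases "x = - pi")
  case False
  thus ?thesis by (auto simp: trunc_cos'_def max_def min_def)
qed (auto simp: trunc_cos'_def)

lemma continuous_on_trunc_cos: "continuous_on S trunc_cos" "continuous_on S trunc_cos'"
proof -
  show "continuous_on S trunc_cos"
    by (rule DERIV_continuous_on[of _ _ trunc_cos']) (use trunc_cos_derivative in \<open>auto intro: has_field_derivative_at_within\<close>)
  show "continuous_on S trunc_cos'" unfolding trunc_cos'_eq[abs_def] by (intro continuous_intros)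
qed

context
  fixes p :: real
  assumes p: "p > 1"
begin

text \<open>Past the angle \<open>pi\<close> both \<open>p * Arg (cis t)\<close> and its unwrapped
  version exceed \<open>pi\<close> in modulus, where \<open>g\<close> is constant, so the jump of
  \<open>Arg\<close> is invisible. As \<open>pi / p < pi\<close>, the open window reaches beyond
  \<open>2 * pi * k + pi\<close>; the windows therefore cover the line and derivatives may be
  computed with unwrapped angles.\<close>

lemma Arg_cis_local:
  fixes g :: "real \<Rightarrow> real" and k :: int
  assumes g: "\<And>x y. \<bar>x\<bar> \<ge> pi \<Longrightarrow> \<bar>y\<bar> \<ge> pi \<Longrightarrow> g x = g y"
    and t: "2 * pi * k - pi < t" "t < 2 * pi * k + 2 * pi - pi / p"
  shows "g (p * Arg (cis t)) = g (p * (t - 2 * pi * k))"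
proof -
  have cis: "cis t = cis (t - 2 * pi * k)"
    by (metis cis_divide cis_multiple_2pi div_by_1 Ints_of_int mult.assoc)
  show ?thesis
  proof (cases "t - 2 * pi * k \<le> pi")
    case True
    hence "Arg (cis t) = t - 2 * pi * k" unfolding cis using t by (intro Arg_cis) auto
    thus ?thesis by simp
  next
    case False
    have cis2: "cis t = cis (t - 2 * pi * k - 2 * pi)" unfolding cis by (simp add: cis_divide[symmetric])
    have "pi / p > 0" using p by simp
    hence A: "Arg (cis t) = t - 2 * pi * k - 2 * pi"
      unfolding cis2 by (intro Arg_cis) (use False t in auto)
    have "p * (2 * pi - (t - 2 * pi * k)) \<ge> p * (pi / p)" using t p by (intro mult_left_mono) auto
    hence 1: "\<bar>p * Arg (cis t)\<bar> \<ge> pi" unfolding A using p by (simp add: abs_if algebra_simps)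
    have "p * (t - 2 * pi * k) \<ge> 1 * pi" using False p by (intro mult_mono) auto
    hence 2: "\<bar>p * (t - 2 * pi * k)\<bar> \<ge> pi" by auto
    show ?thesis by (rule g[OF 1 2])
  qed
qed

lemma profile_local_index:
  obtains k :: int where "2 * pi * k - pi < t" "t < 2 * pi * k + 2 * pi - pi / p" "t - 2 * pi * k = Arg (cis t)"
proof -
  define k where "k = \<lceil>(t - pi) / (2 * pi)\<rceil>"
  have "(t - pi) / (2 * pi) \<le> k" "k < (t - pi) / (2 * pi) + 1" unfolding k_def by linarith+
  hence k: "t - pi \<le> 2 * pi * k" "2 * pi * k < t - pi + 2 * pi" by (auto simp: field_simps)
  have "pi / p < pi" using p by (simp add: field_simps)
  moreover have "cis t = cis (t - 2 * pi * k)"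
    by (metis cis_divide cis_multiple_2pi div_by_1 Ints_of_int mult.assoc)
  hence "t - 2 * pi * k = Arg (cis t)" using k by (simp only:, intro Arg_cis[symmetric]) auto
  ultimately show ?thesis using k by (intro that[of k]) auto
qed

lemma profile_derivative: "(profile p has_real_derivative profile' p t) (at t)"
  and profile'_derivative: "p * \<bar>Arg (cis t)\<bar> \<noteq> pi \<Longrightarrow> (profile' p has_real_derivative profile'' p t) (at t)"
  and isCont_profile': "isCont (profile' p) t"
proof -
  obtain k :: int where k: "2 * pi * k - pi < t" "t < 2 * pi * k + 2 * pi - pi / p" "t - 2 * pi * k = Arg (cis t)"
    by (rule profile_local_index)
  let ?U = "{2 * pi * k - pi<..<2 * pi * k + 2 * pi - pi / p}"
  have U: "open ?U" "t \<in> ?U" using k by auto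
  have loc: "profile p x = trunc_cos (p * (x - 2 * pi * k))" "profile' p x = p * trunc_cos' (p * (x - 2 * pi * k))" if "x \<in> ?U" for x
  proof -
    have "trunc_cos (p * Arg (cis x)) = trunc_cos (p * (x - 2 * pi * k))"
      by (rule Arg_cis_local) (use that in \<open>auto simp: trunc_cos_def\<close>)
    moreover have "trunc_cos' (p * Arg (cis x)) = trunc_cos' (p * (x - 2 * pi * k))"
      by (rule Arg_cis_local) (use that in \<open>auto simp: trunc_cos'_def\<close>)
    ultimately show "profile p x = trunc_cos (p * (x - 2 * pi * k))" "profile' p x = p * trunc_cos' (p * (x - 2 * pi * k))"
      by (simp_all add: profile_def profile'_def)
  qed
  have "((\<lambda>x. trunc_cos (p * (x - 2 * pi * k))) has_real_derivative trunc_cos' (p * (t - 2 * pi * k)) * p) (at t)"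
    by (rule DERIV_chain2[OF trunc_cos_derivative]) (auto intro!: derivative_eq_intros)
  hence "(profile p has_real_derivative trunc_cos' (p * (t - 2 * pi * k)) * p) (at t)"
    by (rule has_field_derivative_transform_within_open[OF _ U]) (use loc in auto)
  thus "(profile p has_real_derivative profile' p t) (at t)"
    by (simp only: loc(2)[OF U(2)] mult.commute)
  show "(profile' p has_real_derivative profile'' p t) (at t)" if "p * \<bar>Arg (cis t)\<bar> \<noteq> pi"
  proof -
    have "\<bar>p * (t - 2 * pi * k)\<bar> \<noteq> pi" using that p unfolding k(3) by (simp add: abs_mult)
    from trunc_cos'_derivative[OF this]
    have "((\<lambda>x. trunc_cos' (p * (x - 2 * pi * k))) has_real_derivative trunc_cos'' (p * (t - 2 * pi * k)) * p) (at t)"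
      by (rule DERIV_chain2) (auto intro!: derivative_eq_intros)
    hence "((\<lambda>x. p * trunc_cos' (p * (x - 2 * pi * k))) has_real_derivative p * (trunc_cos'' (p * (t - 2 * pi * k)) * p)) (at t)"
      by (rule DERIV_cmult)
    hence "(profile' p has_real_derivative p * (trunc_cos'' (p * (t - 2 * pi * k)) * p)) (at t)"
      by (rule has_field_derivative_transform_within_open[OF _ U]) (use loc in auto)
    thus ?thesis unfolding k(3) profile''_def by (simp add: power2_eq_square mult_ac)
  qed
  have "continuous_on ?U (\<lambda>x. p * trunc_cos' (p * (x - 2 * pi * k)))"
    by (intro continuous_intros continuous_on_compose2[OF continuous_on_trunc_cos(2)[of UNIV]]) auto
  hence "continuous_on ?U (profile' p)" by (rule continuous_on_eq) (use loc in auto)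
  thus "isCont (profile' p) t" using U continuous_on_eq_continuous_at by blast
qed

lemma continuous_on_profile [continuous_intros]:
  "continuous_on S f \<Longrightarrow> continuous_on S (\<lambda>x. profile p (f x))"
  "continuous_on S f \<Longrightarrow> continuous_on S (\<lambda>x. profile' p (f x))"
proof -
  have "continuous_on UNIV (profile p)"
    by (rule DERIV_continuous_on[of _ _ "profile' p"]) (use profile_derivative in \<open>auto intro: has_field_derivative_at_within\<close>)
  thus "continuous_on S f \<Longrightarrow> continuous_on S (\<lambda>x. profile p (f x))" by (rule continuous_on_compose2) auto
  have "continuous_on UNIV (profile' p)"
    by (intro continuous_at_imp_continuous_on ballI isCont_profile')
  thus "continuous_on S f \<Longrightarrow> continuous_on S (\<lambda>x. profile' p (f x))" by (rule continuous_on_compose2) auto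
qed

text \<open>Inside the sector the third and the last bound are identities; outside, where the
  profile is constantly \<open>-1\<close>, the last one reads \<open>0 \<le> p\<^sup>2\<close>.
  These two give the subharmonicity of the atoms.\<close>

lemma profile_bounds: "-1 \<le> profile p t" "profile p t \<le> 1" "(p * profile p t)\<^sup>2 + (profile' p t)\<^sup>2 \<le> p\<^sup>2"
  "\<bar>profile' p t\<bar> \<le> p" "profile'' p t \<le> - (p\<^sup>2 * profile p t)"
proof -
  show "-1 \<le> profile p t" "profile p t \<le> 1" by (auto simp: profile_def trunc_cos_def)
  have "(p * cos x)\<^sup>2 + (p * sin x)\<^sup>2 = p\<^sup>2" for x
    by (metis power_mult_distrib distrib_left mult.right_neutral sin_cos_squared_add2)
  thus "(p * profile p t)\<^sup>2 + (profile' p t)\<^sup>2 \<le> p\<^sup>2"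
    by (auto simp: profile_def profile'_def trunc_cos_def trunc_cos'_def)
  show "\<bar>profile' p t\<bar> \<le> p" using p by (auto simp: profile'_def trunc_cos'_def abs_mult mult_le_cancel_left1)
  show "profile'' p t \<le> - (p\<^sup>2 * profile p t)"
    by (auto simp: profile_def profile''_def trunc_cos_def trunc_cos''_def)
qed

lemma profile_periodic: "profile p (t + 2*pi) = profile p t" "profile' p (t + 2*pi) = profile' p t"
proof -
  have "cis (t + 2*pi) = cis t" by (simp add: cis_mult[symmetric])
  thus "profile p (t + 2*pi) = profile p t" "profile' p (t + 2*pi) = profile' p t"
    by (simp_all add: profile_def profile'_def)
qed

text \<open>The maximum of the profile is quadratically flat, and this makes \<open>atom_den\<close>
  of second order near the pole.\<close>

lemma one_minus_profile_le:
  assumes "\<bar>t\<bar> < pi"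
  shows "1 - profile p t \<le> (p * t)\<^sup>2 / 2"
proof -
  have *: "1 - trunc_cos x \<le> x\<^sup>2 / 2" for x
  proof (cases "\<bar>x\<bar> < pi")
    case True
    have "1 - cos x = 2 * (sin (x/2))\<^sup>2" using cos_double_sin[of "x/2"] by simp
    moreover have "\<bar>sin (x/2)\<bar> \<le> \<bar>x/2\<bar>" by (rule abs_sin_x_le_abs_x)
    hence "(sin (x/2))\<^sup>2 \<le> (x/2)\<^sup>2" by (simp only: abs_le_square_iff)
    ultimately show ?thesis using True by (simp add: trunc_cos_def power_divide)
  next
    case False
    have "2 \<le> \<bar>x\<bar>" using False pi_ge_two by linarith
    hence "2\<^sup>2 \<le> \<bar>x\<bar>\<^sup>2" by (intro power_mono) auto
    thus ?thesis using False by (simp add: trunc_cos_def)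
  qed
  have "Arg (cis t) = t" using assms by (intro Arg_cis) auto
  thus ?thesis using *[of "p * t"] by (simp add: profile_def)
qed

lemma finite_profile_kinks: "finite {t \<in> {0..2*pi}. p * \<bar>Arg (cis (t - a))\<bar> = pi}"
proof -
  define K where "K = (\<lambda>(c, k::int). a + c + 2 * pi * k) ` ({pi/p, - pi/p} \<times> {\<lfloor>(- a - 2*pi) / (2*pi)\<rfloor>..\<lceil>(4 * pi - a) / (2 * pi)\<rceil>})"
  have "{t \<in> {0..2*pi}. p * \<bar>Arg (cis (t - a))\<bar> = pi} \<subseteq> K"
  proof
    fix t assume t: "t \<in> {t \<in> {0..2*pi}. p * \<bar>Arg (cis (t - a))\<bar> = pi}"
    obtain k :: int where k: "t - a - 2 * pi * k = Arg (cis (t - a))"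
      using profile_local_index[of "t - a"] by metis
    have "\<bar>Arg (cis (t - a))\<bar> = pi / p" using t p by (auto simp: field_simps)
    hence c: "Arg (cis (t - a)) \<in> {pi/p, - pi/p}" by (auto simp: abs_if split: if_splits)
    have "pi / p < pi" "pi / p > 0" using p by (auto simp: field_simps)
    hence "\<bar>Arg (cis (t - a))\<bar> \<le> pi" using c by auto
    hence "- a - 2 * pi \<le> 2 * pi * k" "2 * pi * k \<le> 4 * pi - a" using k t by (auto simp: abs_le_iff)
    hence "(- a - 2 * pi) / (2 * pi) \<le> k" "k \<le> (4 * pi - a) / (2 * pi)" by (auto simp: field_simps)
    hence "k \<in> {\<lfloor>(- a - 2*pi) / (2*pi)\<rfloor>..\<lceil>(4 * pi - a) / (2 * pi)\<rceil>}" by simp linarith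
    moreover have "t = a + Arg (cis (t - a)) + 2 * pi * k" using k by simp
    ultimately show "t \<in> K" unfolding K_def using c by force
  qed
  thus ?thesis by (rule finite_subset) (auto simp: K_def)
qed

end

text \<open>The coordinates are relative to the pole, with \<open>exp (p * s)\<close> in the role of
  \<open>\<bar>z\<bar> powr p\<close>. For \<open>\<kappa> = 1\<close> it vanishes exactly where
  \<open>s = 0\<close> and the profile is \<open>1\<close>; for \<open>\<kappa> < 1\<close> it stays
  above \<open>(1 - \<kappa>) * (1 + (exp (p * s))\<^sup>2)\<close>, so the logarithm has bounded
  first derivatives.\<close>

definition atom_den :: "real \<Rightarrow> real \<Rightarrow> real \<Rightarrow> real \<Rightarrow> real" where
  "atom_den \<kappa> p s t = 1 - 2 * \<kappa> * exp (p * s) * profile p t + (exp (p * s))\<^sup>2"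

definition atom :: "real \<Rightarrow> real \<Rightarrow> real \<Rightarrow> real \<Rightarrow> real" where
  "atom \<kappa> p s t = ln (atom_den \<kappa> p s t) / 2"

definition atom_s :: "real \<Rightarrow> real \<Rightarrow> real \<Rightarrow> real \<Rightarrow> real" where
  "atom_s \<kappa> p s t = p * ((exp (p * s))\<^sup>2 - \<kappa> * exp (p * s) * profile p t) / atom_den \<kappa> p s t"

definition atom_t :: "real \<Rightarrow> real \<Rightarrow> real \<Rightarrow> real \<Rightarrow> real" where
  "atom_t \<kappa> p s t = - (\<kappa> * exp (p * s) * profile' p t) / atom_den \<kappa> p s t"

definition atom_ss :: "real \<Rightarrow> real \<Rightarrow> real \<Rightarrow> real \<Rightarrow> real" where
  "atom_ss \<kappa> p s t = (p\<^sup>2 * (2 * (exp (p * s))\<^sup>2 - \<kappa> * exp (p * s) * profile p t) * atom_den \<kappa> p s t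
     - 2 * (p * ((exp (p * s))\<^sup>2 - \<kappa> * exp (p * s) * profile p t))\<^sup>2) / (atom_den \<kappa> p s t)\<^sup>2"

definition atom_tt :: "real \<Rightarrow> real \<Rightarrow> real \<Rightarrow> real \<Rightarrow> real" where
  "atom_tt \<kappa> p s t = (- (\<kappa> * exp (p * s) * profile'' p t) * atom_den \<kappa> p s t
     - 2 * (\<kappa> * exp (p * s) * profile' p t)\<^sup>2) / (atom_den \<kappa> p s t)\<^sup>2"

context
  fixes p \<kappa> :: real
  assumes p: "p > 1" and \<kappa>: "0 \<le> \<kappa>" "\<kappa> < 1"
begin

lemma atom_den_lower: "(1 - \<kappa>) * (1 + (exp (p * s))\<^sup>2) \<le> atom_den \<kappa> p s t"
proof -
  define x where "x = exp (p * s)"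
  have "\<kappa> * (2 * x * profile p t) \<le> \<kappa> * (1 + x\<^sup>2)"
  proof (rule mult_left_mono)
    have "2 * x * profile p t \<le> 2 * x * 1"
      using profile_bounds(2)[OF p] by (intro mult_left_mono) (auto simp: x_def)
    also have "\<dots> \<le> 1 + x\<^sup>2" using zero_le_power2[of "x - 1"] by (simp add: power2_eq_square algebra_simps)
    finally show "2 * x * profile p t \<le> 1 + x\<^sup>2" .
  qed (use \<kappa> in auto)
  thus ?thesis by (simp add: atom_den_def x_def algebra_simps)
qed

lemma atom_den_pos: "atom_den \<kappa> p s t > 0"
  using atom_den_lower[of s t] \<kappa> by (smt (verit) mult_pos_pos zero_less_power2 zero_le_power2)

lemma atom_den_nonzero [simp]: "atom_den \<kappa> p s t \<noteq> 0"
  using atom_den_pos[of s t] by simp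

lemma atom_den_upper: "atom_den \<kappa> p s t \<le> (1 + exp (p * s))\<^sup>2"
proof -
  have "\<kappa> * (- profile p t) \<le> \<kappa> * 1"
    using \<kappa> profile_bounds(1)[OF p, of t] by (intro mult_left_mono) auto
  hence "\<kappa> * (- profile p t) \<le> 1" using \<kappa> by linarith
  hence "exp (p * s) * (\<kappa> * (- profile p t)) \<le> exp (p * s) * 1" by (intro mult_left_mono) auto
  thus ?thesis by (simp add: atom_den_def power2_eq_square algebra_simps)
qed

lemma atom_den_lower_square: 
  assumes "exp (p * s) \<le> 1"
  shows "(1 - exp (p * s))\<^sup>2 \<le> atom_den \<kappa> p s t"
proof -
  have "\<kappa> * profile p t \<le> 1"
    using \<kappa> profile_bounds(2)[OF p, of t] mult_mono[of \<kappa> 1 "profile p t" 1]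
    by (cases "profile p t \<ge> 0") (auto intro: order_trans[OF mult_nonneg_nonpos])
  hence "exp (p * s) * (\<kappa> * profile p t) \<le> exp (p * s) * 1" by (intro mult_left_mono) auto
  thus ?thesis by (simp add: atom_den_def power2_eq_square algebra_simps)
qed

lemma atom_derivatives:
  "((\<lambda>s. atom \<kappa> p s t) has_real_derivative atom_s \<kappa> p s t) (at s)"
  "((\<lambda>s. atom_s \<kappa> p s t) has_real_derivative atom_ss \<kappa> p s t) (at s)"
  "((\<lambda>t. atom \<kappa> p s t) has_real_derivative atom_t \<kappa> p s t) (at t)"
  "p * \<bar>Arg (cis t)\<bar> \<noteq> pi \<Longrightarrow> ((\<lambda>t. atom_t \<kappa> p s t) has_real_derivative atom_tt \<kappa> p s t) (at t)"
proof -
  have ds: "((\<lambda>s. atom_den \<kappa> p s t) has_real_derivative 2 * p * ((exp (p * s))\<^sup>2 - \<kappa> * exp (p * s) * profile p t)) (at s)"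
    unfolding atom_den_def by (auto intro!: derivative_eq_intros simp: power2_eq_square algebra_simps)
  have dt: "((\<lambda>t. atom_den \<kappa> p s t) has_real_derivative - 2 * \<kappa> * exp (p * s) * profile' p t) (at t)"
    unfolding atom_den_def by (auto intro!: derivative_eq_intros profile_derivative[OF p])
  show "((\<lambda>s. atom \<kappa> p s t) has_real_derivative atom_s \<kappa> p s t) (at s)"
    unfolding atom_def atom_s_def using atom_den_pos
    by (auto intro!: derivative_eq_intros ds)
  show "((\<lambda>s. atom_s \<kappa> p s t) has_real_derivative atom_ss \<kappa> p s t) (at s)"
    unfolding atom_s_def atom_ss_def
    by (auto intro!: derivative_eq_intros ds simp: power2_eq_square algebra_simps)
  show "((\<lambda>t. atom \<kappa> p s t) has_real_derivative atom_t \<kappa> p s t) (at t)"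
    unfolding atom_def atom_t_def using atom_den_pos
    by (auto intro!: derivative_eq_intros dt)
  show "((\<lambda>t. atom_t \<kappa> p s t) has_real_derivative atom_tt \<kappa> p s t) (at t)" if "p * \<bar>Arg (cis t)\<bar> \<noteq> pi"
    unfolding atom_t_def atom_tt_def
  proof (rule DERIV_cong[OF DERIV_divide[OF _ dt]])
    show "((\<lambda>t. - (\<kappa> * exp (p * s) * profile' p t)) has_real_derivative - (\<kappa> * exp (p * s) * profile'' p t)) (at t)"
      by (auto intro!: derivative_eq_intros profile'_derivative[OF p that])
  qed (simp_all add: power2_eq_square)
qed

text \<open>If \<open>profile''\<close> were \<open>- p\<^sup>2 * profile\<close> throughout, the
  numerator of the Laplacian would collapse to \<open>2 * x\<^sup>2 * (p\<^sup>2 - \<kappa>\<^sup>2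
  * ((p * c)\<^sup>2 + d\<^sup>2))\<close>, which is nonnegative. The inequality
  \<open>profile'' \<le> - p\<^sup>2 * profile\<close> can only make it larger.\<close>

lemma atom_subharmonic: "atom_ss \<kappa> p s t + atom_tt \<kappa> p s t \<ge> 0"
proof -
  define x c d D where "x = exp (p * s)" "c = profile p t" "d = profile' p t" "D = atom_den \<kappa> p s t"
  note defs = this
  have D: "D = 1 - 2 * \<kappa> * x * c + x\<^sup>2" "D > 0" using atom_den_pos by (auto simp: defs atom_den_def)
  have x: "x > 0" by (simp add: defs)
  have "\<kappa> * x * (p\<^sup>2 * c) \<le> \<kappa> * x * (- profile'' p t)"
    using profile_bounds(5)[OF p, of t] \<kappa> x by (intro mult_left_mono) (auto simp: defs)
  hence "(\<kappa> * x * (p\<^sup>2 * c)) * D \<le> (- (\<kappa> * x * profile'' p t)) * D"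
    using D(2) by (intro mult_right_mono) auto
  moreover have "(p * c)\<^sup>2 + d\<^sup>2 \<le> p\<^sup>2" using profile_bounds(3)[OF p, of t] by (simp add: defs)
  hence "\<kappa>\<^sup>2 * ((p * c)\<^sup>2 + d\<^sup>2) \<le> 1 * p\<^sup>2" using \<kappa> by (intro mult_mono) (auto simp: power_le_one)
  hence "2 * x\<^sup>2 * (p\<^sup>2 - \<kappa>\<^sup>2 * ((p * c)\<^sup>2 + d\<^sup>2)) \<ge> 0" by simp
  moreover have "p\<^sup>2 * (2 * x\<^sup>2 - \<kappa> * x * c) * D - 2 * (p * (x\<^sup>2 - \<kappa> * x * c))\<^sup>2
       + ((\<kappa> * x * (p\<^sup>2 * c)) * D - 2 * (\<kappa> * x * d)\<^sup>2) = 2 * x\<^sup>2 * (p\<^sup>2 - \<kappa>\<^sup>2 * ((p * c)\<^sup>2 + d\<^sup>2))"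
    unfolding D(1) by algebra
  ultimately have "p\<^sup>2 * (2 * x\<^sup>2 - \<kappa> * x * c) * D - 2 * (p * (x\<^sup>2 - \<kappa> * x * c))\<^sup>2
       + ((- (\<kappa> * x * profile'' p t)) * D - 2 * (\<kappa> * x * d)\<^sup>2) \<ge> 0" by linarith
  moreover have "atom_ss \<kappa> p s t + atom_tt \<kappa> p s t = (p\<^sup>2 * (2 * x\<^sup>2 - \<kappa> * x * c) * D - 2 * (p * (x\<^sup>2 - \<kappa> * x * c))\<^sup>2
       + ((- (\<kappa> * x * profile'' p t)) * D - 2 * (\<kappa> * x * d)\<^sup>2)) / D\<^sup>2"
    by (simp add: atom_ss_def atom_tt_def add_divide_distrib defs)
  ultimately show ?thesis by simp
qed

lemma atom_s_bound: "\<bar>atom_s \<kappa> p s t\<bar> \<le> 2 * p / (1 - \<kappa>)"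
  and atom_t_bound: "\<bar>atom_t \<kappa> p s t\<bar> \<le> p / (1 - \<kappa>)"
proof -
  define x where "x = exp (p * s)"
  have x: "x > 0" "x \<le> 1 + x\<^sup>2"
    using zero_le_power2[of "x - 1"] exp_gt_zero[of "p * s"]
    by (auto simp: x_def power2_eq_square algebra_simps simp del: exp_gt_zero)
  have x1: "1 + x\<^sup>2 > 0" by (simp add: add_pos_nonneg)
  have q: "N / atom_den \<kappa> p s t \<le> c / (1 - \<kappa>)" if "0 \<le> N" "N \<le> c * (1 + x\<^sup>2)" "c > 0" for N c
  proof -
    have "N / atom_den \<kappa> p s t \<le> (c * (1 + x\<^sup>2)) / ((1 - \<kappa>) * (1 + x\<^sup>2))"
    proof (rule frac_le)
      show "(1 - \<kappa>) * (1 + x\<^sup>2) \<le> atom_den \<kappa> p s t" unfolding x_def by (rule atom_den_lower)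
      show "0 < (1 - \<kappa>) * (1 + x\<^sup>2)" using \<kappa> x1 by simp
      show "0 \<le> c * (1 + x\<^sup>2)" using that by linarith
    qed (rule that)
    also have "\<dots> = c / (1 - \<kappa>)" using x1 by simp
    finally show ?thesis .
  qed
  have 1: "\<bar>\<kappa> * x * profile p t\<bar> \<le> 1 * x * 1"
    unfolding abs_mult using \<kappa> x profile_bounds(1,2)[OF p, of t] by (intro mult_mono) auto
  have "\<bar>p * (x\<^sup>2 - \<kappa> * x * profile p t)\<bar> \<le> p * (x\<^sup>2 + x)"
  proof -
    have "\<bar>x\<^sup>2 - \<kappa> * x * profile p t\<bar> \<le> x\<^sup>2 + x" using 1 zero_le_power2[of x] by linarith
    thus ?thesis using p by (simp add: abs_mult)
  qed
  also have "\<dots> \<le> 2 * p * (1 + x\<^sup>2)" 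
    using mult_left_mono[of "x\<^sup>2 + x" "2 * (1 + x\<^sup>2)" p] x p by (simp add: mult_ac)
  finally have "\<bar>p * (x\<^sup>2 - \<kappa> * x * profile p t)\<bar> / atom_den \<kappa> p s t \<le> 2 * p / (1 - \<kappa>)"
    using p by (intro q) auto
  thus "\<bar>atom_s \<kappa> p s t\<bar> \<le> 2 * p / (1 - \<kappa>)"
    using atom_den_pos[of s t] by (simp add: atom_s_def x_def)
  have "\<bar>\<kappa> * x * profile' p t\<bar> \<le> 1 * x * p"
    unfolding abs_mult using \<kappa> x profile_bounds(4)[OF p, of t] by (intro mult_mono) auto
  also have "\<dots> \<le> p * (1 + x\<^sup>2)" using x p by (simp add: mult.commute)
  finally have "\<bar>\<kappa> * x * profile' p t\<bar> / atom_den \<kappa> p s t \<le> p / (1 - \<kappa>)"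
    using p by (intro q) auto
  thus "\<bar>atom_t \<kappa> p s t\<bar> \<le> p / (1 - \<kappa>)"
    using atom_den_pos[of s t] by (simp add: atom_t_def x_def)
qed

lemma atom_le: "atom \<kappa> p s t \<le> ln (1 + exp (p * s))"
proof -
  have "ln (atom_den \<kappa> p s t) \<le> ln ((1 + exp (p * s))\<^sup>2)"
    using atom_den_upper atom_den_pos by (intro ln_mono) auto
  also have "\<dots> = 2 * ln (1 + exp (p * s))" by (subst ln_realpow) (auto intro: add_pos_pos)
  finally show ?thesis by (simp add: atom_def)
qed

text \<open>Since \<open>\<kappa> * profile p t \<le> 1\<close>, the denominator is at least
  \<open>(1 - x)\<^sup>2\<close> with \<open>x = exp (p * s)\<close>, whatever
  \<open>\<kappa>\<close> is. This is the source of the uniform lower bound for the potential on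
  \<open>0 \<le> s \<le> 1\<close>.\<close>

lemma atom_ge:
  assumes "exp (p * s) \<le> 1 / 2"
  shows "atom \<kappa> p s t \<ge> - 2 * exp (p * s)"
proof -
  define x where "x = exp (p * s)"
  have x: "0 < x" "x \<le> 1/2" using assms by (auto simp: x_def)
  have "- x - 2 * x\<^sup>2 \<le> ln (1 - x)" using x by (intro ln_one_minus_pos_lower_bound) auto
  moreover have "2 * x\<^sup>2 \<le> x" using x by (simp add: power2_eq_square)
  ultimately have "- 2 * x \<le> ln (1 - x)" by linarith
  moreover have "2 * ln (1 - x) = ln ((1 - x)\<^sup>2)" using x by (subst ln_realpow) auto
  moreover have "ln ((1 - x)\<^sup>2) \<le> ln (atom_den \<kappa> p s t)"
    using atom_den_lower_square[of s t] x atom_den_pos[of s t] by (intro ln_mono) (simp_all only: x_def, auto)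
  ultimately show ?thesis unfolding atom_def x_def by linarith
qed

text \<open>The constant explodes as \<open>\<kappa>\<close> tends to \<open>1\<close>. That is
  harmless, because it only enters the constant \<open>K\<close> of \<open>cylinder_weight\<close>,
  which is absent from the final estimate.\<close>

lemma atom_asymptotic: "\<bar>atom \<kappa> p s t - p * max s 0\<bar> \<le> ln 4 - ln (1 - \<kappa>)"
proof -
  define x y where "x = exp (p * s)" "y = exp (p * max s 0)"
  have y: "y \<ge> 1" "x \<le> y" "y\<^sup>2 \<le> 1 + x\<^sup>2" "y > 0" using p
    by (auto simp: x_y_def max_def mult_le_0_iff)
  have D: "atom_den \<kappa> p s t > 0" by (rule atom_den_pos)
  have "(1 - \<kappa>) * y\<^sup>2 \<le> (1 - \<kappa>) * (1 + x\<^sup>2)" using y \<kappa> by (intro mult_left_mono) auto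
  also have "\<dots> \<le> atom_den \<kappa> p s t" using atom_den_lower by (simp add: x_y_def)
  finally have "ln ((1 - \<kappa>) * y\<^sup>2) \<le> ln (atom_den \<kappa> p s t)" using \<kappa> y by (intro ln_mono) auto
  moreover have "ln ((1 - \<kappa>) * y\<^sup>2) = ln (1 - \<kappa>) + 2 * ln y"
    using \<kappa> y by (subst ln_mult) (auto simp: ln_realpow)
  moreover have "atom_den \<kappa> p s t \<le> 4 * y\<^sup>2"
  proof -
    have "atom_den \<kappa> p s t \<le> (1 + x)\<^sup>2" using atom_den_upper by (simp add: x_y_def)
    also have "\<dots> \<le> (2 * y)\<^sup>2"
    proof (rule power_mono)
      have "x > 0" by (simp add: x_y_def)
      thus "1 + x \<le> 2 * y" "0 \<le> 1 + x" using y by auto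
    qed
    finally show ?thesis by (simp add: power_mult_distrib)
  qed
  hence "ln (atom_den \<kappa> p s t) \<le> ln (4 * y\<^sup>2)" using D by (intro ln_mono) auto
  moreover have "ln (4 * y\<^sup>2) = ln 4 + 2 * ln y" using y by (subst ln_mult) (auto simp: ln_realpow)
  moreover have "ln y = p * max s 0" by (simp add: x_y_def)
  moreover have "ln 4 \<ge> (0::real)" "ln (1 - \<kappa>) \<le> 0" using \<kappa> by auto
  ultimately show ?thesis unfolding atom_def abs_le_iff by (intro conjI; linarith)
qed

lemma continuous_on_atom [continuous_intros]:
  assumes "continuous_on S f" "continuous_on S g"
  shows "continuous_on S (\<lambda>x. atom \<kappa> p (f x) (g x))" "continuous_on S (\<lambda>x. atom_s \<kappa> p (f x) (g x))"
    "continuous_on S (\<lambda>x. atom_t \<kappa> p (f x) (g x))" "continuous_on S (\<lambda>x. atom_ss \<kappa> p (f x) (g x))"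
proof -
  have D: "continuous_on S (\<lambda>x. atom_den \<kappa> p (f x) (g x))"
    unfolding atom_den_def by (intro continuous_intros continuous_on_profile[OF p] assms)
  note [continuous_intros] = D continuous_on_profile[OF p assms(2)] assms
  have "\<forall>x\<in>S. (atom_den \<kappa> p (f x) (g x))\<^sup>2 \<noteq> 0" by simp
  thus "continuous_on S (\<lambda>x. atom \<kappa> p (f x) (g x))" "continuous_on S (\<lambda>x. atom_s \<kappa> p (f x) (g x))"
    "continuous_on S (\<lambda>x. atom_t \<kappa> p (f x) (g x))" "continuous_on S (\<lambda>x. atom_ss \<kappa> p (f x) (g x))"
    unfolding atom_def atom_s_def atom_t_def atom_ss_def by (intro continuous_intros; simp)+
qed

lemma atom_periodic: "atom \<kappa> p s (t + 2*pi) = atom \<kappa> p s t" "atom_t \<kappa> p s (t + 2*pi) = atom_t \<kappa> p s t"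
  by (simp_all add: atom_def atom_t_def atom_den_def profile_periodic[OF p])

end

section \<open>Polynomials of small weighted norm\<close>

definition potential :: "real \<Rightarrow> real \<Rightarrow> (complex \<Rightarrow> nat) \<Rightarrow> complex set \<Rightarrow> real \<Rightarrow> real \<Rightarrow> real" where
  "potential \<kappa> p m Z s t = (\<Sum>a\<in>Z. real (m a) * atom \<kappa> p (s - ln (cmod a)) (t - Arg a))"

text \<open>This is \<open>ln (1 + \<bar>z\<bar>\<^sup>2)\<close> for
  \<open>s = ln \<bar>z\<bar>\<close>: strictly subharmonic, with a slope that rises from
  \<open>0\<close> to \<open>2\<close>.\<close>

definition softplus :: "real \<Rightarrow> real" where "softplus s = ln (1 + exp (2 * s))"

lemma softplus_bounds: "0 \<le> softplus s" "2 * s \<le> softplus s" "s \<ge> 0 \<Longrightarrow> softplus s \<le> 2 * s + ln 2"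
  "s \<le> 0 \<Longrightarrow> softplus s \<le> ln 2"
proof -
  show "0 \<le> softplus s" by (simp add: softplus_def)
  have "ln (exp (2 * s)) \<le> ln (1 + exp (2 * s))" by (intro ln_mono) (auto intro: add_pos_pos)
  thus "2 * s \<le> softplus s" by (simp add: softplus_def)
  have "ln (1 + exp (2 * s)) \<le> ln (2 * exp (2 * s))" if "s \<ge> 0"
    using that by (intro ln_mono) (auto intro: add_pos_pos)
  thus "s \<ge> 0 \<Longrightarrow> softplus s \<le> 2 * s + ln 2" by (simp add: softplus_def ln_mult)
  show "s \<le> 0 \<Longrightarrow> softplus s \<le> ln 2" unfolding softplus_def by (intro ln_mono) (auto intro: add_pos_pos)
qed

lemma softplus_derivatives:
  "(softplus has_real_derivative 2 * exp (2 * s) / (1 + exp (2 * s))) (at s)"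
  "((\<lambda>s. 2 * exp (2 * s) / (1 + exp (2 * s))) has_real_derivative 4 * exp (2 * s) / (1 + exp (2 * s))\<^sup>2) (at s)"
proof -
  have pos: "1 + exp (2 * s) > 0" by (auto intro: add_pos_pos)
  hence nz: "1 + exp (2 * s) \<noteq> 0" by simp
  show "(softplus has_real_derivative 2 * exp (2 * s) / (1 + exp (2 * s))) (at s)"
    unfolding softplus_def[abs_def] using pos by (auto intro!: derivative_eq_intros)
  have e: "((\<lambda>s. 2 * exp (2 * s)) has_real_derivative 4 * exp (2 * s)) (at s)"
    "((\<lambda>s. 1 + exp (2 * s)) has_real_derivative 2 * exp (2 * s)) (at s)"
    by (auto intro!: derivative_eq_intros)
  show "((\<lambda>s. 2 * exp (2 * s) / (1 + exp (2 * s))) has_real_derivative 4 * exp (2 * s) / (1 + exp (2 * s))\<^sup>2) (at s)"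
    by (rule DERIV_cong[OF DERIV_divide[OF e nz]]) (simp add: power2_eq_square algebra_simps)
qed

text \<open>The atoms contribute a nonnegative amount to the Laplacian, so the whole lower bound
  comes from \<open>softplus\<close>. The term \<open>s / 4\<close> places the slope at minus
  infinity strictly between the exponents \<open>0\<close> and \<open>1\<close>.\<close>

lemma cylinder_weight_potential:
  fixes Z :: "complex set" and m :: "complex \<Rightarrow> nat"
  assumes p: "p > 1" and \<kappa>: "0 \<le> \<kappa>" "\<kappa> < 1" and Z: "finite Z" and \<tau>: "\<tau> \<ge> 0"
    and N: "real N < p * (\<Sum>a\<in>Z. real (m a)) + 2 * \<tau> + 1/4" "p * (\<Sum>a\<in>Z. real (m a)) + 2 * \<tau> + 1/4 < real N + 1"
  defines "u \<equiv> \<lambda>f s t. \<Sum>a\<in>Z. real (m a) * f \<kappa> p (s - ln (cmod a)) (t - Arg a)"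
  defines "K0 \<equiv> \<Sum>a\<in>Z. real (m a) * (2 * p / (1 - \<kappa>) + (ln 4 - ln (1 - \<kappa>)) + p * \<bar>ln (cmod a)\<bar>)"
  shows "cylinder_weight (\<lambda>s t. potential \<kappa> p m Z s t + \<tau> * softplus s + s / 4)
    (\<lambda>s t. u atom_s s t + \<tau> * (2 * exp (2 * s) / (1 + exp (2 * s))) + 1/4)
    (u atom_t) (\<lambda>s t. u atom_ss s t + \<tau> * (4 * exp (2 * s) / (1 + exp (2 * s))\<^sup>2)) (u atom_tt)
    (\<lambda>s. \<tau> * (4 * exp (2 * s) / (1 + exp (2 * s))\<^sup>2))
    (\<Union>a\<in>Z. {t. p * \<bar>Arg (cis (t - Arg a))\<bar> = pi})
    (p * (\<Sum>a\<in>Z. real (m a)) + 2 * \<tau> + 1/4) (1/4) (K0 + 2 * \<tau> + 1/4) K0 N"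
proof
  note ad = atom_derivatives[OF p \<kappa>]
  have k1: "1 - \<kappa> > 0" using \<kappa> by simp
  have A0: "0 \<le> ln 4 - ln (1 - \<kappa>)" using \<kappa> by (smt (verit) ln_ge_zero ln_le_zero_iff)
  have P0: "0 \<le> 2 * p / (1 - \<kappa>)" using p k1 by simp
  have e2: "1 + exp (2 * s) > 0" "1 + exp (2 * s) \<noteq> 0" for s :: real
    by (auto intro: add_pos_pos) (smt (verit) exp_gt_zero)
  have shift_s: "((\<lambda>s. f \<kappa> p (s - c) t) has_real_derivative g \<kappa> p (s - c) t) (at s)"
    if "\<And>s. ((\<lambda>s. f \<kappa> p s t) has_real_derivative g \<kappa> p s t) (at s)" for f g c s t
  proof -
    have "((\<lambda>s. f \<kappa> p (s - c) t) has_real_derivative g \<kappa> p (s - c) t * 1) (at s)"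
      by (rule DERIV_chain2[OF that]) (auto intro!: derivative_eq_intros)
    thus ?thesis by simp
  qed
  have shift_t: "((\<lambda>t. f \<kappa> p s (t - c)) has_real_derivative g \<kappa> p s (t - c)) (at t)"
    if "((\<lambda>t. f \<kappa> p s t) has_real_derivative g \<kappa> p s (t - c)) (at (t - c))" for f g c s t
  proof -
    have "((\<lambda>t. f \<kappa> p s (t - c)) has_real_derivative g \<kappa> p s (t - c) * 1) (at t)"
      by (rule DERIV_chain2[where f = "f \<kappa> p s" and g = "\<lambda>t. t - c", OF that]) (auto intro!: derivative_eq_intros)
    thus ?thesis by simp
  qed
  have usum: "((\<lambda>s. u f s t) has_real_derivative u g s t) (at s)"
    if "\<And>s t. ((\<lambda>s. f \<kappa> p s t) has_real_derivative g \<kappa> p s t) (at s)" for f g s t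
    unfolding u_def by (intro DERIV_sum DERIV_cmult shift_s that)
  have ut: "((\<lambda>t. u f s t) has_real_derivative u g s t) (at t)"
    if "\<And>a s. a \<in> Z \<Longrightarrow> ((\<lambda>t. f \<kappa> p s t) has_real_derivative g \<kappa> p s (t - Arg a)) (at (t - Arg a))" for f g s t
    unfolding u_def by (rule DERIV_sum, rule DERIV_cmult, rule shift_t, rule that)
  have pot: "potential \<kappa> p m Z s t = u atom s t" for s t by (simp add: potential_def u_def)
  show "((\<lambda>s. potential \<kappa> p m Z s t + \<tau> * softplus s + s / 4) has_real_derivative
      u atom_s s t + \<tau> * (2 * exp (2 * s) / (1 + exp (2 * s))) + 1/4) (at s)" for s t
    unfolding pot
    by (rule DERIV_add[OF DERIV_add[OF usum[of atom atom_s, OF ad(1)] DERIV_cmult[OF softplus_derivatives(1)]] DERIV_cdivide[OF DERIV_ident]])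
  show "((\<lambda>t. potential \<kappa> p m Z s t + \<tau> * softplus s + s / 4) has_real_derivative u atom_t s t) (at t)" for s t
  proof -
    have "((\<lambda>t. u atom s t + (\<tau> * softplus s + s / 4)) has_real_derivative u atom_t s t + 0) (at t)"
      by (rule DERIV_add[OF ut[of atom atom_t, OF ad(3)] DERIV_const])
    thus ?thesis unfolding pot by (simp add: add.assoc)
  qed
  show "((\<lambda>s. u atom_s s t + \<tau> * (2 * exp (2 * s) / (1 + exp (2 * s))) + 1/4) has_real_derivative
      u atom_ss s t + \<tau> * (4 * exp (2 * s) / (1 + exp (2 * s))\<^sup>2)) (at s)" for s t
  proof -
    have "((\<lambda>s. u atom_s s t + \<tau> * (2 * exp (2 * s) / (1 + exp (2 * s))) + 1/4) has_real_derivative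
      u atom_ss s t + \<tau> * (4 * exp (2 * s) / (1 + exp (2 * s))\<^sup>2) + 0) (at s)"
      by (rule DERIV_add[OF DERIV_add[OF usum[of atom_s atom_ss, OF ad(2)] DERIV_cmult[OF softplus_derivatives(2)]] DERIV_const])
    thus ?thesis by simp
  qed
  show "((\<lambda>t. u atom_t s t) has_real_derivative u atom_tt s t) (at t)"
    if "t \<notin> (\<Union>a\<in>Z. {t. p * \<bar>Arg (cis (t - Arg a))\<bar> = pi})" for s t
    by (rule ut[of atom_t atom_tt, OF ad(4)]) (use that in auto)
  show "finite ((\<Union>a\<in>Z. {t. p * \<bar>Arg (cis (t - Arg a))\<bar> = pi}) \<inter> {0..2*pi})"
  proof -
    have "(\<Union>a\<in>Z. {t. p * \<bar>Arg (cis (t - Arg a))\<bar> = pi}) \<inter> {0..2*pi}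
      = (\<Union>a\<in>Z. {t \<in> {0..2*pi}. p * \<bar>Arg (cis (t - Arg a))\<bar> = pi})" by auto
    thus ?thesis using finite_profile_kinks[OF p] Z by simp
  qed
  note ci = continuous_on_atom[OF p \<kappa>]
  have cs: "continuous_on S (\<lambda>x. softplus (f x))" if "continuous_on S f" for S :: "'b::topological_space set" and f
    unfolding softplus_def using e2 by (intro continuous_intros that) (auto simp: less_imp_neq)
  show "continuous_on UNIV (\<lambda>(s,t). potential \<kappa> p m Z s t + \<tau> * softplus s + s / 4)"
    unfolding pot u_def split_beta by (intro continuous_intros ci cs) auto
  show "continuous_on UNIV (\<lambda>(s,t). u atom_s s t + \<tau> * (2 * exp (2 * s) / (1 + exp (2 * s))) + 1/4)"
    unfolding u_def split_beta by (intro continuous_intros ci) (use e2 in auto)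
  show "continuous_on UNIV (\<lambda>(s,t). u atom_ss s t + \<tau> * (4 * exp (2 * s) / (1 + exp (2 * s))\<^sup>2))"
    unfolding u_def split_beta by (intro continuous_intros ci) (use e2 in auto)
  show "continuous_on UNIV (u atom_t s)" for s
    unfolding u_def by (intro continuous_intros ci)
  show "continuous_on UNIV (\<lambda>s. \<tau> * (4 * exp (2 * s) / (1 + exp (2 * s))\<^sup>2))"
    by (intro continuous_intros) (use e2 in auto)
  have per: "atom \<kappa> p s (t + 2*pi - c) = atom \<kappa> p s (t - c)" "atom_t \<kappa> p s (t + 2*pi - c) = atom_t \<kappa> p s (t - c)" for s t c
    using atom_periodic[OF p \<kappa>, of s "t - c"] by (simp_all add: algebra_simps)
  show "potential \<kappa> p m Z s (t + 2*pi) + \<tau> * softplus s + s / 4 = potential \<kappa> p m Z s t + \<tau> * softplus s + s / 4" for s t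
    by (simp only: potential_def per)
  show "u atom_t s (t + 2*pi) = u atom_t s t" for s t by (simp only: u_def per)
  show "\<tau> * (4 * exp (2 * s) / (1 + exp (2 * s))\<^sup>2) \<le> u atom_ss s t + \<tau> * (4 * exp (2 * s) / (1 + exp (2 * s))\<^sup>2) + u atom_tt s t" for s t
  proof -
    have "u atom_ss s t + u atom_tt s t = (\<Sum>a\<in>Z. real (m a) * (atom_ss \<kappa> p (s - ln (cmod a)) (t - Arg a) + atom_tt \<kappa> p (s - ln (cmod a)) (t - Arg a)))"
      by (simp add: u_def sum.distrib distrib_left)
    also have "\<dots> \<ge> 0" by (intro sum_nonneg mult_nonneg_nonneg atom_subharmonic[OF p \<kappa>]) auto
    finally show ?thesis by simp
  qed
  show "0 \<le> \<tau> * (4 * exp (2 * s) / (1 + exp (2 * s))\<^sup>2)" for s using \<tau> by simp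
  have ub: "\<bar>u f s t\<bar> \<le> K0" if "\<And>s t. \<bar>f \<kappa> p s t\<bar> \<le> 2 * p / (1 - \<kappa>)" for f s t
    unfolding u_def K0_def
  proof (rule order_trans[OF sum_abs], rule sum_mono)
    fix a
    have "\<bar>f \<kappa> p (s - ln (cmod a)) (t - Arg a)\<bar> \<le> 2 * p / (1 - \<kappa>) + (ln 4 - ln (1 - \<kappa>)) + p * \<bar>ln (cmod a)\<bar>"
      using that[of "s - ln (cmod a)" "t - Arg a"] A0 mult_nonneg_nonneg[of p "\<bar>ln (cmod a)\<bar>"] p by linarith
    thus "\<bar>real (m a) * f \<kappa> p (s - ln (cmod a)) (t - Arg a)\<bar> \<le> real (m a) * (2 * p / (1 - \<kappa>) + (ln 4 - ln (1 - \<kappa>)) + p * \<bar>ln (cmod a)\<bar>)"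
      by (simp add: abs_mult mult_left_mono)
  qed
  show "\<bar>u atom_s s t + \<tau> * (2 * exp (2 * s) / (1 + exp (2 * s))) + 1/4\<bar> \<le> K0 + 2 * \<tau> + 1/4" for s t
  proof -
    have f: "2 * exp (2 * s) / (1 + exp (2 * s)) \<le> 2" "0 \<le> 2 * exp (2 * s) / (1 + exp (2 * s))"
      using e2[of s] by (auto simp: divide_le_eq)
    hence "\<tau> * (2 * exp (2 * s) / (1 + exp (2 * s))) \<le> \<tau> * 2" "0 \<le> \<tau> * (2 * exp (2 * s) / (1 + exp (2 * s)))"
      using mult_left_mono[OF f(1) \<tau>] mult_nonneg_nonneg[OF \<tau> f(2)] by blast+
    moreover have "\<bar>u atom_s s t\<bar> \<le> K0" by (intro ub atom_s_bound[OF p \<kappa>])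
    ultimately show ?thesis by linarith
  qed
  show "\<bar>u atom_t s t\<bar> \<le> K0" for s t
  proof (rule ub)
    fix s t
    have "p / (1 - \<kappa>) \<le> 2 * p / (1 - \<kappa>)" using p k1 by (intro divide_right_mono) auto
    thus "\<bar>atom_t \<kappa> p s t\<bar> \<le> 2 * p / (1 - \<kappa>)" using atom_t_bound[OF p \<kappa>, of s t] by linarith
  qed
  have pb: "\<bar>potential \<kappa> p m Z s t - p * (\<Sum>a\<in>Z. real (m a)) * max s 0\<bar> \<le> K0" for s t
  proof -
    have "potential \<kappa> p m Z s t - p * (\<Sum>a\<in>Z. real (m a)) * max s 0
       = (\<Sum>a\<in>Z. real (m a) * (atom \<kappa> p (s - ln (cmod a)) (t - Arg a) - p * max s 0))"
      by (simp add: potential_def right_diff_distrib sum_subtractf sum_distrib_left sum_distrib_right mult_ac)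
    also have "\<bar>\<dots>\<bar> \<le> K0" unfolding K0_def
    proof (rule order_trans[OF sum_abs], rule sum_mono)
      fix a
      have "\<bar>p * max (s - ln (cmod a)) 0 - p * max s 0\<bar> \<le> p * \<bar>ln (cmod a)\<bar>"
        using p by (simp add: abs_mult flip: right_diff_distrib)
      hence "\<bar>atom \<kappa> p (s - ln (cmod a)) (t - Arg a) - p * max s 0\<bar> \<le> 2 * p / (1 - \<kappa>) + (ln 4 - ln (1 - \<kappa>)) + p * \<bar>ln (cmod a)\<bar>"
        using atom_asymptotic[OF p \<kappa>, of "s - ln (cmod a)" "t - Arg a"] P0 by linarith
      thus "\<bar>real (m a) * (atom \<kappa> p (s - ln (cmod a)) (t - Arg a) - p * max s 0)\<bar> \<le> real (m a) * (2 * p / (1 - \<kappa>) + (ln 4 - ln (1 - \<kappa>)) + p * \<bar>ln (cmod a)\<bar>)"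
        by (simp add: abs_mult mult_left_mono)
    qed
    finally show ?thesis .
  qed
  have ln2: "ln 2 \<le> (2::real)" using ln_2_less_1 by linarith
  show "\<bar>potential \<kappa> p m Z s t + \<tau> * softplus s + s / 4 - (p * (\<Sum>a\<in>Z. real (m a)) + 2 * \<tau> + 1/4) * s\<bar> \<le> K0 + 2 * \<tau> + 1/4"
    if "s \<ge> 0" for s t
  proof -
    have "0 \<le> softplus s - 2 * s" "softplus s - 2 * s \<le> 2" using softplus_bounds[of s] that ln2 by auto
    hence "0 \<le> \<tau> * (softplus s - 2 * s)" "\<tau> * (softplus s - 2 * s) \<le> \<tau> * 2" using \<tau> by (auto intro: mult_left_mono)
    thus ?thesis using pb[of s t] that by (simp add: algebra_simps)
  qed
  show "\<bar>potential \<kappa> p m Z s t + \<tau> * softplus s + s / 4 - 1/4 * s\<bar> \<le> K0 + 2 * \<tau> + 1/4"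
    if "s \<le> 0" for s t
  proof -
    have "0 \<le> softplus s" "softplus s \<le> 2" using softplus_bounds[of s] that ln2 by auto
    hence "0 \<le> \<tau> * softplus s" "\<tau> * softplus s \<le> \<tau> * 2" using \<tau> by (auto intro: mult_left_mono)
    thus ?thesis using pb[of s t] that by (simp add: max_def split: if_splits)
  qed
qed (use N in auto)

text \<open>For \<open>s \<ge> 1\<close> the cut-off is \<open>1\<close>, so the minimizer is a
  genuine polynomial in \<open>z\<close> with constant term \<open>1\<close>. Zeros of modulus at
  least \<open>exp 2\<close> stay away from \<open>0 \<le> s \<le> 1\<close>, where the two
  constants of the estimate are taken; therefore the bound depends on the zeros only through
  \<open>S\<close>.\<close>

lemma exists_weighted_polynomial:
  fixes Z :: "complex set" and m :: "complex \<Rightarrow> nat"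
  assumes p: "p > 1" and \<kappa>: "0 \<le> \<kappa>" "\<kappa> < 1" and Z: "finite Z" "\<And>a. a \<in> Z \<Longrightarrow> exp 2 \<le> cmod a"
    and S: "(\<Sum>a\<in>Z. real (m a) * cmod a powr (- p)) \<le> S"
  obtains N :: nat and x :: "nat \<Rightarrow> complex" where "x 0 = 1"
    "\<And>b c. 1 \<le> b \<Longrightarrow> b \<le> c \<Longrightarrow> integral {b..c} (\<lambda>s. integral {0..2*pi} (\<lambda>t. (cmod (\<Sum>i\<le>N. x i * (of_real (exp s) * cis t) ^ i))\<^sup>2
       * exp (- 2 * potential \<kappa> p m Z s t - 4 * s))) \<le> 8 * pi * (1 + exp 2)\<^sup>2 * exp (4 * exp p * S)"
proof -
  define M where "M = (\<lambda>\<tau>. p * (\<Sum>a\<in>Z. real (m a)) + 2 * \<tau> + 1/4)"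
  have Mpos: "M \<tau> > 0" if "\<tau> \<ge> 0" for \<tau>
    using that p by (auto simp: M_def intro!: add_nonneg_pos add_nonneg_nonneg mult_nonneg_nonneg sum_nonneg)
  \<comment> \<open>The total slope must not be an integer. The two candidates differ by
    \<open>1/2\<close>, so at most one of them is an integer.\<close>
  obtain \<tau> where \<tau>: "\<tau> = 1/2 \<or> \<tau> = 3/4" "M \<tau> \<notin> \<int>"
  proof (cases "M (1/2) \<in> \<int>")
    case True
    then obtain i where i: "M (1/2) = of_int i" by (auto elim: Ints_cases)
    have "M (3/4) \<notin> \<int>"
    proof
      assume "M (3/4) \<in> \<int>"
      then obtain j where "M (3/4) = of_int j" by (auto elim: Ints_cases)
      hence "of_int j = of_int i + (1/2::real)" using i by (simp add: M_def)
      hence "of_int (2 * j) = (of_int (2 * i + 1) :: real)" by simp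
      hence "2 * j = 2 * i + 1" by (simp only: of_int_eq_iff)
      thus False by presburger
    qed
    thus ?thesis using that by blast
  qed (use that in blast)
  define N where "N = nat \<lfloor>M \<tau>\<rfloor>"
  have "M \<tau> > 0" using \<tau> by (intro Mpos) auto
  hence "of_int \<lfloor>M \<tau>\<rfloor> = real N" by (simp add: N_def)
  moreover have "of_int \<lfloor>M \<tau>\<rfloor> \<noteq> M \<tau>" using \<tau>(2) Ints_of_int by metis
  ultimately have N: "real N < M \<tau>" "M \<tau> < real N + 1" by linarith+
  have \<tau>0: "\<tau> \<ge> 0" using \<tau> by auto
  interpret cylinder_weight "\<lambda>s t. potential \<kappa> p m Z s t + \<tau> * softplus s + s / 4"
    "\<lambda>s t. (\<Sum>a\<in>Z. real (m a) * atom_s \<kappa> p (s - ln (cmod a)) (t - Arg a)) + \<tau> * (2 * exp (2 * s) / (1 + exp (2 * s))) + 1/4"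
    "\<lambda>s t. \<Sum>a\<in>Z. real (m a) * atom_t \<kappa> p (s - ln (cmod a)) (t - Arg a)"
    "\<lambda>s t. (\<Sum>a\<in>Z. real (m a) * atom_ss \<kappa> p (s - ln (cmod a)) (t - Arg a)) + \<tau> * (4 * exp (2 * s) / (1 + exp (2 * s))\<^sup>2)"
    "\<lambda>s t. \<Sum>a\<in>Z. real (m a) * atom_tt \<kappa> p (s - ln (cmod a)) (t - Arg a)"
    "\<lambda>s. \<tau> * (4 * exp (2 * s) / (1 + exp (2 * s))\<^sup>2)"
    "\<Union>a\<in>Z. {t. p * \<bar>Arg (cis (t - Arg a))\<bar> = pi}" "p * (\<Sum>a\<in>Z. real (m a)) + 2 * \<tau> + 1/4" "1/4"
    "(\<Sum>a\<in>Z. real (m a) * (2 * p / (1 - \<kappa>) + (ln 4 - ln (1 - \<kappa>)) + p * \<bar>ln (cmod a)\<bar>)) + 2 * \<tau> + 1/4"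
    "\<Sum>a\<in>Z. real (m a) * (2 * p / (1 - \<kappa>) + (ln 4 - ln (1 - \<kappa>)) + p * \<bar>ln (cmod a)\<bar>)" N
    by (rule cylinder_weight_potential[OF p \<kappa> Z(1) \<tau>0]) (use N in \<open>auto simp: M_def\<close>)
  \<comment> \<open>On \<open>0 \<le> s \<le> 1\<close> the number
    \<open>exp (p * (s - ln \<bar>a\<bar>))\<close> is at most
    \<open>exp p * \<bar>a\<bar> powr (- p)\<close> and at most \<open>1/2\<close>, so
    \<open>atom_ge\<close> summed over the zeros gives \<open>B0\<close>. The constant
    \<open>c0\<close> bounds the Laplacian of the \<open>softplus\<close> term from below for
    \<open>\<tau> \<ge> 1/2\<close>.\<close>
  define B0 where "B0 = 2 * exp p * S"
  define c0 :: real where "c0 = 2 / (1 + exp 2)\<^sup>2"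
  have "\<exists>x. x 0 = 1 \<and> (\<lambda>s. integral {0..2*pi} (\<lambda>t. (cmod (\<Sum>i\<le>N. x i * basis_fun i s t))\<^sup>2
      * exp (- 2 * (potential \<kappa> p m Z s t + \<tau> * softplus s + s / 4)))) integrable_on UNIV \<and>
    integral UNIV (\<lambda>s. integral {0..2*pi} (\<lambda>t. (cmod (\<Sum>i\<le>N. x i * basis_fun i s t))\<^sup>2
      * exp (- 2 * (potential \<kappa> p m Z s t + \<tau> * softplus s + s / 4)))) \<le> 2 * pi * exp (2 * B0) / c0"
  proof (rule exists_small_dbar_correction[of c0 B0])
    show "c0 > 0" unfolding c0_def by (intro divide_pos_pos zero_less_power add_pos_pos) auto
    fix s :: real assume s: "s \<in> {0..1}"
    have "2 / (1 + exp 2)\<^sup>2 \<le> (\<tau> * 4 * exp (2 * s)) / (1 + exp (2 * s))\<^sup>2"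
    proof (rule frac_le)
      have "1/2 * 4 * 1 \<le> \<tau> * 4 * exp (2 * s)" using \<tau>(1) s by (intro mult_mono) auto
      thus "2 \<le> \<tau> * 4 * exp (2 * s)" by simp
      show "(1 + exp (2 * s))\<^sup>2 \<le> (1 + exp 2)\<^sup>2" using s by (intro power_mono) (auto intro: add_nonneg_nonneg)
      show "0 < (1 + exp (2 * s))\<^sup>2" by (intro zero_less_power add_pos_pos) auto
    qed (use \<tau>0 in auto)
    thus "c0 \<le> \<tau> * (4 * exp (2 * s) / (1 + exp (2 * s))\<^sup>2)" by (simp add: c0_def)
    fix t
    have "(\<Sum>a\<in>Z. real (m a) * (- 2 * (exp p * cmod a powr (- p)))) \<le> potential \<kappa> p m Z s t"
      unfolding potential_def
    proof (intro sum_mono mult_left_mono)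
      fix a assume a: "a \<in> Z"
      have a0: "cmod a > 0" using Z(2)[OF a] exp_gt_zero[of 2] by linarith
      have la: "2 \<le> ln (cmod a)" using Z(2)[OF a] a0 by (simp add: ln_ge_iff)
      have "p * (s - ln (cmod a)) \<le> p * (1 - ln (cmod a))" using s p by (intro mult_left_mono) auto
      hence e1: "exp (p * (s - ln (cmod a))) \<le> exp (p * (1 - ln (cmod a)))" by simp
      have e2: "exp (p * (1 - ln (cmod a))) = exp p * cmod a powr (- p)"
        using a0 by (simp add: powr_def exp_add[symmetric] algebra_simps)
      have "p * (1 - ln (cmod a)) \<le> 1 * (-1)"
        using la p mult_left_mono[of "1 - ln (cmod a)" "-1" p] by linarith
      hence "exp (p * (1 - ln (cmod a))) \<le> exp (-1)" by simp
      also have "\<dots> \<le> 1/2" using exp_ge_add_one_self[of 1] by (simp add: exp_minus field_simps)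
      finally have "exp (p * (s - ln (cmod a))) \<le> 1/2" using e1 by linarith
      from atom_ge[OF p \<kappa> this, of "t - Arg a"] e1
      show "- 2 * (exp p * cmod a powr (- p)) \<le> atom \<kappa> p (s - ln (cmod a)) (t - Arg a)" unfolding e2 by linarith
    qed auto
    moreover have "(\<Sum>a\<in>Z. real (m a) * (- 2 * (exp p * cmod a powr (- p)))) = - 2 * exp p * (\<Sum>a\<in>Z. real (m a) * cmod a powr (- p))"
      by (simp add: sum_distrib_left mult_ac sum_negf)
    moreover have "2 * exp p * (\<Sum>a\<in>Z. real (m a) * cmod a powr (- p)) \<le> 2 * exp p * S"
      using S by (intro mult_left_mono) auto
    moreover have "0 \<le> \<tau> * softplus s" using \<tau>0 softplus_bounds by simp
    ultimately show "- B0 \<le> potential \<kappa> p m Z s t + \<tau> * softplus s + s / 4" using s unfolding B0_def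
      by (simp only: atLeastAtMost_iff) linarith
  qed blast
  then obtain x where x: "x 0 = 1" and xi: "(\<lambda>s. integral {0..2*pi} (\<lambda>t. (cmod (\<Sum>i\<le>N. x i * basis_fun i s t))\<^sup>2
      * exp (- 2 * (potential \<kappa> p m Z s t + \<tau> * softplus s + s / 4)))) integrable_on UNIV" and
    xb: "integral UNIV (\<lambda>s. integral {0..2*pi} (\<lambda>t. (cmod (\<Sum>i\<le>N. x i * basis_fun i s t))\<^sup>2
      * exp (- 2 * (potential \<kappa> p m Z s t + \<tau> * softplus s + s / 4)))) \<le> 2 * pi * exp (2 * B0) / c0" by blast
  have cpot: "continuous_on A (\<lambda>x. potential \<kappa> p m Z (f x) (g x))" if "continuous_on A f" "continuous_on A g" for A :: "'b::topological_space set" and f g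
    unfolding potential_def by (intro continuous_intros continuous_on_atom[OF p \<kappa>] that)
  have csoft: "continuous_on A (\<lambda>x. softplus (f x))" if "continuous_on A f" for A :: "'b::topological_space set" and f
  proof -
    have "1 + exp (2 * f x) \<noteq> 0" for x by (smt (verit) exp_gt_zero)
    thus ?thesis unfolding softplus_def by (intro continuous_intros that) auto
  qed
  \<comment> \<open>Up to \<open>ln 4\<close>, the simple weight \<open>4 * s\<close> dominates
    \<open>2 * \<tau> * softplus s + s / 2\<close>, because \<open>\<tau> \<le> 3/4\<close> and
    \<open>softplus s \<le> 2 * s + ln 2\<close>.\<close>
  have gen: "- 2 * P - 4 * s \<le> l4 + (- 2 * (P + T + s / 4))"
    if "T \<le> 3/4 * (2 * s + l)" "2 * l = l4" "0 < l" "1 \<le> s" for P T l l4 s :: real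
    using that by argo
  show ?thesis
  proof (rule that[of x N])
    fix b c :: real assume bc: "1 \<le> b" "b \<le> c"
    let ?G = "\<lambda>s. integral {0..2*pi} (\<lambda>t. (cmod (\<Sum>i\<le>N. x i * basis_fun i s t))\<^sup>2
      * exp (- 2 * (potential \<kappa> p m Z s t + \<tau> * softplus s + s / 4)))"
    let ?g = "\<lambda>s. integral {0..2*pi} (\<lambda>t. (cmod (\<Sum>i\<le>N. x i * (of_real (exp s) * cis t) ^ i))\<^sup>2 * exp (- 2 * potential \<kappa> p m Z s t - 4 * s))"
    have cg: "continuous_on A ?g" for A
      unfolding cbox_interval[symmetric]
      by (rule integral_continuous_on_param, unfold split_beta, intro continuous_intros cpot)
    have cG: "continuous_on A ?G" for A
      unfolding cbox_interval[symmetric]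
      by (rule integral_continuous_on_param, unfold split_beta, intro continuous_intros cpot csoft)
    have le: "?g s \<le> 4 * ?G s" if "s \<in> {b..c}" for s
    proof -
      have s: "s \<ge> 1" using that bc by auto
      have "?g s \<le> integral {0..2*pi} (\<lambda>t. 4 * ((cmod (\<Sum>i\<le>N. x i * basis_fun i s t))\<^sup>2
        * exp (- 2 * (potential \<kappa> p m Z s t + \<tau> * softplus s + s / 4))))"
      proof (rule integral_le)
        fix t
        have b: "basis_fun i s t = (of_real (exp s) * cis t) ^ i" for i
          using s by (simp add: basis_fun_def cutoff_simps power_mult_distrib Complex.DeMoivre exp_of_nat_mult)
        have e: "exp (- 2 * potential \<kappa> p m Z s t - 4 * s) \<le> 4 * exp (- 2 * (potential \<kappa> p m Z s t + \<tau> * softplus s + s / 4))"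
        proof -
          have "\<tau> * softplus s \<le> 3/4 * (2 * s + ln 2)"
            using \<tau>(1) s softplus_bounds[of s] by (intro mult_mono) auto
          moreover have "2 * ln 2 = ln (4::real)" using ln_realpow[of 2 2] by simp
          moreover have "0 < ln (2::real)" by simp
          ultimately have "- 2 * potential \<kappa> p m Z s t - 4 * s \<le> ln 4 + (- 2 * (potential \<kappa> p m Z s t + \<tau> * softplus s + s / 4))"
            using gen s by blast
          hence "exp (- 2 * potential \<kappa> p m Z s t - 4 * s) \<le> exp (ln 4 + (- 2 * (potential \<kappa> p m Z s t + \<tau> * softplus s + s / 4)))"
            by (simp only: exp_le_cancel_iff)
          thus ?thesis unfolding exp_add by simp
        qed
        show "(cmod (\<Sum>i\<le>N. x i * (of_real (exp s) * cis t) ^ i))\<^sup>2 * exp (- 2 * potential \<kappa> p m Z s t - 4 * s)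
           \<le> 4 * ((cmod (\<Sum>i\<le>N. x i * basis_fun i s t))\<^sup>2 * exp (- 2 * (potential \<kappa> p m Z s t + \<tau> * softplus s + s / 4)))"
          unfolding b using mult_left_mono[OF e, of "(cmod (\<Sum>i\<le>N. x i * (of_real (exp s) * cis t) ^ i))\<^sup>2"] by (simp add: mult.left_commute)
      qed (intro integrable_continuous_real continuous_intros cpot)+
      thus ?thesis by simp
    qed
    have G0: "0 \<le> ?G s" for s
      by (rule integral_nonneg, intro integrable_continuous_real continuous_intros cpot csoft) simp
    have "integral {b..c} ?g \<le> integral {b..c} (\<lambda>s. 4 * ?G s)"
      by (intro integral_le integrable_continuous_real continuous_on_mult_left cg cG le)
    also have "\<dots> = 4 * integral {b..c} ?G" by simp
    also have "integral {b..c} ?G \<le> integral UNIV ?G"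
      by (rule integral_subset_le[OF subset_UNIV integrable_continuous_real[OF cG] xi]) (rule ballI, rule G0)
    also note xb
    also have "4 * (2 * pi * exp (2 * B0) / c0) = 4 * pi * (1 + exp 2)\<^sup>2 * exp (4 * exp p * S)"
      by (simp add: B0_def c0_def mult_ac)
    also have "\<dots> \<le> 8 * pi * (1 + exp 2)\<^sup>2 * exp (4 * exp p * S)" by simp
    finally show "integral {b..c} ?g \<le> 8 * pi * (1 + exp 2)\<^sup>2 * exp (4 * exp p * S)" by simp
  qed (use x in auto)
qed

lemma parseval_polynomial:
  fixes x :: "nat \<Rightarrow> complex"
  shows "((\<lambda>t. (cmod (\<Sum>i\<le>N. x i * (of_real r * cis t) ^ i))\<^sup>2) has_integral
     2 * pi * (\<Sum>i\<le>N. (cmod (x i))\<^sup>2 * r ^ (2 * i))) {0..2*pi}"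
proof -
  define c where "c i = x i * of_real (r ^ i)" for i
  have F: "(\<Sum>i\<le>N. x i * (of_real r * cis t) ^ i) = (\<Sum>i\<le>N. c i * cis (real i * t))" for t
    by (intro sum.cong) (auto simp: c_def power_mult_distrib Complex.DeMoivre)
  have sq: "complex_of_real ((cmod (\<Sum>i\<le>N. x i * (of_real r * cis t) ^ i))\<^sup>2)
     = (\<Sum>i\<le>N. \<Sum>j\<le>N. c i * cnj (c j) * cis (of_int (int i - int j) * t))" for t
  proof -
    have "complex_of_real ((cmod (\<Sum>i\<le>N. x i * (of_real r * cis t) ^ i))\<^sup>2)
       = (\<Sum>i\<le>N. c i * cis (real i * t)) * cnj (\<Sum>i\<le>N. c i * cis (real i * t))"
      unfolding F complex_norm_square ..
    also have "\<dots> = (\<Sum>i\<le>N. \<Sum>j\<le>N. (c i * cis (real i * t)) * (cnj (c j) * cnj (cis (real j * t))))"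
      by (simp add: sum_product)
    also have "\<dots> = (\<Sum>i\<le>N. \<Sum>j\<le>N. c i * cnj (c j) * cis (of_int (int i - int j) * t))"
    proof (intro sum.cong refl)
      fix i j
      have "cis (of_int (int i - int j) * t) = cis (real i * t) * cnj (cis (real j * t))"
        by (simp add: cis_cnj cis_mult left_diff_distrib)
      thus "(c i * cis (real i * t)) * (cnj (c j) * cnj (cis (real j * t))) = c i * cnj (c j) * cis (of_int (int i - int j) * t)"
        by simp
    qed
    finally show ?thesis .
  qed
  have ci: "((\<lambda>t. cis (of_int k * t)) has_integral (if k = 0 then of_real (2*pi) else 0)) {0..2*pi}" for k :: int
    using has_integral_cis[of k 0] has_integral_const_real[of "1::complex" 0 "2*pi"]
    by (auto simp: scaleR_conv_of_real)
  have "((\<lambda>t. complex_of_real ((cmod (\<Sum>i\<le>N. x i * (of_real r * cis t) ^ i))\<^sup>2)) has_integral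
     (\<Sum>i\<le>N. \<Sum>j\<le>N. c i * cnj (c j) * (if int i - int j = 0 then of_real (2*pi) else 0))) {0..2*pi}"
    unfolding sq by (intro has_integral_sum finite_atMost has_integral_mult_right ci)
  also have "(\<Sum>i\<le>N. \<Sum>j\<le>N. c i * cnj (c j) * (if int i - int j = 0 then of_real (2*pi) else 0))
     = (\<Sum>i\<le>N. c i * cnj (c i) * complex_of_real (2*pi))"
  proof (intro sum.cong refl)
    fix i assume i: "i \<in> {..N}"
    have "(\<Sum>j\<le>N. c i * cnj (c j) * (if int i - int j = 0 then complex_of_real (2*pi) else 0))
       = (\<Sum>j\<le>N. if i = j then c i * cnj (c i) * complex_of_real (2*pi) else 0)"
      by (intro sum.cong) auto
    thus "(\<Sum>j\<le>N. c i * cnj (c j) * (if int i - int j = 0 then complex_of_real (2*pi) else 0)) = c i * cnj (c i) * complex_of_real (2*pi)"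
      using i by simp
  qed
  also have "\<dots> = complex_of_real (2 * pi * (\<Sum>i\<le>N. (cmod (x i))\<^sup>2 * r ^ (2 * i)))"
  proof -
    have "c i * cnj (c i) = of_real ((cmod (x i))\<^sup>2 * r ^ (2 * i))" for i
    proof -
      have "c i * cnj (c i) = of_real ((cmod (c i))\<^sup>2)" by (rule complex_norm_square[symmetric])
      also have "(cmod (c i))\<^sup>2 = (cmod (x i))\<^sup>2 * r ^ (2 * i)"
        by (simp add: c_def norm_mult power_mult_distrib norm_power power_mult[symmetric] power_even_abs mult.commute[of i 2])
      finally show ?thesis .
    qed
    thus ?thesis by (simp add: sum_distrib_left mult_ac)
  qed
  finally have fin: "((\<lambda>t. complex_of_real ((cmod (\<Sum>i\<le>N. x i * (of_real r * cis t) ^ i))\<^sup>2)) has_integral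
     complex_of_real (2 * pi * (\<Sum>i\<le>N. (cmod (x i))\<^sup>2 * r ^ (2 * i)))) {0..2*pi}" .
  from has_integral_linear[OF fin bounded_linear_Re] show ?thesis
    by (simp only: o_def Re_complex_of_real)
qed

text \<open>A majorant of \<open>potential\<close> on the whole circle, independent of
  \<open>\<kappa>\<close>; its exponential is the product in the growth bound.\<close>

definition radial_potential :: "real \<Rightarrow> (complex \<Rightarrow> nat) \<Rightarrow> complex set \<Rightarrow> real \<Rightarrow> real" where
  "radial_potential p m Z s = (\<Sum>a\<in>Z. real (m a) * ln (1 + exp (p * (s - ln (cmod a)))))"

lemma radial_potential_mono: "p \<ge> 0 \<Longrightarrow> s \<le> s' \<Longrightarrow> radial_potential p m Z s \<le> radial_potential p m Z s'"
  unfolding radial_potential_def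
proof (rule sum_mono, rule mult_left_mono)
  fix a assume "p \<ge> 0" "s \<le> s'"
  hence "p * (s - ln (cmod a)) \<le> p * (s' - ln (cmod a))" by (intro mult_left_mono) auto
  moreover have "0 < 1 + exp (p * (s - ln (cmod a)))" by (intro add_pos_pos) auto
  ultimately show "ln (1 + exp (p * (s - ln (cmod a)))) \<le> ln (1 + exp (p * (s' - ln (cmod a))))"
    by (intro ln_mono) auto
qed auto

lemma exp_radial_potential:
  assumes "finite Z" "r > 0" "\<And>a. a \<in> Z \<Longrightarrow> a \<noteq> 0"
  shows "exp (radial_potential p m Z (ln r)) = (\<Prod>a\<in>Z. (1 + (r / cmod a) powr p) ^ m a)"
proof -
  have "exp (radial_potential p m Z (ln r)) = (\<Prod>a\<in>Z. exp (real (m a) * ln (1 + exp (p * (ln r - ln (cmod a))))))"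
    using assms(1) by (simp add: radial_potential_def exp_sum)
  also have "\<dots> = (\<Prod>a\<in>Z. (1 + (r / cmod a) powr p) ^ m a)"
  proof (intro prod.cong refl)
    fix a assume "a \<in> Z"
    hence "a \<noteq> 0" by (rule assms(3))
    hence "exp (p * (ln r - ln (cmod a))) = (r / cmod a) powr p"
      using assms(2) by (simp add: powr_def ln_div)
    moreover have "1 + (r / cmod a) powr p > 0" by (simp add: add_pos_nonneg)
    ultimately show "exp (real (m a) * ln (1 + exp (p * (ln r - ln (cmod a))))) = (1 + (r / cmod a) powr p) ^ m a"
      by (simp add: exp_of_nat_mult)
  qed
  finally show ?thesis .
qed

text \<open>For each zero, \<open>ln (1 + x * exp (p * d)) - ln (1 + x) \<le> x * (exp (p * d) - 1)
  \<le> 2 * p * d * x\<close>. Thus the radial potential changes by a bounded amount on intervals of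
  length comparable to \<open>exp (- p * s)\<close>.\<close>

lemma radial_potential_step:
  assumes p: "p > 0" and S: "(\<Sum>a\<in>Z. real (m a) * cmod a powr (- p)) \<le> S" and Z: "\<And>a. a \<in> Z \<Longrightarrow> a \<noteq> 0"
    and d: "0 \<le> d" "p * d \<le> 1"
  shows "radial_potential p m Z (s + d) \<le> radial_potential p m Z s + 2 * p * d * exp (p * s) * S"
proof -
  have "radial_potential p m Z (s + d) \<le> (\<Sum>a\<in>Z. real (m a) * (ln (1 + exp (p * (s - ln (cmod a)))) + 2 * (p * d) * (exp (p * s) * cmod a powr (- p))))"
    unfolding radial_potential_def
  proof (intro sum_mono mult_left_mono)
    fix a assume a: "a \<in> Z"
    define x where "x = exp (p * (s - ln (cmod a)))"
    have x: "x > 0" "x = exp (p * s) * cmod a powr (- p)"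
      using Z[OF a] by (auto simp: x_def powr_def exp_add[symmetric] algebra_simps)
    have "exp (p * d) \<le> 1 + p * d + (p * d)\<^sup>2" using p d by (intro exp_bound) auto
    also have "(p * d)\<^sup>2 \<le> p * d" using p d by (simp add: power2_eq_square mult_left_le)
    finally have e: "exp (p * d) - 1 \<le> 2 * (p * d)" by linarith
    have "1 + x * exp (p * d) = (1 + x) * (1 + x * (exp (p * d) - 1) / (1 + x))" using x by (simp add: field_simps)
    moreover have q: "0 \<le> x * (exp (p * d) - 1) / (1 + x)" using x p d by simp
    ultimately have "ln (1 + x * exp (p * d)) = ln (1 + x) + ln (1 + x * (exp (p * d) - 1) / (1 + x))"
      using x by (simp add: ln_mult add_pos_nonneg)
    also have "ln (1 + x * (exp (p * d) - 1) / (1 + x)) \<le> x * (exp (p * d) - 1) / (1 + x)"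
      using q by (rule ln_add_one_self_le_self)
    also have "\<dots> \<le> x * (exp (p * d) - 1) / 1"
      using x(1) p d by (intro divide_left_mono) auto
    also have "\<dots> = x * (exp (p * d) - 1)" by simp
    also have "\<dots> \<le> x * (2 * (p * d))" using x e by (intro mult_left_mono) auto
    finally have "ln (1 + x * exp (p * d)) \<le> ln (1 + x) + x * (2 * (p * d))" by simp
    moreover have "exp (p * (s + d - ln (cmod a))) = x * exp (p * d)"
      by (simp add: x_def exp_add[symmetric] algebra_simps)
    ultimately show "ln (1 + exp (p * (s + d - ln (cmod a)))) \<le> ln (1 + exp (p * (s - ln (cmod a)))) + 2 * (p * d) * (exp (p * s) * cmod a powr (- p))"
      using x(2) by (simp add: x_def[symmetric] mult_ac)
  qed auto
  also have "\<dots> = radial_potential p m Z s + 2 * p * d * exp (p * s) * (\<Sum>a\<in>Z. real (m a) * cmod a powr (- p))"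
    by (simp add: radial_potential_def distrib_left sum.distrib sum_distrib_left mult_ac)
  also have "\<dots> \<le> radial_potential p m Z s + 2 * p * d * exp (p * s) * S"
    using S p d by (intro add_left_mono mult_left_mono) auto
  finally show ?thesis .
qed

text \<open>From mean squares to pointwise bounds, independently of the degree: by Parseval's
  identity the mean square increases with the radius, so its average over a thin strip bounds it at
  the inner edge, and Cauchy-Schwarz with geometric factors passes to the sum of the moduli of the
  terms. A strip of width about \<open>exp (- p * s)\<close> costs \<open>exp (p * s)\<close> and
  the weight \<open>exp (- 4 * s)\<close> costs \<open>exp (2 * s)\<close>, hence the exponent
  \<open>p + 2\<close>.\<close>

lemma polynomial_growth_bound:
  fixes x :: "nat \<Rightarrow> complex"
  assumes p: "p > 1" and \<kappa>: "0 \<le> \<kappa>" "\<kappa> < 1" and Z: "finite Z" "\<And>a. a \<in> Z \<Longrightarrow> a \<noteq> 0"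
    and S: "(\<Sum>a\<in>Z. real (m a) * cmod a powr (- p)) \<le> S" and C: "C \<ge> 0"
    and x: "\<And>b c. 1 \<le> b \<Longrightarrow> b \<le> c \<Longrightarrow> integral {b..c} (\<lambda>s. integral {0..2*pi} (\<lambda>t. (cmod (\<Sum>i\<le>N. x i * (of_real (exp s) * cis t) ^ i))\<^sup>2
       * exp (- 2 * potential \<kappa> p m Z s t - 4 * s))) \<le> C"
  shows "cmod (\<Sum>i\<le>N. x i * z ^ i) \<le>
     sqrt (4 * p\<^sup>2 * C * exp (4 * S + 4) / pi) * exp (S * exp p + p + 2) * (1 + cmod z) powr (p + 2) * (\<Prod>a\<in>Z. (1 + (cmod z / cmod a) powr p) ^ m a)"
proof -
  define V where "V = radial_potential p m Z"
  define I where "I s = (\<Sum>i\<le>N. (cmod (x i))\<^sup>2 * (exp s) ^ (2 * i))" for s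
  define Mj where "Mj r = (\<Sum>i\<le>N. cmod (x i) * r ^ i)" for r
  have S0: "S \<ge> 0" by (rule order_trans[OF sum_nonneg S]) auto
  have I0: "I s \<ge> 0" for s unfolding I_def by (intro sum_nonneg) auto
  have Imono: "I s \<le> I s'" if "s \<le> s'" for s s'
    unfolding I_def using that by (intro sum_mono mult_left_mono power_mono) auto
  have potV: "potential \<kappa> p m Z s t \<le> V s" for s t
    unfolding potential_def V_def radial_potential_def by (intro sum_mono mult_left_mono atom_le[OF p \<kappa>]) auto
  have cpot: "continuous_on A (\<lambda>x. potential \<kappa> p m Z (f x) (g x))" if "continuous_on A f" "continuous_on A g" for A :: "'b::topological_space set" and f g
    unfolding potential_def by (intro continuous_intros continuous_on_atom[OF p \<kappa>] that)
  have step: "(c - b) * (2 * pi * I b * exp (- 2 * V c - 4 * c)) \<le> C" if bc: "1 \<le> b" "b \<le> c" for b c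
  proof -
    let ?g = "\<lambda>s. integral {0..2*pi} (\<lambda>t. (cmod (\<Sum>i\<le>N. x i * (of_real (exp s) * cis t) ^ i))\<^sup>2 * exp (- 2 * potential \<kappa> p m Z s t - 4 * s))"
    have cg: "continuous_on {b..c} ?g"
      unfolding cbox_interval[symmetric]
      by (rule integral_continuous_on_param, unfold split_beta, intro continuous_intros cpot)
    have "(c - b) * (2 * pi * I b * exp (- 2 * V c - 4 * c)) = integral {b..c} (\<lambda>s. 2 * pi * I b * exp (- 2 * V c - 4 * c))"
      using bc by simp
    also have "\<dots> \<le> integral {b..c} ?g"
    proof (rule integral_le)
      fix s assume s: "s \<in> {b..c}"
      have "2 * pi * I b * exp (- 2 * V c - 4 * c) \<le> 2 * pi * I s * exp (- 2 * V s - 4 * s)"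
        using Imono[of b s] I0 radial_potential_mono[of p s c m Z] s p
        by (intro mult_mono mult_left_mono) (auto simp: V_def)
      also have "\<dots> = integral {0..2*pi} (\<lambda>t. (cmod (\<Sum>i\<le>N. x i * (of_real (exp s) * cis t) ^ i))\<^sup>2) * exp (- 2 * V s - 4 * s)"
        using integral_unique[OF parseval_polynomial[where x = x and N = N and r = "exp s"]] by (simp add: I_def)
      also have "\<dots> = integral {0..2*pi} (\<lambda>t. (cmod (\<Sum>i\<le>N. x i * (of_real (exp s) * cis t) ^ i))\<^sup>2 * exp (- 2 * V s - 4 * s))"
        by simp
      also have "\<dots> \<le> ?g s"
        by (intro integral_le mult_left_mono integrable_continuous_real continuous_intros cpot) (use potV[of s] in auto)
      finally show "2 * pi * I b * exp (- 2 * V c - 4 * c) \<le> ?g s" .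
    qed (rule integrable_continuous_real[OF continuous_on_const] integrable_continuous_real[OF cg])+
    also have "\<dots> \<le> C" by (rule x[OF bc])
    finally show ?thesis .
  qed
  define D where "D = sqrt (4 * p\<^sup>2 * C * exp (4 * S + 4) / pi)"
  have D0: "D \<ge> 0" using C by (simp add: D_def)
  have main: "Mj (exp s) \<le> D * exp (V s) * exp ((p + 2) * s)" if s: "s \<ge> 1" for s
  proof -
    \<comment> \<open>Chosen so that \<open>p * (2 * d) * exp (p * s) = 1\<close>: the radial
      potential then rises by at most \<open>2 * S\<close> up to \<open>s + 2 * d\<close>. The first
      half of this interval pays for the geometric factors, the second half is used for
      averaging.\<close>
    define d where "d = exp (- p * s) / (2 * p)"
    have e: "exp (- p * s) \<le> 1" "exp (- p * s) * exp (p * s) = 1"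
      using s p by (auto simp: exp_add[symmetric])
    have pd: "p * (2 * d) = exp (- p * s)" using p by (simp add: d_def)
    have "1 * (2 * d) \<le> p * (2 * d)" using p by (intro mult_right_mono) (auto simp: d_def)
    hence d2: "2 * d \<le> 1" "p * (2 * d) \<le> 1" using pd e(1) by linarith+
    have d4: "p * (2 * d) * exp (p * s) = 1" unfolding pd by (rule e(2))
    have "d > 0" using p by (simp add: d_def)
    note d = this d2 d4
    have "V (s + 2 * d) \<le> V s + 2 * p * (2 * d) * exp (p * s) * S"
      unfolding V_def by (rule radial_potential_step[OF _ S Z(2)]) (use p d in auto)
    also have "2 * p * (2 * d) * exp (p * s) * S = 2 * S" using d(4) by (simp add: mult_ac)
    finally have V2: "V (s + 2 * d) \<le> V s + 2 * S" .
    define X where "X = 2 * (V s + 2 * S) + 4 * (s + 1)"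
    define Jd where "Jd = 2 * pi * I (s + d)"
    have Jd0: "Jd \<ge> 0" using I0 by (simp add: Jd_def)
    have "d * (Jd * exp (- 2 * V (s + 2 * d) - 4 * (s + 2 * d))) \<le> C"
      using step[of "s + d" "s + 2 * d"] s d(1) by (simp add: Jd_def)
    moreover have "d * (Jd * exp (- X)) \<le> d * (Jd * exp (- 2 * V (s + 2 * d) - 4 * (s + 2 * d)))"
    proof (intro mult_left_mono)
      have "- X \<le> - 2 * V (s + 2 * d) - 4 * (s + 2 * d)" using V2 d(2) unfolding X_def by argo
      thus "exp (- X) \<le> exp (- 2 * V (s + 2 * d) - 4 * (s + 2 * d))" by (simp only: exp_le_cancel_iff)
    qed (use Jd0 d(1) in auto)
    ultimately have "d * (Jd * exp (- X)) \<le> C" by (rule order_trans[rotated])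
    hence "d * (Jd * exp (- X)) * exp X \<le> C * exp X" by (rule mult_right_mono) auto
    moreover have "exp (- X) * exp X = 1" by (simp flip: exp_add)
    hence "d * (Jd * exp (- X)) * exp X = d * Jd" by (simp add: mult.assoc)
    ultimately have I1: "d * (2 * pi * I (s + d)) \<le> C * exp (2 * (V s + 2 * S) + 4 * (s + 1))"
      by (simp only: X_def Jd_def)
    have "Mj (exp s) = (\<Sum>i\<le>N. (cmod (x i) * exp (s + d) ^ i) * exp (- d) ^ i)"
      unfolding Mj_def
    proof (intro sum.cong refl)
      fix i
      have "exp (s + d) ^ i * exp (- d) ^ i = exp s ^ i" by (simp flip: power_mult_distrib exp_add)
      thus "cmod (x i) * exp s ^ i = (cmod (x i) * exp (s + d) ^ i) * exp (- d) ^ i" by (simp only: mult.assoc)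
    qed
    hence "(Mj (exp s))\<^sup>2 \<le> (\<Sum>i\<le>N. (cmod (x i) * exp (s + d) ^ i)\<^sup>2) * (\<Sum>i\<le>N. (exp (- d) ^ i)\<^sup>2)"
      using Cauchy_Schwarz_ineq_sum[of "\<lambda>i. cmod (x i) * exp (s + d) ^ i" "\<lambda>i. exp (- d) ^ i" "{..N}"] by simp
    also have "(\<Sum>i\<le>N. (cmod (x i) * exp (s + d) ^ i)\<^sup>2) = I (s + d)"
      unfolding I_def by (simp add: power_mult_distrib power_even_eq)
    also have "(\<Sum>i\<le>N. (exp (- d) ^ i)\<^sup>2) \<le> 2 / d"
    proof -
      define q where "q = exp (- 2 * d)"
      have q: "0 \<le> q" "q < 1" using d by (auto simp: q_def)
      have "(exp (- d) ^ i)\<^sup>2 = q ^ i" for i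
      proof -
        have "(exp (- d) ^ i)\<^sup>2 = ((exp (- d))\<^sup>2) ^ i" by (simp only: power_even_eq[symmetric] power_mult)
        thus ?thesis by (simp add: q_def exp_double[symmetric])
      qed
      hence "(\<Sum>i\<le>N. (exp (- d) ^ i)\<^sup>2) = (\<Sum>i\<le>N. q ^ i)" by simp
      also have "\<dots> = (1 - q ^ Suc N) / (1 - q)" using sum_gp0[of q N] q by simp
      also have "\<dots> \<le> 1 / (1 - q)" using q by (intro divide_right_mono) auto
      also have "\<dots> \<le> 1 / (d / 2)"
      proof (rule divide_left_mono)
        have "1 + 2 * d \<le> exp (2 * d)" by (rule exp_ge_add_one_self)
        hence "q \<le> 1 / (1 + 2 * d)" using d by (simp add: q_def exp_minus field_simps)
        also have "\<dots> \<le> 1 - d / 2"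
        proof -
          have "d * d \<le> d * (1/2)" using d by (intro mult_left_mono) auto
          hence "1 \<le> (1 - d / 2) * (1 + 2 * d)" using d(1) by (simp add: algebra_simps)
          thus ?thesis using d(1) by (simp add: pos_divide_le_eq)
        qed
        finally show "d / 2 \<le> 1 - q" by simp
      qed (use q d in auto)
      finally show ?thesis by simp
    qed
    hence "I (s + d) * (\<Sum>i\<le>N. (exp (- d) ^ i)\<^sup>2) \<le> I (s + d) * (2 / d)" by (intro mult_left_mono I0)
    also have "\<dots> = d * (2 * pi * I (s + d)) * (1 / (pi * d\<^sup>2))" using d by (simp add: field_simps power2_eq_square)
    also have "\<dots> \<le> C * exp (2 * (V s + 2 * S) + 4 * (s + 1)) * (1 / (pi * d\<^sup>2))"
      using I1 by (intro mult_right_mono) auto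
    also have "1 / (pi * d\<^sup>2) = 4 * p\<^sup>2 / pi * (exp (p * s))\<^sup>2"
      by (simp add: d_def power_divide exp_minus power_inverse field_simps)
    also have "C * exp (2 * (V s + 2 * S) + 4 * (s + 1)) * (4 * p\<^sup>2 / pi * (exp (p * s))\<^sup>2)
        = (4 * p\<^sup>2 * C * exp (4 * S + 4) / pi) * (exp (V s) * exp ((p + 2) * s))\<^sup>2"
    proof -
      have "exp (2 * (V s + 2 * S) + 4 * (s + 1)) * (exp (p * s))\<^sup>2 = exp (4 * S + 4) * (exp (V s) * exp ((p + 2) * s))\<^sup>2"
        unfolding power_mult_distrib exp_double[symmetric] exp_add[symmetric]
        by (rule arg_cong[where f = exp]) (simp add: algebra_simps)
      thus ?thesis by (simp add: mult_ac)
    qed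
    also have "\<dots> = (D * exp (V s) * exp ((p + 2) * s))\<^sup>2"
      using C by (simp add: D_def power_mult_distrib)
    finally have "(Mj (exp s))\<^sup>2 \<le> (D * exp (V s) * exp ((p + 2) * s))\<^sup>2" .
    thus ?thesis by (rule power2_le_imp_le) (use D0 in auto)
  qed
  have MjF: "cmod (\<Sum>i\<le>N. x i * z ^ i) \<le> Mj (cmod z)"
    unfolding Mj_def by (rule sum_norm_le) (simp add: norm_mult norm_power)
  have E1: "1 \<le> exp (S * exp p + p + 2)" using S0 p by (simp add: add_nonneg_nonneg)
  have P1: "1 \<le> (\<Prod>a\<in>Z. (1 + (cmod z / cmod a) powr p) ^ m a)" by (intro prod_ge_1 one_le_power) auto
  show ?thesis
  proof (cases "cmod z \<ge> exp 1")
    case True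
    define s where "s = ln (cmod z)"
    have z0: "cmod z > 0" using True exp_gt_zero[of 1] by linarith
    have s: "s \<ge> 1" "exp s = cmod z" using True z0 by (auto simp: s_def ln_ge_iff)
    have "cmod (\<Sum>i\<le>N. x i * z ^ i) \<le> D * exp (V s) * exp ((p + 2) * s)"
      using MjF main[OF s(1)] s(2) by simp
    also have "exp (V s) = (\<Prod>a\<in>Z. (1 + (cmod z / cmod a) powr p) ^ m a)"
      unfolding V_def s_def by (rule exp_radial_potential) (use Z z0 in auto)
    also have "exp ((p + 2) * s) = cmod z powr (p + 2)" using z0 by (simp add: powr_def s_def)
    also have "\<dots> \<le> (1 + cmod z) powr (p + 2)" using p by (intro powr_mono2) auto
    finally have "cmod (\<Sum>i\<le>N. x i * z ^ i) \<le> D * (\<Prod>a\<in>Z. (1 + (cmod z / cmod a) powr p) ^ m a) * (1 + cmod z) powr (p + 2)"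
      using D0 P1 by (simp add: mult_left_mono)
    also have "\<dots> \<le> D * (\<Prod>a\<in>Z. (1 + (cmod z / cmod a) powr p) ^ m a) * (1 + cmod z) powr (p + 2) * exp (S * exp p + p + 2)"
      using mult_left_mono[OF E1, of "D * (\<Prod>a\<in>Z. (1 + (cmod z / cmod a) powr p) ^ m a) * (1 + cmod z) powr (p + 2)"] D0 P1 by simp
    finally show ?thesis unfolding D_def by (simp add: mult_ac)
  next
    case False
    \<comment> \<open>The mean square estimate starts only at \<open>s = 1\<close>. Inside the disc
      of radius \<open>exp 1\<close> the monotone majorant \<open>Mj\<close> is taken at the
      boundary, where \<open>V 1 \<le> exp p * S\<close>.\<close>
    have "Mj (cmod z) \<le> Mj (exp 1)"
      unfolding Mj_def using False by (intro sum_mono mult_left_mono power_mono) auto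
    also have "\<dots> \<le> D * exp (V 1) * exp ((p + 2) * 1)" by (rule main) simp
    also have "\<dots> \<le> D * exp (S * exp p + p + 2)"
    proof -
      have "V 1 \<le> (\<Sum>a\<in>Z. real (m a) * (exp p * cmod a powr (- p)))"
        unfolding V_def radial_potential_def
      proof (intro sum_mono mult_left_mono)
        fix a assume a: "a \<in> Z"
        have "exp (p * (1 - ln (cmod a))) = exp p * cmod a powr (- p)"
          using Z(2)[OF a] by (simp add: powr_def exp_add[symmetric] algebra_simps)
        thus "ln (1 + exp (p * (1 - ln (cmod a)))) \<le> exp p * cmod a powr (- p)"
          using ln_add_one_self_le_self[of "exp (p * (1 - ln (cmod a)))"] by simp
      qed auto
      also have "\<dots> = exp p * (\<Sum>a\<in>Z. real (m a) * cmod a powr (- p))" by (simp add: sum_distrib_left mult_ac)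
      also have "\<dots> \<le> exp p * S" using S by (intro mult_left_mono) auto
      finally have "exp (V 1) * exp ((p + 2) * 1) \<le> exp (S * exp p + p + 2)"
        by (simp add: exp_add[symmetric] mult.commute)
      from mult_left_mono[OF this D0] show ?thesis by (simp add: mult.assoc)
    qed
    also have "D * exp (S * exp p + p + 2) \<le> D * exp (S * exp p + p + 2) * ((1 + cmod z) powr (p + 2) * (\<Prod>a\<in>Z. (1 + (cmod z / cmod a) powr p) ^ m a))"
    proof -
      have "1 \<le> (1 + cmod z) powr (p + 2)" using p by (intro ge_one_powr_ge_zero) auto
      hence "1 * 1 \<le> (1 + cmod z) powr (p + 2) * (\<Prod>a\<in>Z. (1 + (cmod z / cmod a) powr p) ^ m a)"
        using P1 by (intro mult_mono) auto
      from mult_left_mono[OF this, of "D * exp (S * exp p + p + 2)"] D0 show ?thesis by simp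
    qed
    finally show ?thesis using MjF unfolding D_def by (simp add: mult.assoc)
  qed
qed

section \<open>Jensen's inequality for circle means\<close>

lemma entire_factor_out:
  assumes f: "f holomorphic_on UNIV" and f0: "f 0 \<noteq> 0" and Z: "finite Z" "0 \<notin> Z"
  obtains g where "g holomorphic_on UNIV" "\<And>z. f z = (\<Prod>a\<in>Z. (1 - z / a) ^ nat (zorder f a)) * g z"
    "\<And>a. a \<in> Z \<Longrightarrow> g a \<noteq> 0" "g 0 = f 0"
proof -
  have "\<exists>g. g holomorphic_on UNIV \<and> (\<forall>z. f z = (\<Prod>a\<in>Z. (1 - z / a) ^ nat (zorder f a)) * g z) \<and> (\<forall>a\<in>Z. g a \<noteq> 0)"
    using Z
  proof (induction Z rule: finite_induct)
    case empty
    show ?case using f by auto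
  next
    case (insert b Z)
    then obtain g where g: "g holomorphic_on UNIV" "\<And>z. f z = (\<Prod>a\<in>Z. (1 - z / a) ^ nat (zorder f a)) * g z" "\<And>a. a \<in> Z \<Longrightarrow> g a \<noteq> 0"
      by auto
    have b0: "b \<noteq> 0" using insert by auto
    have "g 0 \<noteq> 0" using f0 g(2)[of 0] by auto
    hence "\<exists>w\<in>UNIV. g w \<noteq> 0" by auto
    from zorder_exist_zero[OF g(1) open_UNIV connected_UNIV UNIV_I this, of b]
    have zg: "(if g b = 0 then 0 < zorder g b else zorder g b = 0)" and "\<exists>r>0. cball b r \<subseteq> UNIV \<and> zor_poly g b holomorphic_on cball b r \<and>
       (\<forall>w\<in>cball b r. g w = zor_poly g b w * (w - b) ^ nat (zorder g b) \<and> zor_poly g b w \<noteq> 0)" by blast+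
    then obtain r where r0: "r > 0" "zor_poly g b holomorphic_on cball b r"
      "\<forall>w\<in>cball b r. g w = zor_poly g b w * (w - b) ^ nat (zorder g b) \<and> zor_poly g b w \<noteq> 0" by blast
    have r: "r > 0" "zor_poly g b holomorphic_on cball b r"
      "\<And>w. w \<in> cball b r \<Longrightarrow> g w = zor_poly g b w * (w - b) ^ nat (zorder g b)" "\<And>w. w \<in> cball b r \<Longrightarrow> zor_poly g b w \<noteq> 0"
      "zorder g b \<ge> 0" using r0 zg by (auto split: if_splits)
    define n where "n = nat (zorder g b)"
    define P where "P z = (\<Prod>a\<in>Z. (1 - z / a) ^ nat (zorder f a))" for z
    have Pb: "P b \<noteq> 0" using insert by (auto simp: P_def field_simps)
    have Ph: "P holomorphic_on A" for A unfolding P_def using insert by (intro holomorphic_intros) auto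
    have "zorder f b = int n"
    proof (rule zorder_eqI[of "ball b r" b "\<lambda>z. P z * zor_poly g b z"])
      show "(\<lambda>z. P z * zor_poly g b z) holomorphic_on ball b r"
        by (intro holomorphic_on_mult Ph holomorphic_on_subset[OF r(2)]) auto
      show "f w = P w * zor_poly g b w * (w - b) powi int n" if "w \<in> ball b r" for w
        using g(2)[of w] r(3)[of w] that unfolding power_int_of_nat by (simp add: P_def n_def[symmetric])
    qed (use r Pb in auto)
    hence n: "nat (zorder f b) = n" by simp
    \<comment> \<open>The factor \<open>(- b) ^ n\<close> at the removed point comes from
      \<open>z - b = (1 - z / b) * (- b)\<close>.\<close>
    define h where "h z = (if z = b then zor_poly g b b * (- b) ^ n else g z / (1 - z / b) ^ n)" for z
    have hh: "h z = zor_poly g b z * (- b) ^ n" if "z \<in> ball b r" for z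
    proof (cases "z = b")
      case False
      have "(1 - z / b) * (- b) = z - b" using b0 by (simp add: field_simps)
      hence "(1 - z / b) ^ n * (- b) ^ n = (z - b) ^ n" by (metis power_mult_distrib)
      thus ?thesis using False r(3)[of z] that b0 by (simp add: h_def n_def field_simps)
    qed (simp add: h_def)
    have "h holomorphic_on ball b r \<union> (- {b})"
    proof (rule holomorphic_on_Un)
      have "(\<lambda>z. zor_poly g b z * (- b) ^ n) holomorphic_on ball b r"
        by (intro holomorphic_intros holomorphic_on_subset[OF r(2)]) auto
      thus "h holomorphic_on ball b r" by (rule holomorphic_transform) (use hh in auto)
      have "(\<lambda>z. g z / (1 - z / b) ^ n) holomorphic_on - {b}"
        by (intro holomorphic_intros holomorphic_on_subset[OF g(1)]) (use b0 in \<open>auto simp: field_simps\<close>)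
      thus "h holomorphic_on - {b}" by (rule holomorphic_transform) (auto simp: h_def)
    qed auto
    moreover have "ball b r \<union> (- {b}) = UNIV" using r(1) by auto
    ultimately have hol: "h holomorphic_on UNIV" by simp
    have gh: "g z = (1 - z / b) ^ n * h z" for z
    proof (cases "z = b")
      case True
      show ?thesis
      proof (cases "n = 0")
        case False
        thus ?thesis using True r(3)[of b] r(1) b0 by (simp add: n_def)
      qed (use True r(1) r(3)[of b] in \<open>simp add: n_def h_def\<close>)
    next
      case False
      hence "1 - z / b \<noteq> 0" using b0 by (auto simp: field_simps)
      thus ?thesis using False by (simp add: h_def)
    qed
    show ?case
    proof (intro exI[of _ h] conjI allI ballI hol)
      show "f z = (\<Prod>a\<in>insert b Z. (1 - z / a) ^ nat (zorder f a)) * h z" for z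
        using insert gh[of z] g(2)[of z] n by (simp add: mult_ac)
      fix a assume "a \<in> insert b Z"
      then consider "a = b" | "a \<in> Z" by auto
      thus "h a \<noteq> 0"
      proof cases
        case 1
        have "zor_poly g b b \<noteq> 0" using r(1) r(4)[of b] by simp
        thus ?thesis using 1 b0 by (simp add: h_def)
      next
        case 2
        hence "(1 - a / b) ^ n * h a \<noteq> 0" using g(3)[of a] unfolding gh[of a] by blast
        thus ?thesis by (rule contrapos_nn) simp
      qed
    qed
  qed
  then obtain g where g: "g holomorphic_on UNIV" "\<And>z. f z = (\<Prod>a\<in>Z. (1 - z / a) ^ nat (zorder f a)) * g z" "\<And>a. a \<in> Z \<Longrightarrow> g a \<noteq> 0" by auto
  have "g 0 = f 0" using g(2)[of 0] by simp
  thus ?thesis using that g by blast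
qed

lemma finite_zeros_cball:
  assumes f: "f holomorphic_on UNIV" and f0: "f 0 \<noteq> (0::complex)"
  shows "finite {z \<in> cball 0 R. f z = 0}"
proof (cases "f constant_on UNIV")
  case True
  hence "{z \<in> cball 0 R. f z = 0} = {}" using f0 by (auto simp: constant_on_def)
  thus ?thesis by (simp only: finite.emptyI)
qed (use holomorphic_compact_finite_zeros[of f UNIV "cball 0 R"] f in auto)

abbreviation circ :: "real \<Rightarrow> real \<Rightarrow> complex" where "circ r t \<equiv> of_real r * exp (\<i> * of_real t)"

abbreviation log_circle_integrable :: "real \<Rightarrow> (complex \<Rightarrow> complex) \<Rightarrow> bool" where
  "log_circle_integrable r f \<equiv> set_integrable lborel {0..2*pi} (\<lambda>t. ln (cmod (f (circ r t))))"

lemma has_integral_mean_value: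
  assumes "L holomorphic_on cball 0 r" "r > 0"
  shows "((\<lambda>t. L (circ r t)) has_integral (2 * of_real pi * L 0)) {0..2*pi}"
proof -
  have "((\<lambda>u. L u / (u - 0)) has_contour_integral (2 * of_real pi * \<i> * L 0)) (circlepath 0 r)"
    by (rule Cauchy_integral_circlepath_simple) (use assms in auto)
  hence "((\<lambda>t. L (0 + of_real r * cis t) / (0 + of_real r * cis t - 0) * of_real r * \<i> * cis t) has_integral (2 * of_real pi * \<i> * L 0)) {0..2*pi}"
    unfolding circlepath_def by (subst (asm) has_contour_integral_part_circlepath_iff) auto
  hence "((\<lambda>t. \<i> * L (circ r t)) has_integral (2 * of_real pi * \<i> * L 0)) {0..2*pi}"
    by (rule has_integral_eq[rotated]) (use assms(2) in \<open>auto simp: cis_conv_exp\<close>)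
  from has_integral_mult_right[OF this, of "- \<i>"] show ?thesis by (simp add: mult_ac)
qed

lemma continuous_log_circle:
  assumes "continuous_on (sphere 0 r) f" "r \<ge> 0" "\<And>z. z \<in> sphere 0 r \<Longrightarrow> f z \<noteq> 0"
  shows "continuous_on {0..2*pi} (\<lambda>t. ln (cmod (f (circ r t))))" "log_circle_integrable r f"
proof -
  have "continuous_on {0..2*pi} (\<lambda>t. f (circ r t))"
    by (rule continuous_on_compose2[OF assms(1)]) (use assms(2) in \<open>auto intro!: continuous_intros simp: norm_mult\<close>)
  thus "continuous_on {0..2*pi} (\<lambda>t. ln (cmod (f (circ r t))))"
    by (intro continuous_intros) (use assms in \<open>auto simp: norm_mult\<close>)
  thus "log_circle_integrable r f" by (rule borel_integrable_atLeastAtMost')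
qed

text \<open>On the disc \<open>f\<close> has a holomorphic logarithm, and the real part of the
  latter has the mean value property.\<close>

lemma circle_mean_zero_free:
  assumes f: "f holomorphic_on UNIV" and r: "r > 0" and nz: "\<And>z. z \<in> cball 0 r \<Longrightarrow> f z \<noteq> 0"
  shows "log_circle_integrable r f" "circle_mean r f = ln (cmod (f 0))"
proof -
  have cf: "continuous_on A f" for A using f holomorphic_on_imp_continuous_on continuous_on_subset by blast
  have c: "continuous_on {0..2*pi} (\<lambda>t. ln (cmod (f (circ r t))))" "log_circle_integrable r f"
    by (rule continuous_log_circle; use cf r nz in auto)+
  show "log_circle_integrable r f" by fact
  obtain L where L: "L holomorphic_on cball 0 r" "\<And>z. z \<in> cball 0 r \<Longrightarrow> f z = exp (L z)"
    using contractible_imp_holomorphic_log[of f "cball 0 r"] nz holomorphic_on_subset[OF f] convex_imp_contractible[of "cball 0 r"]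
    by (metis convex_cball subset_UNIV)
  have ln: "ln (cmod (f z)) = Re (L z)" if "z \<in> cball 0 r" for z using L(2)[OF that] by simp
  have "((\<lambda>t. Re (L (circ r t))) has_integral Re (2 * of_real pi * L 0)) {0..2*pi}"
    using has_integral_linear[OF has_integral_mean_value[OF L(1) r] bounded_linear_Re] by (simp add: o_def)
  hence "((\<lambda>t. ln (cmod (f (circ r t)))) has_integral 2 * pi * ln (cmod (f 0))) {0..2*pi}"
    by (rule has_integral_eq_rhs[OF has_integral_eq[rotated]]) (use ln r in \<open>auto simp: norm_mult\<close>)
  hence "(LBINT t:{0..2*pi}. ln (cmod (f (circ r t)))) = 2 * pi * ln (cmod (f 0))"
    using set_borel_integral_eq_integral(2)[OF c(2)] by (simp add: integral_unique)
  thus "circle_mean r f = ln (cmod (f 0))" using r by (simp add: circle_mean_def)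
qed

lemma AE_circle_neq:
  assumes r: "r > 0"
  shows "AE t in lborel. circ r t \<noteq> a"
proof -
  have "countable {t. circ r t = a}"
  proof (cases "\<exists>t0. circ r t0 = a")
    case True
    then obtain t0 where t0: "circ r t0 = a" by auto
    have "{t. circ r t = a} \<subseteq> range (\<lambda>n::int. t0 + 2 * pi * n)"
    proof
      fix t assume "t \<in> {t. circ r t = a}"
      hence "circ r t = circ r t0" using t0 by simp
      hence "exp (\<i> * of_real t) = exp (\<i> * of_real t0)" using r by simp
      then obtain n :: int where "\<i> * of_real t = \<i> * of_real t0 + (of_int (2 * n) * pi) * \<i>" by (auto simp: exp_eq)
      hence "\<i> * complex_of_real t = \<i> * of_real (t0 + 2 * pi * n)" by (simp add: algebra_simps)
      hence "t = t0 + 2 * pi * n" by (metis complex_i_not_zero mult_left_cancel of_real_eq_iff)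
      thus "t \<in> range (\<lambda>n::int. t0 + 2 * pi * n)" by auto
    qed
    thus ?thesis by (rule countable_subset) auto
  qed (auto simp: )
  hence "{t. circ r t = a} \<in> null_sets lborel" by (rule countable_imp_null_set_lborel)
  from AE_not_in[OF this] show ?thesis by simp
qed

text \<open>When the zero lies on the circle, Fatou's lemma along the radius gives integrability
  and the inequality (equality holds as well, but would need a separate argument).\<close>

lemma circle_mean_linear_factor:
  assumes a: "a \<noteq> 0" and r: "r > 0"
  shows "log_circle_integrable r (\<lambda>z. 1 - z / a)" "circle_mean r (\<lambda>z. 1 - z / a) \<ge> max 0 (ln (r / cmod a))"
proof -
  have hol: "(\<lambda>z. 1 - z / b) holomorphic_on UNIV" if "b \<noteq> 0" for b :: complex
    using that by (intro holomorphic_intros) auto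
  have nz: "1 - z / b \<noteq> 0" if "b \<noteq> 0" "z \<in> cball 0 s" "s < cmod b" for b z :: complex and s
    using that by (auto simp: field_simps)
  have out: "log_circle_integrable s (\<lambda>z. 1 - z / b)" "circle_mean s (\<lambda>z. 1 - z / b) = 0" if "s > 0" "s < cmod b" for b s
    using circle_mean_zero_free[of "\<lambda>z. 1 - z / b" s] hol[of b] nz[of b _ s] that by force+
  consider "r < cmod a" | "r > cmod a" | "r = cmod a" by linarith
  hence "log_circle_integrable r (\<lambda>z. 1 - z / a) \<and> circle_mean r (\<lambda>z. 1 - z / a) \<ge> max 0 (ln (r / cmod a))"
  proof cases
    case 1
    moreover have "ln (r / cmod a) \<le> 0" using 1 r a by (simp add: field_simps)
    ultimately show ?thesis using out[OF r 1] by simp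
  next
    case 2
    \<comment> \<open>\<open>b\<close> is the reflection of \<open>a\<close> in the circle. On the
      circle \<open>\<bar>1 - z / a\<bar> = (r / \<bar>a\<bar>) * \<bar>1 - z / b\<bar>\<close>, and
      the second factor has no zero in the closed disc.\<close>
    define b where "b = of_real (r\<^sup>2) / cnj a"
    have "cmod b = r\<^sup>2 / cmod a" by (simp add: b_def norm_divide norm_power)
    moreover have "r * cmod a < r\<^sup>2" using 2 r by (simp add: power2_eq_square)
    ultimately have b: "r < cmod b" using a by (simp add: pos_less_divide_eq)
    have eq: "cmod (1 - circ r t / a) = r / cmod a * cmod (1 - circ r t / b)" for t
    proof -
      have ee: "exp (\<i> * of_real t) * cnj (exp (\<i> * of_real t)) = 1"
        by (simp add: exp_cnj exp_add[symmetric])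
      have "cmod (1 - circ r t / b) = cmod (cnj (1 - circ r t / b))" by (rule complex_mod_cnj[symmetric])
      also have "cnj (1 - circ r t / b) = 1 - a * cnj (exp (\<i> * of_real t)) / r"
        using r by (simp add: b_def power2_eq_square mult_ac)
      also have "cmod \<dots> = cmod (- (circ r t / a) * (1 - a * cnj (exp (\<i> * of_real t)) / r)) / (r / cmod a)"
        using r a by (simp add: norm_mult norm_divide)
      also have "- (circ r t / a) * (1 - a * cnj (exp (\<i> * of_real t)) / r) = 1 - circ r t / a"
      proof -
        have "- (circ r t / a) * (1 - a * cnj (exp (\<i> * of_real t)) / r) = - (circ r t / a) + exp (\<i> * of_real t) * cnj (exp (\<i> * of_real t))"
          using r a by (simp add: field_simps)
        thus ?thesis unfolding ee by simp
      qed
      finally show ?thesis using r a by (simp add: field_simps)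
    qed
    have nzb: "1 - circ r t / b \<noteq> 0" for t using nz[of b "circ r t" r] b r by (auto simp: norm_mult)
    have ln: "ln (cmod (1 - circ r t / a)) = ln (r / cmod a) + ln (cmod (1 - circ r t / b))" for t
      unfolding eq using r a nzb by (subst ln_mult) auto
    have i: "log_circle_integrable r (\<lambda>z. 1 - z / b)" "circle_mean r (\<lambda>z. 1 - z / b) = 0" using out[OF r b] by auto
    have c: "set_integrable lborel {0..2*pi} (\<lambda>t. ln (r / cmod a))" by (intro borel_integrable_atLeastAtMost' continuous_intros)
    have "log_circle_integrable r (\<lambda>z. 1 - z / a)" unfolding ln by (rule set_integral_add(1)[OF c i(1)])
    moreover have "circle_mean r (\<lambda>z. 1 - z / a) = ln (r / cmod a)"
    proof -
      have "(LBINT t:{0..2*pi}. ln (cmod (1 - circ r t / a))) = (LBINT t:{0..2*pi}. ln (r / cmod a)) + (LBINT t:{0..2*pi}. ln (cmod (1 - circ r t / b)))"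
        unfolding ln by (rule set_integral_add(2)[OF c i(1)])
      also have "(LBINT t:{0..2*pi}. ln (cmod (1 - circ r t / b))) = 0" using i(2) r by (simp add: circle_mean_def)
      also have "(LBINT t:{0..2*pi}. ln (r / cmod a)) = 2 * pi * ln (r / cmod a)"
        by (subst set_borel_integral_eq_integral(2)[OF c]) simp
      finally show ?thesis using r by (simp add: circle_mean_def)
    qed
    moreover have "ln (r / cmod a) \<ge> 0" using 2 r a by (simp add: field_simps)
    ultimately show ?thesis by simp
  next
    case 3
    define \<rho> where "\<rho> n = r * (1 - 1 / real (n + 2))" for n :: nat
    have \<rho>: "\<rho> n > 0" "\<rho> n < cmod a" for n
    proof -
      have "0 < 1 - 1 / real (n + 2)" "1 - 1 / real (n + 2) < 1" by auto
      thus "\<rho> n > 0" "\<rho> n < cmod a" using r mult_strict_left_mono[of "1 - 1 / real (n + 2)" 1 r] 3 by (auto simp: \<rho>_def)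
    qed
    have lim: "\<rho> \<longlonglongrightarrow> r"
    proof -
      have "(\<lambda>n. r * (1 - 1 / real (n + 2))) \<longlonglongrightarrow> r" by real_asymp
      thus ?thesis unfolding \<rho>_def .
    qed
    \<comment> \<open>On the disc \<open>\<bar>1 - z / a\<bar> \<le> 2\<close>, so subtracting its
      logarithm from \<open>ln 3\<close> gives nonnegative functions. Those on the inner circles all
      have integral \<open>2 * pi * ln 3\<close>, since the mean of the logarithm is
      \<open>0\<close> there.\<close>
    define u where "u n t = ln 3 - ln (cmod (1 - circ (\<rho> n) t / a))" for n t
    define w where "w t = ln 3 - ln (cmod (1 - circ r t / a))" for t
    have bd: "cmod (1 - circ s t / a) \<le> 2" if "0 \<le> s" "s \<le> r" for s t
    proof -
      have "cmod (1 - circ s t / a) \<le> 1 + cmod (circ s t / a)" using norm_triangle_ineq4[of 1 "circ s t / a"] by simp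
      also have "\<dots> \<le> 2" using that 3 a by (simp add: norm_mult norm_divide)
      finally show ?thesis .
    qed
    have u0: "u n t \<ge> 0" for n t
      using bd[of "\<rho> n" t] \<rho>[of n] 3 nz[of a "circ (\<rho> n) t" "\<rho> n"] a
      by (auto simp: u_def norm_mult)
    have w0: "w t \<ge> 0" for t
    proof (cases "1 - circ r t / a = 0")
      case False
      thus ?thesis using bd[of r t] r by (auto simp: w_def)
    qed (simp add: w_def)
    have cu: "continuous_on {0..2*pi} (u n)" for n
      unfolding u_def
      by (intro continuous_intros continuous_log_circle(1)) (use nz[of a _ "\<rho> n"] a \<rho>[of n] in \<open>auto intro!: continuous_intros\<close>)
    have iu: "set_integrable lborel {0..2*pi} (u n)" "(LBINT t:{0..2*pi}. u n t) = 2 * pi * ln 3" for n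
    proof -
      show i: "set_integrable lborel {0..2*pi} (u n)" by (rule borel_integrable_atLeastAtMost'[OF cu])
      have c: "set_integrable lborel {0..2*pi} (\<lambda>t. ln 3 :: real)" by (intro borel_integrable_atLeastAtMost' continuous_intros)
      have "(LBINT t:{0..2*pi}. u n t) = (LBINT t:{0..2*pi}. ln 3) - (LBINT t:{0..2*pi}. ln (cmod (1 - circ (\<rho> n) t / a)))"
        unfolding u_def by (rule set_integral_diff(2)[OF c out(1)[OF \<rho>]])
      also have "(LBINT t:{0..2*pi}. ln (cmod (1 - circ (\<rho> n) t / a))) = 0" using out(2)[OF \<rho>, of n] \<rho>(1)[of n] by (simp add: circle_mean_def)
      also have "(LBINT t:{0..2*pi}. ln 3 :: real) = 2 * pi * ln 3" by (subst set_borel_integral_eq_integral(2)[OF c]) simp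
      finally show "(LBINT t:{0..2*pi}. u n t) = 2 * pi * ln 3" by simp
    qed
    have mw: "(\<lambda>t. indicator {0..2*pi} t *\<^sub>R w t) \<in> borel_measurable lborel" unfolding w_def by measurable
    have null: "AE t in lborel. circ r t \<noteq> a" by (rule AE_circle_neq[OF r])
    have "(\<integral>\<^sup>+t. ennreal (indicator {0..2*pi} t *\<^sub>R w t) \<partial>lborel) \<le> (\<integral>\<^sup>+t. liminf (\<lambda>n. ennreal (indicator {0..2*pi} t *\<^sub>R u n t)) \<partial>lborel)"
    proof (rule nn_integral_mono_AE)
      show "AE t in lborel. ennreal (indicator {0..2*pi} t *\<^sub>R w t) \<le> liminf (\<lambda>n. ennreal (indicator {0..2*pi} t *\<^sub>R u n t))"
        using null
      proof eventually_elim
        case (elim t)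
        have "cmod (1 - circ r t / a) \<noteq> 0" using elim a by auto
        hence "(\<lambda>n. u n t) \<longlonglongrightarrow> w t" unfolding u_def w_def by (intro tendsto_intros lim a)
        hence "(\<lambda>n. ennreal (indicator {0..2*pi} t *\<^sub>R u n t)) \<longlonglongrightarrow> ennreal (indicator {0..2*pi} t *\<^sub>R w t)"
          by (intro tendsto_ennrealI tendsto_intros)
        thus ?case by (simp add: lim_imp_Liminf)
      qed
    qed
    also have "\<dots> \<le> liminf (\<lambda>n. \<integral>\<^sup>+t. ennreal (indicator {0..2*pi} t *\<^sub>R u n t) \<partial>lborel)"
      by (rule nn_integral_liminf) (unfold u_def, measurable)
    also have "(\<lambda>n. \<integral>\<^sup>+t. ennreal (indicator {0..2*pi} t *\<^sub>R u n t) \<partial>lborel) = (\<lambda>n. ennreal (2 * pi * ln 3))"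
    proof
      fix n
      have "(\<integral>\<^sup>+t. ennreal (indicator {0..2*pi} t *\<^sub>R u n t) \<partial>lborel) = ennreal (LBINT t. indicator {0..2*pi} t *\<^sub>R u n t)"
        using iu(1)[of n] u0 unfolding set_integrable_def by (intro nn_integral_eq_integral) auto
      thus "(\<integral>\<^sup>+t. ennreal (indicator {0..2*pi} t *\<^sub>R u n t) \<partial>lborel) = ennreal (2 * pi * ln 3)"
        using iu(2)[of n] by (simp add: set_lebesgue_integral_def)
    qed
    finally have fin: "(\<integral>\<^sup>+t. ennreal (indicator {0..2*pi} t *\<^sub>R w t) \<partial>lborel) \<le> ennreal (2 * pi * ln 3)" by (simp add: Liminf_const)
    have iw: "set_integrable lborel {0..2*pi} w" unfolding set_integrable_def
      using fin w0 by (intro integrableI_nonneg mw) (auto simp: top_unique intro: le_less_trans)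
    have "ennreal (LBINT t:{0..2*pi}. w t) \<le> ennreal (2 * pi * ln 3)"
      using fin nn_integral_eq_integral[OF iw[unfolded set_integrable_def]] w0 by (auto simp: set_lebesgue_integral_def)
    hence wle: "(LBINT t:{0..2*pi}. w t) \<le> 2 * pi * ln 3" by (subst (asm) ennreal_le_iff) auto
    have c: "set_integrable lborel {0..2*pi} (\<lambda>t. ln 3 :: real)" by (intro borel_integrable_atLeastAtMost' continuous_intros)
    have eq: "ln (cmod (1 - circ r t / a)) = ln 3 - w t" for t by (simp add: w_def)
    have "log_circle_integrable r (\<lambda>z. 1 - z / a)" unfolding eq by (rule set_integral_diff(1)[OF c iw])
    moreover have "(LBINT t:{0..2*pi}. ln (cmod (1 - circ r t / a))) \<ge> 0"
      unfolding eq set_integral_diff(2)[OF c iw] using wle by (subst set_borel_integral_eq_integral(2)[OF c]) simp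
    hence "circle_mean r (\<lambda>z. 1 - z / a) \<ge> 0" using r by (simp add: circle_mean_def)
    moreover have "ln (r / cmod a) = 0" using 3 a by simp
    ultimately show ?thesis by simp
  qed
  thus "log_circle_integrable r (\<lambda>z. 1 - z / a)" "circle_mean r (\<lambda>z. 1 - z / a) \<ge> max 0 (ln (r / cmod a))" by auto
qed

lemma AE_circle_nonzero:
  assumes f: "f holomorphic_on UNIV" and f0: "f 0 \<noteq> 0" and r: "r > 0"
  shows "AE t in lborel. f (circ r t) \<noteq> 0"
proof -
  let ?Z = "{z \<in> cball 0 r. f z = 0}"
  have fin: "finite ?Z" by (rule finite_zeros_cball[OF f f0])
  have "AE t in lborel. \<forall>a\<in>?Z. circ r t \<noteq> a"
    using fin AE_circle_neq[OF r] by (intro AE_finite_allI) auto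
  thus ?thesis
  proof eventually_elim
    case (elim t)
    have "circ r t \<in> cball 0 r" using r by (simp add: norm_mult)
    thus ?case using elim by blast
  qed
qed

text \<open>The convention \<open>ln 0 = 0\<close> breaks additivity at the zeros of
  \<open>f\<close> and \<open>g\<close>, but these occupy a null set of angles.\<close>

lemma circle_mean_mult:
  assumes f: "f holomorphic_on UNIV" "f 0 \<noteq> 0" and g: "g holomorphic_on UNIV" "g 0 \<noteq> 0" and r: "r > 0"
    and i: "log_circle_integrable r f" "log_circle_integrable r g"
  shows "log_circle_integrable r (\<lambda>z. f z * g z)" "circle_mean r (\<lambda>z. f z * g z) = circle_mean r f + circle_mean r g"
proof -
  have cc: "continuous_on UNIV f" "continuous_on UNIV g" using f g by (auto intro: holomorphic_on_imp_continuous_on)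
  have mf[measurable]: "f \<in> borel_measurable borel" "g \<in> borel_measurable borel"
    using cc by (auto intro: borel_measurable_continuous_onI)
  have ae: "AE t in lborel. ln (cmod (f (circ r t) * g (circ r t))) = ln (cmod (f (circ r t))) + ln (cmod (g (circ r t)))"
    using AE_circle_nonzero[OF f r] AE_circle_nonzero[OF g r]
    by eventually_elim (simp add: norm_mult ln_mult)
  have s: "set_integrable lborel {0..2*pi} (\<lambda>t. ln (cmod (f (circ r t))) + ln (cmod (g (circ r t))))"
    by (rule set_integral_add(1)[OF i])
  show fg: "log_circle_integrable r (\<lambda>z. f z * g z)"
    unfolding set_integrable_def
    by (rule integrable_cong_AE_imp[OF s[unfolded set_integrable_def]])
       (measurable, use ae in eventually_elim, simp)
  have "(LBINT t:{0..2*pi}. ln (cmod (f (circ r t) * g (circ r t)))) = (LBINT t:{0..2*pi}. ln (cmod (f (circ r t))) + ln (cmod (g (circ r t))))"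
    unfolding set_lebesgue_integral_def by (rule integral_cong_AE) (measurable, use ae in eventually_elim, simp)
  also have "\<dots> = (LBINT t:{0..2*pi}. ln (cmod (f (circ r t)))) + (LBINT t:{0..2*pi}. ln (cmod (g (circ r t))))"
    by (rule set_integral_add(2)[OF i])
  finally show "circle_mean r (\<lambda>z. f z * g z) = circle_mean r f + circle_mean r g"
    using r by (simp add: circle_mean_def distrib_left)
qed

lemma circle_mean_product:
  assumes r: "r > 0" and Z: "finite Z" "0 \<notin> Z" and g: "g holomorphic_on UNIV" "g 0 \<noteq> 0" "log_circle_integrable r g"
  shows "log_circle_integrable r (\<lambda>z. (\<Prod>a\<in>Z. (1 - z / a) ^ m a) * g z) \<and>
    circle_mean r (\<lambda>z. (\<Prod>a\<in>Z. (1 - z / a) ^ m a) * g z) \<ge> (\<Sum>a\<in>Z. real (m a) * max 0 (ln (r / cmod a))) + circle_mean r g"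
  using Z
proof (induction Z rule: finite_induct)
  case (insert b Z)
  define G where "G z = (\<Prod>a\<in>Z. (1 - z / a) ^ m a) * g z" for z
  have G: "G holomorphic_on UNIV" "G 0 \<noteq> 0" unfolding G_def using insert g by (auto intro!: holomorphic_intros)
  have IH: "log_circle_integrable r G" "circle_mean r G \<ge> (\<Sum>a\<in>Z. real (m a) * max 0 (ln (r / cmod a))) + circle_mean r g"
    using insert unfolding G_def by auto
  have b: "b \<noteq> 0" using insert by auto
  have pw: "log_circle_integrable r (\<lambda>z. (1 - z / b) ^ k * G z) \<and>
    circle_mean r (\<lambda>z. (1 - z / b) ^ k * G z) \<ge> real k * max 0 (ln (r / cmod b)) + circle_mean r G" for k
  proof (induction k)
    case (Suc k)
    have eq: "(1 - z / b) ^ Suc k * G z = (1 - z / b) * ((1 - z / b) ^ k * G z)" for z by (simp add: mult.assoc)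
    have l: "(\<lambda>z. 1 - z / b) holomorphic_on UNIV" using b by (auto intro!: holomorphic_intros)
    have h: "(\<lambda>z. (1 - z / b) ^ k * G z) holomorphic_on UNIV" using b G by (auto intro!: holomorphic_intros)
    note mult = circle_mean_mult[OF l _ h _ r circle_mean_linear_factor(1)[OF b r]]
    show ?case unfolding eq
      using mult Suc circle_mean_linear_factor(2)[OF b r] G(2) by (auto simp: algebra_simps)
  qed (use IH in auto)
  have eq: "(\<Prod>a\<in>insert b Z. (1 - z / a) ^ m a) * g z = (1 - z / b) ^ m b * G z" for z
    using insert by (auto simp: G_def mult.assoc)
  have sum: "(\<Sum>a\<in>insert b Z. real (m a) * max 0 (ln (r / cmod a))) = real (m b) * max 0 (ln (r / cmod b)) + (\<Sum>a\<in>Z. real (m a) * max 0 (ln (r / cmod a)))"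
    using insert by simp
  show ?case unfolding eq sum using pw[of "m b"] IH(2) by linarith
qed (use g in auto)

text \<open>Once all zeros in the closed disc are joined to \<open>Z\<close> and divided out, the
  remaining factor has mean \<open>ln \<bar>f 0\<bar>\<close>. The added terms are nonnegative, so
  they may be dropped again.\<close>

lemma jensen_inequality:
  assumes f: "f holomorphic_on UNIV" and f0: "f 0 \<noteq> 0" and r: "r > 0" and Z: "finite Z" "0 \<notin> Z"
  shows "log_circle_integrable r f"
    "circle_mean r f \<ge> ln (cmod (f 0)) + (\<Sum>a\<in>Z. real (nat (zorder f a)) * max 0 (ln (r / cmod a)))"
proof -
  define Y where "Y = Z \<union> {z \<in> cball 0 r. f z = 0}"
  have Y: "finite Y" "0 \<notin> Y" using Z finite_zeros_cball[OF f f0] f0 by (auto simp: Y_def)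
  obtain g where g: "g holomorphic_on UNIV" "\<And>z. f z = (\<Prod>a\<in>Y. (1 - z / a) ^ nat (zorder f a)) * g z"
    "\<And>a. a \<in> Y \<Longrightarrow> g a \<noteq> 0" "g 0 = f 0" using entire_factor_out[OF f f0 Y] by blast
  have "g z \<noteq> 0" if "z \<in> cball 0 r" for z
    using g(2)[of z] g(3)[of z] that by (cases "z \<in> Y") (auto simp: Y_def)
  note zf = circle_mean_zero_free[OF g(1) r this]
  have g0: "g 0 \<noteq> 0" using g(4) f0 by simp
  from circle_mean_product[OF r Y g(1) g0 zf(1), of "\<lambda>a. nat (zorder f a)"]
  have *: "log_circle_integrable r f" "circle_mean r f \<ge> (\<Sum>a\<in>Y. real (nat (zorder f a)) * max 0 (ln (r / cmod a))) + circle_mean r g"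
    unfolding g(2)[symmetric] by auto
  show "log_circle_integrable r f" by fact
  have "(\<Sum>a\<in>Z. real (nat (zorder f a)) * max 0 (ln (r / cmod a))) \<le> (\<Sum>a\<in>Y. real (nat (zorder f a)) * max 0 (ln (r / cmod a)))"
    using Y by (intro sum_mono2) (auto simp: Y_def)
  thus "circle_mean r f \<ge> ln (cmod (f 0)) + (\<Sum>a\<in>Z. real (nat (zorder f a)) * max 0 (ln (r / cmod a)))"
    using * zf(2) g(4) by simp
qed

lemma norm_le_max_modulus:
  assumes "continuous_on UNIV f" "cmod z = r"
  shows "cmod (f z) \<le> max_modulus r f"
  unfolding max_modulus_def
proof (rule cSUP_upper)
  have "compact ((\<lambda>z. cmod (f z)) ` sphere 0 r)"
    by (intro compact_continuous_image continuous_intros continuous_on_subset[OF assms(1)]) auto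
  thus "bdd_above ((\<lambda>z. cmod (f z)) ` sphere 0 r)" by (intro bounded_imp_bdd_above compact_imp_bounded)
qed (use assms in auto)

lemma max_modulus_le:
  assumes "r \<ge> 0" "\<And>z. cmod z = r \<Longrightarrow> cmod (f z) \<le> B"
  shows "max_modulus r f \<le> B"
  unfolding max_modulus_def using assms by (intro cSUP_least) (auto intro!: exI[of _ "of_real r"] simp: sphere_eq_empty)

text \<open>Jensen's inequality needs a nonzero value at \<open>0\<close>, so \<open>h\<close> is
  written as \<open>z ^ n * g\<close> with \<open>g 0 \<noteq> 0\<close>; for
  \<open>r \<ge> 1\<close> the factor \<open>z ^ n\<close> only helps. The quotient then stays above
  \<open>\<bar>g 0\<bar>\<close>.\<close>

lemma no_small_multiplier:
  assumes f: "f holomorphic_on UNIV" "f 0 \<noteq> 0" and h: "h holomorphic_on UNIV" "h \<noteq> (\<lambda>_. 0)"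
  shows "Liminf at_top (\<lambda>r. ereal (max_modulus r (\<lambda>z. f z * h z) / exp (circle_mean r f))) \<noteq> 0"
proof -
  have "\<exists>w\<in>UNIV. h w \<noteq> 0" using h(2) by (auto simp: fun_eq_iff)
  from zorder_exist_zero[OF h(1) open_UNIV connected_UNIV UNIV_I this, of 0]
  obtain e where e: "e > 0" "zor_poly h 0 holomorphic_on cball 0 e"
     "\<forall>w\<in>cball 0 e. h w = zor_poly h 0 w * w ^ nat (zorder h 0) \<and> zor_poly h 0 w \<noteq> 0" by auto
  define n where "n = nat (zorder h 0)"
  define g where "g z = (if z = 0 then zor_poly h 0 0 else h z / z ^ n)" for z
  have ge: "g z = zor_poly h 0 z" if "z \<in> cball 0 e" for z using e(3) that by (auto simp: g_def n_def)
  have "g holomorphic_on ball 0 e \<union> (- {0})"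
  proof (rule holomorphic_on_Un)
    show "g holomorphic_on ball 0 e"
      by (rule holomorphic_transform[OF holomorphic_on_subset[OF e(2)]]) (use ge in auto)
    have "(\<lambda>z. h z / z ^ n) holomorphic_on - {0}"
      by (intro holomorphic_intros holomorphic_on_subset[OF h(1)]) auto
    thus "g holomorphic_on - {0}" by (rule holomorphic_transform) (auto simp: g_def)
  qed auto
  moreover have "ball 0 e \<union> (- {0}) = (UNIV :: complex set)" using e(1) by auto
  ultimately have g: "g holomorphic_on UNIV" by simp
  have g0: "g 0 \<noteq> 0" using e by (simp add: g_def)
  have hg: "h z = z ^ n * g z" for z
  proof (cases "z = 0")
    case True
    have "h 0 = zor_poly h 0 0 * 0 ^ n" using e(1,3) by (simp add: n_def)
    thus ?thesis using True by (simp add: g_def mult.commute)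
  qed (simp add: g_def)
  define c where "c = cmod (g 0)"
  have c: "c > 0" using g0 by (simp add: c_def)
  have low: "c \<le> max_modulus r (\<lambda>z. f z * h z) / exp (circle_mean r f)" if r: "r \<ge> 1" for r
  proof -
    have r0: "r > 0" using r by simp
    have fi: "log_circle_integrable r f" by (rule jensen_inequality[OF f r0, of "{}"]) auto
    have gi: "log_circle_integrable r g" "circle_mean r g \<ge> ln c"
      using jensen_inequality[OF g g0 r0, of "{}"] by (auto simp: c_def)
    note fg = circle_mean_mult[OF f g g0 r0 fi gi(1)]
    define M where "M = max_modulus r (\<lambda>z. f z * h z)"
    have chf: "continuous_on UNIV (\<lambda>z. f z * h z)" using f h by (intro continuous_intros holomorphic_on_imp_continuous_on)
    have bound: "cmod (f (circ r t) * g (circ r t)) \<le> M" for t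
    proof -
      have "1 * cmod (f (circ r t) * g (circ r t)) \<le> r ^ n * cmod (f (circ r t) * g (circ r t))"
        using r by (intro mult_right_mono one_le_power) auto
      also have "\<dots> = cmod (f (circ r t) * h (circ r t))" using r by (simp add: hg norm_mult norm_power)
      also have "\<dots> \<le> M" unfolding M_def by (rule norm_le_max_modulus[OF chf]) (use r in \<open>auto simp: norm_mult\<close>)
      finally show ?thesis by simp
    qed
    \<comment> \<open>Some angle avoids the zeros of both factors. This makes \<open>M\<close>
      positive, so that \<open>ln M\<close> is meaningful.\<close>
    have "\<exists>t. f (circ r t) \<noteq> 0 \<and> g (circ r t) \<noteq> 0"
    proof (rule ccontr)
      assume "\<not> ?thesis"
      hence no: "f (circ r t) = 0 \<or> g (circ r t) = 0" for t by auto
      have "AE t in lborel. f (circ r t) \<noteq> 0 \<and> g (circ r t) \<noteq> 0"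
        using AE_circle_nonzero[OF f r0] AE_circle_nonzero[OF g g0 r0] by eventually_elim simp
      hence "AE t in (lborel :: real measure). False" by (rule AE_mp) (use no in auto)
      thus False by (simp add: AE_iff_null emeasure_lborel_UNIV null_sets_def)
    qed
    then obtain t0 where "f (circ r t0) \<noteq> 0" "g (circ r t0) \<noteq> 0" by auto
    hence M0: "M > 0" using bound[of t0] by (smt (verit) mult_eq_0_iff zero_less_norm_iff)
    have ci: "set_integrable lborel {0..2*pi} (\<lambda>t. ln M)" by (intro borel_integrable_atLeastAtMost' continuous_intros)
    have "(LBINT t:{0..2*pi}. ln (cmod (f (circ r t) * g (circ r t)))) \<le> (LBINT t:{0..2*pi}. ln M)"
    proof (rule set_integral_mono_AE[OF fg(1) ci])
      show "AE t\<in>{0..2*pi} in lborel. ln (cmod (f (circ r t) * g (circ r t))) \<le> ln M"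
        using AE_circle_nonzero[OF f r0] AE_circle_nonzero[OF g g0 r0]
      proof eventually_elim
        case (elim t)
        hence "cmod (f (circ r t) * g (circ r t)) > 0" by simp
        thus ?case using bound[of t] M0 by (intro impI ln_mono) auto
      qed
    qed
    also have "(LBINT t:{0..2*pi}. ln M) = 2 * pi * ln M" by (subst set_borel_integral_eq_integral(2)[OF ci]) simp
    finally have "circle_mean r (\<lambda>z. f z * g z) \<le> ln M" using r0 by (simp add: circle_mean_def field_simps)
    hence "circle_mean r f + ln c \<le> ln M" using fg(2) gi(2) by simp
    hence "exp (circle_mean r f + ln c) \<le> exp (ln M)" by (simp only: exp_le_cancel_iff)
    hence "exp (circle_mean r f) * c \<le> M" using c M0 by (simp add: exp_add)
    thus ?thesis unfolding M_def by (simp add: pos_le_divide_eq mult.commute)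
  qed
  have "ereal c \<le> Liminf at_top (\<lambda>r. ereal (max_modulus r (\<lambda>z. f z * h z) / exp (circle_mean r f)))"
    by (rule Liminf_bounded) (use low in \<open>auto intro!: eventually_mono[OF eventually_ge_at_top[of 1]]\<close>)
  thus ?thesis using c by (metis ereal_less_eq(3) linorder_not_le zero_ereal_def)
qed

section \<open>Integrals of circle means\<close>

context
  fixes p :: real
  assumes p: "p \<ge> 1"
begin

abbreviation (input) kern :: "real \<Rightarrow> real" where "kern t \<equiv> p\<^sup>2 * t powr (p - 1) / (1 + t powr p)\<^sup>2"

lemma one_plus_powr_pos: "1 + t powr p > 0"
  by (simp add: add_pos_nonneg)

lemma kern_nonneg: "kern t \<ge> 0" by simp

lemma kern_cont: "t > 0 \<Longrightarrow> isCont (\<lambda>t. kern t) t"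
  using one_plus_powr_pos[of t] by (intro continuous_intros) auto

lemma DERIV_powr_p: "t > 0 \<Longrightarrow> ((\<lambda>t. t powr p) has_real_derivative p * t powr (p - 1)) (at t)"
  by (auto intro!: derivative_eq_intros)

lemma kern_integral:
  "set_integrable lborel {0<..} (\<lambda>t. kern t)" "(LBINT t:{0<..}. kern t) = p"
proof -
  define F where "F t = - p / (1 + t powr p)" for t
  have dF: "DERIV F t :> kern t" if t: "t > 0" for t
  proof -
    have d: "((\<lambda>t. 1 + t powr p) has_real_derivative p * t powr (p - 1)) (at t)"
      using DERIV_add[OF DERIV_const DERIV_powr_p[OF t], of 1] by simp
    show ?thesis unfolding F_def
      by (rule DERIV_cong[OF DERIV_divide[OF DERIV_const d]])
         (use one_plus_powr_pos[of t] in \<open>auto simp: power2_eq_square\<close>)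
  qed
  have A: "((F \<circ> real_of_ereal) \<longlongrightarrow> - p) (at_right (ereal 0))"
    unfolding ereal_tendsto_simps F_def using p by real_asymp
  have B: "((F \<circ> real_of_ereal) \<longlongrightarrow> 0) (at_left \<infinity>)"
    unfolding ereal_tendsto_simps F_def using p by real_asymp
  have e: "einterval (ereal 0) \<infinity> = {0<..}" by (auto simp: einterval_def)
  have "set_integrable lborel (einterval (ereal 0) \<infinity>) (\<lambda>t. kern t)" "(LBINT t=ereal 0..\<infinity>. kern t) = 0 - (- p)"
    by (rule interval_integral_FTC_nonneg[where F = F]; use dF kern_cont A B in auto)+
  thus "set_integrable lborel {0<..} (\<lambda>t. kern t)" "(LBINT t:{0<..}. kern t) = p"
    unfolding e interval_lebesgue_integral_def by auto
qed

text \<open>This explains the kernel: it turns a Jensen term, a truncated logarithm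
  \<open>max 0 (ln (r / \<bar>a\<bar>))\<close>, into
  \<open>ln (1 + (r / \<bar>a\<bar>) powr p)\<close>.\<close>

lemma log_kern_integral:
  assumes x: "x > 0"
  shows "set_integrable lborel {0<..} (\<lambda>t. max 0 (ln (t / x)) * kern t)"
    "(LBINT t:{0<..}. max 0 (ln (t / x)) * kern t) = ln (1 + (1 / x) powr p)"
proof -
  \<comment> \<open>Integration by parts with the primitive \<open>- p / (1 + t powr p)\<close> of
    the kernel; the remaining integrand \<open>p / (t * (1 + t powr p))\<close> has the primitive
    \<open>p * ln t - ln (1 + t powr p)\<close>.\<close>
  define G where "G t = - p * ln (t / x) / (1 + t powr p) + (p * ln t - ln (1 + t powr p))" for t
  have dG: "DERIV G t :> ln (t / x) * kern t" if t: "t > 0" for t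
  proof -
    define D where "D = 1 + t powr p"
    have D: "D > 0" using one_plus_powr_pos by (simp add: D_def)
    have tp: "t * t powr (p - 1) = t powr p" using t powr_mult_base[of t "p - 1"] by simp
    have d: "((\<lambda>t. 1 + t powr p) has_real_derivative p * t powr (p - 1)) (at t)"
      using DERIV_add[OF DERIV_const DERIV_powr_p[OF t], of 1] by simp
    have l: "((\<lambda>t. - p * ln (t / x)) has_real_derivative - p / t) (at t)"
      using t x by (auto intro!: derivative_eq_intros simp: field_simps)
    have l2: "((\<lambda>t. p * ln t) has_real_derivative p / t) (at t)"
      using t by (auto intro!: derivative_eq_intros)
    have l3: "((\<lambda>t. ln (1 + t powr p)) has_real_derivative p * t powr (p - 1) / D) (at t)"
      unfolding D_def using DERIV_chain2[OF DERIV_ln_divide[OF one_plus_powr_pos] d] by simp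
    have "(G has_real_derivative ((- p / t) * D - (- p * ln (t / x)) * (p * t powr (p - 1))) / (D * D) + (p / t - p * t powr (p - 1) / D)) (at t)"
      unfolding G_def[abs_def] using D
      by (intro DERIV_add DERIV_diff l2 l3) (use DERIV_divide[OF l d] in \<open>auto simp: D_def\<close>)
    moreover have "((- p / t) * D - (- p * ln (t / x)) * (p * t powr (p - 1))) / (D * D) + (p / t - p * t powr (p - 1) / D) = ln (t / x) * kern t"
    proof -
      have "p / t - p * t powr (p - 1) / D = p / (t * D)"
      proof -
        have "p / t - p * t powr (p - 1) / D = p * (D - t * t powr (p - 1)) / (t * D)"
          using t D by (simp add: field_simps)
        also have "D - t * t powr (p - 1) = 1" unfolding tp by (simp add: D_def)
        finally show ?thesis by simp
      qed
      moreover have "((- p / t) * D - (- p * ln (t / x)) * (p * t powr (p - 1))) / (D * D) = - (p / (t * D)) + ln (t / x) * (p\<^sup>2 * t powr (p - 1) / D\<^sup>2)"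
        using t D by (simp add: field_simps power2_eq_square)
      ultimately show ?thesis by (simp add: D_def)
    qed
    ultimately show ?thesis by simp
  qed
  have Gx: "G x = - ln (1 + (1 / x) powr p)"
  proof -
    have "ln (1 + x powr p) = ln (x powr p * (1 + (1 / x) powr p))"
      using x by (simp add: powr_divide distrib_left add.commute)
    also have "\<dots> = p * ln x + ln (1 + (1 / x) powr p)"
      using x one_plus_powr_pos[of "1 / x"] by (subst ln_mult) (auto simp: ln_powr)
    finally show ?thesis using x by (simp add: G_def)
  qed
  have A: "((G \<circ> real_of_ereal) \<longlongrightarrow> - ln (1 + (1 / x) powr p)) (at_right (ereal x))"
    unfolding ereal_tendsto_simps Gx[symmetric]
    using DERIV_isCont[OF dG[OF x]] by (auto simp: isCont_def intro: tendsto_within_subset)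
  have B: "((G \<circ> real_of_ereal) \<longlongrightarrow> 0) (at_left \<infinity>)"
    unfolding ereal_tendsto_simps G_def using p x by real_asymp
  have cont: "isCont (\<lambda>t. ln (t / x) * kern t) t" if "t > 0" for t
    using that x one_plus_powr_pos[of t] by (intro continuous_intros) auto
  have e: "einterval (ereal x) \<infinity> = {x<..}" by (auto simp: einterval_def)
  have "set_integrable lborel (einterval (ereal x) \<infinity>) (\<lambda>t. ln (t / x) * kern t)"
    "(LBINT t=ereal x..\<infinity>. ln (t / x) * kern t) = 0 - (- ln (1 + (1 / x) powr p))"
    by (rule interval_integral_FTC_nonneg[where F = G]; use dG cont A B x in \<open>auto intro!: mult_nonneg_nonneg\<close>)+
  hence i: "set_integrable lborel {x<..} (\<lambda>t. ln (t / x) * kern t)" "(LBINT t:{x<..}. ln (t / x) * kern t) = ln (1 + (1 / x) powr p)"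
    unfolding e interval_lebesgue_integral_def by auto
  have eq: "indicator {x<..} t *\<^sub>R (ln (t / x) * kern t) = indicator {0<..} t *\<^sub>R (max 0 (ln (t / x)) * kern t)" for t
    using x by (auto simp: indicator_def max_def ln_ge_zero_iff field_simps)
  show "set_integrable lborel {0<..} (\<lambda>t. max 0 (ln (t / x)) * kern t)"
    "(LBINT t:{0<..}. max 0 (ln (t / x)) * kern t) = ln (1 + (1 / x) powr p)"
    using i unfolding set_integrable_def set_lebesgue_integral_def eq by auto
qed

lemma extended_integral_ge:
  assumes g: "integrable M g" and le: "\<And>x. x \<in> space M \<Longrightarrow> g x \<le> f x"
  shows "ereal (integral\<^sup>L M g) \<le> extended_integral M f"
proof -
  have fin: "(\<integral>\<^sup>+x. ennreal (g x) \<partial>M) \<noteq> \<infinity>" "(\<integral>\<^sup>+x. ennreal (- g x) \<partial>M) \<noteq> \<infinity>"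
    using g by (auto simp: real_integrable_def)
  have "ereal (integral\<^sup>L M g) = enn2ereal (\<integral>\<^sup>+x. ennreal (g x) \<partial>M) - enn2ereal (\<integral>\<^sup>+x. ennreal (- g x) \<partial>M)"
    unfolding real_lebesgue_integral_def[OF g] using fin
    by (cases "\<integral>\<^sup>+x. ennreal (g x) \<partial>M"; cases "\<integral>\<^sup>+x. ennreal (- g x) \<partial>M") auto
  also have "\<dots> \<le> enn2ereal (\<integral>\<^sup>+x. ennreal (f x) \<partial>M) - enn2ereal (\<integral>\<^sup>+x. ennreal (- f x) \<partial>M)"
    by (intro ereal_minus_mono; simp only: less_eq_ennreal.rep_eq[symmetric]; intro nn_integral_mono ennreal_leI) (use le in auto)
  finally show ?thesis by (simp add: extended_integral_def)
qed

text \<open>Jensen's inequality under the integral sign. A finite \<open>Z\<close> keeps the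
  minorant integrable, so the comparison also makes sense when the integral on the right is
  infinite.\<close>

lemma extended_integral_lower_bound:
  assumes f: "f holomorphic_on UNIV" "f 0 \<noteq> 0" and Z: "finite Z" "0 \<notin> Z" and r: "r \<ge> 0"
  shows "ereal (p * ln (cmod (f 0)) + (\<Sum>a\<in>Z. real (nat (zorder f a)) * ln (1 + (r / cmod a) powr p)))
    \<le> extended_integral (restrict_space lborel {0<..}) (\<lambda>t. circle_mean (r * t) f * kern t)"
proof -
  define M where "M = restrict_space lborel ({0<..} :: real set)"
  define l where "l a t = real (nat (zorder f a)) * (max 0 (ln (r * t / cmod a)) * kern t)" for a t
  define g where "g t = ln (cmod (f 0)) * kern t + (\<Sum>a\<in>Z. l a t)" for t
  have M: "integrable M h \<longleftrightarrow> set_integrable lborel {0<..} h" "integral\<^sup>L M h = (LBINT t:{0<..}. h t)" for h :: "real \<Rightarrow> real"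
    by (simp_all add: M_def integrable_restrict_space integral_restrict_space set_integrable_def set_lebesgue_integral_def)
  have li: "integrable M (l a) \<and> integral\<^sup>L M (l a) = real (nat (zorder f a)) * ln (1 + (r / cmod a) powr p)" if "a \<in> Z" for a
  proof (cases "r = 0")
    case True
    thus ?thesis by (simp add: l_def[abs_def])
  next
    case False
    have "a \<noteq> 0" using Z that by metis
    hence x: "cmod a / r > 0" using False r by simp
    have eq: "l a = (\<lambda>t. real (nat (zorder f a)) * (max 0 (ln (t / (cmod a / r))) * kern t))"
      by (simp add: l_def[abs_def] mult.commute)
    have i: "integrable M (\<lambda>t. max 0 (ln (t / (cmod a / r))) * kern t)"
      "integral\<^sup>L M (\<lambda>t. max 0 (ln (t / (cmod a / r))) * kern t) = ln (1 + (1 / (cmod a / r)) powr p)"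
      unfolding M by (rule log_kern_integral[OF x])+
    show ?thesis unfolding eq integral_mult_right_zero i(2) by (intro conjI integrable_mult_right i(1)) simp
  qed
  have ki: "integrable M (\<lambda>t. kern t)" "integral\<^sup>L M (\<lambda>t. kern t) = p" unfolding M by (rule kern_integral)+
  have gi: "integrable M g" unfolding g_def using li ki by (intro Bochner_Integration.integrable_add Bochner_Integration.integrable_sum integrable_mult_right) auto
  have ki': "integrable M (\<lambda>t. ln (cmod (f 0)) * kern t)" by (rule integrable_mult_right) (rule ki)
  have li': "integrable M (\<lambda>t. \<Sum>a\<in>Z. l a t)" using li by (intro Bochner_Integration.integrable_sum) auto
  have "integral\<^sup>L M g = ln (cmod (f 0)) * p + (\<Sum>a\<in>Z. integral\<^sup>L M (l a))"
    unfolding g_def Bochner_Integration.integral_add[OF ki' li'] integral_mult_right_zero ki(2)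
    by (subst Bochner_Integration.integral_sum) (use li in auto)
  hence gv: "integral\<^sup>L M g = p * ln (cmod (f 0)) + (\<Sum>a\<in>Z. real (nat (zorder f a)) * ln (1 + (r / cmod a) powr p))"
    using li by (simp add: mult.commute)
  have "ereal (integral\<^sup>L M g) \<le> extended_integral M (\<lambda>t. circle_mean (r * t) f * kern t)"
  proof (rule extended_integral_ge[OF gi])
    fix t assume "t \<in> space M"
    hence t: "t > 0" by (simp add: M_def space_restrict_space)
    have "ln (cmod (f 0)) + (\<Sum>a\<in>Z. real (nat (zorder f a)) * max 0 (ln (r * t / cmod a))) \<le> circle_mean (r * t) f"
    proof (cases "r = 0")
      case True
      thus ?thesis by (simp add: circle_mean_def)
    next
      case False
      thus ?thesis using r t by (intro jensen_inequality(2)[OF f _ Z]) auto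
    qed
    from mult_right_mono[OF this kern_nonneg[of t]]
    show "g t \<le> circle_mean (r * t) f * kern t"
      by (simp only: g_def l_def distrib_right sum_distrib_right mult.assoc)
  qed
  from this[unfolded gv] show ?thesis unfolding M_def .
qed

end

section \<open>Zeros forced by singular weights\<close>

text \<open>If \<open>F\<close> is of size at least \<open>g \<sigma>\<^sup>j\<close> with \<open>j < m a\<close> at distance \<open>\<sigma>\<close> from \<open>a\<close>, then the weight
  \<open>exp (-2 potential)\<close>, about \<open>\<sigma>\<close> to the power \<open>-2 m a\<close>, makes the integral over a sector logarithmically large.\<close>

lemma singular_weight_lower_bound:
  fixes F :: "complex \<Rightarrow> complex"
  assumes p: "p > 1" and \<kappa>: "0 \<le> \<kappa>" "\<kappa> < 1" and Z: "finite Z" "a \<in> Z" "\<And>b. b \<in> Z \<Longrightarrow> b \<noteq> 0"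
    and S: "(\<Sum>b\<in>Z. real (m b) * cmod b powr (- p)) \<le> S" and a: "exp 2 \<le> cmod a"
    and F: "continuous_on UNIV F"
    and C: "\<And>b c. 1 \<le> b \<Longrightarrow> b \<le> c \<Longrightarrow> integral {b..c} (\<lambda>s. integral {0..2*pi} (\<lambda>t. (cmod (F (of_real (exp s) * cis t)))\<^sup>2
       * exp (- 2 * potential \<kappa> p m Z s t - 4 * s))) \<le> C"
    and d: "0 < d" "d < e" "p * e \<le> 1" "1 - \<kappa> \<le> d\<^sup>2"
    and \<theta>: "0 \<le> \<theta>" "\<theta> + e \<le> 2 * pi" "cis \<theta> = cis (Arg a)" and j: "j < m a" and g: "g \<ge> 0"
    and low: "\<And>\<sigma> \<phi>. d \<le> \<sigma> \<Longrightarrow> \<sigma> \<le> e \<Longrightarrow> 0 \<le> \<phi> \<Longrightarrow> \<phi> \<le> \<sigma> \<Longrightarrow> g * \<sigma> ^ j \<le> cmod (F (of_real (exp (ln (cmod a) + \<sigma>)) * cis (\<theta> + \<phi>)))"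
  shows "g\<^sup>2 * (inverse (14 * p\<^sup>2) ^ m a * exp (- 2 * (exp (p * (ln (cmod a) + 1)) * S) - 4 * (ln (cmod a) + 1))) * ln (e / d) \<le> C"
proof -
  define sa where "sa = ln (cmod a)"
  define c where "c = g\<^sup>2 * (inverse (14 * p\<^sup>2) ^ m a * exp (- 2 * (exp (p * (sa + 1)) * S) - 4 * (sa + 1)))"
  have c0: "c \<ge> 0" by (simp add: c_def)
  have a0: "cmod a > 0" using a exp_gt_zero[of 2] by linarith
  have sa: "sa \<ge> 2" using a a0 by (simp add: sa_def ln_ge_iff)
  have "1 * e \<le> p * e" using p d by (intro mult_right_mono) auto
  hence e1: "e \<le> 1" using d by linarith
  define h where "h s t = (cmod (F (of_real (exp s) * cis t)))\<^sup>2 * exp (- 2 * potential \<kappa> p m Z s t - 4 * s)" for s t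
  have cpot: "continuous_on A (\<lambda>x. potential \<kappa> p m Z (f x) (k x))" if "continuous_on A f" "continuous_on A k" for A :: "'b::topological_space set" and f k
    unfolding potential_def by (intro continuous_intros continuous_on_atom[OF p \<kappa>] that)
  note cF = continuous_on_compose2[OF F _ subset_UNIV]
  have ch: "continuous_on A (h s)" for A s unfolding h_def by (intro continuous_intros cpot cF)
  have cI: "continuous_on A (\<lambda>s. integral {0..2*pi} (h s))" for A
    unfolding cbox_interval[symmetric]
    by (rule integral_continuous_on_param, unfold split_beta h_def, intro continuous_intros cpot cF)
  have h0: "h s t \<ge> 0" for s t by (simp add: h_def)
  \<comment> \<open>The hypothesis \<open>1 - \<kappa> \<le> d\<^sup>2\<close> makes the smoothing
    negligible at distance \<open>\<sigma> \<ge> d\<close>. With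
    \<open>x = exp (p * \<sigma>)\<close> the denominator is
    \<open>(x - 1)\<^sup>2 + 2 * x * (1 - \<kappa> * q)\<close>; the two terms contribute
    \<open>4\<close> and \<open>9\<close> times \<open>p\<^sup>2 * \<sigma>\<^sup>2\<close>, and
    \<open>14\<close> leaves room.\<close>
  have den: "atom_den \<kappa> p \<sigma> (\<theta> + \<phi> - Arg a) \<le> 14 * p\<^sup>2 * \<sigma>\<^sup>2" if "d \<le> \<sigma>" "\<sigma> \<le> e" "0 \<le> \<phi>" "\<phi> \<le> \<sigma>" for \<sigma> \<phi>
  proof -
    define x where "x = exp (p * \<sigma>)"
    define q where "q = profile p \<phi>"
    have \<sigma>: "0 < \<sigma>" "p * \<sigma> \<le> 1" "0 \<le> p * \<sigma>" "\<sigma> \<le> 1"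
      using that d p e1 order_trans[OF mult_left_mono[of \<sigma> e p]] by auto
    have prof: "profile p (\<theta> + \<phi> - Arg a) = q"
    proof -
      have "cis (\<theta> + \<phi> - Arg a) = cis \<theta> * cis \<phi> / cis (Arg a)" by (simp only: cis_divide[symmetric] cis_mult[symmetric])
      also have "\<dots> = cis \<phi>" unfolding \<theta>(3) by simp
      finally show ?thesis by (simp add: profile_def q_def)
    qed
    have "x \<le> 1 + p * \<sigma> + (p * \<sigma>)\<^sup>2" unfolding x_def using \<sigma> by (intro exp_bound) auto
    moreover have "(p * \<sigma>)\<^sup>2 \<le> p * \<sigma>" using \<sigma> by (simp add: power2_eq_square mult_left_le)
    ultimately have x: "1 \<le> x" "x - 1 \<le> 2 * (p * \<sigma>)" "x \<le> 3" using \<sigma> by (auto simp: x_def)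
    have x2: "(x - 1)\<^sup>2 \<le> (2 * (p * \<sigma>))\<^sup>2" using x by (intro power_mono) auto
    have "\<phi> < pi" using that e1 pi_gt3 by linarith
    hence "1 - q \<le> (p * \<phi>)\<^sup>2 / 2" unfolding q_def using that by (intro one_minus_profile_le[OF p]) auto
    also have "\<dots> \<le> (p * \<sigma>)\<^sup>2 / 2" using that p by (intro divide_right_mono power_mono mult_left_mono mult_nonneg_nonneg) auto
    finally have q1: "1 - q \<le> (p * \<sigma>)\<^sup>2 / 2" .
    have q2: "-1 \<le> q" "q \<le> 1" using profile_bounds[OF p] by (auto simp: q_def)
    have "1 - \<kappa> * q = (1 - q) + q * (1 - \<kappa>)" by (simp add: algebra_simps)
    also have "\<dots> \<le> (p * \<sigma>)\<^sup>2 / 2 + 1 * (1 - \<kappa>)"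
      using q1 q2 \<kappa> by (intro add_mono mult_right_mono) auto
    also have "1 - \<kappa> \<le> \<sigma>\<^sup>2" using d that by (meson order_trans power_mono less_imp_le)
    also have "\<sigma>\<^sup>2 \<le> p\<^sup>2 * \<sigma>\<^sup>2" using p by (simp add: mult_le_cancel_right1 one_le_power)
    finally have k: "1 - \<kappa> * q \<le> 3/2 * (p\<^sup>2 * \<sigma>\<^sup>2)" by (simp add: power_mult_distrib mult.commute)
    have "0 \<le> 1 - \<kappa> * q"
      using mult_mono[of \<kappa> 1 q 1] \<kappa> q2 mult_nonneg_nonpos[of \<kappa> q] by (cases "q \<ge> 0") auto
    hence "2 * x * (1 - \<kappa> * q) \<le> 2 * 3 * (3/2 * (p\<^sup>2 * \<sigma>\<^sup>2))"
      using x k by (intro mult_mono) auto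
    moreover have "atom_den \<kappa> p \<sigma> (\<theta> + \<phi> - Arg a) = (x - 1)\<^sup>2 + 2 * x * (1 - \<kappa> * q)"
      unfolding atom_den_def prof x_def[symmetric] by (simp add: power2_eq_square algebra_simps)
    moreover have "0 \<le> p\<^sup>2 * \<sigma>\<^sup>2" by simp
    moreover have "(x - 1)\<^sup>2 \<le> 4 * (p\<^sup>2 * \<sigma>\<^sup>2)" using x2 by (simp add: power_mult_distrib)
    ultimately show ?thesis unfolding mult.assoc by linarith
  qed
  \<comment> \<open>Since \<open>j < m a\<close> and \<open>\<sigma> \<le> 1\<close>, the quotient
    of \<open>\<sigma> ^ (2 * j)\<close> by \<open>\<sigma> ^ (2 * m a)\<close> is at least
    \<open>1 / \<sigma>\<^sup>2\<close>. The other atoms are bounded above by \<open>atom_le\<close>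
    and \<open>S\<close>.\<close>
  have hlow: "c / \<sigma>\<^sup>2 \<le> h (sa + \<sigma>) (\<theta> + \<phi>)" if \<sigma>: "d \<le> \<sigma>" "\<sigma> \<le> e" "0 \<le> \<phi>" "\<phi> \<le> \<sigma>" for \<sigma> \<phi>
  proof -
    define D where "D = atom_den \<kappa> p \<sigma> (\<theta> + \<phi> - Arg a)"
    have s0: "0 < \<sigma>" "\<sigma> \<le> 1" using that d e1 by auto
    have D: "0 < D" "D \<le> 14 * p\<^sup>2 * \<sigma>\<^sup>2" using den[OF \<sigma>] atom_den_pos[OF p \<kappa>] by (auto simp: D_def)
    have "potential \<kappa> p m Z (sa + \<sigma>) (\<theta> + \<phi>) = real (m a) * atom \<kappa> p \<sigma> (\<theta> + \<phi> - Arg a)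
       + (\<Sum>b\<in>Z - {a}. real (m b) * atom \<kappa> p (sa + \<sigma> - ln (cmod b)) (\<theta> + \<phi> - Arg b))"
      unfolding potential_def using Z by (subst sum.remove[of Z a]) (auto simp: sa_def)
    also have "(\<Sum>b\<in>Z - {a}. real (m b) * atom \<kappa> p (sa + \<sigma> - ln (cmod b)) (\<theta> + \<phi> - Arg b))
       \<le> (\<Sum>b\<in>Z - {a}. real (m b) * (exp (p * (sa + 1)) * cmod b powr (- p)))"
    proof (intro sum_mono mult_left_mono)
      fix b assume "b \<in> Z - {a}"
      hence b: "b \<noteq> 0" using Z by auto
      have "atom \<kappa> p (sa + \<sigma> - ln (cmod b)) (\<theta> + \<phi> - Arg b) \<le> ln (1 + exp (p * (sa + \<sigma> - ln (cmod b))))"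
        by (rule atom_le[OF p \<kappa>])
      also have "\<dots> \<le> exp (p * (sa + \<sigma> - ln (cmod b)))" by (rule ln_add_one_self_le_self) simp
      also have "\<dots> \<le> exp (p * (sa + 1 - ln (cmod b)))" using s0 p by simp
      also have "\<dots> = exp (p * (sa + 1)) * cmod b powr (- p)"
        using b by (simp add: powr_def exp_add[symmetric] algebra_simps)
      finally show "atom \<kappa> p (sa + \<sigma> - ln (cmod b)) (\<theta> + \<phi> - Arg b) \<le> exp (p * (sa + 1)) * cmod b powr (- p)" .
    qed auto
    also have "\<dots> \<le> (\<Sum>b\<in>Z. real (m b) * (exp (p * (sa + 1)) * cmod b powr (- p)))"
      using Z by (intro sum_mono2) auto
    also have "\<dots> = exp (p * (sa + 1)) * (\<Sum>b\<in>Z. real (m b) * cmod b powr (- p))" by (simp add: sum_distrib_left mult_ac)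
    also have "\<dots> \<le> exp (p * (sa + 1)) * S" using S by (intro mult_left_mono) auto
    finally have "2 * potential \<kappa> p m Z (sa + \<sigma>) (\<theta> + \<phi>) \<le> real (m a) * ln D + 2 * (exp (p * (sa + 1)) * S)"
      by (simp add: atom_def D_def)
    hence "real (m a) * (- ln D) + (- 2 * (exp (p * (sa + 1)) * S) - 4 * (sa + 1)) \<le> - 2 * potential \<kappa> p m Z (sa + \<sigma>) (\<theta> + \<phi>) - 4 * (sa + \<sigma>)"
      using s0 by simp
    hence "exp (real (m a) * (- ln D) + (- 2 * (exp (p * (sa + 1)) * S) - 4 * (sa + 1))) \<le> exp (- 2 * potential \<kappa> p m Z (sa + \<sigma>) (\<theta> + \<phi>) - 4 * (sa + \<sigma>))"
      by (simp only: exp_le_cancel_iff)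
    moreover have "exp (real (m a) * (- ln D)) = inverse D ^ m a"
      using D(1) by (simp only: exp_of_nat_mult) (simp add: exp_minus)
    ultimately have E: "inverse D ^ m a * exp (- 2 * (exp (p * (sa + 1)) * S) - 4 * (sa + 1)) \<le> exp (- 2 * potential \<kappa> p m Z (sa + \<sigma>) (\<theta> + \<phi>) - 4 * (sa + \<sigma>))"
      by (simp only: exp_add)
    have "inverse (14 * p\<^sup>2 * \<sigma>\<^sup>2) ^ m a \<le> inverse D ^ m a"
      using D by (intro power_mono le_imp_inverse_le) auto
    hence E2: "inverse (14 * p\<^sup>2 * \<sigma>\<^sup>2) ^ m a * exp (- 2 * (exp (p * (sa + 1)) * S) - 4 * (sa + 1)) \<le> exp (- 2 * potential \<kappa> p m Z (sa + \<sigma>) (\<theta> + \<phi>) - 4 * (sa + \<sigma>))"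
      using E by (meson order_trans mult_right_mono exp_ge_zero)
    have Fl: "(g * \<sigma> ^ j)\<^sup>2 \<le> (cmod (F (of_real (exp (sa + \<sigma>)) * cis (\<theta> + \<phi>))))\<^sup>2"
      using low[OF \<sigma>] g s0 by (intro power_mono) (auto simp: sa_def)
    have "c / \<sigma>\<^sup>2 \<le> (g * \<sigma> ^ j)\<^sup>2 * (inverse (14 * p\<^sup>2 * \<sigma>\<^sup>2) ^ m a * exp (- 2 * (exp (p * (sa + 1)) * S) - 4 * (sa + 1)))"
    proof -
      have "\<sigma> ^ (2 * (m a - 1)) \<le> \<sigma> ^ (2 * j)" using j s0 by (intro power_decreasing) auto
      hence "\<sigma> ^ (2 * (m a - 1)) * \<sigma>\<^sup>2 \<le> \<sigma> ^ (2 * j) * \<sigma>\<^sup>2" by (intro mult_right_mono) auto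
      moreover have "\<sigma> ^ (2 * (m a - 1)) * \<sigma>\<^sup>2 = (\<sigma>\<^sup>2) ^ m a"
      proof -
        have "2 * (m a - 1) + 2 = 2 * m a" using j by simp
        thus ?thesis by (metis power_add power_mult)
      qed
      ultimately have "(\<sigma>\<^sup>2) ^ m a \<le> (\<sigma> ^ j)\<^sup>2 * \<sigma>\<^sup>2" by (simp add: power_even_eq)
      hence "1 / \<sigma>\<^sup>2 \<le> (\<sigma> ^ j)\<^sup>2 * inverse (\<sigma>\<^sup>2) ^ m a" using s0 by (simp add: power_inverse field_simps)
      note ineq = mult_left_mono[OF this c0]
      obtain X E where XE: "X = inverse (14 * p\<^sup>2) ^ m a" "E = exp (- 2 * (exp (p * (sa + 1)) * S) - 4 * (sa + 1))" by blast
      have c_eq: "c = g\<^sup>2 * (X * E)" by (simp only: c_def XE)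
      have pw: "inverse (14 * p\<^sup>2 * \<sigma>\<^sup>2) ^ m a = X * inverse (\<sigma>\<^sup>2) ^ m a"
        by (simp only: XE inverse_mult_distrib power_mult_distrib)
      show ?thesis using ineq unfolding pw XE(2)[symmetric] c_eq by (simp add: power_mult_distrib mult_ac)
    qed
    also have "\<dots> \<le> h (sa + \<sigma>) (\<theta> + \<phi>)"
      unfolding h_def using Fl E2 p by (intro mult_mono) auto
    finally show ?thesis .
  qed
  \<comment> \<open>The sector has angular width \<open>\<sigma>\<close>, so integration over it
    leaves \<open>c / \<sigma>\<close>, whose integral from \<open>d\<close> to \<open>e\<close> is
    \<open>c * ln (e / d)\<close>.\<close>
  have inner: "c / \<sigma> \<le> integral {0..2*pi} (h (sa + \<sigma>))" if \<sigma>: "d \<le> \<sigma>" "\<sigma> \<le> e" for \<sigma>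
  proof -
    have s0: "0 < \<sigma>" using that d by auto
    have "c / \<sigma> = integral {\<theta>..\<theta>+\<sigma>} (\<lambda>t. c / \<sigma>\<^sup>2)" using s0 by (simp add: power2_eq_square)
    also have "\<dots> \<le> integral {\<theta>..\<theta>+\<sigma>} (h (sa + \<sigma>))"
    proof (rule integral_le)
      show "h (sa + \<sigma>) integrable_on {\<theta>..\<theta>+\<sigma>}" by (rule integrable_continuous_real[OF ch])
      fix t assume "t \<in> {\<theta>..\<theta>+\<sigma>}"
      thus "c / \<sigma>\<^sup>2 \<le> h (sa + \<sigma>) t" using hlow[OF \<sigma>, of "t - \<theta>"] by auto
    qed auto
    also have "\<dots> \<le> integral {0..2*pi} (h (sa + \<sigma>))"
      by (rule integral_subset_le) (use \<theta> \<sigma> h0 in \<open>auto intro: integrable_continuous_real ch\<close>)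
    finally show ?thesis .
  qed
  have "c * ln (e / d) = integral {sa + d..sa + e} (\<lambda>s. c / (s - sa))"
  proof -
    have "((\<lambda>s. c / (s - sa)) has_integral c * ln (sa + e - sa) - c * ln (sa + d - sa)) {sa + d..sa + e}"
      by (rule fundamental_theorem_of_calculus)
         (use d in \<open>auto intro!: derivative_eq_intros simp flip: has_real_derivative_iff_has_vector_derivative\<close>)
    thus ?thesis using d by (simp add: integral_unique ln_div right_diff_distrib)
  qed
  also have "\<dots> \<le> integral {sa + d..sa + e} (\<lambda>s. integral {0..2*pi} (h s))"
  proof (rule integral_le)
    show "(\<lambda>s. c / (s - sa)) integrable_on {sa + d..sa + e}"
      by (intro integrable_continuous_real continuous_intros) (use d in auto)
    show "(\<lambda>s. integral {0..2*pi} (h s)) integrable_on {sa + d..sa + e}" by (rule integrable_continuous_real[OF cI])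
    fix s assume "s \<in> {sa + d..sa + e}"
    thus "c / (s - sa) \<le> integral {0..2*pi} (h s)" using inner[of "s - sa"] by simp
  qed
  also have "\<dots> \<le> C" unfolding h_def by (rule C) (use sa d in auto)
  finally show ?thesis by (simp add: c_def sa_def)
qed

lemma entire_zorder:
  assumes f: "f holomorphic_on UNIV" and ex: "f b \<noteq> 0"
  obtains G where "G holomorphic_on UNIV" "zorder f a \<ge> 0"
    "\<And>z. f z = (z - a) ^ nat (zorder f a) * G z" "G a \<noteq> 0" "f a = 0 \<longleftrightarrow> zorder f a > 0"
proof -
  from ex have ex': "\<exists>w\<in>UNIV. f w \<noteq> 0" by auto
  define n where "n = nat (zorder f a)"
  from zorder_exist_zero[OF f open_UNIV connected_UNIV UNIV_I ex', of a]
  have zg: "(if f a = 0 then 0 < zorder f a else zorder f a = 0)" and "\<exists>r>0. cball a r \<subseteq> UNIV \<and> zor_poly f a holomorphic_on cball a r \<and>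
     (\<forall>w\<in>cball a r. f w = zor_poly f a w * (w - a) ^ n \<and> zor_poly f a w \<noteq> 0)"
    unfolding n_def by blast+
  then obtain r where r: "r > 0" "zor_poly f a holomorphic_on cball a r"
    "\<And>w. w \<in> cball a r \<Longrightarrow> f w = zor_poly f a w * (w - a) ^ n" "\<And>w. w \<in> cball a r \<Longrightarrow> zor_poly f a w \<noteq> 0" by blast
  define G where "G z = (if z = a then zor_poly f a a else f z / (z - a) ^ n)" for z
  have Gz: "G z = zor_poly f a z" if "z \<in> ball a r" for z
    using r(3)[of z] that by (auto simp: G_def)
  have "G holomorphic_on ball a r \<union> (- {a})"
  proof (rule holomorphic_on_Un)
    have "zor_poly f a holomorphic_on ball a r" by (rule holomorphic_on_subset[OF r(2)]) auto
    thus "G holomorphic_on ball a r" by (rule holomorphic_transform) (use Gz in auto)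
    have "(\<lambda>z. f z / (z - a) ^ n) holomorphic_on - {a}"
      by (intro holomorphic_intros holomorphic_on_subset[OF f]) auto
    thus "G holomorphic_on - {a}" by (rule holomorphic_transform) (auto simp: G_def)
  qed auto
  moreover have "ball a r \<union> (- {a}) = UNIV" using r(1) by auto
  ultimately have G: "G holomorphic_on UNIV" by simp
  have fG: "f z = (z - a) ^ n * G z" for z
    using r(1) r(3)[of a] by (cases "z = a") (auto simp: G_def)
  have Ga: "G a \<noteq> 0" using r(1) r(4)[of a] by (simp add: G_def)
  show ?thesis
    by (rule that[OF G]) (use zg fG Ga in \<open>auto simp: n_def[symmetric] split: if_splits\<close>)
qed

text \<open>Divisibility is expressed by an entire quotient rather than by \<open>zorder\<close>, so
  it passes to products and rescalings by acting on the quotient, also for functions that might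
  vanish identically.\<close>

definition divisible_at :: "(complex \<Rightarrow> complex) \<Rightarrow> complex \<Rightarrow> nat \<Rightarrow> bool" where
  "divisible_at F a n \<longleftrightarrow> (\<exists>H. H holomorphic_on UNIV \<and> (\<forall>z. F z = (z - a) ^ n * H z))"

lemma divisible_atI: "H holomorphic_on UNIV \<Longrightarrow> (\<And>z. F z = (z - a) ^ n * H z) \<Longrightarrow> divisible_at F a n"
  by (auto simp: divisible_at_def)

lemma divisible_at_mult:
  assumes "divisible_at F a n" "G holomorphic_on UNIV"
  shows "divisible_at (\<lambda>z. F z * G z) a n" "divisible_at (\<lambda>z. G z * F z) a n"
proof -
  obtain H where H: "H holomorphic_on UNIV" "\<And>z. F z = (z - a) ^ n * H z"
    using assms(1) by (auto simp: divisible_at_def)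
  show "divisible_at (\<lambda>z. F z * G z) a n" "divisible_at (\<lambda>z. G z * F z) a n"
    by (rule divisible_atI[of "\<lambda>z. H z * G z"]; use H assms(2) in \<open>auto intro!: holomorphic_intros\<close>)+
qed

text \<open>Near each point a quotient exists once the power of \<open>z - a\<close> in
  \<open>f\<close> is cancelled. Two local quotients that differed at a point would differ nearby;
  then \<open>f\<close> would vanish on an open set and hence identically.\<close>

lemma entire_divide:
  assumes f: "f holomorphic_on UNIV" "f b \<noteq> 0" and F: "F holomorphic_on UNIV"
    and zo: "\<And>a. f a = 0 \<Longrightarrow> divisible_at F a (nat (zorder f a))"
  obtains h where "h holomorphic_on UNIV" "\<And>z. F z = f z * h z"
proof -
  have loc: "\<exists>r>0. \<exists>k. k holomorphic_on ball a r \<and> (\<forall>z\<in>ball a r. F z = f z * k z)" for a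
  proof -
    obtain G where G: "G holomorphic_on UNIV" "zorder f a \<ge> 0" "\<And>z. f z = (z - a) ^ nat (zorder f a) * G z" "G a \<noteq> 0" "f a = 0 \<longleftrightarrow> zorder f a > 0"
      using entire_zorder[OF f] by metis
    have "divisible_at F a (nat (zorder f a))"
    proof (cases "f a = 0")
      case False
      hence "zorder f a = 0" using G(2,5) by linarith
      thus ?thesis using F by (intro divisible_atI[of F]) auto
    qed (rule zo)
    then obtain H where H: "H holomorphic_on UNIV" "\<And>z. F z = (z - a) ^ nat (zorder f a) * H z"
      by (auto simp: divisible_at_def)
    have "continuous_on UNIV G" using G(1) by (rule holomorphic_on_imp_continuous_on)
    hence "isCont G a" by (simp add: continuous_on_eq_continuous_at)
    then obtain r where r: "r > 0" "\<forall>z. dist a z < r \<longrightarrow> G z \<noteq> 0" using continuous_at_avoid[of a G 0] G(4) by blast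
    define k where "k z = H z / G z" for z
    have "k holomorphic_on ball a r" unfolding k_def
      using r by (intro holomorphic_intros holomorphic_on_subset[OF H(1)] holomorphic_on_subset[OF G(1)]) auto
    moreover have "F z = f z * k z" if "z \<in> ball a r" for z
      using r that by (simp add: k_def G(3)[of z] H(2)[of z])
    ultimately show ?thesis using r(1) by blast
  qed
  then obtain R k where R: "\<And>a. R a > 0" and k: "\<And>a. k a holomorphic_on ball a (R a)" "\<And>a z. z \<in> ball a (R a) \<Longrightarrow> F z = f z * k a z" by metis
  define h where "h z = k z z" for z
  have Fh: "F z = f z * h z" for z unfolding h_def using k(2)[of z z] R[of z] by simp
  have hk: "h z = k a z" if z: "z \<in> ball a (R a)" for a z
  proof (rule ccontr)
    assume ne: "h z \<noteq> k a z"
    define U where "U = ball a (R a) \<inter> ball z (R z)"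
    have zU: "z \<in> U" "open U" using z R[of z] by (auto simp: U_def)
    have "continuous_on U (\<lambda>w. k z w - k a w)"
      using k(1) by (intro continuous_intros holomorphic_on_imp_continuous_on) (auto simp: U_def intro: holomorphic_on_subset)
    hence "isCont (\<lambda>w. k z w - k a w) z" using zU by (simp add: continuous_on_eq_continuous_at)
    moreover have "k z z - k a z \<noteq> 0" using ne by (simp add: h_def)
    ultimately obtain e where e: "e > 0" "\<forall>w. dist z w < e \<longrightarrow> k z w - k a w \<noteq> 0" using continuous_at_avoid[of z "\<lambda>w. k z w - k a w" 0] by auto
    have z0: "f w = 0" if "w \<in> U \<inter> ball z e" for w
    proof -
      have "f w * k z w = f w * k a w" using that k(2) unfolding U_def by (metis IntD1 IntD2)
      moreover have "k z w - k a w \<noteq> 0" using e(2) that by auto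
      ultimately show ?thesis by auto
    qed
    have "f b = 0"
      by (rule analytic_continuation_open[of "U \<inter> ball z e" UNIV f "\<lambda>_. 0"]) (use f z0 zU e in auto)
    thus False using f(2) by simp
  qed
  have "h holomorphic_on ball a (R a)" for a
    by (rule holomorphic_transform[OF k(1)]) (use hk in auto)
  hence "h holomorphic_on (\<Union>a. ball a (R a))" by (intro holomorphic_on_UN_open) auto
  moreover have "(\<Union>a. ball a (R a)) = UNIV" using R by auto
  ultimately show ?thesis using that Fh by simp
qed

text \<open>If the limit had order \<open>j < m a\<close>, approximants far along the sequence would
  be at least \<open>g / 2 * \<sigma> ^ j\<close> on a sector at \<open>a\<close>, and
  \<open>singular_weight_lower_bound\<close> would exceed \<open>C\<close>. The sector is truncated
  at distance \<open>d\<close>, so closeness to the limit and closeness of \<open>\<kappa>\<close>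
  to \<open>1\<close> are needed for a single index only.\<close>

lemma divisible_at_limit:
  fixes F :: "nat \<Rightarrow> complex \<Rightarrow> complex"
  assumes p: "p > 1" and \<kappa>: "\<And>n. 0 \<le> \<kappa> n" "\<And>n. \<kappa> n < 1" "\<kappa> \<longlonglongrightarrow> 1"
    and Z: "\<And>n. finite (Z n)" "\<And>n b. b \<in> Z n \<Longrightarrow> b \<noteq> 0" "eventually (\<lambda>n. a \<in> Z n) sequentially"
    and S: "\<And>n. (\<Sum>b\<in>Z n. real (m b) * cmod b powr (- p)) \<le> S" and a: "exp 2 \<le> cmod a"
    and F: "\<And>n. continuous_on UNIV (F n)"
    and C: "\<And>n b c. 1 \<le> b \<Longrightarrow> b \<le> c \<Longrightarrow> integral {b..c} (\<lambda>s. integral {0..2*pi} (\<lambda>t. (cmod (F n (of_real (exp s) * cis t)))\<^sup>2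
       * exp (- 2 * potential (\<kappa> n) p m (Z n) s t - 4 * s))) \<le> C"
    and G: "G holomorphic_on UNIV" "G b \<noteq> 0" and lim: "\<And>K. compact K \<Longrightarrow> uniform_limit K F G sequentially"
  shows "divisible_at G a (m a)"
proof -
  obtain H where H: "H holomorphic_on UNIV" "zorder G a \<ge> 0" "\<And>z. G z = (z - a) ^ nat (zorder G a) * H z" "H a \<noteq> 0"
    using entire_zorder[OF G] by metis
  define j where "j = nat (zorder G a)"
  have GH: "G z = (z - a) ^ j * H z" for z using H(3) by (simp add: j_def)
  have a1: "cmod a \<ge> 1" using a exp_ge_add_one_self[of 2] by linarith
  show ?thesis
  proof (cases "m a \<le> j")
    case True
    show ?thesis
    proof (rule divisible_atI)
      show "(\<lambda>z. (z - a) ^ (j - m a) * H z) holomorphic_on UNIV" by (intro holomorphic_intros H)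
      show "G z = (z - a) ^ m a * ((z - a) ^ (j - m a) * H z)" for z
        using True by (simp add: GH mult.assoc[symmetric] power_add[symmetric])
    qed
  next
    case False
    hence j: "j < m a" by simp
    define g where "g = cmod (H a) / 2"
    have g: "g > 0" using H(4) by (simp add: g_def)
    \<comment> \<open>The inner integral runs over \<open>{0..2*pi}\<close>, so the argument of
      \<open>a\<close> is moved into this interval; later \<open>e \<le> 2 * pi - \<theta>\<close>
      keeps the sector inside.\<close>
    define \<theta> where "\<theta> = (if Arg a \<ge> 0 then Arg a else Arg a + 2 * pi)"
    have \<theta>: "0 \<le> \<theta>" "\<theta> < 2 * pi" "cis \<theta> = cis (Arg a)"
      using Arg_bounded[of a] by (auto simp: \<theta>_def simp flip: cis_mult)
    have a_eq: "a = of_real (cmod a) * cis \<theta>" unfolding \<theta>(3) using rcis_cmod_Arg[of a] by (simp add: rcis_def)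
    have "continuous_on UNIV (\<lambda>w. cmod (H (a * exp w)))"
      by (intro continuous_intros continuous_on_compose2[OF holomorphic_on_imp_continuous_on[OF H(1)]]) auto
    hence "((\<lambda>w. cmod (H (a * exp w))) \<longlongrightarrow> cmod (H (a * exp 0))) (at 0)"
      unfolding continuous_on_eq_continuous_at[OF open_UNIV] isCont_def by blast
    hence "eventually (\<lambda>w. g < cmod (H (a * exp w))) (at 0)"
      by (rule order_tendstoD) (use g in \<open>simp add: g_def\<close>)
    then obtain \<delta> where \<delta>: "\<delta> > 0" "\<And>w. w \<noteq> 0 \<Longrightarrow> cmod w < \<delta> \<Longrightarrow> g < cmod (H (a * exp w))"
      unfolding eventually_at by auto
    define e where "e = min (min (\<delta> / 3) (1 / p)) (2 * pi - \<theta>)"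
    have e: "e > 0" "p * e \<le> 1" "\<theta> + e \<le> 2 * pi" "2 * e < \<delta>"
    proof -
      show "e > 0" using \<delta> p \<theta> by (simp add: e_def)
      have "e \<le> 1 / p" by (simp add: e_def)
      thus "p * e \<le> 1" using p by (simp add: field_simps)
      have "e \<le> \<delta> / 3" unfolding e_def by (meson min.cobounded1 order_trans)
      thus "2 * e < \<delta>" using \<delta>(1) by linarith
      show "\<theta> + e \<le> 2 * pi" by (simp add: e_def min_def)
    qed
    define pt where "pt \<sigma> \<phi> = of_real (exp (ln (cmod a) + \<sigma>)) * cis (\<theta> + \<phi>)" for \<sigma> \<phi>
    have pt: "pt \<sigma> \<phi> = a * exp (Complex \<sigma> \<phi>)" for \<sigma> \<phi>
    proof -
      have "pt \<sigma> \<phi> = (of_real (cmod a) * cis \<theta>) * (of_real (exp \<sigma>) * cis \<phi>)"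
      proof -
        have "exp (ln (cmod a)) = cmod a" using a1 by (intro exp_ln) linarith
        thus ?thesis by (simp only: pt_def exp_add cis_mult[symmetric] of_real_mult mult_ac)
      qed
      thus ?thesis unfolding a_eq[symmetric] by (simp add: exp_eq_polar)
    qed
    define R where "R = cmod a * exp e"
    have Gl: "g * \<sigma> ^ j \<le> cmod (G (pt \<sigma> \<phi>)) \<and> pt \<sigma> \<phi> \<in> cball 0 R" if \<sigma>: "0 < \<sigma>" "\<sigma> \<le> e" "0 \<le> \<phi>" "\<phi> \<le> \<sigma>" for \<sigma> \<phi>
    proof -
      define w where "w = Complex \<sigma> \<phi>"
      have w: "w \<noteq> 0" "cmod w < \<delta>" "cmod (exp w) = exp \<sigma>"
        using \<sigma> e(4) cmod_le[of w] by (auto simp: w_def complex_eq_iff)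
      have "\<sigma> \<le> exp \<sigma> - 1" using exp_ge_add_one_self[of \<sigma>] by linarith
      also have "\<dots> \<le> cmod (exp w - 1)" using norm_triangle_ineq2[of "exp w" 1] w(3) by simp
      also have "\<dots> \<le> cmod a * cmod (exp w - 1)" using a1 by (simp add: mult_le_cancel_right1)
      also have "\<dots> = cmod (pt \<sigma> \<phi> - a)" by (simp add: pt w_def norm_mult[symmetric] right_diff_distrib)
      finally have "\<sigma> ^ j * g \<le> cmod (pt \<sigma> \<phi> - a) ^ j * cmod (H (pt \<sigma> \<phi>))"
        using \<delta>(2)[OF w(1,2)] \<sigma> g by (intro mult_mono power_mono) (auto simp: pt w_def)
      moreover have "cmod (pt \<sigma> \<phi>) \<le> R" using \<sigma> w(3) by (simp add: pt R_def norm_mult w_def mult_left_mono)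
      ultimately show ?thesis by (simp add: GH norm_mult norm_power mult.commute)
    qed
    define A where "A = (g/2)\<^sup>2 * (inverse (14 * p\<^sup>2) ^ m a * exp (- 2 * (exp (p * (ln (cmod a) + 1)) * S) - 4 * (ln (cmod a) + 1)))"
    have A: "A > 0" using g p by (simp add: A_def)
    \<comment> \<open>Fixed before the index \<open>n\<close>, and such that
      \<open>A * ln (e / d) = \<bar>C\<bar> + A\<close>, which exceeds \<open>C\<close>.\<close>
    define d where "d = e * exp (- (\<bar>C\<bar> / A + 1))"
    have L: "\<bar>C\<bar> / A + 1 > 0" using A by (simp add: add_nonneg_pos)
    have d: "0 < d" "d < e"
    proof -
      have "exp (- (\<bar>C\<bar> / A + 1)) < 1" using L by (subst exp_less_one_iff) linarith
      thus "0 < d" "d < e" using e(1) by (auto simp: d_def)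
    qed
    have "eventually (\<lambda>n. \<forall>z\<in>cball 0 R. dist (F n z) (G z) < g * d ^ j / 2) sequentially"
      by (rule uniform_limitD[OF lim]) (use g d in auto)
    moreover have "eventually (\<lambda>n. \<kappa> n > 1 - d\<^sup>2) sequentially"
      by (rule order_tendstoD[OF \<kappa>(3)]) (use d in auto)
    ultimately have ev: "eventually (\<lambda>n. (\<forall>z\<in>cball 0 R. dist (F n z) (G z) < g * d ^ j / 2) \<and> \<kappa> n > 1 - d\<^sup>2 \<and> a \<in> Z n) sequentially"
      using Z(3) by eventually_elim auto
    then obtain n where n: "\<And>z. z \<in> cball 0 R \<Longrightarrow> dist (F n z) (G z) < g * d ^ j / 2" "\<kappa> n > 1 - d\<^sup>2" "a \<in> Z n"
      using eventually_happens'[OF sequentially_bot ev] by blast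
    have "A * ln (e / d) \<le> C" unfolding A_def
    proof (rule singular_weight_lower_bound[OF p \<kappa>(1,2) Z(1) n(3) Z(2) S a F C])
      show "g / 2 * \<sigma> ^ j \<le> cmod (F n (of_real (exp (ln (cmod a) + \<sigma>)) * cis (\<theta> + \<phi>)))"
        if \<sigma>: "d \<le> \<sigma>" "\<sigma> \<le> e" "0 \<le> \<phi>" "\<phi> \<le> \<sigma>" for \<sigma> \<phi>
      proof -
        have *: "g * \<sigma> ^ j \<le> cmod (G (pt \<sigma> \<phi>))" "pt \<sigma> \<phi> \<in> cball 0 R" using Gl[of \<sigma> \<phi>] \<sigma> d by auto
        have "g * d ^ j \<le> g * \<sigma> ^ j" using \<sigma> d g by (intro mult_left_mono power_mono) auto
        moreover have "cmod (G (pt \<sigma> \<phi>)) - cmod (F n (pt \<sigma> \<phi>)) \<le> dist (F n (pt \<sigma> \<phi>)) (G (pt \<sigma> \<phi>))"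
          unfolding dist_norm by (subst norm_minus_commute) (rule norm_triangle_ineq2)
        ultimately show ?thesis using *(1) n(1)[OF *(2)] by (simp add: pt_def)
      qed
    qed (use d e n g j \<theta> in auto)
    moreover have "ln (e / d) = \<bar>C\<bar> / A + 1" using e(1) by (simp add: d_def ln_div ln_mult exp_minus)
    ultimately have "\<bar>C\<bar> + A \<le> C" using A by (simp add: distrib_left)
    thus ?thesis using A by linarith
  qed
qed

section \<open>Entire functions with prescribed zeros and controlled growth\<close>

lemma prod_eq_exp_sum_ln:
  assumes "\<And>a. a \<in> Z \<Longrightarrow> u a \<ge> (0::real)"
  shows "(\<Prod>a\<in>Z. (1 + u a) ^ m a) = exp (\<Sum>a\<in>Z. real (m a) * ln (1 + u a))"
proof (cases "finite Z")
  case True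
  have "(1 + u a) ^ m a = exp (real (m a) * ln (1 + u a))" if "a \<in> Z" for a
    using assms[OF that] by (simp add: exp_of_nat_mult)
  thus ?thesis using True by (simp add: exp_sum)
qed simp

lemma sum_ln_le_powr:
  assumes r: "r \<ge> 0" and S: "(\<Sum>a\<in>Z. real (m a) * cmod a powr (- p)) \<le> S"
  shows "(\<Sum>a\<in>Z. real (m a) * ln (1 + (r / cmod a) powr p)) \<le> r powr p * S"
proof -
  have "(\<Sum>a\<in>Z. real (m a) * ln (1 + (r / cmod a) powr p)) \<le> (\<Sum>a\<in>Z. r powr p * (real (m a) * cmod a powr (- p)))"
  proof (rule sum_mono)
    fix a
    have "ln (1 + (r / cmod a) powr p) \<le> (r / cmod a) powr p" by (rule ln_add_one_self_le_self) simp
    also have "\<dots> = r powr p * cmod a powr (- p)" using r by (simp add: powr_divide powr_minus field_simps)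
    finally have "real (m a) * ln (1 + (r / cmod a) powr p) \<le> real (m a) * (r powr p * cmod a powr (- p))"
      by (rule mult_left_mono) simp
    thus "real (m a) * ln (1 + (r / cmod a) powr p) \<le> r powr p * (real (m a) * cmod a powr (- p))" by (simp only: mult_ac)
  qed
  also have "\<dots> = r powr p * (\<Sum>a\<in>Z. real (m a) * cmod a powr (- p))" by (rule sum_distrib_left[symmetric])
  also have "\<dots> \<le> r powr p * S" using S by (intro mult_left_mono) auto
  finally show ?thesis .
qed

lemma locally_bounded_limit:
  fixes F :: "nat \<Rightarrow> complex \<Rightarrow> complex"
  assumes hol: "\<And>n. F n holomorphic_on UNIV" and bd: "\<And>n z. cmod (F n z) \<le> B (cmod z)"
    and B: "\<And>x y. 0 \<le> x \<Longrightarrow> x \<le> y \<Longrightarrow> B x \<le> B y"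
  shows "\<exists>G r. G holomorphic_on UNIV \<and> strict_mono (r :: nat \<Rightarrow> nat) \<and> (\<forall>z. (\<lambda>n. F (r n) z) \<longlonglongrightarrow> G z) \<and>
    (\<forall>K. compact K \<longrightarrow> uniform_limit K (\<lambda>n. F (r n)) G sequentially)"
proof -
  have "\<exists>C. \<forall>h\<in>range F. \<forall>z\<in>K. cmod (h z) \<le> C" if K: "compact K" for K
  proof -
    obtain R where "\<And>z. z \<in> K \<Longrightarrow> cmod z \<le> R" using compact_imp_bounded[OF K] by (auto simp: bounded_iff)
    hence "cmod (F n z) \<le> B R" if "z \<in> K" for n z using that bd[of n z] B[of "cmod z" R] by fastforce
    thus ?thesis by blast
  qed
  then obtain G r where "G holomorphic_on UNIV" "strict_mono (r :: nat \<Rightarrow> nat)"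
    "\<And>z. z \<in> UNIV \<Longrightarrow> (\<lambda>n. F (r n) z) \<longlonglongrightarrow> G z" "\<And>K. compact K \<Longrightarrow> K \<subseteq> UNIV \<Longrightarrow> uniform_limit K (F \<circ> r) G sequentially"
    using Montel[of UNIV "range F" F] hol by (auto simp: image_iff) metis
  thus ?thesis by (intro exI[of _ G] exI[of _ r]) (simp add: o_def)
qed

abbreviation canonical_product :: "(complex \<Rightarrow> nat) \<Rightarrow> complex set \<Rightarrow> complex \<Rightarrow> complex" where
  "canonical_product m Z z \<equiv> (\<Prod>a\<in>Z. (1 - z / a) ^ m a)"

lemma canonical_product_remove:
  assumes Z: "finite Z" "0 \<notin> Z" "a \<in> Z"
  shows "canonical_product m Z z = (z - a) ^ m a * ((- inverse a) ^ m a * canonical_product m (Z - {a}) z)"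
proof -
  have a: "a \<noteq> 0" using Z by metis
  have "1 - z / a = (z - a) * (- inverse a)" using a by (simp add: field_simps)
  hence "(1 - z / a) ^ m a = (z - a) ^ m a * (- inverse a) ^ m a" by (simp only: power_mult_distrib)
  thus ?thesis using Z by (subst prod.remove[of Z a]) (auto simp: mult.assoc)
qed

lemma canonical_product_holomorphic: "finite Z \<Longrightarrow> 0 \<notin> Z \<Longrightarrow> canonical_product m Z holomorphic_on A"
  by (intro holomorphic_intros) auto

lemma divisible_at_canonical_product:
  assumes Z: "finite Z" "0 \<notin> Z" "a \<in> Z"
  shows "divisible_at (canonical_product m Z) a (m a)"
  by (rule divisible_atI[OF _ canonical_product_remove[OF Z]],
      intro holomorphic_on_mult holomorphic_on_const canonical_product_holomorphic) (use Z in auto)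

lemma norm_canonical_product_le: "cmod (canonical_product m Z z) \<le> (\<Prod>a\<in>Z. (1 + cmod z / cmod a) ^ m a)"
proof -
  have "cmod (1 - z / a) \<le> 1 + cmod z / cmod a" for a
    using norm_triangle_ineq4[of 1 "z / a"] by (simp add: norm_divide)
  thus ?thesis unfolding prod_norm[symmetric] norm_power by (intro prod_mono) (auto intro!: power_mono)
qed

text \<open>The bound by \<open>K\<close> times the product over all of \<open>A\<close> is phrased
  through upper bounds \<open>B\<close> of its finite partial sums of logarithms. No infinite
  product has to be formed, and a divergent one imposes no condition.\<close>

definition majorized :: "real \<Rightarrow> (complex \<Rightarrow> nat) \<Rightarrow> complex set \<Rightarrow> (complex \<Rightarrow> complex) \<Rightarrow> real \<Rightarrow> bool" where
  "majorized p m A F K \<longleftrightarrow> F holomorphic_on UNIV \<and> F 0 \<noteq> 0 \<and> K > 0 \<and> (\<forall>a\<in>A. divisible_at F a (m a)) \<and>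
     (\<forall>z B. (\<forall>Z. finite Z \<longrightarrow> Z \<subseteq> A \<longrightarrow> (\<Sum>a\<in>Z. real (m a) * ln (1 + (cmod z / cmod a) powr p)) \<le> B) \<longrightarrow> cmod (F z) \<le> K * exp B)"

lemma majorizedI:
  assumes "F holomorphic_on UNIV" "F 0 \<noteq> 0" "K > 0" "\<And>a. a \<in> A \<Longrightarrow> divisible_at F a (m a)"
    "\<And>z B. (\<And>Z. finite Z \<Longrightarrow> Z \<subseteq> A \<Longrightarrow> (\<Sum>a\<in>Z. real (m a) * ln (1 + (cmod z / cmod a) powr p)) \<le> B) \<Longrightarrow> cmod (F z) \<le> K * exp B"
  shows "majorized p m A F K"
  using assms unfolding majorized_def by blast

text \<open>For \<open>p = 1\<close> each factor satisfies \<open>\<bar>1 - z / a\<bar> \<le> 1 +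
  \<bar>z\<bar> / \<bar>a\<bar>\<close> with no loss. The zeros survive in the limit because the
  partial products divided by \<open>(z - a) ^ m a\<close> obey the same local bound and have a
  convergent subsequence too.\<close>

lemma exists_majorized_one:
  assumes A: "0 \<notin> A" "\<And>R. finite {a\<in>A. cmod a \<le> R}" and a1: "\<And>a. a \<in> A \<Longrightarrow> cmod a \<ge> 1"
    and S: "\<And>Z. finite Z \<Longrightarrow> Z \<subseteq> A \<Longrightarrow> (\<Sum>a\<in>Z. real (m a) * cmod a powr (- 1)) \<le> S"
  shows "\<exists>F K. majorized 1 m A F K"
proof -
  define Z where "Z n = {a\<in>A. cmod a \<le> real n}" for n
  have Z: "finite (Z n)" "0 \<notin> Z n" "Z n \<subseteq> A" for n using A by (auto simp: Z_def)
  have S0: "S \<ge> 0" using S[of "{}"] by simp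
  have bd: "cmod (canonical_product m Y z) \<le> exp (\<Sum>a\<in>Y. real (m a) * ln (1 + (cmod z / cmod a) powr 1))" for Y z
  proof -
    have "(\<Prod>a\<in>Y. (1 + cmod z / cmod a) ^ m a) = exp (\<Sum>a\<in>Y. real (m a) * ln (1 + (cmod z / cmod a) powr 1))"
      by (subst prod_eq_exp_sum_ln) auto
    thus ?thesis using norm_canonical_product_le[where m = m and Z = Y and z = z] by simp
  qed
  have bd2: "cmod (canonical_product m Y z) \<le> exp (cmod z powr 1 * S)" if "finite Y" "Y \<subseteq> A" for Y z
    using order_trans[OF bd[where Y = Y and z = z], of "exp (cmod z powr 1 * S)"] sum_ln_le_powr[OF norm_ge_zero[of z] S[OF that]] by simp
  have mono: "exp (x powr 1 * S) \<le> exp (y powr 1 * S)" if "0 \<le> x" "x \<le> y" for x y :: real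
    using that S0 by (auto intro!: mult_right_mono)
  obtain G r where G: "G holomorphic_on UNIV" and r: "strict_mono (r :: nat \<Rightarrow> nat)" and
    lim: "\<And>z. (\<lambda>n. canonical_product m (Z (r n)) z) \<longlonglongrightarrow> G z"
    using locally_bounded_limit[of "\<lambda>n. canonical_product m (Z n)", OF canonical_product_holomorphic[OF Z(1,2)] bd2[OF Z(1,3)] mono]
    by blast
  have "(\<lambda>n. canonical_product m (Z (r n)) 0) \<longlonglongrightarrow> 1" by simp
  hence G0: "G 0 = 1" using lim[of 0] LIMSEQ_unique by blast
  have "majorized 1 m A G 1"
  proof (rule majorizedI[OF G])
    show "G 0 \<noteq> 0" using G0 by simp
    show "divisible_at G a (m a)" if a: "a \<in> A" for a
    proof -
      \<comment> \<open>From index \<open>k\<close> on, the partial product contains the factor of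
        \<open>a\<close>; the shift by \<open>k\<close> makes this hold for every
        \<open>n\<close>.\<close>
      define k where "k = nat \<lceil>cmod a\<rceil>"
      have aZ: "a \<in> Z (r (n + k))" for n
      proof -
        have "k \<le> r (n + k)" using seq_suble[OF r, of "n + k"] by linarith
        hence "cmod a \<le> real (r (n + k))" using real_nat_ceiling_ge[of "cmod a"] unfolding k_def[symmetric] by linarith
        thus ?thesis using a by (simp add: Z_def)
      qed
      define c where "c = (- inverse a) ^ m a"
      have c: "canonical_product m (Z (r (n + k))) z = (z - a) ^ m a * (c * canonical_product m (Z (r (n + k)) - {a}) z)" for n z
        unfolding c_def by (rule canonical_product_remove[OF Z(1,2) aZ])
      define H where "H n z = c * canonical_product m (Z (r (n + k)) - {a}) z" for n z
      have Hh: "H n holomorphic_on UNIV" for n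
        unfolding H_def by (intro holomorphic_on_mult holomorphic_on_const canonical_product_holomorphic) (use Z in auto)
      have Hb: "cmod (H n z) \<le> exp (cmod z powr 1 * S)" for n z
      proof -
        have "cmod (- inverse a) \<le> 1" using a1[OF a] by (auto simp: norm_inverse inverse_le_1_iff)
        hence "cmod c \<le> 1" unfolding c_def norm_power by (intro power_le_one) auto
        moreover have "cmod (canonical_product m (Z (r (n + k)) - {a}) z) \<le> exp (cmod z powr 1 * S)"
          by (rule bd2) (use Z in auto)
        ultimately have "cmod c * cmod (canonical_product m (Z (r (n + k)) - {a}) z) \<le> 1 * exp (cmod z powr 1 * S)"
          by (intro mult_mono) auto
        thus ?thesis by (simp add: H_def norm_mult)
      qed
      obtain H' s where H': "H' holomorphic_on UNIV" and s: "strict_mono (s :: nat \<Rightarrow> nat)" and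
        limH: "\<And>z. (\<lambda>n. H (s n) z) \<longlonglongrightarrow> H' z"
        using locally_bounded_limit[of H, OF Hh Hb mono] by blast
      have "G z = (z - a) ^ m a * H' z" for z
      proof -
        have sk: "strict_mono (\<lambda>n. s n + k)" using s by (simp add: strict_mono_def)
        have "(\<lambda>n. (z - a) ^ m a * H (s n) z) \<longlonglongrightarrow> (z - a) ^ m a * H' z" by (intro tendsto_intros limH)
        moreover have "(\<lambda>n. (z - a) ^ m a * H (s n) z) \<longlonglongrightarrow> G z"
          unfolding H_def c[symmetric] using LIMSEQ_subseq_LIMSEQ[OF lim[of z] sk] by (simp add: o_def)
        ultimately show ?thesis by (rule LIMSEQ_unique[rotated])
      qed
      thus ?thesis by (rule divisible_atI[OF H'])
    qed
    show "(0::real) < 1" by simp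
    show "cmod (G z) \<le> 1 * exp B" if "\<And>Z. finite Z \<Longrightarrow> Z \<subseteq> A \<Longrightarrow> (\<Sum>a\<in>Z. real (m a) * ln (1 + (cmod z / cmod a) powr 1)) \<le> B" for z B
      unfolding mult_1
    proof (rule LIMSEQ_le_const2[OF tendsto_norm[OF lim[of z]]])
      have "cmod (canonical_product m (Z (r n)) z) \<le> exp B" for n
        using order_trans[OF bd[where Y = "Z (r n)" and z = z], of "exp B"] that[OF Z(1,3)] by simp
      thus "\<exists>N. \<forall>n\<ge>N. cmod (canonical_product m (Z (r n)) z) \<le> exp B" by blast
    qed
  qed
  thus ?thesis by blast
qed

lemma one_plus_le_powr:
  assumes p: "p \<ge> 1" and x: "x \<ge> (0::real)"
  shows "(1 + x) powr p \<le> 2 powr p * (1 + x powr p)" "1 + x \<le> 2 * (1 + x powr p)"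
proof -
  have "1 + x \<le> 2 * max 1 x" by simp
  hence "(1 + x) powr p \<le> (2 * max 1 x) powr p" using p x by (intro powr_mono2) auto
  also have "\<dots> = 2 powr p * max 1 x powr p" using x by (simp add: powr_mult)
  also have "\<dots> \<le> 2 powr p * (1 + x powr p)" by (intro mult_left_mono) (auto simp: max_def)
  finally show "(1 + x) powr p \<le> 2 powr p * (1 + x powr p)" .
  have "x \<le> 1 + x powr p"
  proof (cases "x \<le> 1")
    case False
    hence "x powr 1 \<le> x powr p" using p by (intro powr_mono) auto
    thus ?thesis using False by simp
  qed (simp add: add_increasing2)
  moreover have "0 \<le> x powr p" by simp
  ultimately have "1 + x \<le> 2 + x powr p" "2 + x powr p \<le> 2 * (1 + x powr p)" by simp_all
  thus "1 + x \<le> 2 * (1 + x powr p)" by (rule order_trans)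
qed

lemma exists_majorized_finite:
  assumes p: "p \<ge> 1" and A: "0 \<notin> A" "finite A"
  shows "\<exists>F K. majorized p m A F K"
proof -
  have "majorized p m A (canonical_product m A) (2 ^ (\<Sum>a\<in>A. m a))"
  proof (rule majorizedI)
  show "divisible_at (canonical_product m A) a (m a)" if "a \<in> A" for a
      by (rule divisible_at_canonical_product[OF A(2,1) that])
  fix z B assume B: "\<And>Z. finite Z \<Longrightarrow> Z \<subseteq> A \<Longrightarrow> (\<Sum>a\<in>Z. real (m a) * ln (1 + (cmod z / cmod a) powr p)) \<le> B"
  have "(\<Prod>a\<in>A. (1 + cmod z / cmod a) ^ m a) \<le> (\<Prod>a\<in>A. (2 * (1 + (cmod z / cmod a) powr p)) ^ m a)"
    by (intro prod_mono conjI power_mono one_plus_le_powr(2) p) auto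
  also have "\<dots> = 2 ^ (\<Sum>a\<in>A. m a) * (\<Prod>a\<in>A. (1 + (cmod z / cmod a) powr p) ^ m a)"
    by (simp only: power_mult_distrib prod.distrib power_sum)
  also have "(\<Prod>a\<in>A. (1 + (cmod z / cmod a) powr p) ^ m a) \<le> exp B"
    by (subst prod_eq_exp_sum_ln) (use B[OF A(2)] in auto)
  finally show "cmod (canonical_product m A z) \<le> 2 ^ (\<Sum>a\<in>A. m a) * exp B"
    using norm_canonical_product_le[where m = m and Z = A and z = z] by simp
qed (use A canonical_product_holomorphic in auto)
  thus ?thesis by blast
qed

text \<open>A linear factor grows like \<open>r\<close>, while the bound allows
  \<open>r powr p\<close>; each of the zeros in \<open>Z\<close>, counted with multiplicity, thus
  gains \<open>(1 + r) powr (p - 1)\<close>. Enough of them gain the lost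
  \<open>(1 + r) powr (p + 2)\<close>.\<close>

lemma absorb_polynomial_factor:
  assumes p: "p > 1" and Z: "\<And>a. a \<in> Z \<Longrightarrow> 1 \<le> cmod a \<and> cmod a \<le> R" and R: "R \<ge> 1"
    and M: "p + 2 \<le> (p - 1) * real (\<Sum>a\<in>Z. m a)" and r: "r \<ge> 0"
  shows "(1 + r) powr (p + 2) * (\<Prod>a\<in>Z. (1 + r / cmod a) ^ m a)
     \<le> (R powr (p - 1) * 2 powr p) ^ (\<Sum>a\<in>Z. m a) * (\<Prod>a\<in>Z. (1 + (r / cmod a) powr p) ^ m a)"
proof -
  define y where "y = (1 + r) powr (p - 1)"
  have *: "y * (1 + r / cmod a) \<le> R powr (p - 1) * 2 powr p * (1 + (r / cmod a) powr p)" if a: "a \<in> Z" for a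
  proof -
    define x where "x = r / cmod a"
    have a1: "1 \<le> cmod a" "cmod a \<le> R" using Z[OF a] by auto
    have x: "x \<ge> 0" using r by (simp add: x_def)
    have "r = cmod a * x" using a1 by (auto simp: x_def)
    also have "\<dots> \<le> R * x" using a1 x by (intro mult_right_mono) auto
    finally have "1 + r \<le> R * (1 + x)" using R by (simp add: distrib_left)
    hence "y \<le> (R * (1 + x)) powr (p - 1)" unfolding y_def using r p by (intro powr_mono2) auto
    also have "\<dots> = R powr (p - 1) * (1 + x) powr (p - 1)" by (rule powr_mult)
    finally have "y * (1 + x) \<le> R powr (p - 1) * (1 + x) powr (p - 1) * (1 + x)" using x by (intro mult_right_mono) auto
    also have "\<dots> = R powr (p - 1) * (1 + x) powr p" using x powr_mult_base[of "1 + x" "p - 1"] by (simp add: mult_ac)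
    also have "\<dots> \<le> R powr (p - 1) * (2 powr p * (1 + x powr p))"
      using one_plus_le_powr(1)[of p x] p x by (intro mult_left_mono) auto
    finally show ?thesis by (simp add: x_def mult.assoc)
  qed
  have "(1 + r) powr (p + 2) \<le> (1 + r) powr ((p - 1) * real (\<Sum>a\<in>Z. m a))" using M r by (intro powr_mono) auto
  also have "\<dots> = y ^ (\<Sum>a\<in>Z. m a)" unfolding y_def powr_powr[symmetric] by (rule powr_realpow) (use r in simp)
  finally have "(1 + r) powr (p + 2) * (\<Prod>a\<in>Z. (1 + r / cmod a) ^ m a) \<le> y ^ (\<Sum>a\<in>Z. m a) * (\<Prod>a\<in>Z. (1 + r / cmod a) ^ m a)"
    using r by (intro mult_right_mono prod_nonneg) auto
  also have "\<dots> = (\<Prod>a\<in>Z. (y * (1 + r / cmod a)) ^ m a)" by (simp only: power_mult_distrib prod.distrib power_sum)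
  also have "\<dots> \<le> (\<Prod>a\<in>Z. (R powr (p - 1) * 2 powr p * (1 + (r / cmod a) powr p)) ^ m a)"
    using r by (intro prod_mono conjI power_mono * zero_le_power) (auto simp: y_def)
  also have "\<dots> = (R powr (p - 1) * 2 powr p) ^ (\<Sum>a\<in>Z. m a) * (\<Prod>a\<in>Z. (1 + (r / cmod a) powr p) ^ m a)"
    by (simp only: power_mult_distrib prod.distrib power_sum)
  finally show ?thesis .
qed

text \<open>A finite reserve \<open>Z0\<close> of zeros is realized by linear factors and pays for
  the polynomial loss of the \<open>L\<^sup>2\<close> method, which produces the other zeros. If
  \<open>A\<close> is finite such a reserve may not exist, but then the full product of linear
  factors suffices.\<close>

lemma exists_majorized_power:
  assumes p: "p > 1" and A: "\<And>R. finite {a\<in>A. cmod a \<le> R}" and a2: "\<And>a. a \<in> A \<Longrightarrow> exp 2 \<le> cmod a"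
    and m: "\<And>a. a \<in> A \<Longrightarrow> m a \<ge> 1"
    and S: "\<And>Z. finite Z \<Longrightarrow> Z \<subseteq> A \<Longrightarrow> (\<Sum>a\<in>Z. real (m a) * cmod a powr (- p)) \<le> S"
  shows "\<exists>F K. majorized p m A F K"
proof (cases "finite A")
  case True
  have "(0::real) < exp 2" by simp
  hence "0 \<notin> A" using a2[of 0] by auto
  thus ?thesis using exists_majorized_finite[OF less_imp_le[OF p]] True by blast
next
  case False
  have a1: "cmod a \<ge> 1" if "a \<in> A" for a using a2[OF that] exp_ge_add_one_self[of 2] by linarith
  \<comment> \<open>The number of zeros, each of multiplicity at least \<open>1\<close>, needed for
    \<open>absorb_polynomial_factor\<close>.\<close>
  obtain n :: nat where "(p + 2) / (p - 1) < real n" using reals_Archimedean2 by blast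
  hence n: "p + 2 \<le> (p - 1) * real n" using p by (simp add: pos_divide_less_eq mult.commute)
  obtain Z0 where Z0: "finite Z0" "card Z0 = n" "Z0 \<subseteq> A" using infinite_arbitrarily_large[OF False] by blast
  have "n \<le> (\<Sum>a\<in>Z0. m a)" using sum_mono[of Z0 "\<lambda>_. 1" m] m Z0 by auto
  hence "(p - 1) * real n \<le> (p - 1) * real (\<Sum>a\<in>Z0. m a)" using p by (intro mult_left_mono) (auto simp del: of_nat_sum)
  hence M: "p + 2 \<le> (p - 1) * real (\<Sum>a\<in>Z0. m a)" using n by linarith
  define R where "R = Max (insert 1 (cmod ` Z0))"
  have R: "R \<ge> 1" "\<And>a. a \<in> Z0 \<Longrightarrow> cmod a \<le> R" using Z0 by (auto simp: R_def)
  define Z where "Z k = {a\<in>A. cmod a \<le> real k} - Z0" for k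
  have Z: "finite (Z k)" "\<And>a. a \<in> Z k \<Longrightarrow> exp 2 \<le> cmod a" "\<And>a. a \<in> Z k \<Longrightarrow> a \<noteq> 0" "Z k \<subseteq> A" "Z k \<inter> Z0 = {}" for k
    using A a2 a1 by (force simp: Z_def)+
  note SZ = S[OF Z(1,4)]
  have S0: "S \<ge> 0" using S[of "{}"] by simp
  define \<kappa> where "\<kappa> k = 1 - 1 / (real k + 2)" for k :: nat
  have \<kappa>: "0 \<le> \<kappa> k" "\<kappa> k < 1" for k by (auto simp: \<kappa>_def)
  have \<kappa>l: "\<kappa> \<longlonglongrightarrow> 1" unfolding \<kappa>_def by real_asymp
  define C where "C = 8 * pi * (1 + exp 2)\<^sup>2 * exp (4 * exp p * S)"
  have C0: "C \<ge> 0" by (simp add: C_def)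
  define P where "P k N x \<longleftrightarrow> (\<forall>b c. 1 \<le> b \<longrightarrow> b \<le> c \<longrightarrow> integral {b..c} (\<lambda>s. integral {0..2*pi} (\<lambda>t. (cmod (\<Sum>i\<le>N. x i * (of_real (exp s) * cis t) ^ i))\<^sup>2
       * exp (- 2 * potential (\<kappa> k) p m (Z k) s t - 4 * s))) \<le> C)" for k N and x :: "nat \<Rightarrow> complex"
  have "\<exists>N x. x 0 = 1 \<and> P k N x" for k
    by (rule exists_weighted_polynomial[OF p \<kappa> Z(1,2) SZ]) (auto simp: P_def C_def)
  then obtain N x where x0: "\<And>k. x k 0 = 1" and "\<And>k. P k (N k) (x k)" by metis
  hence x: "integral {b..c} (\<lambda>s. integral {0..2*pi} (\<lambda>t. (cmod (\<Sum>i\<le>N k. x k i * (of_real (exp s) * cis t) ^ i))\<^sup>2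
       * exp (- 2 * potential (\<kappa> k) p m (Z k) s t - 4 * s))) \<le> C" if "1 \<le> b" "b \<le> c" for k b c
    using that unfolding P_def by blast
  define F where "F k z = (\<Sum>i\<le>N k. x k i * z ^ i)" for k z
  define K0 where "K0 = sqrt (4 * p\<^sup>2 * C * exp (4 * S + 4) / pi) * exp (S * exp p + p + 2)"
  have K0: "K0 \<ge> 0" using C0 by (simp add: K0_def)
  have Fh: "F k holomorphic_on UNIV" for k unfolding F_def by (intro holomorphic_intros)
  have Fb: "cmod (F k z) \<le> K0 * (1 + cmod z) powr (p + 2) * exp (\<Sum>a\<in>Z k. real (m a) * ln (1 + (cmod z / cmod a) powr p))" for k z
  proof -
    have "cmod (F k z) \<le> K0 * (1 + cmod z) powr (p + 2) * (\<Prod>a\<in>Z k. (1 + (cmod z / cmod a) powr p) ^ m a)"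
      unfolding F_def K0_def by (rule polynomial_growth_bound[OF p \<kappa> Z(1,3) SZ C0 x])
    also have "(\<Prod>a\<in>Z k. (1 + (cmod z / cmod a) powr p) ^ m a) = exp (\<Sum>a\<in>Z k. real (m a) * ln (1 + (cmod z / cmod a) powr p))"
      by (rule prod_eq_exp_sum_ln) simp
    finally show ?thesis .
  qed
  have Fb2: "cmod (F k z) \<le> K0 * (1 + cmod z) powr (p + 2) * exp (cmod z powr p * S)" for k z
    by (rule order_trans[OF Fb])
       (use K0 sum_ln_le_powr[OF norm_ge_zero[of z] SZ[of k]] in \<open>auto intro!: mult_left_mono\<close>)
  have mono: "K0 * (1 + u) powr (p + 2) * exp (u powr p * S) \<le> K0 * (1 + v) powr (p + 2) * exp (v powr p * S)" if "0 \<le> u" "u \<le> v" for u v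
    using that p S0 K0 by (intro mult_mono) (auto intro!: mult_left_mono mult_right_mono powr_mono2)
  obtain G r where G: "G holomorphic_on UNIV" and r: "strict_mono (r :: nat \<Rightarrow> nat)" and
    lim: "\<And>z. (\<lambda>k. F (r k) z) \<longlonglongrightarrow> G z" and ulim: "\<And>Y. compact Y \<Longrightarrow> uniform_limit Y (\<lambda>k. F (r k)) G sequentially"
    using locally_bounded_limit[of F, OF Fh Fb2 mono] by blast
  have "(\<lambda>k. F (r k) 0) \<longlonglongrightarrow> 1" by (simp add: F_def x0)
  hence G0: "G 0 = 1" using lim[of 0] LIMSEQ_unique by blast
  have divG: "divisible_at G a (m a)" if a: "a \<in> A - Z0" for a
  proof (rule divisible_at_limit[of p "\<lambda>k. \<kappa> (r k)" "\<lambda>k. Z (r k)" a m S "\<lambda>k. F (r k)" C G 0])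
    show "eventually (\<lambda>k. a \<in> Z (r k)) sequentially"
      using eventually_ge_at_top[of "nat \<lceil>cmod a\<rceil>"]
    proof eventually_elim
      case (elim k)
      hence "nat \<lceil>cmod a\<rceil> \<le> r k" using seq_suble[OF r, of k] by linarith
      hence "cmod a \<le> real (r k)" using real_nat_ceiling_ge[of "cmod a"] by linarith
      thus ?case using a by (simp add: Z_def)
    qed
    show "(\<lambda>k. \<kappa> (r k)) \<longlonglongrightarrow> 1" using LIMSEQ_subseq_LIMSEQ[OF \<kappa>l r] by (simp add: o_def)
    show "continuous_on UNIV (F (r k))" for k using Fh by (rule holomorphic_on_imp_continuous_on)
    show "integral {b..c} (\<lambda>s. integral {0..2*pi} (\<lambda>t. (cmod (F (r k) (of_real (exp s) * cis t)))\<^sup>2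
       * exp (- 2 * potential (\<kappa> (r k)) p m (Z (r k)) s t - 4 * s))) \<le> C" if "1 \<le> b" "b \<le> c" for k b c
      unfolding F_def by (rule x[OF that])
  qed (use p \<kappa> Z SZ a a2 G G0 ulim in auto)
  have Z00: "0 \<notin> Z0" using Z0 a1[of 0] by auto
  define c where "c = (R powr (p - 1) * 2 powr p) ^ (\<Sum>a\<in>Z0. m a)"
  have c: "c > 0" using R by (simp add: c_def)
  \<comment> \<open>\<open>K0 + 1\<close> in place of \<open>K0\<close> guarantees a positive
    constant.\<close>
  have "majorized p m A (\<lambda>z. canonical_product m Z0 z * G z) ((K0 + 1) * c)"
  proof (rule majorizedI)
    show hol: "(\<lambda>z. canonical_product m Z0 z * G z) holomorphic_on UNIV"
      by (intro holomorphic_on_mult G canonical_product_holomorphic Z0 Z00)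
    show "canonical_product m Z0 0 * G 0 \<noteq> 0" using G0 Z0 by simp
    show "(K0 + 1) * c > 0" using K0 c by simp
    show "divisible_at (\<lambda>z. canonical_product m Z0 z * G z) a (m a)" if a: "a \<in> A" for a
    proof (cases "a \<in> Z0")
      case True
      have "divisible_at (canonical_product m Z0) a (m a)"
        by (rule divisible_at_canonical_product[OF Z0(1) Z00 True])
      thus ?thesis using G by (rule divisible_at_mult)
    next
      case False
      thus ?thesis using a divG Z0 Z00 by (intro divisible_at_mult(2) canonical_product_holomorphic) auto
    qed
    fix z B assume B: "\<And>Z. finite Z \<Longrightarrow> Z \<subseteq> A \<Longrightarrow> (\<Sum>a\<in>Z. real (m a) * ln (1 + (cmod z / cmod a) powr p)) \<le> B"
    \<comment> \<open>\<open>s\<close> is the share of \<open>Z0\<close> in \<open>B\<close>. As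
      \<open>Z (r k)\<close> is disjoint from \<open>Z0\<close>, the polynomials obey the bound with
      \<open>B - s\<close>, and the linear factors restore \<open>exp s\<close>.\<close>
    define s where "s = (\<Sum>a\<in>Z0. real (m a) * ln (1 + (cmod z / cmod a) powr p))"
    have "cmod (F (r k) z) \<le> K0 * (1 + cmod z) powr (p + 2) * exp (B - s)" for k
    proof -
      have "(\<Sum>a\<in>Z (r k). real (m a) * ln (1 + (cmod z / cmod a) powr p)) + s \<le> B"
        using B[of "Z (r k) \<union> Z0"] Z[of "r k"] Z0 by (simp add: s_def sum.union_disjoint)
      thus ?thesis using K0 by (intro order_trans[OF Fb] mult_left_mono) auto
    qed
    hence Gb: "cmod (G z) \<le> K0 * (1 + cmod z) powr (p + 2) * exp (B - s)"
      by (intro LIMSEQ_le_const2[OF tendsto_norm[OF lim[of z]]]) blast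
    have ex: "(\<Prod>a\<in>Z0. (1 + (cmod z / cmod a) powr p) ^ m a) = exp s" unfolding s_def by (rule prod_eq_exp_sum_ln) auto
    have ab: "(1 + cmod z) powr (p + 2) * (\<Prod>a\<in>Z0. (1 + cmod z / cmod a) ^ m a) \<le> c * exp s"
      unfolding c_def ex[symmetric] using Z0 a1 R by (intro absorb_polynomial_factor p M) auto
    have "cmod (canonical_product m Z0 z * G z) \<le> (\<Prod>a\<in>Z0. (1 + cmod z / cmod a) ^ m a) * (K0 * (1 + cmod z) powr (p + 2) * exp (B - s))"
      unfolding norm_mult by (intro mult_mono norm_canonical_product_le Gb prod_nonneg) auto
    also have "\<dots> = K0 * exp (B - s) * ((1 + cmod z) powr (p + 2) * (\<Prod>a\<in>Z0. (1 + cmod z / cmod a) ^ m a))" by (simp only: mult_ac)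
    also have "\<dots> \<le> (K0 + 1) * exp (B - s) * (c * exp s)"
      using K0 c by (intro mult_mono ab mult_nonneg_nonneg prod_nonneg) auto
    also have "\<dots> = (K0 + 1) * c * exp B" by (simp add: exp_diff)
    finally show "cmod (canonical_product m Z0 z * G z) \<le> (K0 + 1) * c * exp B" .
  qed
  thus ?thesis by blast
qed

section \<open>The multiplier\<close>

text \<open>Multiplying the variable by \<open>exp 2 / \<delta>\<close> moves every zero beyond
  modulus \<open>exp 2\<close>. The ratios \<open>\<bar>z\<bar> / \<bar>a\<bar>\<close>, and with
  them the majorant, are unaffected.\<close>

lemma exists_majorized:
  assumes p: "p \<ge> 1" and A: "\<And>R. finite {a\<in>A. cmod a \<le> R}" and \<delta>: "\<delta> > 0" "\<And>a. a \<in> A \<Longrightarrow> \<delta> \<le> cmod a"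
    and m: "\<And>a. a \<in> A \<Longrightarrow> m a \<ge> 1"
    and S: "\<And>Z. finite Z \<Longrightarrow> Z \<subseteq> A \<Longrightarrow> (\<Sum>a\<in>Z. real (m a) * cmod a powr (- p)) \<le> S"
  shows "\<exists>F K. majorized p m A F K"
proof -
  define l where "l = exp 2 / \<delta>"
  define c where "c = complex_of_real l"
  have l: "l > 0" using \<delta> by (simp add: l_def)
  have c: "c \<noteq> 0" "cmod c = l" using l by (auto simp: c_def)
  define A' where "A' = (\<lambda>a. c * a) ` A"
  define m' where "m' b = m (b / c)" for b
  have m'c: "m' (c * a) = m a" for a using c by (simp add: m'_def)
  have pull: "\<exists>Y. finite Y \<and> Y \<subseteq> A \<and> (\<forall>w::complex \<Rightarrow> real. (\<Sum>b\<in>Z. w b) = (\<Sum>a\<in>Y. w (c * a)))" if Z: "finite Z" "Z \<subseteq> A'" for Z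
  proof -
    obtain Y where Y: "Y \<subseteq> A" "finite Y" "Z = (\<lambda>a. c * a) ` Y" using finite_subset_image Z unfolding A'_def by metis
    have "inj_on (\<lambda>a. c * a) Y" using c by (auto simp: inj_on_def)
    hence "\<forall>w::complex \<Rightarrow> real. (\<Sum>b\<in>Z. w b) = (\<Sum>a\<in>Y. w (c * a))" unfolding Y(3) by (simp add: sum.reindex)
    thus ?thesis using Y by blast
  qed
  have fin: "finite {b\<in>A'. cmod b \<le> R}" for R
  proof (rule finite_subset)
    show "{b\<in>A'. cmod b \<le> R} \<subseteq> (\<lambda>a. c * a) ` {a\<in>A. cmod a \<le> R / l}"
      using l c by (auto simp: A'_def norm_mult field_simps)
  qed (use A in blast)
  have big: "exp 2 \<le> cmod b" if b: "b \<in> A'" for b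
  proof -
    obtain a where a: "a \<in> A" "b = c * a" using b by (auto simp: A'_def)
    have "l * \<delta> \<le> l * cmod a" using \<delta>(2)[OF a(1)] l by (intro mult_left_mono) auto
    thus ?thesis using a \<delta>(1) c by (simp add: l_def norm_mult)
  qed
  have m'1: "m' b \<ge> 1" if "b \<in> A'" for b using that m c by (auto simp: A'_def m'c)
  have S': "(\<Sum>b\<in>Z. real (m' b) * cmod b powr (- p)) \<le> l powr (- p) * S" if Z: "finite Z" "Z \<subseteq> A'" for Z
  proof -
    obtain Y where Y: "finite Y" "Y \<subseteq> A" "\<And>w::complex \<Rightarrow> real. (\<Sum>b\<in>Z. w b) = (\<Sum>a\<in>Y. w (c * a))" using pull[OF Z] by blast
    have "(\<Sum>b\<in>Z. real (m' b) * cmod b powr (- p)) = l powr (- p) * (\<Sum>a\<in>Y. real (m a) * cmod a powr (- p))"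
      unfolding Y(3) m'c using l c by (simp add: norm_mult powr_mult sum_distrib_left mult_ac)
    thus ?thesis using S[OF Y(1,2)] l by (simp add: mult_left_mono)
  qed
  have "\<exists>F K. majorized p m' A' F K"
  proof (cases "p = 1")
    case True
    have big1: "cmod b \<ge> 1" if "b \<in> A'" for b using big[OF that] exp_ge_add_one_self[of 2] by linarith
    have n0: "0 \<notin> A'" using big1[of 0] by auto
    show ?thesis unfolding True by (rule exists_majorized_one[OF n0 fin big1]) (use S' True in auto)
  next
    case False
    hence "p > 1" using p by simp
    thus ?thesis by (rule exists_majorized_power[OF _ fin big m'1 S'])
  qed
  then obtain F K where "majorized p m' A' F K" by blast
  hence F: "F holomorphic_on UNIV" "F 0 \<noteq> 0" "K > 0" and div: "\<And>b. b \<in> A' \<Longrightarrow> divisible_at F b (m' b)" and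
    bd: "\<And>z B. (\<And>Z. finite Z \<Longrightarrow> Z \<subseteq> A' \<Longrightarrow> (\<Sum>b\<in>Z. real (m' b) * ln (1 + (cmod z / cmod b) powr p)) \<le> B) \<Longrightarrow> cmod (F z) \<le> K * exp B"
    unfolding majorized_def by blast+
  have hol: "(\<lambda>z. H (c * z)) holomorphic_on UNIV" if "H holomorphic_on UNIV" for H
    using holomorphic_on_compose_gen[of "\<lambda>z. c * z" UNIV H UNIV] that by (auto simp: o_def intro!: holomorphic_intros)
  have "majorized p m A (\<lambda>z. F (c * z)) K"
  proof (rule majorizedI[OF hol[OF F(1)]])
    show "divisible_at (\<lambda>z. F (c * z)) a (m a)" if a: "a \<in> A" for a
    proof -
      have "c * a \<in> A'" using a by (auto simp: A'_def)
      hence "divisible_at F (c * a) (m a)" using div[of "c * a"] m'c by simp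
      then obtain H where H: "H holomorphic_on UNIV" "\<And>z. F z = (z - c * a) ^ m a * H z" by (auto simp: divisible_at_def)
      show ?thesis
      proof (rule divisible_atI)
        show "(\<lambda>z. c ^ m a * H (c * z)) holomorphic_on UNIV" by (intro holomorphic_intros hol H)
        show "F (c * z) = (z - a) ^ m a * (c ^ m a * H (c * z))" for z
          unfolding H(2)[of "c * z"] right_diff_distrib[symmetric] power_mult_distrib by simp
      qed
    qed
    fix z B assume B: "\<And>Z. finite Z \<Longrightarrow> Z \<subseteq> A \<Longrightarrow> (\<Sum>a\<in>Z. real (m a) * ln (1 + (cmod z / cmod a) powr p)) \<le> B"
    show "cmod (F (c * z)) \<le> K * exp B"
    proof (rule bd)
      fix Z assume Z: "finite Z" "Z \<subseteq> A'"
      obtain Y where Y: "finite Y" "Y \<subseteq> A" "\<And>w::complex \<Rightarrow> real. (\<Sum>b\<in>Z. w b) = (\<Sum>a\<in>Y. w (c * a))" using pull[OF Z] by blast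
      show "(\<Sum>b\<in>Z. real (m' b) * ln (1 + (cmod (c * z) / cmod b) powr p)) \<le> B"
        unfolding Y(3) m'c using B[OF Y(1,2)] c l by (simp add: norm_mult)
    qed
  qed (use F in auto)
  thus ?thesis by blast
qed

text \<open>The quotient of the majorized function by \<open>f\<close> is entire because the former
  has at least the zeros of \<open>f\<close>. The constant factor cancels \<open>K\<close> and
  brings in \<open>\<bar>f 0\<bar> powr p\<close>.\<close>

lemma exists_multiplier:
  assumes p: "p \<ge> 1" and f: "f holomorphic_on UNIV" "f 0 \<noteq> 0" and \<delta>: "\<delta> > 0" "\<And>a. f a = 0 \<Longrightarrow> \<delta> \<le> cmod a"
    and S: "\<And>Z. finite Z \<Longrightarrow> Z \<subseteq> {a. f a = 0} \<Longrightarrow> (\<Sum>a\<in>Z. real (nat (zorder f a)) * cmod a powr (- p)) \<le> S"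
  shows "\<exists>h. h holomorphic_on UNIV \<and> h \<noteq> (\<lambda>_. 0) \<and> (\<forall>z t. (\<forall>Z. finite Z \<longrightarrow> Z \<subseteq> {a. f a = 0} \<longrightarrow>
      p * ln (cmod (f 0)) + (\<Sum>a\<in>Z. real (nat (zorder f a)) * ln (1 + (cmod z / cmod a) powr p)) \<le> t) \<longrightarrow> cmod (f z * h z) \<le> exp t)"
proof -
  have fin: "finite {a \<in> {a. f a = 0}. cmod a \<le> R}" for R
    using finite_zeros_cball[OF f, of R] by (rule rev_finite_subset) auto
  have m: "nat (zorder f a) \<ge> 1" if a: "a \<in> {a. f a = 0}" for a
  proof -
    have "zorder f a > 0" using entire_zorder[OF f, of a] a by blast
    thus ?thesis by simp
  qed
  have "\<exists>F K. majorized p (\<lambda>a. nat (zorder f a)) {a. f a = 0} F K"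
    by (rule exists_majorized[OF p fin \<delta>(1) _ m S]) (use \<delta>(2) in auto)
  then obtain F K where FK: "majorized p (\<lambda>a. nat (zorder f a)) {a. f a = 0} F K" by blast
  hence F: "F holomorphic_on UNIV" "F 0 \<noteq> 0" "K > 0" and div: "\<And>a. f a = 0 \<Longrightarrow> divisible_at F a (nat (zorder f a))"
    unfolding majorized_def by blast+
  obtain g where g: "g holomorphic_on UNIV" "\<And>z. F z = f z * g z" using entire_divide[OF f F(1) div] by blast
  define c where "c = exp (p * ln (cmod (f 0))) / K"
  have c: "c > 0" using F(3) by (simp add: c_def)
  show ?thesis
  proof (intro exI[of _ "\<lambda>z. of_real c * g z"] conjI allI impI)
    show "(\<lambda>z. of_real c * g z) holomorphic_on UNIV" by (intro holomorphic_intros g)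
    have "of_real c * g 0 \<noteq> 0" using c F(2) g(2)[of 0] by auto
    thus "(\<lambda>z. of_real c * g z) \<noteq> (\<lambda>_. 0)" by metis
    fix z t assume t: "\<forall>Z. finite Z \<longrightarrow> Z \<subseteq> {a. f a = 0} \<longrightarrow>
      p * ln (cmod (f 0)) + (\<Sum>a\<in>Z. real (nat (zorder f a)) * ln (1 + (cmod z / cmod a) powr p)) \<le> t"
    have "\<forall>Z. finite Z \<longrightarrow> Z \<subseteq> {a. f a = 0} \<longrightarrow>
      (\<Sum>a\<in>Z. real (nat (zorder f a)) * ln (1 + (cmod z / cmod a) powr p)) \<le> t - p * ln (cmod (f 0))"
      using t by (simp add: le_diff_eq add.commute)
    hence "cmod (F z) \<le> K * exp (t - p * ln (cmod (f 0)))" using FK unfolding majorized_def by blast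
    hence "c * cmod (F z) \<le> c * (K * exp (t - p * ln (cmod (f 0))))" using c by (intro mult_left_mono) auto
    also have "\<dots> = exp t" using F(3) by (simp add: c_def exp_diff)
    finally show "cmod (f z * (of_real c * g z)) \<le> exp t" using c by (simp add: g(2) norm_mult mult_ac)
  qed
qed

text \<open>For \<open>0 \<le> x \<le> X\<close> one has
  \<open>x \<le> (1 + x) * ln (1 + x) \<le> (1 + X) * ln (1 + x)\<close>, and zeros of modulus at
  least \<open>\<delta>\<close> give \<open>X = (r / \<delta>) powr p\<close>. So boundedness of the
  logarithmic sums at a single \<open>r > 0\<close> forces convergence of the sum of
  \<open>\<bar>a\<bar> powr (- p)\<close>.\<close>

lemma sum_powr_le_of_sum_ln_le:
  assumes \<delta>: "\<delta> > 0" "\<And>a. a \<in> Z \<Longrightarrow> \<delta> \<le> cmod a" and r: "r > 0" and p: "p \<ge> 1"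
  shows "(\<Sum>a\<in>Z. real (m a) * cmod a powr (- p)) \<le>
    r powr (- p) * (1 + (r / \<delta>) powr p) * (\<Sum>a\<in>Z. real (m a) * ln (1 + (r / cmod a) powr p))"
  unfolding sum_distrib_left
proof (rule sum_mono)
  fix a assume a: "a \<in> Z"
  define x where "x = (r / cmod a) powr p"
  define X where "X = (r / \<delta>) powr p"
  have a0: "cmod a > 0" using \<delta> a by force
  have x: "0 \<le> x" "x \<le> X" unfolding x_def X_def using \<delta> a r p a0 by (auto intro!: powr_mono2 divide_left_mono)
  have "- ln (1 + x) = ln (1 / (1 + x))" using x by (simp add: ln_div)
  also have "\<dots> \<le> 1 / (1 + x) - 1" using x by (intro ln_le_minus_one) auto
  finally have "1 - 1 / (1 + x) \<le> ln (1 + x)" by linarith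
  hence "(1 + x) * (1 - 1 / (1 + x)) \<le> (1 + x) * ln (1 + x)" using x by (intro mult_left_mono) auto
  moreover have "(1 + x) * (1 - 1 / (1 + x)) = x" using x by (simp add: right_diff_distrib)
  ultimately have "x \<le> (1 + x) * ln (1 + x)" by simp
  also have "\<dots> \<le> (1 + X) * ln (1 + x)" using x by (intro mult_right_mono) auto
  finally have "r powr (- p) * x \<le> r powr (- p) * ((1 + X) * ln (1 + x))" by (rule mult_left_mono) simp
  moreover have "r powr (- p) * x = cmod a powr (- p)" using r a0 by (simp add: x_def powr_divide powr_minus field_simps)
  ultimately have "cmod a powr (- p) \<le> r powr (- p) * (1 + X) * ln (1 + x)" by simp
  hence "real (m a) * cmod a powr (- p) \<le> real (m a) * (r powr (- p) * (1 + X) * ln (1 + x))" by (rule mult_left_mono) simp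
  thus "real (m a) * cmod a powr (- p) \<le> r powr (- p) * (1 + (r / \<delta>) powr p) * (real (m a) * ln (1 + (r / cmod a) powr p))"
    unfolding x_def X_def by (simp only: mult_ac)
qed

theorem theorem1:
  fixes f :: "complex \<Rightarrow> complex" and p :: real
  assumes "f holomorphic_on UNIV"
    and "f 0 \<noteq> 0"
    and "p \<ge> 1"
  shows "(\<exists>h. h holomorphic_on UNIV \<and> h \<noteq> (\<lambda>_. 0) \<and>
           (\<forall>r\<ge>0. ereal (max_modulus r (\<lambda>z. f z * h z)) \<le>
              exp_ereal (extended_integral (restrict_space lborel {0<..})
                (\<lambda>t. circle_mean (r * t) f *
                      (p\<^sup>2 * t powr (p - 1) / (1 + t powr p)\<^sup>2))))) \<and>
         \<not> (\<exists>h. h holomorphic_on UNIV \<and> h \<noteq> (\<lambda>_. 0) \<and>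
           Liminf at_top (\<lambda>r. ereal (max_modulus r (\<lambda>z. f z * h z) / exp (circle_mean r f))) = 0)"
proof
  note f = assms(1,2) and p = assms(3)
  show "\<not> (\<exists>h. h holomorphic_on UNIV \<and> h \<noteq> (\<lambda>_. 0) \<and>
    Liminf at_top (\<lambda>r. ereal (max_modulus r (\<lambda>z. f z * h z) / exp (circle_mean r f))) = 0)"
    using no_small_multiplier[OF f] by blast
  define T where "T r = extended_integral (restrict_space lborel {0<..})
    (\<lambda>t. circle_mean (r * t) f * (p\<^sup>2 * t powr (p - 1) / (1 + t powr p)\<^sup>2))" for r
  have low: "ereal (p * ln (cmod (f 0)) + (\<Sum>a\<in>Z. real (nat (zorder f a)) * ln (1 + (r / cmod a) powr p))) \<le> T r"
    if "finite Z" "Z \<subseteq> {a. f a = 0}" "r \<ge> 0" for Z r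
    unfolding T_def by (rule extended_integral_lower_bound[OF p f that(1) _ that(3)]) (use that(2) f(2) in auto)
  \<comment> \<open>\<open>low\<close> for the empty set shows that \<open>T r\<close> is not minus
    infinity, and an infinite \<open>T r\<close> makes the inequality trivial; only finite values
    remain.\<close>
  have bound: "ereal x \<le> exp_ereal (T r)" if "r \<ge> 0" "\<And>t. T r = ereal t \<Longrightarrow> x \<le> exp t" for x r
    using that low[of "{}" r] by (cases "T r") (auto simp: exp_ereal_def)
  have "continuous_on UNIV f" using f(1) by (rule holomorphic_on_imp_continuous_on)
  hence "isCont f 0" by (simp add: continuous_on_eq_continuous_at)
  then obtain \<delta> where "\<delta> > 0" "\<forall>z. dist 0 z < \<delta> \<longrightarrow> f z \<noteq> 0" using continuous_at_avoid[of 0 f 0] f(2) by blast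
  hence \<delta>: "\<delta> > 0" "\<And>a. f a = 0 \<Longrightarrow> \<delta> \<le> cmod a" by (auto simp: not_less[symmetric])
  show "\<exists>h. h holomorphic_on UNIV \<and> h \<noteq> (\<lambda>_. 0) \<and>
           (\<forall>r\<ge>0. ereal (max_modulus r (\<lambda>z. f z * h z)) \<le>
              exp_ereal (extended_integral (restrict_space lborel {0<..})
                (\<lambda>t. circle_mean (r * t) f * (p\<^sup>2 * t powr (p - 1) / (1 + t powr p)\<^sup>2))))"
    unfolding T_def[symmetric]
  proof (cases "\<exists>S. \<forall>Z. finite Z \<longrightarrow> Z \<subseteq> {a. f a = 0} \<longrightarrow> (\<Sum>a\<in>Z. real (nat (zorder f a)) * cmod a powr (- p)) \<le> S")
    case True
    then obtain S where S: "\<And>Z. finite Z \<Longrightarrow> Z \<subseteq> {a. f a = 0} \<Longrightarrow> (\<Sum>a\<in>Z. real (nat (zorder f a)) * cmod a powr (- p)) \<le> S" by blast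
    obtain h where h: "h holomorphic_on UNIV" "h \<noteq> (\<lambda>_. 0)" and
      hb: "\<And>z t. (\<And>Z. finite Z \<Longrightarrow> Z \<subseteq> {a. f a = 0} \<Longrightarrow>
      p * ln (cmod (f 0)) + (\<Sum>a\<in>Z. real (nat (zorder f a)) * ln (1 + (cmod z / cmod a) powr p)) \<le> t) \<Longrightarrow> cmod (f z * h z) \<le> exp t"
      using exists_multiplier[OF p f \<delta> S] by blast
    show "\<exists>h. h holomorphic_on UNIV \<and> h \<noteq> (\<lambda>_. 0) \<and> (\<forall>r\<ge>0. ereal (max_modulus r (\<lambda>z. f z * h z)) \<le> exp_ereal (T r))"
    proof (intro exI[of _ h] conjI h allI impI bound)
      fix r t :: real assume r: "r \<ge> 0" and t: "T r = ereal t"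
      show "max_modulus r (\<lambda>z. f z * h z) \<le> exp t"
      proof (rule max_modulus_le[OF r])
        fix z :: complex assume z: "cmod z = r"
        show "cmod (f z * h z) \<le> exp t"
        proof (rule hb)
          fix Z assume "finite Z" "Z \<subseteq> {a. f a = 0}"
          from low[OF this r] show "p * ln (cmod (f 0)) + (\<Sum>a\<in>Z. real (nat (zorder f a)) * ln (1 + (cmod z / cmod a) powr p)) \<le> t"
            unfolding t z by simp
        qed
      qed
    qed
  next
    case False
    \<comment> \<open>Only \<open>r = 0\<close> will matter, and there \<open>\<bar>f 0 * c\<bar> =
      \<bar>f 0\<bar> powr p = exp (p * ln \<bar>f 0\<bar>)\<close>, which is the lower bound of
      \<open>exp (T 0)\<close> for the empty set of zeros.\<close>
    define c where "c = cmod (f 0) powr (p - 1)"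
    have c: "c > 0" using f by (simp add: c_def)
    show "\<exists>h. h holomorphic_on UNIV \<and> h \<noteq> (\<lambda>_. 0) \<and> (\<forall>r\<ge>0. ereal (max_modulus r (\<lambda>z. f z * h z)) \<le> exp_ereal (T r))"
    proof (intro exI[of _ "\<lambda>_. of_real c"] conjI allI impI bound holomorphic_on_const)
      have "complex_of_real c \<noteq> 0" using c by simp
      thus "(\<lambda>_. complex_of_real c) \<noteq> (\<lambda>_. 0)" by (simp add: fun_eq_iff)
      fix r t :: real assume r: "r \<ge> 0" and t: "T r = ereal t"
      have le: "p * ln (cmod (f 0)) + (\<Sum>a\<in>Z. real (nat (zorder f a)) * ln (1 + (r / cmod a) powr p)) \<le> t"
        if "finite Z" "Z \<subseteq> {a. f a = 0}" for Z
        using low[OF that r] unfolding t by simp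
      \<comment> \<open>A finite \<open>T r\<close> with \<open>r > 0\<close> would bound all finite
        sums of \<open>\<bar>a\<bar> powr (- p)\<close> over the zeros, contrary to the case
        assumption.\<close>
      have r0: "r = 0"
      proof (rule ccontr)
        assume "r \<noteq> 0"
        hence r: "r > 0" using r by simp
        have "(\<Sum>a\<in>Z. real (nat (zorder f a)) * cmod a powr (- p)) \<le> r powr (- p) * (1 + (r / \<delta>) powr p) * (t - p * ln (cmod (f 0)))"
          if Z: "finite Z" "Z \<subseteq> {a. f a = 0}" for Z
        proof (rule order_trans[OF sum_powr_le_of_sum_ln_le[OF \<delta>(1) _ r p]])
          show "r powr (- p) * (1 + (r / \<delta>) powr p) * (\<Sum>a\<in>Z. real (nat (zorder f a)) * ln (1 + (r / cmod a) powr p))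
            \<le> r powr (- p) * (1 + (r / \<delta>) powr p) * (t - p * ln (cmod (f 0)))"
            using le[OF Z] by (intro mult_left_mono) (auto intro!: mult_nonneg_nonneg add_nonneg_nonneg)
        qed (use \<delta> Z in auto)
        thus False using False by blast
      qed
      show "max_modulus r (\<lambda>z. f z * complex_of_real c) \<le> exp t"
      proof (rule max_modulus_le[OF r])
        fix z :: complex assume "cmod z = r"
        hence "cmod (f z * of_real c) = cmod (f 0) * cmod (f 0) powr (p - 1)" using r0 c by (simp add: norm_mult c_def)
        also have "\<dots> = exp (p * ln (cmod (f 0)))" using f(2) powr_mult_base[of "cmod (f 0)" "p - 1"] by (simp add: powr_def)
        also have "\<dots> \<le> exp t" using le[of "{}"] by simp
        finally show "cmod (f z * of_real c) \<le> exp t" .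
      qed
    qed
  qed
qed

end
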